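(* Let $p\ge2$ be an integer, $r_0,r_2,\varepsilon_0>0$, and $\delta>0$ sufficiently small. Put $D_1=D(0,r_0)$, $D_2=D(0,r_2)$, $\Sigma=S(-\delta,\delta,\varepsilon_0)$, $\alpha=-\frac{3\pi}{2p}+\frac{2\delta}p$, $\beta=\frac{3\pi}{2p}-\frac{2\delta}p$, and let $r_1\in\,]0,r_0(\cos 2\delta)^{1/p}[$. Consider the equation $$\varepsilon y'=p\,x^{p-1}y+\varepsilon P(x,y,\varepsilon),\qquad\varepsilon=\eta^p,$$ with $P$ analytic and bounded in $D_1\times D_2\times\Sigma$ and admitting a uniform asymptotic expansion in powers of $\varepsilon$ as $\Sigma\ni\varepsilon\to0$. Then for every $\mu>0$ there exist $\eta_1>0$ and a solution $y(x,\eta)$ of this equation defined for $\eta\in S_1=S(-\frac\delta p,\frac\delta p,\eta_1)$ and $x\in V(\eta)=V(\alpha,\beta,r_1,\mu|\eta|)$. Moreover $y$ has a combined asymptotic expansion as $S_1\ni\eta\to0$, $x\in V(\eta)$.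
   Context: $D(0,r)$ is the open disc of $\mathbb C$. $S(\alpha,\beta,r)=\{x\in\mathbb C:0<|x|<r,\alpha<\arg x<\beta\}$. For $\mu>0$, $V(\alpha,\beta,r,\mu)=\{x:(0<|x|<r,\alpha<\arg x<\beta)\text{ or }|x|<\mu\}$. "$\delta$ sufficiently small" means: $0<\delta\le\delta_0$ for some $\delta_0>0$. The solution is holomorphic in $(x,\eta)$, with values in $D_2$; $'$ is $d/dx$. Uniform asymptotic expansion of $P$: there are holomorphic $P_k$ on $D_1\times D_2$ such that for every $N$ there is $C_N$ with $|P(x,y,\varepsilon)-\sum_{k<N}P_k(x,y)\varepsilon^k|\le C_N|\varepsilon|^N$ on $D_1\times D_2\times\Sigma$. $\mathcal H(r_1)$: bounded holomorphic functions on $D(0,r_1)$. $\mathcal G(V)$, for an infinite quasi-sector $V$: bounded holomorphic functions $g$ on $V$ with an asymptotic expansion $g(X)\sim\sum_{\nu\ge1}g_\nu X^{-\nu}$ as $V\ni X\to\infty$ (for every $N$, $|g(X)-\sum_{\nu=1}^{N-1}g_\nu X^{-\nu}|\le C_N|X|^{-N}$ on $V$). $y$ has a combined asymptotic expansion as $S_1\ni\eta\to0$, $x\in V(\eta)$, if there are $a_n\in\mathcal H(r_1)$ and $g_n\in\mathcal G(V)$, $V=V(\alpha-\frac\delta p,\beta+\frac\delta p,\infty,\mu)$, such that for every $N$ there is $K_N$ with $|y(x,\eta)-\sum_{n=0}^{N-1}(a_n(x)+g_n(\frac x\eta))\eta^n|\le K_N|\eta|^N$ for all $\eta\in S_1$,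 $x\in V(\eta)$. *)

theory Defs
  imports "HOL-Complex_Analysis.Complex_Analysis"
begin

(* arg x is not restricted to a principal value: x belongs to the sector iff some argument
   of x lies strictly between a and b.  The radius is an extended real, so that r = \<infinity> covers the
   infinite (quasi-)sectors. *)
definition sector :: "real \<Rightarrow> real \<Rightarrow> ereal \<Rightarrow> complex set" where
  "sector a b r = {x. x \<noteq> 0 \<and> ereal (norm x) < r \<and> (\<exists>\<theta>. a < \<theta> \<and> \<theta> < b \<and> is_Arg x \<theta>)}"

definition quasi_sector :: "real \<Rightarrow> real \<Rightarrow> ereal \<Rightarrow> real \<Rightarrow> complex set" where
  "quasi_sector a b r \<mu> = sector a b r \<union> ball 0 \<mu>"

(* Holomorphy in several variables: existence of a complex-linear Frechet derivative at every
   point; only meant for open sets. *)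
definition holomorphic2_on :: "(complex \<times> complex \<Rightarrow> complex) \<Rightarrow> (complex \<times> complex) set \<Rightarrow> bool" where
  "holomorphic2_on f U \<longleftrightarrow>
     (\<forall>z\<in>U. \<exists>a b. (f has_derivative (\<lambda>(h, k). a * h + b * k)) (at z))"

definition holomorphic3_on ::
    "(complex \<times> complex \<times> complex \<Rightarrow> complex) \<Rightarrow> (complex \<times> complex \<times> complex) set \<Rightarrow> bool" where
  "holomorphic3_on f U \<longleftrightarrow>
     (\<forall>z\<in>U. \<exists>a b c. (f has_derivative (\<lambda>(h, k, l). a * h + b * k + c * l)) (at z))"

definition uniform_asymptotic_expansion ::
    "complex set \<Rightarrow> complex set \<Rightarrow> complex set \<Rightarrow> (complex \<Rightarrow> complex \<Rightarrow> complex \<Rightarrow> complex) \<Rightarrow> bool" where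
  "uniform_asymptotic_expansion D1 D2 \<Sigma> P \<longleftrightarrow>
     (\<exists>Pk :: nat \<Rightarrow> complex \<Rightarrow> complex \<Rightarrow> complex.
        (\<forall>k. holomorphic2_on (\<lambda>(x, y). Pk k x y) (D1 \<times> D2)) \<and>
        (\<forall>N. \<exists>C. \<forall>x\<in>D1. \<forall>y\<in>D2. \<forall>\<epsilon>\<in>\<Sigma>.
           norm (P x y \<epsilon> - (\<Sum>k<N. Pk k x y * \<epsilon> ^ k)) \<le> C * norm \<epsilon> ^ N))"

definition H_space :: "real \<Rightarrow> (complex \<Rightarrow> complex) set" where
  "H_space r = {a. a holomorphic_on ball 0 r \<and> bounded (a ` ball 0 r)}"

(* X = 0 lies in every quasi-sector; there the bound C / |X|^N is infinite, hence void, so this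
   point is left out of the estimate (division by zero yields 0 in HOL). *)
definition G_space :: "complex set \<Rightarrow> (complex \<Rightarrow> complex) set" where
  "G_space V = {g. g holomorphic_on V \<and> bounded (g ` V) \<and>
     (\<exists>c :: nat \<Rightarrow> complex. \<forall>N. \<exists>C. \<forall>X\<in>V - {0}.
        norm (g X - (\<Sum>\<nu>\<in>{1..<N}. c \<nu> / X ^ \<nu>)) \<le> C / norm X ^ N)}"

(* The two inclusions say that the terms a n x and g n (x / \<eta>) are evaluated inside the domains
   of a n and g n. *)
definition combined_asymptotic_expansion ::
    "complex set \<Rightarrow> (complex \<Rightarrow> complex set) \<Rightarrow> real \<Rightarrow> complex set \<Rightarrow>
     (complex \<Rightarrow> complex \<Rightarrow> complex) \<Rightarrow> bool" where
  "combined_asymptotic_expansion S1 V\<eta> r1 V y \<longleftrightarrow>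
     (\<forall>\<eta>\<in>S1. V\<eta> \<eta> \<subseteq> ball 0 r1 \<and> (\<lambda>x. x / \<eta>) ` V\<eta> \<eta> \<subseteq> V) \<and>
     (\<exists>(a :: nat \<Rightarrow> complex \<Rightarrow> complex) g.
        (\<forall>n. a n \<in> H_space r1) \<and> (\<forall>n. g n \<in> G_space V) \<and>
        (\<forall>N. \<exists>K. \<forall>\<eta>\<in>S1. \<forall>x\<in>V\<eta> \<eta>.
           norm (y x \<eta> - (\<Sum>n<N. (a n x + g n (x / \<eta>)) * \<eta> ^ n)) \<le> K * norm \<eta> ^ N))"

(* Being a solution includes that (x, y, \<eta>^p) stays in the domain D1 \<times> D2 \<times> \<Sigma> of P. *)
definition is_solution ::
    "nat \<Rightarrow> complex set \<Rightarrow> complex set \<Rightarrow> complex set \<Rightarrow> (complex \<Rightarrow> complex \<Rightarrow> complex \<Rightarrow> complex) \<Rightarrow>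
     complex set \<Rightarrow> (complex \<Rightarrow> complex set) \<Rightarrow> (complex \<Rightarrow> complex \<Rightarrow> complex) \<Rightarrow> bool" where
  "is_solution p D1 D2 \<Sigma> P S1 V\<eta> y \<longleftrightarrow>
     holomorphic2_on (\<lambda>(x, \<eta>). y x \<eta>) {(x, \<eta>). \<eta> \<in> S1 \<and> x \<in> V\<eta> \<eta>} \<and>
     (\<forall>\<eta>\<in>S1. \<forall>x\<in>V\<eta> \<eta>.
        x \<in> D1 \<and> y x \<eta> \<in> D2 \<and> \<eta> ^ p \<in> \<Sigma> \<and>
        \<eta> ^ p * deriv (\<lambda>t. y t \<eta>) x =
          of_nat p * x ^ (p - 1) * y x \<eta> + \<eta> ^ p * P x (y x \<eta>) (\<eta> ^ p))"

end

theory Submission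
  imports Defs
begin

text \<open>Along a path on which \<open>Re (t ^ p / \<epsilon>)\<close> increases, variation of constants bounds the solutions
  of \<open>\<epsilon> u' = p x\<^sup>p\<^sup>-\<^sup>1 u + \<epsilon> f\<close> by \<open>O(|\<eta>| sup |f|)\<close>. From every point of the domain such paths lead to
  the point \<open>\<rho> > 0\<close> at the top of the hill: radially to \<open>0\<close> where \<open>Re (x ^ p / \<epsilon>)\<close> is
  negative, and along a chord in the variable \<open>x ^ p\<close> elsewhere; the condition
  \<open>r1 < r0 (cos 2\<delta>)\<^sup>1\<^sup>/\<^sup>p\<close> is what makes the chords ascending for all \<open>|arg \<epsilon>| < \<delta>\<close>. Picard
  iteration of the integral operator based at \<open>\<rho>\<close> gives the solution. The functions
  \<open>\<Sum>(a\<^sub>n(x) + g\<^sub>n(x/\<eta>)) \<eta>\<^sup>n\<close> form, up to \<open>O(\<eta>\<^sup>N)\<close>, an algebra on which the linear equation can be solved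
  (on the part in \<open>x / \<eta>\<close> by the same estimates with \<open>\<eta> = 1\<close>, \<open>\<rho> = \<infinity>\<close>). Iterating the equation
  from the approximation \<open>0\<close> thus produces such sums which approximate the solution up to
  \<open>O(|\<eta>|\<^sup>N)\<close> plus a boundary layer at \<open>\<rho>\<close>, which is exponentially small for \<open>|x| < r1\<close>.
  Uniqueness of the coefficients makes the sums for different \<open>N\<close> compatible.\<close>

text \<open>One weighted estimate carries the proof: a constant weight gives the contraction, a
  power of \<open>1 + |X|\<close> the expansions at infinity, and \<open>|\<eta>| ^ N\<close> plus a
  boundary layer the error of the sums. The last weight is forced by the normalisation: the solution
  is made to vanish at \<open>\<rho>\<close>, a combined sum is not, and the discrepancy spreads
  downhill as a multiple of the homogeneous solution. It is recorded with half of its exponent, the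
  growth that the estimate tolerates. The obstacle is uniformity in \<open>\<eta>\<close>. Constants
  may depend on the shape of the paths alone, so each path has to cross the level lines of
  \<open>Re (x ^ p / \<eta> ^ p)\<close> at an angle bounded below, with \<open>sin \<delta>\<close>
  as its measure. Chords serve \<open>p |Arg x| \<le> 3 pi / 4\<close>; a small disc and the rays
  serve the rest. The top of the hill (\<open>\<rho>\<close>, or infinity for functions of
  \<open>x / \<eta>\<close>) lies outside the open domains. It is replaced by points
  \<open>q n\<close> of the positive axis, and boundary conditions become limits along them.\<close>

section \<open>Tools: parameter integrals, Cauchy estimates, holomorphy in several variables\<close>

text \<open>The Riemann sums \<open>S n\<close> are finite sums of holomorphic functions. Uniform
  continuity of \<open>h\<close> on \<open>cball z d \<times> {0..1}\<close> makes them converge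
  uniformly on closed discs, and holomorphy survives such limits.\<close>

lemma holomorphic_parametric_integral:
  fixes h :: "complex \<Rightarrow> real \<Rightarrow> complex"
  assumes U: "open U"
    and cont: "continuous_on (U \<times> {0..1}) (\<lambda>(z, t). h z t)"
    and hol: "\<And>t. t \<in> {0..1} \<Longrightarrow> (\<lambda>z. h z t) holomorphic_on U"
  shows "(\<lambda>z. integral {0..1} (h z)) holomorphic_on U"
proof -
  define S where "S n z = (\<Sum>j<n. h z (real j / real n) / of_nat n)" for n z
  have conth: "continuous_on {0..1} (h z)" if "z \<in> U" for z
  proof -
    have "continuous_on {0..1} ((\<lambda>(z, t). h z t) \<circ> (\<lambda>t. (z, t)))"
      by (intro continuous_on_compose continuous_intros continuous_on_subset[OF cont]) (use that in auto)
    then show ?thesis by (simp add: o_def)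
  qed
  show ?thesis
  proof (rule holomorphic_uniform_sequence[OF U, where f = S])
    show "S n holomorphic_on U" for n
      unfolding S_def by (intro holomorphic_intros hol) (auto simp: divide_simps)
    fix z assume z: "z \<in> U"
    then obtain d where d: "d > 0" "cball z d \<subseteq> U"
      using U open_contains_cball by blast
    have "uniformly_continuous_on (cball z d \<times> {0..1}) (\<lambda>(z, t). h z t)"
      by (rule compact_uniformly_continuous[OF continuous_on_subset[OF cont]])
        (use d in \<open>auto intro: compact_Times\<close>)
    note uc = this[unfolded uniformly_continuous_on_def, rule_format]
    have "uniform_limit (cball z d) S (\<lambda>z. integral {0..1} (h z)) sequentially"
    proof (rule uniform_limitI)
      fix e :: real assume e: "e > 0"
      obtain r where r: "r > 0" and rr: "\<And>a b. a \<in> cball z d \<times> {0..1} \<Longrightarrow> b \<in> cball z d \<times> {0..1} \<Longrightarrow>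
          dist b a < r \<Longrightarrow> dist (case b of (z, t) \<Rightarrow> h z t) (case a of (z, t) \<Rightarrow> h z t) < e / 2"
        using uc[of "e / 2"] e by (metis half_gt_zero)
      obtain N :: nat where N: "N > 0" "1 / real N < r"
        using r by (metis gr0I inverse_eq_divide reals_Archimedean zero_less_Suc ex_inverse_of_nat_less)
      have "dist (S n w) (integral {0..1} (h w)) < e" if n: "n \<ge> N" and w: "w \<in> cball z d" for n w
      proof -
        have n0: "n > 0" using n N by simp
        have rn: "1 / real n < r"
          using n N by (smt (verit) frac_le of_nat_0_less_iff of_nat_mono)
        have wU: "w \<in> U" using w d by auto
        have "norm (integral {0..1} (h w) - S n w) \<le> e / 2"
        proof -
          \<comment> \<open>The integral is cut at the nodes of \<open>S n\<close>, so that the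
            error is a sum of \<open>n\<close> errors, one for each cell of length
            \<open>1 / n\<close>.\<close>
          have iv: "integral {0..real k / n} (h w) = (\<Sum>j<k. integral {real j / n..real (Suc j) / n} (h w))"
            if "k \<le> n" for k using that
          proof (induction k)
            case (Suc k)
            have "integral {0..real k / n} (h w) + integral {real k / n..real (Suc k) / n} (h w)
                = integral {0..real (Suc k) / n} (h w)"
            proof (rule Henstock_Kurzweil_Integration.integral_combine)
              show "h w integrable_on {0..real (Suc k) / n}"
                by (rule integrable_continuous_interval[OF continuous_on_subset[OF conth[OF wU]]])
                  (use Suc.prems n0 in \<open>auto simp: field_simps\<close>)
            qed (use n0 in \<open>auto simp: divide_simps\<close>)
            then show ?case using Suc by simp
          qed simp
          have "integral {0..1} (h w) - S n w
              = (\<Sum>j<n. integral {real j / n..real (Suc j) / n} (h w) - h w (real j / n) / of_nat n)"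
            using iv[of n] n0 by (simp add: S_def sum_subtractf)
          also have "norm \<dots> \<le> (\<Sum>j<n. e / 2 * (1 / n))"
          proof (rule sum_norm_le)
            fix j assume "j \<in> {..<n}"
            then have j: "Suc j \<le> n" by auto
            have jl: "real j / n \<le> real (Suc j) / n" "real j / n \<ge> 0" "real (Suc j) / n \<le> 1"
              using j n0 by (auto simp: divide_simps)
            have ln: "real (Suc j) / n - real j / n = 1 / n" by (simp add: add_divide_distrib)
            have ii: "h w integrable_on {real j / n..real (Suc j) / n}"
              by (rule integrable_continuous_interval[OF continuous_on_subset[OF conth[OF wU]]])
                (use jl in auto)
            have eq: "integral {real j / n..real (Suc j) / n} (h w) - h w (real j / n) / of_nat n
                = integral {real j / n..real (Suc j) / n} (\<lambda>t. h w t - h w (real j / n))"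
              using ii ln jl by (subst Henstock_Kurzweil_Integration.integral_diff)
                (auto simp: scaleR_conv_of_real of_real_divide field_simps simp flip: of_real_diff)
            have "norm \<dots> \<le> e / 2 * (real (Suc j) / n - real j / n)"
            proof (rule integral_bound)
              show "continuous_on {real j / n..real (Suc j) / n} (\<lambda>t. h w t - h w (real j / n))"
                by (intro continuous_intros continuous_on_subset[OF conth[OF wU]]) (use jl in auto)
              fix t assume t: "t \<in> {real j / n..real (Suc j) / n}"
              have "0 \<le> t" "t \<le> 1" using t jl by (meson atLeastAtMost_iff order_trans)+
              from t have "\<bar>t - real j / n\<bar> \<le> 1 / n" using ln by auto
              then have "dist (w, t) (w, real j / n) < r"
                using rn by (simp add: dist_Pair_Pair dist_real_def)
              then have "dist (h w t) (h w (real j / n)) < e / 2"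
                using rr[of "(w, real j / n)" "(w, t)"] w t jl \<open>0 \<le> t\<close> \<open>t \<le> 1\<close> by auto
              then show "norm (h w t - h w (real j / n)) \<le> e / 2"
                by (simp add: dist_norm)
            qed (use jl in auto)
            then show "norm (integral {real j / n..real (Suc j) / n} (h w) - h w (real j / n) / of_nat n)
                \<le> e / 2 * (1 / n)" unfolding eq ln by simp
          qed
          also have "\<dots> = e / 2" using n0 by simp
          finally show ?thesis .
        qed
        then show ?thesis using e by (simp add: dist_norm norm_minus_commute)
      qed
      then show "\<forall>\<^sub>F n in sequentially. \<forall>w\<in>cball z d. dist (S n w) (integral {0..1} (h w)) < e"
        by (auto simp: eventually_at_top_linorder intro!: exI[of _ N])
    qed
    with d show "\<exists>d>0. cball z d \<subseteq> U \<and> uniform_limit (cball z d) S (\<lambda>z. integral {0..1} (h z)) sequentially"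
      by blast
  qed
qed

text \<open>The Cauchy inequality is used on the circle of radius \<open>r / 2\<close>, which lies
  inside the open ball with its closed disc; this is the factor 2.\<close>

lemma deriv_bound_Cauchy:
  assumes "f holomorphic_on ball z r" "r > 0" "\<And>w. w \<in> ball z r \<Longrightarrow> norm (f w) \<le> B"
  shows "norm (deriv f z) \<le> 2 * B / r"
proof -
  have "norm ((deriv ^^ 1) f z) \<le> (fact 1) * B / (r/2) ^ 1"
  proof (rule Cauchy_inequality)
    show "f holomorphic_on ball z (r/2)" using assms by (auto intro: holomorphic_on_subset)
    show "continuous_on (cball z (r/2)) f"
      using assms by (intro holomorphic_on_imp_continuous_on holomorphic_on_subset[OF assms(1)]) auto
    show "\<And>x. norm (z - x) = r / 2 \<Longrightarrow> norm (f x) \<le> B" using assms by (auto simp: dist_norm)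
  qed (use assms in auto)
  then show ?thesis by (simp add: mult.commute)
qed

text \<open>Around each point of the smaller ball there is a disc of radius \<open>r\<close> inside
  the larger one, so the derivative is at most \<open>2 * B / r\<close> on a convex set.\<close>

lemma lipschitz_Cauchy:
  assumes hol: "f holomorphic_on ball z (2 * r)" and r: "r > 0"
    and B: "\<And>w. w \<in> ball z (2 * r) \<Longrightarrow> norm (f w) \<le> B"
    and ab: "a \<in> ball z r" "b \<in> ball z r"
  shows "norm (f a - f b) \<le> 2 * B / r * norm (a - b)"
proof (rule field_differentiable_bound[where S = "ball z r" and f' = "deriv f"])
  fix x assume x: "x \<in> ball z r"
  then have sub: "ball x r \<subseteq> ball z (2 * r)"
    using dist_triangle_lt[of z x] by (fastforce simp: dist_commute subset_iff intro: dist_triangle_less_add)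
  show "(f has_field_derivative deriv f x) (at x within ball z r)"
    by (rule has_field_derivative_at_within[OF holomorphic_derivI[OF hol]]) (use x r in auto)
  show "norm (deriv f x) \<le> 2 * B / r"
    by (rule deriv_bound_Cauchy) (use sub hol r B in \<open>auto intro: holomorphic_on_subset\<close>)
qed (use ab in auto)

text \<open>By Cauchy the common bound \<open>B\<close> yields a Lipschitz constant in
  \<open>x\<close> that does not depend on \<open>e\<close>. A joint increment splits into one in
  \<open>x\<close>, controlled uniformly, and one in \<open>e\<close> at a fixed
  \<open>x\<close>.\<close>

lemma separately_holomorphic_continuous_on:
  fixes f :: "complex \<Rightarrow> complex \<Rightarrow> complex"
  assumes D: "open D"
    and bnd: "\<And>x e. (x, e) \<in> D \<Longrightarrow> norm (f x e) \<le> B"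
    and holx: "\<And>e. (\<lambda>x. f x e) holomorphic_on {x. (x, e) \<in> D}"
    and conte: "\<And>x. continuous_on {e. (x, e) \<in> D} (f x)"
  shows "continuous_on D (\<lambda>(x, e). f x e)"
proof (clarsimp simp: continuous_on_eq_continuous_at[OF D])
  fix x e assume xe: "(x, e) \<in> D"
  obtain A A' where A: "open A" "open A'" "x \<in> A" "e \<in> A'" "A \<times> A' \<subseteq> D"
    using open_prod_elim[OF D xe] by (metis mem_Sigma_iff)
  obtain r where r: "r > 0" "ball x (2 * r) \<subseteq> A"
  proof -
    obtain r where "r > 0" "ball x r \<subseteq> A" using A open_contains_ball by blast
    then show ?thesis by (intro that[of "r / 2"]) auto
  qed
  have c: "((f x) \<longlongrightarrow> f x e) (at e)"
  proof -
    have "open {e. (x, e) \<in> D}"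
      using open_vimage[OF D, of "\<lambda>e. (x, e)"] by (simp add: vimage_def continuous_on_Pair)
    then show ?thesis
      using conte[of x] xe continuous_on_eq_continuous_at[of "{e. (x, e) \<in> D}" "f x"]
      by (simp add: isCont_def)
  qed
  have c': "((\<lambda>(x', e'). f x e') \<longlongrightarrow> f x e) (at (x, e))"
  proof -
    have "isCont (f x) (snd (x, e))" using c by (simp add: isCont_def)
    then have "isCont (\<lambda>p. f x (snd p)) (x, e)"
      by (rule isCont_o2[rotated]) (intro continuous_intros)
    then show ?thesis by (simp add: isCont_def case_prod_beta')
  qed
  have "((\<lambda>(x', e'). f x' e' - f x e') \<longlongrightarrow> 0) (at (x, e))"
  proof (rule Lim_null_comparison)
    have "\<forall>\<^sub>F p in at (x, e). p \<in> ball x r \<times> A'"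
      using A r by (intro eventually_at_in_open') (auto intro: open_Times)
    then show "\<forall>\<^sub>F p in at (x, e). norm (case p of (x', e') \<Rightarrow> f x' e' - f x e') \<le> 2 * B / r * norm (fst p - x)"
    proof eventually_elim
      case (elim p)
      obtain x' e' where p: "p = (x', e')" by fastforce
      have sub: "ball x (2 * r) \<subseteq> {x. (x, e') \<in> D}" using elim p A r by auto
      have "norm (f x' e' - f x e') \<le> 2 * B / r * norm (x' - x)"
        by (rule lipschitz_Cauchy[where z = x]) (use elim p r sub bnd holomorphic_on_subset[OF holx sub] in auto)
      then show ?case by (simp add: p)
    qed
    have "((\<lambda>p. 2 * B / r * norm (fst p - x)) \<longlongrightarrow> 2 * B / r * norm (fst (x, e) - x)) (at (x, e))"
      by (intro tendsto_intros)
    then show "((\<lambda>p. 2 * B / r * norm (fst p - x)) \<longlongrightarrow> 0) (at (x, e))" by simp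
  qed
  from tendsto_add[OF this c'] show "isCont (\<lambda>(x, e). f x e) (x, e)"
    by (simp add: isCont_def case_prod_beta')
qed

text \<open>One partial derivative at the point and continuity of the other one give total
  differentiability. The library criterion expects the continuous partial in the second place, hence
  the exchange of \<open>x\<close> and \<open>e\<close>. For a solution, \<open>f'\<close> is the
  right-hand side of the equation, so its continuity comes from that of the solution.\<close>

lemma holomorphic2_onI:
  fixes f :: "complex \<Rightarrow> complex \<Rightarrow> complex"
  assumes D: "open D"
    and dx: "\<And>x e. (x, e) \<in> D \<Longrightarrow> ((\<lambda>x. f x e) has_field_derivative f' x e) (at x)"
    and de: "\<And>x. f x holomorphic_on {e. (x, e) \<in> D}"
    and cont: "continuous_on D (\<lambda>(x, e). f' x e)"
  shows "holomorphic2_on (\<lambda>(x, e). f x e) D"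
  unfolding holomorphic2_on_def
proof (clarify)
  fix x e assume xe: "(x, e) \<in> D"
  obtain A A' where A: "open A" "open A'" "x \<in> A" "e \<in> A'" "A \<times> A' \<subseteq> D"
    using open_prod_elim[OF D xe] by (metis mem_Sigma_iff)
  obtain r where r: "r > 0" "ball x r \<subseteq> A" using A open_contains_ball by blast
  have op: "open {e. (x, e) \<in> D}"
    using open_vimage[OF D, of "\<lambda>e. (x, e)"] by (simp add: vimage_def continuous_on_Pair)
  obtain b where b: "(f x has_field_derivative b) (at e)"
    using de[of x] xe op holomorphic_derivI by blast
  have "((\<lambda>(e, x). f x e) has_derivative (\<lambda>(te, tx). b * te + blinfun_mult_right (f' x e) tx)) (at (e, x) within A' \<times> ball x r)"
  proof (rule has_derivative_partialsI[where fy = "\<lambda>e x. blinfun_mult_right (f' x e)"])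
    show "(f x has_derivative (*) b) (at e within A')"
      using b has_derivative_at_withinI by (auto simp: has_field_derivative_def)
    show "((\<lambda>y. f y x') has_derivative blinfun_apply (blinfun_mult_right (f' y x'))) (at y within ball x r)"
      if "x' \<in> A'" "y \<in> ball x r" for x' y
    proof -
      have "(y, x') \<in> D" using that A r by blast
      from has_derivative_at_withinI[OF dx[OF this, unfolded has_field_derivative_def]]
      show ?thesis by (simp add: blinfun_mult_right.rep_eq)
    qed
    have "continuous_on (A' \<times> ball x r) (\<lambda>(e, x). blinfun_mult_right (f' x e))"
    proof -
      have "continuous_on (A' \<times> ball x r) ((\<lambda>(x, e). f' x e) \<circ> prod.swap)"
        by (rule continuous_on_compose[OF _ continuous_on_subset[OF cont]])
          (use A r in \<open>force intro!: continuous_intros simp: subset_iff\<close>)+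
      then have "continuous_on (A' \<times> ball x r) (\<lambda>p. f' (snd p) (fst p))" by (simp add: o_def case_prod_beta')
      then show ?thesis
        unfolding case_prod_beta'
        by (rule bounded_linear.continuous_on[OF bounded_linear_blinfun_mult_right])
    qed
    then show "continuous (at (e, x) within A' \<times> ball x r) (\<lambda>(e, x). blinfun_mult_right (f' x e))"
      using A r by (simp add: continuous_on_eq_continuous_within)
  qed (use r in auto)
  then have "((\<lambda>(e, x). f x e) has_derivative (\<lambda>(te, tx). b * te + f' x e * tx)) (at (e, x))"
    using A r at_within_open[of "(e, x)" "A' \<times> ball x r"]
    by (simp add: open_Times blinfun_mult_right.rep_eq)
  then have "((\<lambda>(e, x). f x e) \<circ> prod.swap has_derivative (\<lambda>(te, tx). b * te + f' x e * tx) \<circ> prod.swap) (at (x, e))"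
    by (intro diff_chain_at) (auto intro!: derivative_eq_intros simp: prod.swap_def[abs_def])
  then have "((\<lambda>(x, e). f x e) has_derivative (\<lambda>(h, k). f' x e * h + b * k)) (at (x, e))"
    by (simp add: o_def case_prod_beta' add.commute)
  then show "\<exists>a b. ((\<lambda>(x, e). f x e) has_derivative (\<lambda>(h, k). a * h + b * k)) (at (x, e))" by blast
qed

lemma holomorphic3_on_compose:
  assumes P: "holomorphic3_on (\<lambda>(x, y, e). P x y e) D" and S: "open S"
    and f: "f holomorphic_on S" and g: "g holomorphic_on S" and h: "h holomorphic_on S"
    and im: "\<And>t. t \<in> S \<Longrightarrow> (f t, g t, h t) \<in> D"
  shows "(\<lambda>t. P (f t) (g t) (h t)) holomorphic_on S"
  unfolding holomorphic_on_def
proof (intro ballI, rule field_differentiable_at_within)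
  fix t assume t: "t \<in> S"
  obtain a b c where d: "((\<lambda>(x, y, e). P x y e) has_derivative (\<lambda>(u, v, w). a * u + b * v + c * w)) (at (f t, g t, h t))"
    using P im[OF t] unfolding holomorphic3_on_def by blast
  note d1 = holomorphic_derivI[OF f S t] and d2 = holomorphic_derivI[OF g S t] and d3 = holomorphic_derivI[OF h S t]
  have "((\<lambda>t. (f t, g t, h t)) has_derivative (\<lambda>u. (deriv f t * u, deriv g t * u, deriv h t * u))) (at t)"
    using d1 d2 d3 by (auto simp: has_field_derivative_def intro!: has_derivative_Pair)
  from diff_chain_at[OF this d]
  have "((\<lambda>t. P (f t) (g t) (h t)) has_derivative (\<lambda>u. (a * deriv f t + b * deriv g t + c * deriv h t) * u)) (at t)"
    by (simp add: o_def algebra_simps)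
  then show "(\<lambda>t. P (f t) (g t) (h t)) field_differentiable at t"
    unfolding field_differentiable_def has_field_derivative_def by blast
qed

lemma holomorphic2_on_compose:
  assumes P: "holomorphic2_on (\<lambda>(x, y). P x y) D" and S: "open S"
    and f: "f holomorphic_on S" and g: "g holomorphic_on S"
    and im: "\<And>t. t \<in> S \<Longrightarrow> (f t, g t) \<in> D"
  shows "(\<lambda>t. P (f t) (g t)) holomorphic_on S"
  unfolding holomorphic_on_def
proof (intro ballI, rule field_differentiable_at_within)
  fix t assume t: "t \<in> S"
  obtain a b where d: "((\<lambda>(x, y). P x y) has_derivative (\<lambda>(u, v). a * u + b * v)) (at (f t, g t))"
    using P im[OF t] unfolding holomorphic2_on_def by blast
  note d1 = holomorphic_derivI[OF f S t] and d2 = holomorphic_derivI[OF g S t]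
  have "((\<lambda>t. (f t, g t)) has_derivative (\<lambda>u. (deriv f t * u, deriv g t * u))) (at t)"
    using d1 d2 by (auto simp: has_field_derivative_def intro!: has_derivative_Pair)
  from diff_chain_at[OF this d]
  have "((\<lambda>t. P (f t) (g t)) has_derivative (\<lambda>u. (a * deriv f t + b * deriv g t) * u)) (at t)"
    by (simp add: o_def algebra_simps)
  then show "(\<lambda>t. P (f t) (g t)) field_differentiable at t"
    unfolding field_differentiable_def has_field_derivative_def by blast
qed

lemma holomorphic3_on_imp_continuous_on:
  "holomorphic3_on f D \<Longrightarrow> continuous_on D f"
  unfolding holomorphic3_on_def continuous_on_eq_continuous_within
  by (meson has_derivative_continuous continuous_at_imp_continuous_at_within)

lemma holomorphic2_on_imp_continuous_on:
  "holomorphic2_on f D \<Longrightarrow> continuous_on D f"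
  unfolding holomorphic2_on_def continuous_on_eq_continuous_within
  by (meson has_derivative_continuous continuous_at_imp_continuous_at_within)

section \<open>The a priori estimate\<close>

text \<open>The exponential is the reciprocal of a homogeneous solution, so the term with
  \<open>u\<close> cancels. The constant \<open>c\<close> places the value 1 of the kernel: at the
  start \<open>x ^ p\<close> of a chord, at the outer end of a ray, at \<open>0\<close> for small
  points.\<close>

lemma variation_of_constants_derivative:
  fixes u f :: "complex \<Rightarrow> complex"
  assumes u: "(u has_field_derivative (of_nat p * T s ^ (p - 1) / e * u (T s) + f (T s))) (at (T s))"
    and T: "(T has_vector_derivative T') (at s)"
  shows "((\<lambda>s. u (T s) * exp ((c - T s ^ p) / e)) has_vector_derivative
    T' * (f (T s) * exp ((c - T s ^ p) / e))) (at s)"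
proof -
  have "((\<lambda>x. u x * exp ((c - x ^ p) / e)) has_field_derivative f (T s) * exp ((c - T s ^ p) / e)) (at (T s))"
    unfolding divide_inverse
    by (rule derivative_eq_intros u[unfolded divide_inverse] refl | simp)+ (simp add: algebra_simps)
  then have "((\<lambda>x. u x * exp ((c - x ^ p) / e)) has_field_derivative f (T s) * exp ((c - T s ^ p) / e)) (at (T s) within range T)"
    by (rule has_field_derivative_at_within)
  from field_vector_diff_chain_within[OF T this] show ?thesis by (simp add: o_def)
qed

text \<open>With \<open>R = Re (D / e)\<close> the kernel is \<open>exp (- s R)\<close> and
  \<open>f\<close> may grow like \<open>exp (s R / 2)\<close>, so the integrand decays like
  \<open>exp (- s R / 2)\<close>. The lower bound on \<open>|T s|\<close> limits the speed of
  \<open>T\<close> by a multiple of \<open>|D| / h ^ (p - 1)\<close>, and \<open>re\<close> turns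
  this into a multiple of \<open>R\<close>. Integration gives back \<open>1 / R\<close>, which is
  why the bound is independent of the length of the chord.\<close>

lemma chord_estimate:
  fixes T :: "real \<Rightarrow> complex"
  assumes p: "p \<ge> 1" and h: "h > 0" and \<kappa>: "\<kappa> > 0"
    and Tc: "continuous_on {0..1} T"
    and Tp: "\<And>s. s \<in> {0..1} \<Longrightarrow> T s ^ p = z + of_real s * D"
    and Td: "\<And>s. s \<in> {0<..<1} \<Longrightarrow> (T has_vector_derivative D / (of_nat p * T s ^ (p - 1))) (at s)"
    and low: "\<And>s. s \<in> {0..1} \<Longrightarrow> h / 3 \<le> norm (T s)"
    and re: "\<kappa> * norm D / h ^ p \<le> Re (D / e)"
    and u: "\<And>s. s \<in> {0..1} \<Longrightarrow>
       (u has_field_derivative (of_nat p * T s ^ (p - 1) / e * u (T s) + f (T s))) (at (T s))"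
    and f: "\<And>s. s \<in> {0..1} \<Longrightarrow> h * norm (f (T s)) \<le> B * exp (s * Re (D / e) / 2)"
  shows "norm (u (T 0)) \<le> norm (u (T 1)) * exp (- Re (D / e)) + 2 * 3 ^ (p - 1) * B / \<kappa>"
proof -
  define R where "R = Re (D / e)"
  define g where "g s = u (T s) * exp ((z - T s ^ p) / e)" for s
  \<comment> \<open>A primitive of the bound for the derivative of \<open>g\<close>; comparing
    \<open>g\<close> with it takes the place of estimating an integral.\<close>
  define \<Phi> where "\<Phi> s = - (2 * 3 ^ (p - 1) * B / \<kappa>) * exp (- (s * R) / 2)" for s
  have nexp: "norm (exp ((z - T s ^ p) / e)) = exp (- (s * R))" if "s \<in> {0..1}" for s
  proof -
    have "(z - T s ^ p) / e = of_real (- s) * (D / e)" using Tp[OF that] by simp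
    then show ?thesis unfolding norm_exp_eq_Re R_def by (simp add: times_complex.sel(1) del: times_divide_eq_right of_real_minus)
  qed
  have B0: "B \<ge> 0"
  proof -
    have "0 \<le> h * norm (f (T 0))" using h by simp
    also have "\<dots> \<le> B" using f[of 0] by simp
    finally show ?thesis .
  qed
  have "norm (g 1 - g 0) \<le> \<Phi> 1 - \<Phi> 0"
  proof (rule differentiable_bound_general[OF zero_less_one])
    have "continuous_on {0..1} (\<lambda>s. u (T s))"
    proof (rule continuous_on_compose2[OF _ Tc])
      show "continuous_on (T ` {0..1}) u"
        using DERIV_isCont[OF u] by (auto intro!: continuous_at_imp_continuous_on)
    qed auto
    moreover have "continuous_on {0..1} (\<lambda>s. exp ((z - T s ^ p) / e))"
      unfolding divide_inverse by (intro continuous_intros Tc)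
    ultimately show "continuous_on {0..1} g"
      unfolding g_def by (rule continuous_on_mult)
    show "continuous_on {0..1} \<Phi>"
      unfolding \<Phi>_def by (intro continuous_intros) auto
    fix s :: real assume s: "0 < s" "s < 1"
    show "(g has_vector_derivative D / (of_nat p * T s ^ (p - 1)) * (f (T s) * exp ((z - T s ^ p) / e))) (at s)"
      unfolding g_def by (rule variation_of_constants_derivative[where u = u and f = f and T = T, OF u[of s] Td[of s]]) (use s in auto)
    show "(\<Phi> has_vector_derivative (3 ^ (p - 1) * B / \<kappa>) * R * exp (- (s * R) / 2)) (at s)"
      unfolding \<Phi>_def has_real_derivative_iff_has_vector_derivative[symmetric]
      by (rule derivative_eq_intros refl | simp)+
    have si: "s \<in> {0..1}" using s by auto
    have T0: "norm (T s) > 0" using low[OF si] h by linarith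
    have "norm (D / (of_nat p * T s ^ (p - 1)) * (f (T s) * exp ((z - T s ^ p) / e)))
        = norm D / (real p * norm (T s) ^ (p - 1)) * (norm (f (T s)) * exp (- (s * R)))"
      unfolding norm_mult nexp[OF si] by (simp add: norm_divide norm_power norm_mult)
    also have "\<dots> \<le> norm D / ((h / 3) ^ (p - 1)) * (B * exp (s * R / 2) / h * exp (- (s * R)))"
    proof (intro mult_mono divide_left_mono)
      have "(h / 3) ^ (p - 1) \<le> norm (T s) ^ (p - 1)"
        by (rule power_mono[OF low[OF si]]) (use h in auto)
      also have "\<dots> \<le> real p * norm (T s) ^ (p - 1)"
        using mult_right_mono[of 1 "real p" "norm (T s) ^ (p - 1)"] p by simp
      finally show "(h / 3) ^ (p - 1) \<le> real p * norm (T s) ^ (p - 1)" .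
      show "norm (f (T s)) \<le> B * exp (s * R / 2) / h"
        using f[OF si] h by (simp add: R_def field_simps)
    qed (use h p T0 B0 in auto)
    also have "\<dots> = 3 ^ (p - 1) * B * (norm D / h ^ p) * exp (- (s * R) / 2)"
    proof -
      have "exp (- (s * R) / 2) = exp (s * R / 2) * exp (- (s * R))"
        by (simp flip: exp_add)
      moreover have "h ^ p = h * h ^ (p - 1)" using p by (metis power_eq_if not_one_le_zero)
      ultimately show ?thesis using h by (simp add: power_divide field_simps)
    qed
    also have "\<dots> \<le> 3 ^ (p - 1) * B * (R / \<kappa>) * exp (- (s * R) / 2)"
    proof -
      have "norm D / h ^ p \<le> R / \<kappa>" using re \<kappa> by (simp add: R_def pos_le_divide_eq mult.commute)
      then show ?thesis using B0 by (intro mult_right_mono mult_left_mono) auto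
    qed
    finally show "norm (D / (of_nat p * T s ^ (p - 1)) * (f (T s) * exp ((z - T s ^ p) / e)))
        \<le> (3 ^ (p - 1) * B / \<kappa>) * R * exp (- (s * R) / 2)" by (simp add: mult_ac)
  qed
  also have "\<dots> \<le> 2 * 3 ^ (p - 1) * B / \<kappa>"
    using B0 \<kappa> by (simp add: \<Phi>_def)
  finally have "norm (g 0) \<le> norm (g 1) + 2 * 3 ^ (p - 1) * B / \<kappa>"
    using norm_triangle_ineq2[of "g 0" "g 1"] norm_minus_commute[of "g 1" "g 0"] by linarith
  moreover have "norm (g 0) = norm (u (T 0))" "norm (g 1) = norm (u (T 1)) * exp (- R)"
    unfolding g_def norm_mult using nexp[of 0] nexp[of 1] by simp_all
  ultimately show ?thesis by (simp add: R_def)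
qed

text \<open>From \<open>0\<close> to \<open>x\<close> the hill descends, so the value at
  \<open>0\<close> is damped by \<open>exp (Re (x ^ p / e))\<close>. The source contributes
  \<open>A\<close> times an exponential of \<open>- (1 - t ^ p) \<kappa> A ^ p / 2\<close> with
  \<open>A = |x| / h\<close>, whose integral is bounded uniformly in
  \<open>A \<ge> 1\<close>.\<close>

lemma radial_estimate:
  assumes p: "p \<ge> 1" and h: "h > 0" and \<kappa>: "\<kappa> > 0" and hx: "h \<le> norm x"
    and re: "Re (x ^ p / e) \<le> - \<kappa> * (norm x / h) ^ p"
    and u: "\<And>t. t \<in> {0..1} \<Longrightarrow>
       (u has_field_derivative (of_nat p * (of_real t * x) ^ (p - 1) / e * u (of_real t * x) + f (of_real t * x))) (at (of_real t * x))"
    and f: "\<And>t. t \<in> {0..1} \<Longrightarrow> h * norm (f (of_real t * x)) \<le> B * exp (- (1 - t ^ p) * Re (x ^ p / e) / 2)"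
  shows "norm (u x) \<le> norm (u 0) * exp (Re (x ^ p / e)) + 2 * B / \<kappa>"
proof -
  define R where "R = Re (x ^ p / e)"
  define A where "A = norm x / h"
  have A: "A \<ge> 1" using h hx by (simp add: A_def)
  define T where "T t = of_real t * x" for t :: real
  define g where "g t = u (T t) * exp ((x ^ p - T t ^ p) / e)" for t
  define \<Phi> where "\<Phi> t = (2 * B / \<kappa>) * exp (- ((1 - t) * \<kappa> * A ^ p) / 2)" for t
  have nexp: "norm (exp ((x ^ p - T t ^ p) / e)) = exp ((1 - t ^ p) * R)" for t
  proof -
    have "(x ^ p - T t ^ p) / e = of_real (1 - t ^ p) * (x ^ p / e)"
      by (simp add: T_def power_mult_distrib diff_divide_distrib algebra_simps)
    then show ?thesis unfolding norm_exp_eq_Re R_def by (simp add: times_complex.sel(1) del: times_divide_eq_right of_real_diff of_real_power)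
  qed
  have B0: "B \<ge> 0"
  proof -
    have "0 \<le> h * norm (f (of_real 1 * x))" using h by simp
    also have "\<dots> \<le> B" using f[of 1] by simp
    finally show ?thesis .
  qed
  have "norm (g 1 - g 0) \<le> \<Phi> 1 - \<Phi> 0"
  proof (rule differentiable_bound_general[OF zero_less_one])
    have Tc: "continuous_on {0..1} T" unfolding T_def by (intro continuous_intros)
    have "continuous_on {0..1} (\<lambda>s. u (T s))"
    proof (rule continuous_on_compose2[OF _ Tc])
      show "continuous_on (T ` {0..1}) u"
        using DERIV_isCont[OF u] by (auto intro!: continuous_at_imp_continuous_on simp: T_def)
    qed auto
    moreover have "continuous_on {0..1} (\<lambda>s. exp ((x ^ p - T s ^ p) / e))"
      unfolding divide_inverse by (intro continuous_intros Tc)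
    ultimately show "continuous_on {0..1} g"
      unfolding g_def by (rule continuous_on_mult)
    show "continuous_on {0..1} \<Phi>"
      unfolding \<Phi>_def by (intro continuous_intros) auto
    fix t :: real assume t: "0 < t" "t < 1"
    then have ti: "t \<in> {0..1}" by auto
    show "(g has_vector_derivative x * (f (T t) * exp ((x ^ p - T t ^ p) / e))) (at t)"
      unfolding g_def
    proof (rule variation_of_constants_derivative)
      show "(T has_vector_derivative x) (at t)" unfolding T_def
        by (rule has_vector_derivative_eq_rhs, rule derivative_intros, rule has_vector_derivative_of_real) (rule derivative_eq_intros refl | simp)+
    qed (use u[OF ti] in \<open>simp add: T_def\<close>)
    show "(\<Phi> has_vector_derivative B * A ^ p * exp (- ((1 - t) * \<kappa> * A ^ p) / 2)) (at t)"
      unfolding \<Phi>_def has_real_derivative_iff_has_vector_derivative[symmetric]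
      using \<kappa> by (auto intro!: derivative_eq_intros)
    have "norm (x * (f (T t) * exp ((x ^ p - T t ^ p) / e))) = norm x * (norm (f (T t)) * exp ((1 - t ^ p) * R))"
      by (simp only: norm_mult nexp)
    also have "\<dots> \<le> norm x * (B * exp (- (1 - t ^ p) * R / 2) / h * exp ((1 - t ^ p) * R))"
      using f[OF ti] h by (intro mult_left_mono mult_right_mono) (auto simp: R_def T_def field_simps)
    also have "\<dots> = B * A * exp ((1 - t ^ p) * R / 2)"
    proof -
      have "exp ((1 - t ^ p) * R / 2) = exp (- (1 - t ^ p) * R / 2) * exp ((1 - t ^ p) * R)"
        by (simp flip: exp_add add: field_simps)
      then show ?thesis by (simp add: A_def)
    qed
    \<comment> \<open>Enlarging \<open>A\<close> to \<open>A ^ p\<close> and using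
      \<open>t ^ p \<le> t\<close> makes the exponent linear in \<open>t\<close>, so that the
      right-hand side is exactly the derivative of \<open>\<Phi>\<close>.\<close>
    also have "\<dots> \<le> B * A ^ p * exp (- ((1 - t) * \<kappa> * A ^ p) / 2)"
    proof (intro mult_mono)
      show "A \<le> A ^ p" using A p by (metis power_increasing power_one_right)
      have "t ^ p \<le> t" using t p by (metis less_eq_real_def power_decreasing power_one_right)
      then have "(1 - t ^ p) * R \<le> (1 - t ^ p) * (- \<kappa> * A ^ p)"
        using re t by (intro mult_left_mono) (auto simp: R_def A_def)
      also have "\<dots> \<le> (1 - t) * (- \<kappa> * A ^ p)"
        using \<open>t ^ p \<le> t\<close> \<kappa> A by (intro mult_right_mono_neg) auto
      finally show "exp ((1 - t ^ p) * R / 2) \<le> exp (- ((1 - t) * \<kappa> * A ^ p) / 2)" by simp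
    qed (use A B0 in auto)
    finally show "norm (x * (f (T t) * exp ((x ^ p - T t ^ p) / e))) \<le> B * A ^ p * exp (- ((1 - t) * \<kappa> * A ^ p) / 2)" .
  qed
  also have "\<dots> \<le> 2 * B / \<kappa>"
    using B0 \<kappa> by (simp add: \<Phi>_def)
  finally have "norm (g 1) \<le> norm (g 0) + 2 * B / \<kappa>"
    using norm_triangle_ineq2[of "g 1" "g 0"] by linarith
  moreover have "norm (g 1) = norm (u x)" "norm (g 0) = norm (u 0) * exp R"
    unfolding g_def norm_mult nexp using p by (simp_all add: T_def power_0_left)
  ultimately show ?thesis by (simp add: R_def)
qed

text \<open>For \<open>|x| \<le> m h\<close> the exponent of the kernel has modulus at most
  \<open>m ^ p\<close>, so the values at \<open>0\<close> and at \<open>x\<close> control each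
  other. The second bound brings the estimate from the point \<open>|\<eta>|\<close> back to
  \<open>0\<close>, the first one spreads it from \<open>0\<close> over the small disc.\<close>

lemma small_estimate:
  fixes x e :: complex
  assumes h: "h > 0" and e: "norm e = h ^ p" and hx: "norm x \<le> m * h"
    and u: "\<And>t. t \<in> {0..1} \<Longrightarrow>
       (u has_field_derivative (of_nat p * (of_real t * x) ^ (p - 1) / e * u (of_real t * x) + f (of_real t * x))) (at (of_real t * x))"
    and f: "\<And>t. t \<in> {0..1} \<Longrightarrow> h * norm (f (of_real t * x)) \<le> B" and p: "p \<ge> 1"
  shows "norm (u x) \<le> exp (m ^ p) * (norm (u 0) + m * B * exp (m ^ p))"
    and "norm (u 0) \<le> exp (m ^ p) * (norm (u x) + m * B * exp (m ^ p))"
proof -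
  define T where "T t = of_real t * x" for t :: real
  define g where "g t = u (T t) * exp ((0 - T t ^ p) / e)" for t
  have m0: "m \<ge> 0" using h hx by (smt (verit) mult_neg_pos norm_ge_zero)
  have nz: "norm ((0 - T t ^ p) / e) \<le> m ^ p" if "t \<in> {0..1}" for t
  proof -
    have "norm ((0 - T t ^ p) / e) = (t * norm x / h) ^ p"
      using that h by (simp add: T_def norm_divide norm_power e norm_mult power_divide power_mult_distrib)
    also have "\<dots> \<le> m ^ p"
    proof (rule power_mono)
      have "t * norm x \<le> 1 * norm x" using that by (intro mult_right_mono) auto
      then show "t * norm x / h \<le> m" using hx h by (simp add: field_simps)
    qed (use that h in auto)
    finally show ?thesis .
  qed
  have nexp: "norm (exp ((0 - T t ^ p) / e)) \<le> exp (m ^ p)"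
             "exp (- (m ^ p)) \<le> norm (exp ((0 - T t ^ p) / e))" if "t \<in> {0..1}" for t
    using nz[OF that] abs_Re_le_cmod[of "(0 - T t ^ p) / e"] unfolding norm_exp_eq_Re exp_le_cancel_iff by linarith+
  have B0: "B \<ge> 0"
  proof -
    have "0 \<le> h * norm (f (of_real 1 * x))" using h by simp
    also have "\<dots> \<le> B" using f[of 1] by simp
    finally show ?thesis .
  qed
  have "norm (g 1 - g 0) \<le> m * B * exp (m ^ p) * 1 - m * B * exp (m ^ p) * 0"
  proof (rule differentiable_bound_general[OF zero_less_one])
    have Tc: "continuous_on {0..1} T" unfolding T_def by (intro continuous_intros)
    have "continuous_on {0..1} (\<lambda>s. u (T s))"
    proof (rule continuous_on_compose2[OF _ Tc])
      show "continuous_on (T ` {0..1}) u"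
        using DERIV_isCont[OF u] by (auto intro!: continuous_at_imp_continuous_on simp: T_def)
    qed auto
    moreover have "continuous_on {0..1} (\<lambda>s. exp ((0 - T s ^ p) / e))"
      unfolding divide_inverse by (intro continuous_intros Tc)
    ultimately show "continuous_on {0..1} g"
      unfolding g_def by (rule continuous_on_mult)
    show "continuous_on {0..1} (\<lambda>t. m * B * exp (m ^ p) * t)" by (intro continuous_intros)
    fix t :: real assume t: "0 < t" "t < 1"
    then have ti: "t \<in> {0..1}" by auto
    show "(g has_vector_derivative x * (f (T t) * exp ((0 - T t ^ p) / e))) (at t)"
      unfolding g_def
    proof (rule variation_of_constants_derivative)
      show "(T has_vector_derivative x) (at t)" unfolding T_def
        by (rule has_vector_derivative_eq_rhs, rule derivative_intros, rule has_vector_derivative_of_real) (rule derivative_eq_intros refl | simp)+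
    qed (use u[OF ti] in \<open>simp add: T_def\<close>)
    show "((\<lambda>t. m * B * exp (m ^ p) * t) has_vector_derivative m * B * exp (m ^ p)) (at t)"
      unfolding has_real_derivative_iff_has_vector_derivative[symmetric]
      by (auto intro!: derivative_eq_intros)
    have "norm (x * (f (T t) * exp ((0 - T t ^ p) / e))) \<le> (m * h) * (B / h * exp (m ^ p))"
      unfolding norm_mult using f[OF ti] h hx nexp[OF ti] m0 B0
      by (intro mult_mono) (auto simp: T_def field_simps)
    also have "\<dots> = m * B * exp (m ^ p)" using h by simp
    finally show "norm (x * (f (T t) * exp ((0 - T t ^ p) / e))) \<le> m * B * exp (m ^ p)" .
  qed
  then have d: "norm (g 1 - g 0) \<le> m * B * exp (m ^ p)" by simp
  have g0: "g 0 = u 0" using p by (simp add: g_def T_def power_0_left)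
  have "norm (u x) * exp (- (m ^ p)) \<le> norm (g 1)"
    unfolding g_def norm_mult using nexp(2)[of 1] by (intro mult_mono) (auto simp: T_def)
  also have "\<dots> \<le> norm (u 0) + m * B * exp (m ^ p)"
    using d norm_triangle_ineq2[of "g 1" "g 0"] unfolding g0 by linarith
  finally show "norm (u x) \<le> exp (m ^ p) * (norm (u 0) + m * B * exp (m ^ p))"
    by (simp add: exp_minus field_simps)
  have "norm (u 0) \<le> norm (g 1) + m * B * exp (m ^ p)"
    using d norm_triangle_ineq3[of "g 0" "g 1"] g0 by (simp add: norm_minus_commute)
  also have "\<dots> \<le> norm (u x) * exp (m ^ p) + m * B * exp (m ^ p) * exp (m ^ p)"
  proof (rule add_mono)
    show "norm (g 1) \<le> norm (u x) * exp (m ^ p)"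
      unfolding g_def norm_mult using nexp(1)[of 1] by (intro mult_mono) (auto simp: T_def)
    have "m * B * exp (m ^ p) * 1 \<le> m * B * exp (m ^ p) * exp (m ^ p)"
      using m0 B0 by (intro mult_left_mono) auto
    then show "m * B * exp (m ^ p) \<le> m * B * exp (m ^ p) * exp (m ^ p)" by simp
  qed
  finally show "norm (u 0) \<le> exp (m ^ p) * (norm (u x) + m * B * exp (m ^ p))"
    by (simp add: algebra_simps)
qed

text \<open>The path is the image of a straight segment under a branch of the \<open>p\<close>-th
  root, and the derivative is the one this forces. The last condition says that
  \<open>D / \<eta> ^ p\<close> has argument bounded away from \<open>\<plusminus> pi / 2\<close>;
  \<open>\<kappa>\<close> is the cosine allowed. The factor \<open>1 / 3\<close> keeps the path away
  from the branch point \<open>0\<close>.\<close>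

definition ascending_chord ::
    "nat \<Rightarrow> real \<Rightarrow> complex \<Rightarrow> complex set \<Rightarrow> complex \<Rightarrow> (real \<Rightarrow> complex) \<Rightarrow> complex \<Rightarrow> bool" where
  "ascending_chord p \<kappa> \<eta> W x T D \<longleftrightarrow> T 0 = x \<and> continuous_on {0..1} T \<and>
     (\<forall>s\<in>{0..1}. T s \<in> W \<and> T s ^ p = x ^ p + of_real s * D \<and> norm x / 3 \<le> norm (T s)) \<and>
     (\<forall>s\<in>{0<..<1}. (T has_vector_derivative D / (of_nat p * T s ^ (p - 1))) (at s)) \<and>
     \<kappa> * norm D / norm \<eta> ^ p \<le> Re (D / \<eta> ^ p)"

text \<open>The points that are reached radially from \<open>0\<close>: those where the kernel is
  bounded, and those where \<open>x ^ p / \<eta> ^ p\<close> lies in a closed sector inside the open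
  left half plane.\<close>

definition small_or_descending :: "nat \<Rightarrow> real \<Rightarrow> real \<Rightarrow> complex \<Rightarrow> complex \<Rightarrow> bool" where
  "small_or_descending p \<kappa> m \<eta> x \<longleftrightarrow> norm x \<le> m * norm \<eta> \<or>
     norm \<eta> \<le> norm x \<and> Re (x ^ p / \<eta> ^ p) \<le> - \<kappa> * (norm x / norm \<eta>) ^ p"

text \<open>A weight may grow along a path by at most half of the exponent in the kernel; the other half
  is left to make the kernel integrable.\<close>

definition admissible_weight ::
    "nat \<Rightarrow> real \<Rightarrow> real \<Rightarrow> real \<Rightarrow> complex \<Rightarrow> complex set \<Rightarrow> (complex \<Rightarrow> real) \<Rightarrow> bool" where
  "admissible_weight p \<kappa> m L \<eta> W \<phi> \<longleftrightarrow>
     (\<forall>x\<in>W. \<phi> x \<ge> 0) \<and>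
     (\<forall>x\<in>W. norm x \<le> m * norm \<eta> \<longrightarrow> \<phi> x \<le> L * \<phi> 0 \<and> \<phi> 0 \<le> L * \<phi> x) \<and>
     (\<forall>x\<in>W. \<forall>t\<in>{0..1}. norm \<eta> \<le> norm x \<and> Re (x ^ p / \<eta> ^ p) \<le> - \<kappa> * (norm x / norm \<eta>) ^ p \<longrightarrow>
        \<phi> (of_real t * x) \<le> L * \<phi> x * exp (- (1 - t ^ p) * Re (x ^ p / \<eta> ^ p) / 2)) \<and>
     (\<forall>x\<in>W. \<forall>y\<in>W. norm \<eta> \<le> norm x \<and> norm x / 3 \<le> norm y \<and> 0 \<le> Re ((y ^ p - x ^ p) / \<eta> ^ p) \<longrightarrow>
        \<phi> y \<le> L * \<phi> x * exp (Re ((y ^ p - x ^ p) / \<eta> ^ p) / 2))"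

text \<open>The equation divided by \<open>\<epsilon> = \<eta> ^ p\<close>, so that \<open>f\<close>
  stands for values of \<open>P\<close> and a solution is smaller than \<open>f\<close> by a factor
  \<open>|\<eta>|\<close>.\<close>

definition linear_ode :: "nat \<Rightarrow> complex \<Rightarrow> complex set \<Rightarrow> (complex \<Rightarrow> complex) \<Rightarrow> (complex \<Rightarrow> complex) \<Rightarrow> bool" where
  "linear_ode p \<eta> W f u \<longleftrightarrow>
     (\<forall>x\<in>W. (u has_field_derivative (of_nat p * x ^ (p - 1) / \<eta> ^ p * u x + f x)) (at x))"

text \<open>The constant precedes \<open>\<eta>\<close>, \<open>W\<close> and \<open>\<phi>\<close>:
  it depends on \<open>p\<close>, \<open>\<kappa>\<close>, \<open>m\<close>, \<open>L\<close> alone.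
  A chord bounds \<open>u\<close> at the point \<open>|\<eta>|\<close> and at all points off the
  radial ranges. From \<open>|\<eta>|\<close> the bound passes to \<open>0\<close>, and from
  \<open>0\<close> to the small disc and along the descending rays. The point
  \<open>|\<eta>|\<close> is small itself, yet a chord is demanded there, because it is the entrance
  to the radial part.\<close>

lemma a_priori_estimate:
  fixes \<kappa> m L :: real
  assumes p: "p \<ge> 1" and \<kappa>: "\<kappa> > 0" and m: "m \<ge> 1" and L: "L \<ge> 1"
  shows "\<exists>C>0. \<forall>\<eta> W u f \<phi>. \<eta> \<noteq> 0 \<longrightarrow> (\<forall>x\<in>W. \<forall>t\<in>{0..1}. of_real t * x \<in> W) \<longrightarrow>
     of_real (norm \<eta>) \<in> W \<longrightarrow> admissible_weight p \<kappa> m L \<eta> W \<phi> \<longrightarrow> linear_ode p \<eta> W f u \<longrightarrow>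
     (\<forall>x\<in>W. norm \<eta> * norm (f x) \<le> \<phi> x) \<longrightarrow>
     (\<forall>x\<in>W. (x = of_real (norm \<eta>) \<or> \<not> small_or_descending p \<kappa> m \<eta> x) \<longrightarrow> norm \<eta> \<le> norm x \<and>
        (\<exists>T D. ascending_chord p \<kappa> \<eta> W x T D \<and> norm (u (T 1)) * exp (- Re (D / \<eta> ^ p)) \<le> \<phi> x)) \<longrightarrow>
     (\<forall>x\<in>W. norm (u x) \<le> C * \<phi> x)"
proof -
  \<comment> \<open>\<open>C1\<close> belongs to the chords, \<open>C2\<close> to the origin,
    \<open>C3\<close> to the small disc and \<open>C4\<close> to the rays; the factors
    \<open>L\<close> pay for the comparisons of weights.\<close>
  define C1 where "C1 = 1 + 2 * 3 ^ (p - 1) * L / \<kappa>"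
  define C2 where "C2 = exp (m ^ p) * (C1 * L + m * L * exp (m ^ p))"
  define C3 where "C3 = exp (m ^ p) * (C2 + m * L * exp (m ^ p)) * L"
  define C4 where "C4 = C2 * L + 2 * L / \<kappa>"
  have C1: "C1 > 0" using \<kappa> L by (auto simp: C1_def intro!: add_pos_nonneg)
  have C2: "C2 > 0" using C1 L m by (auto simp: C2_def intro!: mult_pos_pos add_pos_nonneg)
  have C3: "C3 > 0" using C2 L m by (auto simp: C3_def intro!: mult_pos_pos add_pos_nonneg)
  have C4: "C4 > 0" using C2 L \<kappa> by (auto simp: C4_def intro!: mult_pos_pos add_pos_nonneg)
  have bound: "norm (u x) \<le> (C1 + C3 + C4) * \<phi> x"
    if \<eta>: "\<eta> \<noteq> 0" and star: "\<And>x t. x \<in> W \<Longrightarrow> t \<in> {0..1} \<Longrightarrow> of_real t * x \<in> W"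
      and h: "of_real (norm \<eta>) \<in> W" and wt: "admissible_weight p \<kappa> m L \<eta> W \<phi>"
      and ode: "linear_ode p \<eta> W f u"
      and f: "\<And>x. x \<in> W \<Longrightarrow> norm \<eta> * norm (f x) \<le> \<phi> x"
      and ch: "\<And>x. x \<in> W \<Longrightarrow> x = of_real (norm \<eta>) \<or> \<not> small_or_descending p \<kappa> m \<eta> x \<Longrightarrow> norm \<eta> \<le> norm x \<and>
        (\<exists>T D. ascending_chord p \<kappa> \<eta> W x T D \<and> norm (u (T 1)) * exp (- Re (D / \<eta> ^ p)) \<le> \<phi> x)"
      and x: "x \<in> W" for \<eta> W u f \<phi> x
  proof -
    note w = wt[unfolded admissible_weight_def]
    have w0: "\<phi> x \<ge> 0" if "x \<in> W" for x using w that by blast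
    have w1: "\<phi> x \<le> L * \<phi> 0" "\<phi> 0 \<le> L * \<phi> x" if "x \<in> W" "norm x \<le> m * norm \<eta>" for x
      using w that by blast+
    have w2: "\<phi> (of_real t * x) \<le> L * \<phi> x * exp (- (1 - t ^ p) * Re (x ^ p / \<eta> ^ p) / 2)"
      if "x \<in> W" "t \<in> {0..1}" "norm \<eta> \<le> norm x" "Re (x ^ p / \<eta> ^ p) \<le> - \<kappa> * (norm x / norm \<eta>) ^ p" for x t
      using w that by blast
    have w3: "\<phi> y \<le> L * \<phi> x * exp (Re ((y ^ p - x ^ p) / \<eta> ^ p) / 2)"
      if "x \<in> W" "y \<in> W" "norm \<eta> \<le> norm x" "norm x / 3 \<le> norm y" "0 \<le> Re ((y ^ p - x ^ p) / \<eta> ^ p)" for x y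
      using w that by blast
    have n: "norm \<eta> > 0" using \<eta> by simp
    have u: "(u has_field_derivative (of_nat p * x ^ (p - 1) / \<eta> ^ p * u x + f x)) (at x)" if "x \<in> W" for x
      using ode that by (simp add: linear_ode_def)
    have chord: "norm (u x) \<le> C1 * \<phi> x" if x: "x \<in> W" and c: "x = of_real (norm \<eta>) \<or> \<not> small_or_descending p \<kappa> m \<eta> x" for x
    proof -
      obtain T D where TD: "ascending_chord p \<kappa> \<eta> W x T D" "norm (u (T 1)) * exp (- Re (D / \<eta> ^ p)) \<le> \<phi> x"
        and nx: "norm \<eta> \<le> norm x"
        using ch[OF x c] by blast
      note T = TD(1)[unfolded ascending_chord_def]
      have re0: "0 \<le> Re (D / \<eta> ^ p)"
      proof -
        have "0 \<le> \<kappa> * norm D / norm \<eta> ^ p" using \<kappa> by simp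
        with T show ?thesis by linarith
      qed
      have "norm (u (T 0)) \<le> norm (u (T 1)) * exp (- Re (D / \<eta> ^ p)) + 2 * 3 ^ (p - 1) * (L * \<phi> x) / \<kappa>"
      proof (rule chord_estimate[where h = "norm \<eta>" and z = "x ^ p" and f = f and u = u and T = T and e = "\<eta> ^ p" and D = D])
        fix s :: real assume s: "s \<in> {0..1}"
        have "norm x / 3 \<le> norm (T s)" using T s by blast
        then show "norm \<eta> / 3 \<le> norm (T s)" using nx by linarith
        have Ts: "T s \<in> W" using T s by blast
        have eq: "Re ((T s ^ p - x ^ p) / \<eta> ^ p) = s * Re (D / \<eta> ^ p)"
        proof -
          have "T s ^ p = x ^ p + of_real s * D" using T s by blast
          then have "(T s ^ p - x ^ p) / \<eta> ^ p = of_real s * (D / \<eta> ^ p)" by simp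
          then show ?thesis by (simp add: times_complex.sel(1) del: times_divide_eq_right)
        qed
        have "norm \<eta> * norm (f (T s)) \<le> \<phi> (T s)" by (rule f[OF Ts])
        also have "\<dots> \<le> L * \<phi> x * exp (s * Re (D / \<eta> ^ p) / 2)"
          using w3[OF x Ts nx] T s re0 by (simp add: eq)
        finally show "norm \<eta> * norm (f (T s)) \<le> L * \<phi> x * exp (s * Re (D / \<eta> ^ p) / 2)" .
        show "(u has_field_derivative (of_nat p * T s ^ (p - 1) / \<eta> ^ p * u (T s) + f (T s))) (at (T s))"
          by (rule u[OF Ts])
      qed (use T p \<kappa> n in auto)
      also have "\<dots> \<le> C1 * \<phi> x" using TD(2) \<kappa> by (simp add: C1_def field_simps)
      finally show ?thesis using T by simp
    qed
    have zW: "0 \<in> W" using star[OF x, of 0] by simp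
    have hs: "norm (of_real (norm \<eta>) :: complex) \<le> m * norm \<eta>" using m n by simp
    have smf: "norm \<eta> * norm (f (of_real t * x)) \<le> L * \<phi> 0" if "x \<in> W" "norm x \<le> m * norm \<eta>" "t \<in> {0..1}" for x t
    proof -
      have "norm (of_real t * x) \<le> 1 * norm x" unfolding norm_mult using that by (intro mult_right_mono) auto
      then have "norm (of_real t * x) \<le> m * norm \<eta>" using that by linarith
      then show ?thesis using f[OF star[OF that(1,3)]] w1(1)[OF star[OF that(1,3)]] by linarith
    qed
    have u0: "norm (u 0) \<le> C2 * \<phi> 0"
    proof -
      have "norm (u 0) \<le> exp (m ^ p) * (norm (u (of_real (norm \<eta>))) + m * (L * \<phi> 0) * exp (m ^ p))"
      proof (rule small_estimate(2)[where h = "norm \<eta>" and e = "\<eta> ^ p" and f = f and u = u])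
        fix t :: real assume "t \<in> {0..1}"
        note tW = star[OF h this]
        show "(u has_field_derivative of_nat p * (of_real t * of_real (norm \<eta>)) ^ (p - 1) / \<eta> ^ p *
          u (of_real t * of_real (norm \<eta>)) + f (of_real t * of_real (norm \<eta>))) (at (of_real t * of_real (norm \<eta>)))"
          by (rule u[OF tW])
      qed (use n p hs smf[OF h hs] in \<open>auto simp: norm_power\<close>)
      also have "\<dots> \<le> exp (m ^ p) * (C1 * (L * \<phi> 0) + m * (L * \<phi> 0) * exp (m ^ p))"
      proof -
        have "norm (u (of_real (norm \<eta>))) \<le> C1 * \<phi> (of_real (norm \<eta>))" by (rule chord[OF h]) simp
        also have "\<dots> \<le> C1 * (L * \<phi> 0)" using w1(1)[OF h hs] C1 by (intro mult_left_mono) auto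
        finally show ?thesis by simp
      qed
      finally show ?thesis by (simp add: C2_def algebra_simps)
    qed
    show ?thesis
    proof (cases "small_or_descending p \<kappa> m \<eta> x")
      case False
      then have "norm (u x) \<le> C1 * \<phi> x" by (intro chord x) auto
      also have "\<dots> \<le> (C1 + C3 + C4) * \<phi> x" using C3 C4 w0[OF x] by (intro mult_right_mono) auto
      finally show ?thesis .
    next
      case True
      then consider (sm) "norm x \<le> m * norm \<eta>"
        | (rad) "norm \<eta> \<le> norm x" "Re (x ^ p / \<eta> ^ p) \<le> - \<kappa> * (norm x / norm \<eta>) ^ p"
        unfolding small_or_descending_def by blast
      then show ?thesis
      proof cases
        case sm
        have "norm (u x) \<le> exp (m ^ p) * (norm (u 0) + m * (L * \<phi> 0) * exp (m ^ p))"
        proof (rule small_estimate(1)[where h = "norm \<eta>" and e = "\<eta> ^ p" and f = f and u = u])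
          fix t :: real assume "t \<in> {0..1}"
          note tW = star[OF x this]
          show "(u has_field_derivative of_nat p * (of_real t * x) ^ (p - 1) / \<eta> ^ p *
            u (of_real t * x) + f (of_real t * x)) (at (of_real t * x))"
            by (rule u[OF tW])
        qed (use n p sm smf[OF x sm] in \<open>auto simp: norm_power\<close>)
        also have "\<dots> \<le> exp (m ^ p) * (C2 * \<phi> 0 + m * (L * \<phi> 0) * exp (m ^ p))" using u0 by simp
        also have "\<dots> = exp (m ^ p) * (C2 + m * L * exp (m ^ p)) * \<phi> 0" by (simp add: algebra_simps)
        also have "\<dots> \<le> exp (m ^ p) * (C2 + m * L * exp (m ^ p)) * (L * \<phi> x)"
          using w1(2)[OF x sm] C2 m L by (intro mult_left_mono) auto
        also have "\<dots> = C3 * \<phi> x" by (simp add: C3_def)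
        also have "\<dots> \<le> (C1 + C3 + C4) * \<phi> x" using C1 C4 w0[OF x] by (intro mult_right_mono) auto
        finally show ?thesis .
      next
        case rad
        have Rn: "Re (x ^ p / \<eta> ^ p) \<le> 0"
        proof -
          have "0 \<le> \<kappa> * (norm x / norm \<eta>) ^ p" using \<kappa> by simp
          with rad(2) show ?thesis by linarith
        qed
        have "norm (u x) \<le> norm (u 0) * exp (Re (x ^ p / \<eta> ^ p)) + 2 * (L * \<phi> x) / \<kappa>"
        proof (rule radial_estimate[where h = "norm \<eta>" and f = f and u = u])
          fix t :: real assume t: "t \<in> {0..1}"
          note tW = star[OF x t]
          show "(u has_field_derivative of_nat p * (of_real t * x) ^ (p - 1) / \<eta> ^ p *
            u (of_real t * x) + f (of_real t * x)) (at (of_real t * x))"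
            by (rule u[OF tW])
          show "norm \<eta> * norm (f (of_real t * x)) \<le> L * \<phi> x * exp (- (1 - t ^ p) * Re (x ^ p / \<eta> ^ p) / 2)"
            using f[OF tW] w2[OF x t rad] by linarith
        qed (use n p \<kappa> rad in auto)
        \<comment> \<open>The weight at \<open>0\<close> may exceed the weight at \<open>x\<close>
          by \<open>exp (- R / 2)\<close> with \<open>R = Re (x ^ p / \<eta> ^ p) \<le> 0\<close>;
          the kernel \<open>exp R\<close> absorbs this and leaves
          \<open>exp (R / 2) \<le> 1\<close>.\<close>
        also have "norm (u 0) * exp (Re (x ^ p / \<eta> ^ p)) \<le> C2 * (L * \<phi> x)"
        proof -
          have "\<phi> 0 \<le> L * \<phi> x * exp (- Re (x ^ p / \<eta> ^ p) / 2)"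
            using w2[OF x _ rad, of 0] p by (simp add: power_0_left)
          then have "norm (u 0) * exp (Re (x ^ p / \<eta> ^ p)) \<le> C2 * (L * \<phi> x * exp (- Re (x ^ p / \<eta> ^ p) / 2)) * exp (Re (x ^ p / \<eta> ^ p))"
            using u0 C2 by (intro mult_right_mono) (auto intro: order_trans mult_left_mono)
          also have "\<dots> = C2 * (L * \<phi> x) * exp (Re (x ^ p / \<eta> ^ p) / 2)"
          proof -
            have "exp (Re (x ^ p / \<eta> ^ p) / 2) = exp (- Re (x ^ p / \<eta> ^ p) / 2) * exp (Re (x ^ p / \<eta> ^ p))"
              by (simp flip: exp_add)
            then show ?thesis by simp
          qed
          also have "\<dots> \<le> C2 * (L * \<phi> x) * 1"
            using Rn C2 L w0[OF x] by (intro mult_left_mono) auto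
          finally show ?thesis by simp
        qed
        also have "C2 * (L * \<phi> x) + 2 * (L * \<phi> x) / \<kappa> = C4 * \<phi> x" by (simp add: C4_def algebra_simps)
        also have "\<dots> \<le> (C1 + C3 + C4) * \<phi> x" using C1 C3 w0[OF x] by (intro mult_right_mono) auto
        finally show ?thesis by simp
      qed
    qed
  qed
  show ?thesis
  proof (intro exI[of _ "C1 + C3 + C4"] conjI allI impI ballI)
    show "C1 + C3 + C4 > 0" using C1 C3 C4 by simp
    fix \<eta> W u f \<phi> x
    assume *: "\<eta> \<noteq> 0" "\<forall>x\<in>W. \<forall>t\<in>{0..1}. of_real t * x \<in> W" "of_real (norm \<eta>) \<in> W"
      "admissible_weight p \<kappa> m L \<eta> W \<phi>" "linear_ode p \<eta> W f u" "\<forall>x\<in>W. norm \<eta> * norm (f x) \<le> \<phi> x"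
      and ch: "\<forall>x\<in>W. (x = of_real (norm \<eta>) \<or> \<not> small_or_descending p \<kappa> m \<eta> x) \<longrightarrow> norm \<eta> \<le> norm x \<and>
        (\<exists>T D. ascending_chord p \<kappa> \<eta> W x T D \<and> norm (u (T 1)) * exp (- Re (D / \<eta> ^ p)) \<le> \<phi> x)"
      and x: "x \<in> W"
    show "norm (u x) \<le> (C1 + C3 + C4) * \<phi> x"
      by (rule bound[of \<eta> W \<phi> f u x, OF *(1) *(2)[rule_format] *(3-5) *(6)[rule_format] ch[rule_format] x])
  qed
qed

section \<open>Ascending chords and null solutions\<close>

lemma power_polar: "x ^ p = rcis (norm x ^ p) (real p * Arg x)"
  by (metis DeMoivre2 rcis_cmod_Arg)

lemma Re_power_quotient:
  "Re (x ^ p / y ^ p) = (norm x / norm y) ^ p * cos (real p * (Arg x - Arg y))"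
proof -
  have "x ^ p / y ^ p = rcis ((norm x / norm y) ^ p) (real p * (Arg x - Arg y))"
    by (subst (1 2) power_polar) (simp add: rcis_divide power_divide right_diff_distrib)
  then show ?thesis by (simp add: rcis_def)
qed

lemma root_powr:
  assumes w: "w \<noteq> 0" and p: "p \<ge> 1"
  shows "(w powr (1 / of_nat p)) ^ p = w"
    and "Arg (w powr (1 / of_nat p)) = Arg w / real p"
    and "norm (w powr (1 / of_nat p)) ^ p = norm w"
proof -
  have e: "w powr (1 / of_nat p) = exp (Ln w / of_nat p)" using w by (simp add: powr_def)
  show *: "(w powr (1 / of_nat p)) ^ p = w"
    using p w unfolding e exp_of_nat_mult[symmetric] by simp
  have "\<bar>Im (Ln w) / real p\<bar> \<le> \<bar>Im (Ln w)\<bar>" using p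
    by (simp add: abs_divide divide_le_eq mult_le_cancel_left1)
  have le: "- pi < Arg w / real p" "Arg w / real p \<le> pi"
  proof -
    have a: "- pi < Arg w" "Arg w \<le> pi" using mpi_less_Arg Arg_le_pi by auto
    have "pi * 1 \<le> pi * real p" using p by (intro mult_left_mono) auto
    with a have "- pi * real p < Arg w" "Arg w \<le> pi * real p" by linarith+
    then show "- pi < Arg w / real p" "Arg w / real p \<le> pi" using p by (simp_all add: field_simps)
  qed
  have "Ln w = Complex (ln (norm w)) (Arg w)" using w by (simp add: complex_eq_iff Arg_eq_Im_Ln)
  then have "exp (Ln w / of_nat p) = of_real (exp (ln (norm w) / real p)) * exp (\<i> * of_real (Arg w / real p))"
    by (simp add: exp_eq_polar Complex_eq add_divide_distrib exp_add exp_of_real flip: of_real_exp cis_conv_exp)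
  then show "Arg (w powr (1 / of_nat p)) = Arg w / real p"
    unfolding e using le by (intro Arg_unique[where r = "exp (ln (norm w) / real p)"]) auto
  show "norm (w powr (1 / of_nat p)) ^ p = norm w"
    using * by (metis norm_power)
qed

lemma powr_root_power:
  assumes x: "x \<noteq> 0" and p: "p \<ge> 1" and a: "real p * \<bar>Arg x\<bar> < pi"
  shows "(x ^ p) powr (1 / of_nat p) = x" and "Arg (x ^ p) = real p * Arg x"
proof -
  show ar: "Arg (x ^ p) = real p * Arg x"
  proof (rule Arg_unique'[where r = "norm x ^ p"])
    have "\<bar>real p * Arg x\<bar> < pi" using a by (simp add: abs_mult)
    then show "real p * Arg x \<in> {- pi<..pi}" by auto
  qed (use x power_polar in auto)
  have z: "x ^ p \<noteq> 0" using x by simp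
  have n: "norm ((x ^ p) powr (1 / of_nat p)) = norm x"
  proof (rule power_eq_imp_eq_base)
    show "norm ((x ^ p) powr (1 / of_nat p)) ^ p = norm x ^ p"
      using root_powr(3)[OF z p] by (simp add: norm_power)
  qed (use p in auto)
  have "Arg ((x ^ p) powr (1 / of_nat p)) = Arg x"
    using root_powr(2)[OF z p] ar p by simp
  with n show "(x ^ p) powr (1 / of_nat p) = x" by (metis rcis_cmod_Arg)
qed

text \<open>\<open>- 3 / 4\<close> is a rational number just below \<open>cos (3 pi / 4)\<close>,
  convenient for the sum of squares in \<open>norm_add_real_ge\<close>.\<close>

lemma cos_ge_obtuse:
  assumes "\<bar>t\<bar> \<le> 3 * pi / 4"
  shows "- (3/4) \<le> cos t"
proof -
  have "cos (3 * pi / 4) = - (sqrt 2 / 2)"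
    using cos_pi_minus[of "pi / 4"] cos_45 by (simp add: field_simps)
  moreover have "sqrt 2 \<le> 3 / 2" by (rule real_le_lsqrt) (auto simp: power2_eq_square)
  moreover have "cos (3 * pi / 4) \<le> cos \<bar>t\<bar>"
    using assms pi_gt_zero by (intro cos_monotone_0_pi_le) auto
  moreover have "cos \<bar>t\<bar> = cos t" by (simp add: abs_if)
  ultimately show ?thesis by linarith
qed

text \<open>With \<open>A = |z|\<close> the square of the right-hand side is at least
  \<open>A^2 + b^2 - 3/2 A b\<close>, and its excess over \<open>((A + b) / 3)^2\<close> is the
  explicit sum of squares in the proof. This is the origin of the factor \<open>1 / 3\<close> in the
  conditions on chords.\<close>

lemma norm_add_real_ge:
  assumes z: "- (3/4) * norm z \<le> Re z" and b: "b \<ge> 0"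
  shows "(norm z + b) / 3 \<le> norm (z + of_real b)"
proof -
  define A where "A = norm z"
  have "(norm (z + of_real b))\<^sup>2 = A\<^sup>2 + b\<^sup>2 + 2 * b * Re z"
    unfolding cmod_power2 A_def by (simp add: power2_eq_square algebra_simps)
  moreover have "2 * b * (- (3/4) * A) \<le> 2 * b * Re z" using z b unfolding A_def by (intro mult_left_mono) auto
  moreover have "A\<^sup>2 + b\<^sup>2 - 3/2 * A * b - ((A + b) / 3)\<^sup>2 = 31/36 * (A - b)\<^sup>2 + 1/36 * (A\<^sup>2 + b\<^sup>2)"
    by (simp add: power2_eq_square field_simps)
  moreover have "31/36 * (A - b)\<^sup>2 + 1/36 * (A\<^sup>2 + b\<^sup>2) \<ge> 0" by simp
  moreover have "2 * b * (- (3/4) * A) = - (3/2 * A * b)" by simp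
  ultimately have "((A + b) / 3)\<^sup>2 \<le> (norm (z + of_real b))\<^sup>2" by linarith
  then show ?thesis unfolding A_def by (rule power2_le_imp_le) auto
qed

text \<open>Chords are straight in the variable \<open>x ^ p\<close>; on the wedge \<open>p |Arg x| \<le> 3\<pi>/4\<close> they stay away
  from the branch cut and from the origin.\<close>

lemma chord_path:
  assumes p: "p \<ge> 1" and x: "x \<noteq> 0" and a: "real p * \<bar>Arg x\<bar> \<le> 3 * pi / 4" and q: "norm x \<le> q"
  defines "D \<equiv> of_real (q ^ p) - x ^ p"
  defines "T \<equiv> (\<lambda>s::real. (x ^ p + of_real s * D) powr (1 / of_nat p))"
  shows "T 0 = x" and "T 1 = of_real q" and "continuous_on {0..1} T"
    and "\<And>s. s \<in> {0..1} \<Longrightarrow> T s \<noteq> 0 \<and> T s ^ p = x ^ p + of_real s * D \<and> norm x / 3 \<le> norm (T s) \<and>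
       real p * \<bar>Arg (T s)\<bar> < pi \<and> real p * Arg (T s) = Arg (x ^ p + of_real s * D)"
    and "\<And>s. s \<in> {0<..<1} \<Longrightarrow> (T has_vector_derivative D / (of_nat p * T s ^ (p - 1))) (at s)"
proof -
  have q0: "q > 0" using x q by (metis norm_eq_zero norm_ge_zero order_less_le order_less_le_trans)
  have a': "real p * \<bar>Arg x\<bar> < pi" using a pi_gt_zero by linarith
  show "T 0 = x" using powr_root_power(1)[OF x p a'] by (simp add: T_def)
  show "T 1 = of_real q"
  proof -
    have "Arg (of_real q) = 0" using q0 by (simp add: Arg_of_real)
    then show ?thesis using powr_root_power(1)[of "of_real q" p] p q0 pi_gt_zero by (simp add: T_def D_def)
  qed
  define Z where "Z s = x ^ p + of_real s * D" for s :: real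
  have Zs: "Z s = of_real (1 - s) * x ^ p + of_real (s * q ^ p)" for s
    by (simp add: Z_def D_def algebra_simps)
  have ReZ: "- (3/4) * norm x ^ p \<le> Re (x ^ p)"
  proof -
    have "- (3/4) \<le> cos (real p * Arg x)" using a by (intro cos_ge_obtuse) (simp add: abs_mult)
    then have "norm x ^ p * (- (3/4)) \<le> norm x ^ p * cos (real p * Arg x)"
      by (intro mult_left_mono) auto
    moreover have "Re (x ^ p) = norm x ^ p * cos (real p * Arg x)"
      by (metis Re_rcis power_polar)
    ultimately show ?thesis by simp
  qed
  have low: "norm x ^ p / 3 \<le> norm (Z s)" if s: "s \<in> {0..1}" for s
  proof -
    have xq: "norm x ^ p \<le> q ^ p" using q by (intro power_mono) auto
    have n: "norm (of_real (1 - s) * x ^ p) = (1 - s) * norm x ^ p"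
      unfolding norm_mult norm_of_real norm_power using s by simp
    have "- (3/4) * norm (of_real (1 - s) * x ^ p) \<le> Re (of_real (1 - s) * x ^ p)"
    proof -
      have "(1 - s) * (- (3/4) * norm x ^ p) \<le> (1 - s) * Re (x ^ p)" using ReZ s by (intro mult_left_mono) auto
      moreover have "Re (of_real (1 - s) * x ^ p) = (1 - s) * Re (x ^ p)"
        by (simp del: of_real_diff add: times_complex.sel(1))
      ultimately show ?thesis unfolding n by (simp only: mult.left_commute)
    qed
    then have "(norm (of_real (1 - s) * x ^ p) + s * q ^ p) / 3 \<le> norm (Z s)"
      unfolding Zs using s q0 by (intro norm_add_real_ge) auto
    moreover have "norm x ^ p \<le> norm (of_real (1 - s) * x ^ p) + s * q ^ p"
    proof -
      have "s * norm x ^ p \<le> s * q ^ p" using s xq by (intro mult_left_mono) auto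
      then show ?thesis unfolding n by (simp add: algebra_simps)
    qed
    then have "norm x ^ p / 3 \<le> (norm (of_real (1 - s) * x ^ p) + s * q ^ p) / 3" by simp
    ultimately show ?thesis by (rule order_trans[rotated])
  qed
  have xp: "norm x ^ p > 0" using x by simp
  have nz: "Z s \<noteq> 0" if "s \<in> {0..1}" for s
    using low[OF that] xp by auto
  \<comment> \<open>For \<open>s < 1\<close> a convex combination of \<open>x ^ p\<close> and a
    positive number is real only if \<open>x ^ p\<close> is real, and the wedge excludes negative
    real values of \<open>x ^ p\<close>.\<close>
  have slit: "Z s \<notin> \<real>\<^sub>\<le>\<^sub>0" if s: "s \<in> {0..1}" for s
  proof
    assume "Z s \<in> \<real>\<^sub>\<le>\<^sub>0"
    then have neg: "Re (Z s) \<le> 0" "Im (Z s) = 0" by (auto simp: complex_nonpos_Reals_iff)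
    have re: "Re (Z s) = (1 - s) * Re (x ^ p) + s * q ^ p" unfolding Zs
      by (simp del: of_real_mult of_real_diff of_real_power add: times_complex.sel(1))
    have im: "Im (Z s) = (1 - s) * Im (x ^ p)" unfolding Zs
      by (simp del: of_real_mult of_real_diff of_real_power add: times_complex.sel)
    have "s \<noteq> 1" using neg re zero_less_power[OF q0, of p] by auto
    then have im0: "Im (x ^ p) = 0" using im neg by simp
    have "(1 - s) * Re (x ^ p) \<le> 0" 
    proof -
      have "0 \<le> s * q ^ p" using s q0 by simp
      then show ?thesis using neg re by linarith
    qed
    then have "Re (x ^ p) \<le> 0" using \<open>s \<noteq> 1\<close> s by (simp add: mult_le_0_iff)
    then have "norm (x ^ p) = - Re (x ^ p)" using im0 by (simp add: cmod_def)
    then show False using ReZ xp by (simp add: norm_power)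
  qed
  show "T s \<noteq> 0 \<and> T s ^ p = x ^ p + of_real s * D \<and> norm x / 3 \<le> norm (T s) \<and>
       real p * \<bar>Arg (T s)\<bar> < pi \<and> real p * Arg (T s) = Arg (x ^ p + of_real s * D)" if s: "s \<in> {0..1}" for s
  proof -
    have TZ: "T s = Z s powr (1 / of_nat p)" by (simp add: T_def Z_def)
    note r = root_powr[OF nz[OF s] p, folded TZ]
    \<comment> \<open>A factor \<open>1 / 3\<close> for the \<open>p\<close>-th powers gives the
      factor \<open>1 / 3\<close> for the points themselves, since
      \<open>3 ^ p \<ge> 3\<close>.\<close>
    have "(norm x / 3) ^ p \<le> norm (T s) ^ p"
    proof -
      have "(norm x / 3) ^ p \<le> norm x ^ p / 3 ^ 1"
        unfolding power_divide using p by (intro divide_left_mono power_increasing) auto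
      also have "\<dots> \<le> norm (T s) ^ p" using low[OF s] r(3) by simp
      finally show ?thesis .
    qed
    then have l: "norm x / 3 \<le> norm (T s)" using power_mono_iff[of "norm x / 3" "norm (T s)" p] p by simp
    have a: "real p * Arg (T s) = Arg (Z s)" using r(2) p by simp
    have "\<bar>Arg (Z s)\<bar> < pi"
    proof -
      have "Arg (Z s) \<noteq> pi" using slit[OF s]
        by (metis Arg_eq_pi complex_nonpos_Reals_iff order_less_imp_le)
      then show ?thesis using mpi_less_Arg[of "Z s"] Arg_le_pi[of "Z s"] by linarith
    qed
    then have "\<bar>real p * Arg (T s)\<bar> < pi" using a by simp
    then have "real p * \<bar>Arg (T s)\<bar> < pi" by (simp add: abs_mult)
    moreover have "T s \<noteq> 0" using r(1) nz[OF s] p by (cases p) auto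
    ultimately show ?thesis using r(1) l a unfolding Z_def by blast
  qed
  have "continuous_on (- \<real>\<^sub>\<le>\<^sub>0) (\<lambda>z::complex. z powr (1 / of_nat p))"
    by (intro continuous_at_imp_continuous_on ballI DERIV_isCont[OF has_field_derivative_powr]) auto
  moreover have "continuous_on {0..1} Z" unfolding Z_def by (intro continuous_intros)
  ultimately have "continuous_on {0..1} (\<lambda>s. Z s powr (1 / of_nat p))"
    by (rule continuous_on_compose2) (use slit in auto)
  then show "continuous_on {0..1} T" by (simp add: T_def Z_def)
  show "(T has_vector_derivative D / (of_nat p * T s ^ (p - 1))) (at s)" if s: "s \<in> {0<..<1}" for s
  proof -
    have si: "s \<in> {0..1}" using s by auto
    have TZ: "T s = Z s powr (1 / of_nat p)" by (simp add: T_def Z_def)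
    note r = root_powr[OF nz[OF si] p, folded TZ]
    have T0: "T s \<noteq> 0" using r(1) nz[OF si] p by (cases p) auto
    have d: "((\<lambda>z. z powr (1 / of_nat p)) has_field_derivative (1 / of_nat p * Z s powr (1 / of_nat p - 1))) (at (Z s) within range Z)"
      by (rule has_field_derivative_at_within[OF has_field_derivative_powr[OF slit[OF si]]])
    have "(Z has_vector_derivative D) (at s)" unfolding Z_def
      by (rule derivative_eq_intros refl | simp)+
    from field_vector_diff_chain_within[OF this d]
    have "(T has_vector_derivative D * (1 / of_nat p * Z s powr (1 / of_nat p - 1))) (at s)"
      by (simp add: o_def T_def Z_def)
    moreover have "Z s powr (1 / of_nat p - 1) = T s / T s ^ p"
      using nz[OF si] r(1) by (simp add: powr_diff TZ)
    moreover have "T s / T s ^ p = 1 / T s ^ (p - 1)"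
      using T0 p by (cases p) auto
    ultimately show ?thesis by simp
  qed
qed

text \<open>Positivity for the two extreme rotations means
  \<open>|Arg D| < pi / 2 - 2 \<delta>\<close>. Turning by at most \<open>\<delta>\<close> leaves an
  angle of at most \<open>pi / 2 - \<delta>\<close>, whose cosine is at least
  \<open>sin \<delta>\<close>. With \<open>\<psi> = p Arg \<eta>\<close> this yields an ascent rate
  uniform in the direction of \<open>\<eta>\<close>.\<close>

lemma cone_direction:
  assumes \<delta>: "0 < \<delta>" "\<delta> \<le> pi / 8" and D: "D \<noteq> 0"
    and c: "Re (D * cis (2 * \<delta>)) > 0" "Re (D * cis (- (2 * \<delta>))) > 0" and \<psi>: "\<bar>\<psi>\<bar> \<le> \<delta>"
  shows "sin \<delta> * norm D \<le> Re (D * cis (- \<psi>))"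
proof -
  define \<tau> where "\<tau> = Arg D"
  have Re: "Re (D * cis t) = norm D * cos (\<tau> + t)" for t
    by (subst rcis_cmod_Arg[of D, symmetric], simp only: rcis_def mult.assoc cis_mult \<tau>_def) simp
  have nD: "norm D > 0" using D by simp
  have cc: "cos (\<tau> + 2 * \<delta>) > 0" "cos (\<tau> - 2 * \<delta>) > 0"
    using c nD unfolding Re by (simp_all add: zero_less_mult_iff)
  have tau: "\<bar>\<tau>\<bar> \<le> pi" using mpi_less_Arg[of D] Arg_le_pi[of D] by (auto simp: \<tau>_def)
  \<comment> \<open>Of the two hypotheses, the one that turns \<open>D\<close> further away from the
    positive axis is kept.\<close>
  have "cos (\<bar>\<tau>\<bar> + 2 * \<delta>) > 0"
  proof (cases "\<tau> \<ge> 0")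
    case False
    then have "cos (\<bar>\<tau>\<bar> + 2 * \<delta>) = cos (- (\<tau> - 2 * \<delta>))" by (simp add: abs_if)
    then show ?thesis using cc by (simp only: cos_minus)
  qed (use cc in auto)
  then have "\<bar>\<tau>\<bar> + 2 * \<delta> < pi / 2"
  proof -
    have "cos (\<bar>\<tau>\<bar> + 2 * \<delta>) \<le> 0" if "\<not> \<bar>\<tau>\<bar> + 2 * \<delta> < pi / 2"
    proof -
      have "cos (\<bar>\<tau>\<bar> + 2 * \<delta>) = - cos (\<bar>\<tau>\<bar> + 2 * \<delta> - pi)" by simp
      moreover have "cos (\<bar>\<tau>\<bar> + 2 * \<delta> - pi) \<ge> 0"
        by (rule cos_ge_zero) (use that tau \<delta> pi_gt_zero in linarith)+
      ultimately show ?thesis by linarith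
    qed
    then show ?thesis using \<open>cos (\<bar>\<tau>\<bar> + 2 * \<delta>) > 0\<close> by fastforce
  qed
  then have le: "\<bar>\<tau> - \<psi>\<bar> \<le> pi / 2 - \<delta>" using \<psi> by linarith
  have "sin \<delta> = cos (pi / 2 - \<delta>)" by (simp add: cos_diff)
  also have "\<dots> \<le> cos \<bar>\<tau> - \<psi>\<bar>"
    by (rule cos_monotone_0_pi_le) (use le \<delta> pi_gt_zero in linarith)+
  also have "\<dots> = cos (\<tau> - \<psi>)" by (simp add: abs_if cos_diff)
  finally have "norm D * sin \<delta> \<le> norm D * cos (\<tau> - \<psi>)" by (intro mult_left_mono) auto
  then show ?thesis unfolding Re by (simp add: mult.commute)
qed

text \<open>Here the bound \<open>pi / 8\<close> originates:
  \<open>3 pi / 4 - \<delta> \<ge> pi / 2 + \<delta>\<close> is what keeps the cosine below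
  \<open>- sin \<delta>\<close> from the place where the chords stop, even after
  \<open>\<delta>\<close> is lost to the argument of \<open>\<eta> ^ p\<close>.\<close>

lemma cos_obtuse_le:
  assumes \<delta>: "0 < \<delta>" "\<delta> \<le> pi / 8" and t: "3 * pi / 4 - \<delta> \<le> \<bar>t\<bar>" "\<bar>t\<bar> \<le> 3 * pi / 2 - \<delta>"
  shows "cos t \<le> - sin \<delta>"
proof -
  have "cos t = cos \<bar>t\<bar>" by (simp add: abs_if)
  also have "\<dots> = - cos (\<bar>t\<bar> - pi)" by simp
  also have "cos (\<bar>t\<bar> - pi) = cos \<bar>\<bar>t\<bar> - pi\<bar>" by (metis abs_of_nonneg abs_of_nonpos cos_minus linear)
  also have "sin \<delta> \<le> cos \<bar>\<bar>t\<bar> - pi\<bar>"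
  proof -
    have "cos (pi / 2 - \<delta>) \<le> cos \<bar>\<bar>t\<bar> - pi\<bar>"
      by (rule cos_monotone_0_pi_le) (use t \<delta> pi_gt_zero in linarith)+
    then show ?thesis by (simp add: cos_diff)
  qed
  ultimately show ?thesis by linarith
qed

section \<open>Solutions of the linear equation that vanish at the top of the hill\<close>

definition Wint :: "nat \<Rightarrow> complex \<Rightarrow> (complex \<Rightarrow> complex) \<Rightarrow> complex \<Rightarrow> complex" where
  "Wint p \<eta> f x = contour_integral (linepath 0 x) (\<lambda>t. exp (- (t ^ p) / \<eta> ^ p) * f t)"

text \<open>Minus the integral of variation of constants from \<open>x\<close> to the end of the
  sequence \<open>q\<close>. It is split at \<open>0\<close>, and the far part is written as a limit
  because the end point lies outside the domain.\<close>

definition null_solution :: "nat \<Rightarrow> complex \<Rightarrow> (nat \<Rightarrow> real) \<Rightarrow> (complex \<Rightarrow> complex) \<Rightarrow> complex \<Rightarrow> complex" where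
  "null_solution p \<eta> q f x =
     exp (x ^ p / \<eta> ^ p) * (Wint p \<eta> f x - lim (\<lambda>n. Wint p \<eta> f (of_real (q n))))"

text \<open>A holomorphic integrand on a starlike domain has a primitive \<open>g\<close>, and the
  integral over the segment from \<open>0\<close> is \<open>g - g 0\<close>.\<close>

lemma Wint_derivative:
  assumes W: "open W" and star: "\<And>x t. x \<in> W \<Longrightarrow> t \<in> {0..1} \<Longrightarrow> of_real t * x \<in> W"
    and f: "f holomorphic_on W" and x: "x \<in> W"
  shows "(Wint p \<eta> f has_field_derivative exp (- (x ^ p) / \<eta> ^ p) * f x) (at x)"
proof -
  let ?h = "\<lambda>t. exp (- (t ^ p) / \<eta> ^ p) * f t"
  have h: "?h holomorphic_on W" unfolding divide_inverse by (intro holomorphic_intros f)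
  have seg: "closed_segment 0 y \<subseteq> W" if "y \<in> W" for y
    using star[OF that] by (auto simp: closed_segment_def scaleR_conv_of_real)
  have "starlike W" unfolding starlike_def using seg star[OF x, of 0] by auto
  then obtain g where g: "\<And>x. x \<in> W \<Longrightarrow> (g has_field_derivative ?h x) (at x)"
    using holomorphic_starlike_primitive[of W ?h "{}"] W h holomorphic_on_imp_continuous_on[OF h]
      holomorphic_on_imp_differentiable_at[OF h W] by auto
  have eq: "Wint p \<eta> f y = g y - g 0" if "y \<in> W" for y
    unfolding Wint_def
    using contour_integral_primitive[of W g ?h "linepath 0 y"] g seg[OF that]
    by (intro contour_integral_unique) (auto intro: has_field_derivative_at_within)
  have d: "((\<lambda>y. g y - g 0) has_field_derivative ?h x) (at x)"
    by (rule derivative_eq_intros g x | simp)+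
  show ?thesis
    by (rule has_field_derivative_transform_within_open[OF d W x]) (simp add: eq)
qed

lemma null_solution_ode:
  assumes W: "open W" and star: "\<And>x t. x \<in> W \<Longrightarrow> t \<in> {0..1} \<Longrightarrow> of_real t * x \<in> W"
    and f: "f holomorphic_on W"
  shows "linear_ode p \<eta> W f (null_solution p \<eta> q f)"
  unfolding linear_ode_def
proof
  fix x assume x: "x \<in> W"
  note d = Wint_derivative[OF W star f x, of p \<eta>]
  have e: "exp (x ^ p * inverse (\<eta> ^ p)) * exp (- (x ^ p) * inverse (\<eta> ^ p)) = 1"
    by (simp flip: exp_add)
  show "(null_solution p \<eta> q f has_field_derivative of_nat p * x ^ (p - 1) / \<eta> ^ p * null_solution p \<eta> q f x + f x) (at x)"
    unfolding null_solution_def divide_inverse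
    by (rule derivative_eq_intros d[unfolded divide_inverse] refl | simp)+
      (use e in \<open>simp add: algebra_simps exp_minus\<close>)
qed

text \<open>The claim amounts to convergence of \<open>Wint\<close> along \<open>q\<close>. On the
  positive axis the integrand is dominated by the derivative of the increasing bounded function
  \<open>\<Phi>\<close>, so increments of \<open>Wint\<close> are bounded by increments of
  \<open>\<Phi>\<close>, which form a Cauchy sequence along \<open>q\<close>. The factor
  \<open>exp (- q ^ p / \<eta> ^ p)\<close> belongs to the condition: at infinity it admits
  solutions that do not tend to zero.\<close>

lemma null_solution_vanishes:
  assumes p: "p \<ge> 1" and \<eta>: "\<eta> \<noteq> 0" and \<kappa>: "\<kappa> > 0"
    and W: "open W" and star: "\<And>x t. x \<in> W \<Longrightarrow> t \<in> {0..1} \<Longrightarrow> of_real t * x \<in> W"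
    and f: "f holomorphic_on W" and B: "\<And>x. x \<in> W \<Longrightarrow> norm (f x) \<le> B"
    and q: "\<And>n. q n > 0" "\<And>n. of_real (q n) \<in> W" "incseq q"
    and re: "\<kappa> / norm \<eta> ^ p \<le> Re (1 / \<eta> ^ p)"
  shows "(\<lambda>n. null_solution p \<eta> q f (of_real (q n)) * exp (- (of_real (q n) ^ p) / \<eta> ^ p)) \<longlonglongrightarrow> 0"
proof -
  define h where "h = norm \<eta>"
  have h: "h > 0" using \<eta> by (simp add: h_def)
  define \<Phi> where "\<Phi> t = - (B * h * exp \<kappa> / \<kappa>) * exp (- (\<kappa> * t / h))" for t
  have B0: "B \<ge> 0" using B[OF q(2)[of 0]] norm_ge_zero order_trans by blast
  have dist: "norm (Wint p \<eta> f (of_real b) - Wint p \<eta> f (of_real a)) \<le> \<Phi> b - \<Phi> a"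
    if ab: "0 < a" "a < b" and bW: "of_real b \<in> W" for a b
  proof (rule differentiable_bound_general[OF ab(2)])
    have inW: "of_real t \<in> W" if "t \<in> {a..b}" for t
    proof -
      have "of_real (t / b) * of_real b = (of_real t :: complex)" using ab by simp
      then show ?thesis using star[OF bW, of "t / b"] that ab by (simp only:) simp
    qed
    have vd: "((\<lambda>t. Wint p \<eta> f (of_real t)) has_vector_derivative exp (- (of_real t ^ p) / \<eta> ^ p) * f (of_real t)) (at t)"
      if "t \<in> {a..b}" for t
    proof -
      have "((Wint p \<eta> f \<circ> of_real) has_vector_derivative 1 * (exp (- (of_real t ^ p) / \<eta> ^ p) * f (of_real t))) (at t)"
      proof (rule field_vector_diff_chain_within)
        show "(of_real has_vector_derivative (1::complex)) (at t)"
          using has_vector_derivative_of_real[of "\<lambda>x. x" 1 "at t"] by auto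
        show "(Wint p \<eta> f has_field_derivative exp (- (of_real t ^ p) / \<eta> ^ p) * f (of_real t)) (at (of_real t) within range of_real)"
          by (rule has_field_derivative_at_within, rule Wint_derivative[OF W star f inW[OF that]])
      qed
      then show ?thesis by (simp add: o_def)
    qed
    show "continuous_on {a..b} (\<lambda>t. Wint p \<eta> f (of_real t))"
      by (rule continuous_at_imp_continuous_on) (use vd has_vector_derivative_continuous in blast)
    show "continuous_on {a..b} \<Phi>" unfolding \<Phi>_def using h by (intro continuous_intros) auto
    fix t assume t: "a < t" "t < b"
    show "((\<lambda>t. Wint p \<eta> f (of_real t)) has_vector_derivative exp (- (of_real t ^ p) / \<eta> ^ p) * f (of_real t)) (at t)"
      using vd t by simp
    show "(\<Phi> has_vector_derivative B * exp \<kappa> * exp (- (\<kappa> * t / h))) (at t)"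
      unfolding \<Phi>_def has_real_derivative_iff_has_vector_derivative[symmetric] using h \<kappa>
      by (auto intro!: derivative_eq_intros)
    have t0: "t > 0" using t ab by simp
    have "Re (- (of_real t ^ p) / \<eta> ^ p) = - (t ^ p * Re (1 / \<eta> ^ p))"
    proof -
      have "- (of_real t ^ p) / \<eta> ^ p = of_real (- (t ^ p)) * (1 / \<eta> ^ p)" by simp
      then show ?thesis by (simp only: times_complex.sel(1)) simp
    qed
    also have "\<dots> \<le> - (t ^ p * (\<kappa> / h ^ p))"
    proof -
      have "t ^ p * (\<kappa> / norm \<eta> ^ p) \<le> t ^ p * Re (1 / \<eta> ^ p)"
        by (rule mult_left_mono[OF re]) (use t0 in simp)
      then show ?thesis unfolding h_def by linarith
    qed
    also have "\<dots> = - (\<kappa> * (t / h) ^ p)" by (simp add: power_divide)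
    \<comment> \<open>The inequality \<open>(t / h) ^ p \<ge> t / h - 1\<close> replaces the power
      by a linear exponent, at the cost of the factor \<open>exp \<kappa>\<close> in
      \<open>\<Phi>\<close>.\<close>
    also have "\<dots> \<le> \<kappa> - \<kappa> * (t / h)"
    proof -
      have "t / h - 1 \<le> (t / h) ^ p"
      proof (cases "t / h \<le> 1")
        case True
        have "0 \<le> (t / h) ^ p" using t0 h by simp
        with True show ?thesis by linarith
      next
        case False
        then have "(t / h) ^ 1 \<le> (t / h) ^ p" using p by (intro power_increasing) auto
        then show ?thesis by simp
      qed
      then have "\<kappa> * (t / h - 1) \<le> \<kappa> * (t / h) ^ p" using \<kappa> by (intro mult_left_mono) auto
      then show ?thesis by (simp add: right_diff_distrib)
    qed
    finally have "norm (exp (- (of_real t ^ p) / \<eta> ^ p)) \<le> exp (\<kappa> - \<kappa> * (t / h))"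
      unfolding norm_exp_eq_Re by simp
    then have "norm (exp (- (of_real t ^ p) / \<eta> ^ p) * f (of_real t)) \<le> exp (\<kappa> - \<kappa> * (t / h)) * B"
      unfolding norm_mult using B[OF inW] t by (intro mult_mono) auto
    then show "norm (exp (- (of_real t ^ p) / \<eta> ^ p) * f (of_real t)) \<le> B * exp \<kappa> * exp (- (\<kappa> * t / h))"
      by (simp add: exp_diff exp_minus field_simps)
  qed
  have mono: "\<Phi> (q m) \<le> \<Phi> (q n)" if "m \<le> n" for m n
  proof -
    have "exp (- (\<kappa> * q n / h)) \<le> exp (- (\<kappa> * q m / h))"
      using incseqD[OF q(3) that] \<kappa> h by (simp add: divide_right_mono)
    then show ?thesis unfolding \<Phi>_def using B0 h \<kappa> by (intro mult_left_mono_neg) auto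
  qed
  have "convergent (\<lambda>n. \<Phi> (q n))"
  proof (rule Bseq_mono_convergent)
    have "norm (\<Phi> (q n)) \<le> \<bar>\<Phi> (q 0)\<bar>" for n
    proof -
      have "\<Phi> (q n) \<le> 0" using B0 h \<kappa> by (simp add: \<Phi>_def)
      with mono[of 0 n] show ?thesis by simp
    qed
    then show "Bseq (\<lambda>n. \<Phi> (q n))" by (rule BseqI')
  qed (use mono in auto)
  then have Cphi: "Cauchy (\<lambda>n. \<Phi> (q n))" using Cauchy_convergent_iff by blast
  have "Cauchy (\<lambda>n. Wint p \<eta> f (of_real (q n)))"
  proof (rule CauchyI')
    fix e :: real assume "e > 0"
    then obtain M where M: "\<And>m n. m \<ge> M \<Longrightarrow> n \<ge> M \<Longrightarrow> norm (\<Phi> (q m) - \<Phi> (q n)) < e"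
      using CauchyD[OF Cphi] by blast
    have "norm (Wint p \<eta> f (of_real (q m)) - Wint p \<eta> f (of_real (q n))) < e" if "m \<ge> M" "n > m" for m n
    proof (cases "q m = q n")
      case True then show ?thesis using \<open>e > 0\<close> by simp
    next
      case False
      then have "q m < q n" using incseqD[OF q(3), of m n] that by simp
      from dist[OF q(1) this q(2)] M[of m n] that show ?thesis
        by (simp add: norm_minus_commute abs_if split: if_splits)
    qed
    then show "\<exists>M. \<forall>m\<ge>M. \<forall>n>m. dist (Wint p \<eta> f (of_real (q m))) (Wint p \<eta> f (of_real (q n))) < e"
      unfolding dist_norm by blast
  qed
  then have lim: "(\<lambda>n. Wint p \<eta> f (of_real (q n))) \<longlonglongrightarrow> lim (\<lambda>n. Wint p \<eta> f (of_real (q n)))"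
    using Cauchy_convergent_iff convergent_LIMSEQ_iff by blast
  have "null_solution p \<eta> q f (of_real (q n)) * exp (- (of_real (q n) ^ p) / \<eta> ^ p)
      = Wint p \<eta> f (of_real (q n)) - lim (\<lambda>n. Wint p \<eta> f (of_real (q n)))" for n
    by (simp add: null_solution_def exp_minus field_simps)
  then show ?thesis using LIM_zero[OF lim] by simp
qed

section \<open>Domains with ascending chords to the base points\<close>

text \<open>The geometric hypotheses of the a priori estimate, common to the finite and the infinite
  domain. Chords exist only eventually in \<open>n\<close>, because \<open>q n\<close> has to lie
  beyond \<open>x\<close> in the cone of ascending directions.\<close>

definition accessible :: "nat \<Rightarrow> real \<Rightarrow> real \<Rightarrow> complex \<Rightarrow> complex set \<Rightarrow> (nat \<Rightarrow> real) \<Rightarrow> bool" where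
  "accessible p \<kappa> m \<eta> W q \<longleftrightarrow> \<eta> \<noteq> 0 \<and> open W \<and> (\<forall>x\<in>W. \<forall>t\<in>{0..1}. of_real t * x \<in> W) \<and>
     of_real (norm \<eta>) \<in> W \<and> (\<forall>n. q n > 0 \<and> of_real (q n) \<in> W) \<and> incseq q \<and>
     \<kappa> / norm \<eta> ^ p \<le> Re (1 / \<eta> ^ p) \<and>
     (\<forall>x\<in>W. (x = of_real (norm \<eta>) \<or> \<not> small_or_descending p \<kappa> m \<eta> x) \<longrightarrow> norm \<eta> \<le> norm x \<and>
        (\<forall>\<^sub>F n in sequentially. \<exists>T. T 1 = of_real (q n) \<and>
           ascending_chord p \<kappa> \<eta> W x T (of_real (q n ^ p) - x ^ p)))"

text \<open>The boundary inequality holds for infinitely many \<open>n\<close> and the chord exists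
  for almost all \<open>n\<close>, so one index serves both.\<close>

lemma accessible_estimate:
  fixes \<kappa> m L :: real
  assumes p: "p \<ge> 1" and \<kappa>: "\<kappa> > 0" and m: "m \<ge> 1" and L: "L \<ge> 1"
  obtains C where "C > 0"
    "\<And>\<eta> W q u f \<phi> x. accessible p \<kappa> m \<eta> W q \<Longrightarrow> admissible_weight p \<kappa> m L \<eta> W \<phi> \<Longrightarrow>
       linear_ode p \<eta> W f u \<Longrightarrow> (\<And>x. x \<in> W \<Longrightarrow> norm \<eta> * norm (f x) \<le> \<phi> x) \<Longrightarrow>
       (\<And>x. x \<in> W \<Longrightarrow> x = of_real (norm \<eta>) \<or> \<not> small_or_descending p \<kappa> m \<eta> x \<Longrightarrow>
          \<exists>\<^sub>F n in sequentially. norm (u (of_real (q n))) * exp (Re ((x ^ p - of_real (q n ^ p)) / \<eta> ^ p)) \<le> \<phi> x) \<Longrightarrow>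
       x \<in> W \<Longrightarrow> norm (u x) \<le> C * \<phi> x"
proof -
  obtain C where C: "C > 0" and *: "\<forall>\<eta> W u f \<phi>. \<eta> \<noteq> 0 \<longrightarrow> (\<forall>x\<in>W. \<forall>t\<in>{0..1}. of_real t * x \<in> W) \<longrightarrow>
     of_real (norm \<eta>) \<in> W \<longrightarrow> admissible_weight p \<kappa> m L \<eta> W \<phi> \<longrightarrow> linear_ode p \<eta> W f u \<longrightarrow>
     (\<forall>x\<in>W. norm \<eta> * norm (f x) \<le> \<phi> x) \<longrightarrow>
     (\<forall>x\<in>W. (x = of_real (norm \<eta>) \<or> \<not> small_or_descending p \<kappa> m \<eta> x) \<longrightarrow> norm \<eta> \<le> norm x \<and>
        (\<exists>T D. ascending_chord p \<kappa> \<eta> W x T D \<and> norm (u (T 1)) * exp (- Re (D / \<eta> ^ p)) \<le> \<phi> x)) \<longrightarrow>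
     (\<forall>x\<in>W. norm (u x) \<le> C * \<phi> x)"
    using a_priori_estimate[OF p \<kappa> m L] by (elim exE conjE) (rule that)
  show ?thesis
  proof (rule that[OF C])
    fix \<eta> W q u f \<phi> x
    assume acc: "accessible p \<kappa> m \<eta> W q" and wt: "admissible_weight p \<kappa> m L \<eta> W \<phi>"
      and ode: "linear_ode p \<eta> W f u" and f: "\<And>x. x \<in> W \<Longrightarrow> norm \<eta> * norm (f x) \<le> \<phi> x"
      and bc: "\<And>x. x \<in> W \<Longrightarrow> x = of_real (norm \<eta>) \<or> \<not> small_or_descending p \<kappa> m \<eta> x \<Longrightarrow>
          \<exists>\<^sub>F n in sequentially. norm (u (of_real (q n))) * exp (Re ((x ^ p - of_real (q n ^ p)) / \<eta> ^ p)) \<le> \<phi> x"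
      and x: "x \<in> W"
    note a = acc[unfolded accessible_def]
    have "norm \<eta> \<le> norm x \<and> (\<exists>T D. ascending_chord p \<kappa> \<eta> W x T D \<and> norm (u (T 1)) * exp (- Re (D / \<eta> ^ p)) \<le> \<phi> x)"
      if x: "x \<in> W" and s: "x = of_real (norm \<eta>) \<or> \<not> small_or_descending p \<kappa> m \<eta> x" for x
    proof -
      have ev: "norm \<eta> \<le> norm x" "\<forall>\<^sub>F n in sequentially. \<exists>T. T 1 = of_real (q n) \<and>
           ascending_chord p \<kappa> \<eta> W x T (of_real (q n ^ p) - x ^ p)"
        using a x s by blast+
      obtain n T where nT: "T 1 = of_real (q n)" "ascending_chord p \<kappa> \<eta> W x T (of_real (q n ^ p) - x ^ p)"
        "norm (u (of_real (q n))) * exp (Re ((x ^ p - of_real (q n ^ p)) / \<eta> ^ p)) \<le> \<phi> x"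
        using frequently_ex[OF frequently_eventually_conj[OF bc[OF x s] ev(2)]] by blast
      have "- Re ((of_real (q n ^ p) - x ^ p) / \<eta> ^ p) = Re ((x ^ p - of_real (q n ^ p)) / \<eta> ^ p)"
        by (simp add: diff_divide_distrib)
      with nT ev(1) show ?thesis by metis
    qed
    then show "norm (u x) \<le> C * \<phi> x"
      using *[THEN spec, of \<eta>, THEN spec, of W, THEN spec, of u, THEN spec, of f, THEN spec, of \<phi>] a wt ode f x by blast
  qed
qed

lemma admissible_weight_const:
  assumes "\<kappa> > 0" "c \<ge> 0" "L \<ge> 1"
  shows "admissible_weight p \<kappa> m L \<eta> W (\<lambda>_. c)"
proof -
  have cL: "c \<le> L * c" using assms by (simp add: mult_le_cancel_right1)
  have ge: "c \<le> L * c * exp r" if "r \<ge> 0" for r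
  proof -
    have "L * c * 1 \<le> L * c * exp r" using that assms by (intro mult_left_mono) auto
    with cL show ?thesis by linarith
  qed
  then have "\<And>r. r \<ge> 0 \<Longrightarrow> c \<le> L * c * exp r" .
  moreover have "- (1 - t ^ p) * R / 2 \<ge> 0" if "t \<in> {0..1}" "R \<le> - \<kappa> * (norm x / norm \<eta>) ^ p" for t R :: real and x :: complex
  proof -
    have "0 \<le> \<kappa> * (norm x / norm \<eta>) ^ p" using assms by simp
    then have "R \<le> 0" using that by linarith
    moreover have "t ^ p \<le> 1" using that by (simp add: power_le_one)
    ultimately show ?thesis by (simp add: mult_nonpos_nonpos)
  qed
  ultimately have w: "c \<le> L * c * exp (- (1 - t ^ p) * R / 2)"
    if "t \<in> {0..1}" "R \<le> - \<kappa> * (norm x / norm \<eta>) ^ p" for t R :: real and x :: complex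
    using that by blast
  have w': "c \<le> L * c * exp (R / 2)" if "R \<ge> 0" for R
    using ge that by simp
  show ?thesis unfolding admissible_weight_def using assms(2) cL w w' by blast
qed

text \<open>For a fixed \<open>x\<close> the factor \<open>exp (x ^ p / \<eta> ^ p)\<close> is a
  constant, so the boundary term tends to zero and falls below any positive weight.\<close>

lemma vanishing_imp_frequently:
  fixes q :: "nat \<Rightarrow> real"
  assumes "(\<lambda>n. u (of_real (q n)) * exp (- (of_real (q n) ^ p) / \<eta> ^ p)) \<longlonglongrightarrow> 0" and c: "c > 0"
  shows "\<exists>\<^sub>F n in sequentially. norm (u (of_real (q n))) * exp (Re ((x ^ p - of_real (q n ^ p)) / \<eta> ^ p)) \<le> c"
proof -
  have "(\<lambda>n. norm (u (of_real (q n)) * exp (- (of_real (q n) ^ p) / \<eta> ^ p) * exp (x ^ p / \<eta> ^ p))) \<longlonglongrightarrow> 0"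
    by (intro tendsto_norm_zero tendsto_mult_left_zero assms)
  then have "\<forall>\<^sub>F n in sequentially. norm (u (of_real (q n)) * exp (- (of_real (q n) ^ p) / \<eta> ^ p) * exp (x ^ p / \<eta> ^ p)) < c"
    using c by (rule order_tendstoD)
  then have "\<forall>\<^sub>F n in sequentially. norm (u (of_real (q n))) * exp (Re ((x ^ p - of_real (q n ^ p)) / \<eta> ^ p)) \<le> c"
  proof eventually_elim
    case (elim n)
    have "u (of_real (q n)) * exp (- (of_real (q n) ^ p) / \<eta> ^ p) * exp (x ^ p / \<eta> ^ p)
        = u (of_real (q n)) * exp ((x ^ p - of_real (q n ^ p)) / \<eta> ^ p)"
      by (simp add: diff_divide_distrib mult.assoc flip: exp_add)
    with elim have "norm (u (of_real (q n)) * exp ((x ^ p - of_real (q n ^ p)) / \<eta> ^ p)) < c" by (simp only:)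
    then show ?case by (simp only: norm_mult norm_exp_eq_Re)
  qed
  then show ?thesis by (intro eventually_frequently) auto
qed

text \<open>The cosine condition in \<open>finite_domain\<close> says that \<open>x ^ p\<close> lies in the cone with apex \<open>\<rho> ^ p\<close>
  and half opening \<open>\<pi>/2 - 2\<delta>\<close>. In the variable \<open>X = x / \<eta>\<close> the finite domain is contained in the
  infinite one.\<close>

definition infinite_domain :: "nat \<Rightarrow> real \<Rightarrow> real \<Rightarrow> complex set" where
  "infinite_domain p \<mu> \<delta> = {x. norm x < \<mu>} \<union> {x. x \<noteq> 0 \<and> real p * \<bar>Arg x\<bar> < 3 * pi / 2 - \<delta>}"

definition finite_domain :: "nat \<Rightarrow> real \<Rightarrow> real \<Rightarrow> real \<Rightarrow> complex \<Rightarrow> complex set" where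
  "finite_domain p \<mu> \<delta> \<rho> \<eta> = {x. norm x < \<mu> * norm \<eta>} \<union>
     {x. x \<noteq> 0 \<and> norm x < \<rho> \<and> real p * \<bar>Arg x\<bar> < 3 * pi / 2 - 2 * \<delta> \<and>
         norm x ^ p * cos (real p * \<bar>Arg x\<bar> - 2 * \<delta>) < \<rho> ^ p * cos (2 * \<delta>)}"

text \<open>Since \<open>p \<ge> 2\<close>, the arguments stay below \<open>3 pi / 4\<close>; the
  domains avoid the cut on which \<open>Arg\<close> jumps, and the conditions on \<open>Arg\<close>
  define open sets.\<close>

lemma Arg_bound_slit:
  assumes "p \<ge> 2" "x \<noteq> 0" "real p * \<bar>Arg x\<bar> < 3 * pi / 2"
  shows "x \<in> - \<real>\<^sub>\<le>\<^sub>0"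
proof -
  have "2 * \<bar>Arg x\<bar> \<le> real p * \<bar>Arg x\<bar>" using assms by (intro mult_right_mono) auto
  then have "\<bar>Arg x\<bar> < pi" using assms pi_gt_zero by linarith
  then show ?thesis using assms
    by (metis Arg_eq_pi Compl_iff abs_of_nonneg complex_nonpos_Reals_iff less_irrefl order_less_le pi_ge_zero complex_eqI zero_complex.simps)
qed

lemma open_slit_less:
  fixes f :: "complex \<Rightarrow> real"
  assumes "continuous_on (- \<real>\<^sub>\<le>\<^sub>0) f"
  shows "open {x \<in> - \<real>\<^sub>\<le>\<^sub>0. f x < c}"
proof -
  have "open ((- \<real>\<^sub>\<le>\<^sub>0) \<inter> f -` {..<c})"
    by (rule continuous_open_preimage[OF assms]) auto
  moreover have "(- \<real>\<^sub>\<le>\<^sub>0) \<inter> f -` {..<c} = {x \<in> - \<real>\<^sub>\<le>\<^sub>0. f x < c}" by auto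
  ultimately show ?thesis by simp
qed

lemma open_infinite_domain:
  assumes "p \<ge> 2" "\<delta> > 0"
  shows "open (infinite_domain p \<mu> \<delta>)"
proof -
  have eq: "infinite_domain p \<mu> \<delta> = ball 0 \<mu> \<union> {x \<in> - \<real>\<^sub>\<le>\<^sub>0. real p * \<bar>Arg x\<bar> < 3 * pi / 2 - \<delta>}"
    using Arg_bound_slit[OF assms(1)] assms(2) unfolding infinite_domain_def by (force simp: complex_nonpos_Reals_iff)
  show ?thesis unfolding eq by (intro open_Un open_ball open_slit_less continuous_intros) auto
qed

lemma open_finite_domain:
  assumes "p \<ge> 2" "\<delta> > 0"
  shows "open (finite_domain p \<mu> \<delta> \<rho> \<eta>)"
proof -
  have eq: "finite_domain p \<mu> \<delta> \<rho> \<eta> = ball 0 (\<mu> * norm \<eta>) \<union> (ball 0 \<rho> \<inter>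
     {x \<in> - \<real>\<^sub>\<le>\<^sub>0. real p * \<bar>Arg x\<bar> < 3 * pi / 2 - 2 * \<delta>} \<inter>
     {x \<in> - \<real>\<^sub>\<le>\<^sub>0. norm x ^ p * cos (real p * \<bar>Arg x\<bar> - 2 * \<delta>) < \<rho> ^ p * cos (2 * \<delta>)})"
    using Arg_bound_slit[OF assms(1)] assms(2) unfolding finite_domain_def by (force simp: complex_nonpos_Reals_iff)
  show ?thesis unfolding eq by (intro open_Un open_Int open_ball open_slit_less continuous_intros) auto
qed

lemma infinite_domain_starlike:
  assumes "\<mu> > 0" "x \<in> infinite_domain p \<mu> \<delta>" "t \<in> {0..1}"
  shows "of_real t * x \<in> infinite_domain p \<mu> \<delta>"
proof (cases "t = 0 \<or> norm x < \<mu>")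
  case True
  have "t * norm x \<le> norm x" using assms by (simp add: mult_left_le_one_le)
  then have "t * norm x < \<mu>" using assms True by auto
  then show ?thesis using assms by (auto simp: infinite_domain_def norm_mult)
next
  case False
  then show ?thesis using assms by (auto simp: infinite_domain_def)
qed

text \<open>Where the cosine is positive, shrinking \<open>x\<close> decreases the left-hand side of
  the cone condition. Where it is negative, the left-hand side increases at most to 0, and
  \<open>\<rho> ^ p * cos (2 * \<delta>)\<close> is positive.\<close>

lemma finite_domain_starlike:
  assumes "\<mu> > 0" "\<eta> \<noteq> 0" "\<rho> > 0" "0 < \<delta>" "\<delta> \<le> pi / 8" "x \<in> finite_domain p \<mu> \<delta> \<rho> \<eta>" "t \<in> {0..1}"
  shows "of_real t * x \<in> finite_domain p \<mu> \<delta> \<rho> \<eta>"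
proof (cases "t = 0 \<or> norm x < \<mu> * norm \<eta>")
  case True
  have "t * norm x \<le> norm x" using assms by (simp add: mult_left_le_one_le)
  then have "t * norm x < \<mu> * norm \<eta>" using assms True by auto
  then show ?thesis using assms by (auto simp: finite_domain_def norm_mult)
next
  case False
  then have x: "x \<noteq> 0" "norm x < \<rho>" "real p * \<bar>Arg x\<bar> < 3 * pi / 2 - 2 * \<delta>"
      "norm x ^ p * cos (real p * \<bar>Arg x\<bar> - 2 * \<delta>) < \<rho> ^ p * cos (2 * \<delta>)" and t: "t > 0" "t \<le> 1"
    using assms by (auto simp: finite_domain_def)
  have tx: "t * norm x \<le> norm x" using assms by (simp add: mult_left_le_one_le)
  have tp: "0 < t ^ p" "t ^ p \<le> 1" using t by (auto simp: power_le_one)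
  have pos: "0 < \<rho> ^ p * cos (2 * \<delta>)" using assms pi_gt_zero by (intro mult_pos_pos cos_gt_zero_pi) auto
  have "t ^ p * (norm x ^ p * cos (real p * \<bar>Arg x\<bar> - 2 * \<delta>)) < \<rho> ^ p * cos (2 * \<delta>)"
  proof (cases "norm x ^ p * cos (real p * \<bar>Arg x\<bar> - 2 * \<delta>) \<ge> 0")
    case True
    then have "t ^ p * (norm x ^ p * cos (real p * \<bar>Arg x\<bar> - 2 * \<delta>)) \<le> norm x ^ p * cos (real p * \<bar>Arg x\<bar> - 2 * \<delta>)"
      using tp by (intro mult_left_le_one_le) auto
    then show ?thesis using x by linarith
  next
    case False
    then have "t ^ p * (norm x ^ p * cos (real p * \<bar>Arg x\<bar> - 2 * \<delta>)) \<le> 0"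
      using tp False by (intro mult_nonneg_nonpos[of "t ^ p" "norm x ^ p * cos (real p * \<bar>Arg x\<bar> - 2 * \<delta>)"]) linarith+
    then show ?thesis using pos by linarith
  qed
  moreover have "t * norm x < \<rho>" using tx x by linarith
  ultimately show ?thesis using t x by (auto simp: finite_domain_def norm_mult power_mult_distrib mult.assoc)
qed

lemma sin_pos_less_1:
  assumes "0 < \<delta>" "\<delta> \<le> pi / 8"
  shows "0 < sin \<delta>" "sin \<delta> < 1"
proof -
  show "0 < sin \<delta>" using assms pi_gt_zero by (intro sin_gt_zero) linarith+
  have "sin \<delta> < sin (pi / 2)" using assms pi_gt_zero by (intro sin_monotone_2pi) linarith+
  then show "sin \<delta> < 1" by simp
qed

text \<open>Seen from far out on the positive axis, every point lies in an ascending direction: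
  \<open>Re D \<ge> Q ^ p - |x| ^ p\<close> while \<open>|D| \<le> Q ^ p + |x| ^ p\<close>. A point
  outside the small disc with \<open>p |Arg x| > 3 pi / 4\<close> is descending by
  \<open>cos_obtuse_le\<close>, so chords are required in the wedge only.\<close>

lemma accessible_infinite_domain:
  assumes p: "p \<ge> 2" and \<delta>: "0 < \<delta>" "\<delta> \<le> pi / 8" and \<mu>: "\<mu> > 0" and m: "m \<ge> 1" "m \<ge> \<mu>"
  shows "accessible p (sin \<delta>) m 1 (infinite_domain p \<mu> \<delta>) (\<lambda>n. real n + 1)"
proof -
  have p1: "p \<ge> 1" using p by simp
  note sd = sin_pos_less_1[OF \<delta>]
  let ?W = "infinite_domain p \<mu> \<delta>"
  have real_in: "of_real t \<in> ?W" if "t > 0" for t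
    using that \<delta> pi_gt_zero by (simp add: infinite_domain_def Arg_of_real)
  have chord: "\<forall>\<^sub>F n in sequentially. \<exists>T. T 1 = of_real (real n + 1) \<and>
      ascending_chord p (sin \<delta>) 1 ?W x T (of_real ((real n + 1) ^ p) - x ^ p)"
    if x: "x \<noteq> 0" and a: "real p * \<bar>Arg x\<bar> \<le> 3 * pi / 4" for x
  proof -
    \<comment> \<open>The value of \<open>Q ^ p\<close> at which
      \<open>sin \<delta> * (Q ^ p + |x| ^ p) = Q ^ p - |x| ^ p\<close>; from there on the ascent
      condition holds.\<close>
    define c where "c = (1 + sin \<delta>) * norm x ^ p / (1 - sin \<delta>)"
    have "\<forall>\<^sub>F n in sequentially. real n \<ge> norm x \<and> real n \<ge> c"
      by (intro eventually_conj) (rule filterlim_real_sequentially[unfolded filterlim_at_top, rule_format])+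
    then show ?thesis
    proof eventually_elim
      case (elim n)
      define Q where "Q = real n + 1"
      define D where "D = of_real (Q ^ p) - x ^ p"
      define T where "T s = (x ^ p + of_real s * D) powr (1 / of_nat p)" for s :: real
      have qx: "norm x \<le> Q" using elim by (simp add: Q_def)
      note cp = chord_path[OF p1 x a qx, folded D_def, folded T_def]
      have "Q ^ 1 \<le> Q ^ p" using p1 by (intro power_increasing) (auto simp: Q_def)
      then have "c \<le> Q ^ p" using elim by (simp add: Q_def)
      then have "(1 + sin \<delta>) * norm x ^ p \<le> (1 - sin \<delta>) * Q ^ p"
        using sd unfolding c_def by (simp add: divide_le_eq mult.commute)
      then have k: "sin \<delta> * (Q ^ p + norm x ^ p) \<le> Q ^ p - norm x ^ p" by (simp add: algebra_simps)
      have Qp: "Q \<ge> 0" by (simp add: Q_def)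
      have "sin \<delta> * norm D \<le> sin \<delta> * (Q ^ p + norm x ^ p)"
      proof (rule mult_left_mono)
        have "norm D \<le> norm (of_real (Q ^ p) :: complex) + norm (x ^ p)" unfolding D_def by (rule norm_triangle_ineq4)
        then show "norm D \<le> Q ^ p + norm x ^ p" using Qp by (simp add: norm_power)
      qed (use sd in auto)
      also note k
      also have "Q ^ p - norm x ^ p \<le> Re D"
        using complex_Re_le_cmod[of "x ^ p"] by (simp add: D_def norm_power del: of_real_power)
      finally have re: "sin \<delta> * norm D \<le> Re D" .
      have TW: "T s \<in> ?W" if "s \<in> {0..1}" for s
      proof -
        have "real p * \<bar>Arg (T s)\<bar> < pi" "T s \<noteq> 0" using cp(4)[OF that] by auto
        moreover have "pi \<le> 3 * pi / 2 - \<delta>" using \<delta> pi_gt_zero by linarith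
        ultimately show ?thesis by (simp add: infinite_domain_def)
      qed
      have "ascending_chord p (sin \<delta>) 1 ?W x T D"
        unfolding ascending_chord_def using cp TW re by auto
      then show ?case using cp(2) unfolding D_def Q_def by blast
    qed
  qed
  have "norm (1::complex) \<le> norm x \<and> (\<forall>\<^sub>F n in sequentially. \<exists>T. T 1 = of_real (real n + 1) \<and>
      ascending_chord p (sin \<delta>) 1 ?W x T (of_real ((real n + 1) ^ p) - x ^ p))"
    if x: "x \<in> ?W" and s: "x = of_real (norm (1::complex)) \<or> \<not> small_or_descending p (sin \<delta>) m 1 x" for x
    using s
  proof
    assume "x = of_real (norm (1::complex))"
    then show ?thesis using chord[of x] pi_gt_zero by simp
  next
    assume ns: "\<not> small_or_descending p (sin \<delta>) m 1 x"
    then have nx: "norm x > m" and nd: "Re (x ^ p) > - sin \<delta> * norm x ^ p" using m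
      by (auto simp: small_or_descending_def)
    have x0: "x \<noteq> 0" "real p * \<bar>Arg x\<bar> < 3 * pi / 2 - \<delta>" using x nx m \<mu> by (auto simp: infinite_domain_def)
    have "real p * \<bar>Arg x\<bar> \<le> 3 * pi / 4"
    proof (rule ccontr)
      assume "\<not> real p * \<bar>Arg x\<bar> \<le> 3 * pi / 4"
      then have "cos (real p * Arg x) \<le> - sin \<delta>"
        by (intro cos_obtuse_le[OF \<delta>]) (use x0 \<delta> in \<open>simp_all add: abs_mult\<close>)
      then have "norm x ^ p * cos (real p * Arg x) \<le> norm x ^ p * - sin \<delta>" by (intro mult_left_mono) auto
      moreover have "Re (x ^ p) = norm x ^ p * cos (real p * Arg x)" by (metis Re_rcis power_polar)
      ultimately show False using nd by (simp add: mult.commute)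
    qed
    with chord[OF x0(1)] nx m show ?thesis by simp
  qed
  moreover have "incseq (\<lambda>n. real n + 1)" by (auto simp: incseq_def)
  ultimately show ?thesis
    unfolding accessible_def
    using open_infinite_domain[OF p \<delta>(1)] infinite_domain_starlike[OF \<mu>] real_in[of 1] sd
      real_in[of "real n + 1" for n] by (auto simp: infinite_domain_starlike[OF \<mu>])
qed

text \<open>Membership of \<open>x ^ p\<close> in the cone with apex \<open>\<rho> ^ p\<close> is
  the hypothesis of \<open>cone_direction\<close> for the chord that ends at \<open>\<rho>\<close>,
  and by continuity for chords that end at \<open>q n\<close> with \<open>n\<close> large.\<close>

lemma accessible_finite_domain:
  assumes p: "p \<ge> 2" and \<delta>: "0 < \<delta>" "\<delta> \<le> pi / 8" and \<mu>: "\<mu> > 0" and m: "m \<ge> 1" "m \<ge> \<mu>"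
    and \<eta>: "\<eta> \<noteq> 0" "norm \<eta> < \<rho>" "real p * \<bar>Arg \<eta>\<bar> < \<delta>"
    and q: "\<And>n. 0 < q n" "\<And>n. q n < \<rho>" "incseq q" "q \<longlonglongrightarrow> \<rho>"
  shows "accessible p (sin \<delta>) m \<eta> (finite_domain p \<mu> \<delta> \<rho> \<eta>) q"
proof -
  have p1: "p \<ge> 1" using p by simp
  note sd = sin_pos_less_1[OF \<delta>]
  let ?W = "finite_domain p \<mu> \<delta> \<rho> \<eta>"
  have h0: "norm \<eta> > 0" using \<eta> by simp
  have \<rho>: "\<rho> > 0" using h0 \<eta> by linarith
  have c2: "cos (2 * \<delta>) > 0" using \<delta> pi_gt_zero by (intro cos_gt_zero_pi) linarith+
  have real_in: "of_real t \<in> ?W" if "t > 0" "t < \<rho>" for t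
  proof -
    have "t ^ p < \<rho> ^ p" using that p1 by (intro power_strict_mono) auto
    then show ?thesis using that \<delta> pi_gt_zero c2 by (simp add: finite_domain_def Arg_of_real)
  qed
  have chord: "\<forall>\<^sub>F n in sequentially. \<exists>T. T 1 = of_real (q n) \<and>
      ascending_chord p (sin \<delta>) \<eta> ?W x T (of_real (q n ^ p) - x ^ p)"
    if x: "x \<noteq> 0" and a: "real p * \<bar>Arg x\<bar> \<le> 3 * pi / 4" and xr: "norm x < \<rho>"
      and xc: "norm x ^ p * cos (real p * \<bar>Arg x\<bar> - 2 * \<delta>) < \<rho> ^ p * cos (2 * \<delta>)" for x
  proof -
    \<comment> \<open>The cone condition is strict, which leaves room to replace
      \<open>\<rho>\<close> by a nearby \<open>q n\<close>.\<close>
    have "(\<lambda>n. q n ^ p * cos (2 * \<delta>)) \<longlonglongrightarrow> \<rho> ^ p * cos (2 * \<delta>)" by (intro tendsto_intros q)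
    then have "\<forall>\<^sub>F n in sequentially. q n ^ p * cos (2 * \<delta>) > norm x ^ p * cos (real p * \<bar>Arg x\<bar> - 2 * \<delta>)"
      using xc by (rule order_tendstoD)
    moreover have "\<forall>\<^sub>F n in sequentially. q n > norm x" using q(4) xr by (rule order_tendstoD)
    ultimately show ?thesis
    proof eventually_elim
      case (elim n)
      define Q where "Q = q n"
      define D where "D = of_real (Q ^ p) - x ^ p"
      define T where "T s = (x ^ p + of_real s * D) powr (1 / of_nat p)" for s :: real
      have qx: "norm x \<le> Q" using elim by (simp add: Q_def)
      have Q: "0 < Q" "Q < \<rho>" using q by (auto simp: Q_def)
      note cp = chord_path[OF p1 x a qx, folded D_def, folded T_def]
      have Rex: "Re (x ^ p * cis t) = norm x ^ p * cos (real p * Arg x + t)" for t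
        by (subst power_polar, simp only: rcis_def mult.assoc cis_mult) simp
      \<comment> \<open>Among the values
        \<open>cos (\<plusminus> \<theta> \<plusminus> 2 \<delta>)\<close> the largest is
        \<open>cos (\<theta> - 2 \<delta>)\<close>, because
        \<open>sin \<theta> * sin (2 * \<delta>) \<ge> 0\<close>. Therefore the single inequality
        with \<open>|Arg x|\<close> in the domain covers both rotations.\<close>
      have cosle: "cos (real p * Arg x + t) \<le> cos (real p * \<bar>Arg x\<bar> - 2 * \<delta>)" if t: "t = 2 * \<delta> \<or> t = - (2 * \<delta>)" for t
      proof -
        define \<theta> where "\<theta> = real p * \<bar>Arg x\<bar>"
        have th: "0 \<le> \<theta>" by (simp add: \<theta>_def)
        have th': "\<theta> \<le> pi" unfolding \<theta>_def using a pi_gt_zero by linarith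
        have "sin \<theta> \<ge> 0" "sin (2 * \<delta>) \<ge> 0" using th th' \<delta> pi_gt_zero by (auto intro!: sin_ge_zero)
        then have ss: "0 \<le> sin \<theta> * sin (2 * \<delta>)" by simp
        have "real p * Arg x = \<theta> \<or> real p * Arg x = - \<theta>" by (auto simp: \<theta>_def abs_if)
        then have "cos (real p * Arg x + t) = cos (\<theta> + 2 * \<delta>) \<or> cos (real p * Arg x + t) = cos (\<theta> - 2 * \<delta>)"
          using t by (auto simp: cos_add cos_diff)
        moreover have "cos (\<theta> + 2 * \<delta>) \<le> cos (\<theta> - 2 * \<delta>)" using ss by (simp add: cos_add cos_diff)
        ultimately show ?thesis unfolding \<theta>_def by linarith
      qed
      have Rexle: "Re (x ^ p * cis t) < Q ^ p * cos (2 * \<delta>)" if t: "t = 2 * \<delta> \<or> t = - (2 * \<delta>)" for t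
      proof -
        have "norm x ^ p * cos (real p * Arg x + t) \<le> norm x ^ p * cos (real p * \<bar>Arg x\<bar> - 2 * \<delta>)"
          using cosle[OF t] by (intro mult_left_mono) auto
        then show ?thesis using elim unfolding Rex Q_def by linarith
      qed
      have ReQ: "Re (of_real (Q ^ p) * cis t) = Q ^ p * cos (2 * \<delta>)" if t: "t = 2 * \<delta> \<or> t = - (2 * \<delta>)" for t
        using t by (auto simp del: of_real_power)
      have RD: "Re (D * cis t) > 0" if t: "t = 2 * \<delta> \<or> t = - (2 * \<delta>)" for t
      proof -
        have "Re (D * cis t) = Re (of_real (Q ^ p) * cis t) - Re (x ^ p * cis t)"
          by (simp only: D_def left_diff_distrib minus_complex.sel)
        then show ?thesis using Rexle[OF t] ReQ[OF t] by linarith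
      qed
      have "D \<noteq> 0" using RD[of "2 * \<delta>"] by auto
      then have "sin \<delta> * norm D \<le> Re (D * cis (- (real p * Arg \<eta>)))"
        by (rule cone_direction[OF \<delta> _ RD[of "2 * \<delta>"] RD[of "- (2 * \<delta>)"]]) (use \<eta> in \<open>auto simp: abs_mult\<close>)
      moreover have "Re (D / \<eta> ^ p) = Re (D * cis (- (real p * Arg \<eta>))) / norm \<eta> ^ p"
      proof -
        have "D / \<eta> ^ p = D * cis (- (real p * Arg \<eta>)) / of_real (norm \<eta> ^ p)"
          by (subst power_polar[of \<eta>]) (simp add: rcis_def divide_inverse cis_inverse mult_ac)
        then show ?thesis by (simp only: Re_divide_of_real)
      qed
      ultimately have re: "sin \<delta> * norm D / norm \<eta> ^ p \<le> Re (D / \<eta> ^ p)"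
        using h0 by (simp add: divide_right_mono)
      \<comment> \<open>Disc and cone are convex in the variable \<open>x ^ p\<close> and so contain
        the whole chord; the bound on the argument comes from \<open>chord_path\<close>.\<close>
      have TW: "T s \<in> ?W" if s: "s \<in> {0..1}" for s
      proof -
        define Z where "Z = x ^ p + of_real s * D"
        have T: "real p * \<bar>Arg (T s)\<bar> < pi" "T s \<noteq> 0" "T s ^ p = Z" "real p * Arg (T s) = Arg Z"
          using cp(4)[OF s] by (auto simp: Z_def)
        have ZZ: "Z = of_real (1 - s) * x ^ p + of_real s * of_real (Q ^ p)"
          by (simp add: Z_def D_def algebra_simps)
        have nZ: "norm Z = norm (T s) ^ p" using T(3) by (metis norm_power)
        have "pi \<le> 3 * pi / 2 - 2 * \<delta>" using \<delta> pi_gt_zero by linarith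
        then have 1: "real p * \<bar>Arg (T s)\<bar> < 3 * pi / 2 - 2 * \<delta>" using T by linarith
        have xQ: "norm x ^ p \<le> Q ^ p" using qx by (intro power_mono) auto
        have "norm Z \<le> (1 - s) * norm x ^ p + s * Q ^ p"
        proof -
          have "norm Z \<le> norm (of_real (1 - s) * x ^ p) + norm (of_real s * of_real (Q ^ p) :: complex)"
            unfolding ZZ by (rule norm_triangle_ineq)
          also have "\<dots> = (1 - s) * norm x ^ p + s * Q ^ p"
            unfolding norm_mult norm_of_real norm_power using s Q by (simp del: of_real_diff)
          finally show ?thesis .
        qed
        also have "\<dots> \<le> (1 - s) * Q ^ p + s * Q ^ p"
          using s xQ by (intro add_right_mono mult_left_mono) auto
        also have "\<dots> = Q ^ p" by (simp add: algebra_simps)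
        also have "\<dots> < \<rho> ^ p" using Q p1 by (intro power_strict_mono) auto
        finally have "norm (T s) ^ p < \<rho> ^ p" unfolding nZ .
        then have 2: "norm (T s) < \<rho>" using \<rho> by (simp add: power_less_imp_less_base)
        have ReZ: "Re (Z * cis t) < \<rho> ^ p * cos (2 * \<delta>)" if t: "t = 2 * \<delta> \<or> t = - (2 * \<delta>)" for t
        proof -
          have "Z * cis t = of_real (1 - s) * (x ^ p * cis t) + of_real s * (of_real (Q ^ p) * cis t)"
            unfolding ZZ by (simp add: algebra_simps)
          then have "Re (Z * cis t) = (1 - s) * Re (x ^ p * cis t) + s * Re (of_real (Q ^ p) * cis t)"
            by (simp only: plus_complex.sel times_complex.sel(1)) (simp del: of_real_power)
          also have "\<dots> \<le> (1 - s) * (Q ^ p * cos (2 * \<delta>)) + s * (Q ^ p * cos (2 * \<delta>))"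
            using Rexle[OF t] s unfolding ReQ[OF t] by (intro add_right_mono mult_left_mono) auto
          also have "\<dots> = Q ^ p * cos (2 * \<delta>)" by (simp add: algebra_simps)
          also have "\<dots> < \<rho> ^ p * cos (2 * \<delta>)" using \<open>Q ^ p < \<rho> ^ p\<close> c2 by simp
          finally show ?thesis .
        qed
        have RZ: "Re (Z * cis t) = norm Z * cos (Arg Z + t)" for t
          by (subst rcis_cmod_Arg[of Z, symmetric], simp only: rcis_def mult.assoc cis_mult) simp
        have "norm (T s) ^ p * cos (real p * \<bar>Arg (T s)\<bar> - 2 * \<delta>) < \<rho> ^ p * cos (2 * \<delta>)"
        proof (cases "Arg (T s) \<ge> 0")
          case True
          then show ?thesis using ReZ[of "- (2 * \<delta>)"] RZ[of "- (2 * \<delta>)"] T(4) nZ by simp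
        next
          case False
          then have "cos (real p * \<bar>Arg (T s)\<bar> - 2 * \<delta>) = cos (Arg Z + 2 * \<delta>)"
            using T(4) by (simp add: abs_if cos_add cos_diff flip: T(4))
          then show ?thesis using ReZ[of "2 * \<delta>"] RZ[of "2 * \<delta>"] nZ by simp
        qed
        with 1 2 T(2) show ?thesis by (simp add: finite_domain_def)
      qed
      have "ascending_chord p (sin \<delta>) \<eta> ?W x T D"
        unfolding ascending_chord_def using cp TW re by auto
      then show ?case using cp(2) unfolding D_def Q_def by blast
    qed
  qed
  have "norm \<eta> \<le> norm x \<and> (\<forall>\<^sub>F n in sequentially. \<exists>T. T 1 = of_real (q n) \<and>
      ascending_chord p (sin \<delta>) \<eta> ?W x T (of_real (q n ^ p) - x ^ p))"
    if x: "x \<in> ?W" and s: "x = of_real (norm \<eta>) \<or> \<not> small_or_descending p (sin \<delta>) m \<eta> x" for x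
    using s
  proof
    assume xe: "x = of_real (norm \<eta>)"
    have "norm \<eta> ^ p < \<rho> ^ p" using \<eta> p1 by (intro power_strict_mono) auto
    then show ?thesis using chord[of x] pi_gt_zero h0 \<eta> c2 unfolding xe by (simp add: Arg_of_real)
  next
    assume ns: "\<not> small_or_descending p (sin \<delta>) m \<eta> x"
    then have nx: "norm x > m * norm \<eta>" by (simp add: small_or_descending_def)
    have mh: "norm \<eta> \<le> m * norm \<eta>" "\<mu> * norm \<eta> \<le> m * norm \<eta>" using m h0
      by (simp_all add: mult_le_cancel_right1 mult_right_mono)
    then have hx: "norm \<eta> \<le> norm x" using nx by linarith
    then have nd: "Re (x ^ p / \<eta> ^ p) > - sin \<delta> * (norm x / norm \<eta>) ^ p" using ns
      by (auto simp: small_or_descending_def)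
    have x0: "x \<noteq> 0" "norm x < \<rho>" "real p * \<bar>Arg x\<bar> < 3 * pi / 2 - 2 * \<delta>"
       "norm x ^ p * cos (real p * \<bar>Arg x\<bar> - 2 * \<delta>) < \<rho> ^ p * cos (2 * \<delta>)"
      using x nx mh by (auto simp: finite_domain_def)
    have "real p * \<bar>Arg x\<bar> \<le> 3 * pi / 4"
    proof (rule ccontr)
      assume na: "\<not> real p * \<bar>Arg x\<bar> \<le> 3 * pi / 4"
      have e: "\<bar>real p * (Arg x - Arg \<eta>)\<bar> = \<bar>real p * Arg x - real p * Arg \<eta>\<bar>" by (simp add: right_diff_distrib)
      have e2: "\<bar>real p * Arg x\<bar> = real p * \<bar>Arg x\<bar>" "\<bar>real p * Arg \<eta>\<bar> = real p * \<bar>Arg \<eta>\<bar>" by (simp_all add: abs_mult)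
      have "cos (real p * (Arg x - Arg \<eta>)) \<le> - sin \<delta>"
        by (rule cos_obtuse_le[OF \<delta>]) (use x0 \<eta> na e e2 in linarith)+
      then have "(norm x / norm \<eta>) ^ p * cos (real p * (Arg x - Arg \<eta>)) \<le> (norm x / norm \<eta>) ^ p * - sin \<delta>"
        by (intro mult_left_mono) auto
      then show False using nd unfolding Re_power_quotient by (simp add: mult.commute)
    qed
    with chord[OF x0(1) _ x0(2,4)] hx show ?thesis by simp
  qed
  moreover have "sin \<delta> / norm \<eta> ^ p \<le> Re (1 / \<eta> ^ p)"
  proof -
    have "sin \<delta> = cos (pi / 2 - \<delta>)" by (simp add: cos_diff)
    also have "\<dots> \<le> cos \<bar>real p * Arg \<eta>\<bar>"
      by (rule cos_monotone_0_pi_le) (use \<eta> \<delta> pi_gt_zero in \<open>auto simp: abs_mult\<close>)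
    also have "\<dots> = cos (real p * Arg \<eta>)" by (simp add: abs_if)
    finally have "sin \<delta> / norm \<eta> ^ p \<le> cos (real p * Arg \<eta>) / norm \<eta> ^ p" by (simp add: divide_right_mono)
    also have "\<dots> = Re (1 / \<eta> ^ p)"
      using Re_power_quotient[of 1 p \<eta>] by (simp add: power_divide)
    finally show ?thesis .
  qed
  ultimately show ?thesis
    unfolding accessible_def
    using open_finite_domain[OF p \<delta>(1)] finite_domain_starlike[OF \<mu> \<eta>(1) \<rho> \<delta>] real_in[OF h0 \<eta>(2)]
      real_in[OF q(1,2)] q \<eta> by blast
qed

section \<open>Asymptotic expansions at infinity\<close>

lemma power_le_fact_exp:
  fixes x :: real
  assumes "x \<ge> 0"
  shows "x ^ n \<le> fact n * exp x"
proof -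
  have "(\<Sum>k\<in>{n}. x ^ k /\<^sub>R fact k) \<le> (\<Sum>k. x ^ k /\<^sub>R fact k)"
    by (rule sum_le_suminf[OF summable_exp_generic]) (use assms in auto)
  then show ?thesis by (simp add: exp_def field_simps)
qed

text \<open>The three summands of the constant serve the three conditions. On the small disc the
  weight varies by at most \<open>(1 + m) ^ M\<close>. On a ray
  \<open>1 + |x| \<le> (1 + v) (1 + t |x|)\<close> with \<open>v = (1 - t) |x|\<close>, and the
  exponential absorbs \<open>(1 + v) ^ M\<close>. On a chord \<open>|x| \<le> 3 |y|\<close>.\<close>

lemma admissible_weight_power:
  assumes \<kappa>: "\<kappa> > 0" and p: "p \<ge> 1" and m: "m \<ge> 1" and B: "B \<ge> 0"
  shows "admissible_weight p \<kappa> m ((1 + m) ^ M + fact M * (2 / \<kappa>) ^ M * exp (\<kappa> / 2) + 3 ^ M) 1 W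
    (\<lambda>x. B / (1 + norm x) ^ M)"
proof -
  define L where "L = (1 + m) ^ M + fact M * (2 / \<kappa>) ^ M * exp (\<kappa> / 2) + 3 ^ M"
  define b where "b x = (1 + norm x) ^ M" for x :: complex
  have b: "b x > 0" for x unfolding b_def by (intro zero_less_power) (simp add: add_pos_nonneg)
  have b1: "b x \<ge> 1" for x unfolding b_def by (intro one_le_power) simp
  have L1: "(1 + m) ^ M \<le> L" "fact M * (2 / \<kappa>) ^ M * exp (\<kappa> / 2) \<le> L" "3 ^ M \<le> L"
    using \<kappa> m by (auto simp: L_def intro!: add_nonneg_nonneg mult_nonneg_nonneg)
  have L1': "L \<ge> 1" using L1(3) by (metis one_le_numeral one_le_power order_trans)
  have red: "B / b x \<le> L * (B / b y) * e" if "b y \<le> L * e * b x" for x y e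
  proof -
    have "B * b y \<le> B * (L * e * b x)" using that B by (intro mult_left_mono)
    then show ?thesis using b[of x] b[of y] by (simp add: field_simps)
  qed
  have "admissible_weight p \<kappa> m L 1 W (\<lambda>x. B / b x)"
    unfolding admissible_weight_def
  proof (intro conjI ballI impI)
    fix x :: complex
    show "B / b x \<ge> 0" using B b[of x] by simp
    assume x: "norm x \<le> m * norm (1::complex)"
    have "B / b x \<le> L * (B / b 0) * 1" by (rule red) (use L1' b1[of x] mult_mono[of 1 L 1 "b x"] in \<open>auto simp: b_def\<close>)
    then show "B / b x \<le> L * (B / b 0)" by simp
    have "b x \<le> (1 + m) ^ M" unfolding b_def using x by (intro power_mono) auto
    then have "B / b 0 \<le> L * (B / b x) * 1" by (intro red) (use L1 in \<open>auto simp: b_def\<close>)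
    then show "B / b 0 \<le> L * (B / b x)" by simp
  next
    fix x :: complex and t :: real
    assume t: "t \<in> {0..1}" and "norm (1::complex) \<le> norm x \<and> Re (x ^ p / 1 ^ p) \<le> - \<kappa> * (norm x / norm (1::complex)) ^ p"
    then have a: "norm x \<ge> 1" and R: "Re (x ^ p) \<le> - \<kappa> * norm x ^ p" by auto
    define v where "v = (1 - t) * norm x"
    have v: "v \<ge> 0" using t by (simp add: v_def)
    have "1 + norm x \<le> (1 + v) * (1 + t * norm x)"
    proof -
      have "(1 + v) * (1 + t * norm x) - (1 + norm x) = v * (t * norm x)" by (simp add: v_def algebra_simps)
      moreover have "v * (t * norm x) \<ge> 0" using v t by simp
      ultimately show ?thesis by linarith
    qed
    then have "b x \<le> ((1 + v) * (1 + t * norm x)) ^ M" unfolding b_def by (intro power_mono) auto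
    also have "\<dots> = (1 + v) ^ M * b (of_real t * x)" using t by (simp add: b_def power_mult_distrib norm_mult)
    \<comment> \<open>A power is bounded by one term of the exponential series at
      \<open>\<kappa> (1 + v) / 2\<close>, which gives the constant its factorial and the factor
      \<open>exp (\<kappa> / 2)\<close>.\<close>
    also have "(1 + v) ^ M \<le> fact M * (2 / \<kappa>) ^ M * exp (\<kappa> / 2) * exp (\<kappa> * v / 2)"
    proof -
      have "(\<kappa> * (1 + v) / 2) ^ M \<le> fact M * exp (\<kappa> * (1 + v) / 2)"
        using \<kappa> v by (intro power_le_fact_exp) auto
      moreover have "(1 + v) ^ M = (2 / \<kappa>) ^ M * (\<kappa> * (1 + v) / 2) ^ M"
      proof -
        have "1 + v = 2 / \<kappa> * (\<kappa> * (1 + v) / 2)" using \<kappa> by simp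
        then show ?thesis by (metis power_mult_distrib)
      qed
      moreover have "exp (\<kappa> * (1 + v) / 2) = exp (\<kappa> / 2) * exp (\<kappa> * v / 2)"
        by (simp add: distrib_left add_divide_distrib flip: exp_add)
      ultimately show ?thesis using \<kappa> by (simp add: mult_left_mono mult_ac)
    qed
    also have "\<dots> \<le> L * exp (- (1 - t ^ p) * Re (x ^ p) / 2)"
    proof (intro mult_mono)
      have tp: "t ^ p \<le> t" using t p by (metis atLeastAtMost_iff power_decreasing power_one_right)
      have "norm x ^ 1 \<le> norm x ^ p" using a p by (intro power_increasing) auto
      then have "\<kappa> * v \<le> (1 - t) * (\<kappa> * norm x ^ p)"
        using t \<kappa> unfolding v_def by (simp add: mult_left_mono mult.left_commute)
      also have "\<dots> \<le> (1 - t ^ p) * (\<kappa> * norm x ^ p)" using tp \<kappa> by (intro mult_right_mono) auto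
      also have "\<dots> \<le> (1 - t ^ p) * (- Re (x ^ p))"
        using R t by (intro mult_left_mono) (auto simp: power_le_one)
      finally show "exp (\<kappa> * v / 2) \<le> exp (- (1 - t ^ p) * Re (x ^ p) / 2)" by (simp add: algebra_simps)
    qed (use L1 L1' in auto)
    finally have "b x \<le> L * exp (- (1 - t ^ p) * Re (x ^ p) / 2) * b (of_real t * x)"
      using b[of "of_real t * x"] by (simp add: mult_right_mono)
    from red[OF this] show "B / b (of_real t * x) \<le> L * (B / b x) * exp (- (1 - t ^ p) * Re (x ^ p / 1 ^ p) / 2)" by simp
  next
    fix x y :: complex
    assume "norm (1::complex) \<le> norm x \<and> norm x / 3 \<le> norm y \<and> 0 \<le> Re ((y ^ p - x ^ p) / 1 ^ p)"
    then have y: "norm x \<le> 3 * norm y" "0 \<le> Re (y ^ p - x ^ p)" by auto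
    have "b x \<le> (3 * (1 + norm y)) ^ M" unfolding b_def using y by (intro power_mono) auto
    also have "\<dots> = 3 ^ M * 1 * b y" unfolding b_def power_mult_distrib by simp
    also have "\<dots> \<le> L * exp (Re (y ^ p - x ^ p) / 2) * b y"
      using L1 L1' y b[of y] by (intro mult_right_mono mult_mono) auto
    finally have "b x \<le> L * exp (Re (y ^ p - x ^ p) / 2) * b y" .
    from red[OF this] show "B / b y \<le> L * (B / b x) * exp (Re ((y ^ p - x ^ p) / 1 ^ p) / 2)" by simp
  qed
  then show ?thesis by (simp add: L_def b_def)
qed

section \<open>Functions of \<open>X = x / \<eta>\<close> with expansions at infinity\<close>

locale layer =
  fixes p :: nat and \<mu> \<delta> :: real
  assumes p: "p \<ge> 2" and \<delta>: "0 < \<delta>" "\<delta> \<le> pi / 8" and \<mu>: "\<mu> > 0"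
begin

abbreviation V where "V \<equiv> infinite_domain p \<mu> \<delta>"

text \<open>A uniformizer at infinity without poles in \<open>V\<close>; expansions in powers of \<open>sv X\<close> replace
  expansions in powers of \<open>1 / X\<close>, which are singular at \<open>0 \<in> V\<close>.\<close>

definition sv :: "complex \<Rightarrow> complex" where "sv X = 1 / (X + of_real (\<mu> + 1))"

text \<open>The pole \<open>- (\<mu> + 1)\<close> of \<open>sv\<close> lies outside the disc of
  radius \<open>\<mu>\<close> by 1, and outside the sector because
  \<open>|Arg X| \<le> 3 pi / 4\<close> for \<open>p \<ge> 2\<close>. So \<open>1 / sv\<close> is
  comparable with \<open>1 + |X|\<close> on all of \<open>V\<close>.\<close>

lemma norm_shift_ge:
  assumes "X \<in> V" shows "1 + norm X \<le> (3 + \<mu>) * norm (X + of_real (\<mu> + 1))"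
proof (cases "norm X < \<mu>")
  case True
  have "norm (of_real (\<mu> + 1) :: complex) - norm X \<le> norm (of_real (\<mu> + 1) + X)" by (metis norm_diff_ineq)
  then have "1 \<le> norm (X + of_real (\<mu> + 1))" using True \<mu> by (simp add: add.commute del: of_real_add)
  then have "(3 + \<mu>) * 1 \<le> (3 + \<mu>) * norm (X + of_real (\<mu> + 1))" using \<mu> by (intro mult_left_mono) auto
  moreover have "1 + norm X \<le> (3 + \<mu>) * 1" using True by simp
  ultimately show ?thesis by (rule order_trans[rotated])
next
  case False
  then have X: "X \<noteq> 0" "real p * \<bar>Arg X\<bar> < 3 * pi / 2 - \<delta>" using assms by (auto simp: infinite_domain_def)
  have "2 * \<bar>Arg X\<bar> \<le> real p * \<bar>Arg X\<bar>" using p by (intro mult_right_mono) auto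
  then have a: "\<bar>Arg X\<bar> \<le> 3 * pi / 4" using X \<delta> by linarith
  have "norm X * (- (3/4)) \<le> norm X * cos (Arg X)" using cos_ge_obtuse[OF a] by (intro mult_left_mono) auto
  also have "\<dots> = Re X" by (metis Re_rcis rcis_cmod_Arg)
  finally have re: "- (3/4) * norm X \<le> Re X" by simp
  define c where "c = \<mu> + 1"
  have c: "c > 0" using \<mu> by (simp add: c_def)
  have "(norm X + c) / 3 \<le> norm (X + of_real c)" using re c by (intro norm_add_real_ge) auto
  then have "norm X + c \<le> 3 * norm (X + of_real c)" by simp
  also have "\<dots> \<le> (3 + \<mu>) * norm (X + of_real c)" using \<mu> by (intro mult_right_mono) auto
  finally show ?thesis using \<mu> by (simp add: c_def)
qed

lemma sv_nz: "X \<in> V \<Longrightarrow> X + of_real (\<mu> + 1) \<noteq> 0"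
proof
  assume X: "X \<in> V" and "X + of_real (\<mu> + 1) = 0"
  then have "1 + norm X \<le> 0" using norm_shift_ge[OF X] by simp
  then show False using norm_ge_zero[of X] by linarith
qed

lemma sv_nonzero: "X \<in> V \<Longrightarrow> sv X \<noteq> 0"
  using sv_nz[of X] by (simp add: sv_def)

lemma norm_sv_le: "X \<in> V \<Longrightarrow> norm (sv X) \<le> (3 + \<mu>) / (1 + norm X)"
proof -
  assume X: "X \<in> V"
  have "norm (sv X) = 1 / norm (X + of_real (\<mu> + 1))" by (simp add: sv_def norm_divide)
  moreover have "0 < 1 + norm X" using norm_ge_zero[of X] by linarith
  moreover have "0 < norm (X + of_real (\<mu> + 1))" using sv_nz[OF X] by simp
  moreover have "1 / norm (X + of_real (\<mu> + 1)) = (3 + \<mu>) / ((3 + \<mu>) * norm (X + of_real (\<mu> + 1)))"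
    using \<mu> by simp
  moreover have "(3 + \<mu>) / ((3 + \<mu>) * norm (X + of_real (\<mu> + 1))) \<le> (3 + \<mu>) / (1 + norm X)"
    by (rule divide_left_mono[OF norm_shift_ge[OF X]])
      (use \<mu> \<open>0 < 1 + norm X\<close> \<open>0 < norm (X + of_real (\<mu> + 1))\<close> in \<open>auto intro!: mult_pos_pos simp del: of_real_add\<close>)
  ultimately show ?thesis by (simp only:)
qed

lemma norm_sv_le': "X \<in> V \<Longrightarrow> norm (sv X) \<le> 3 + \<mu>"
proof -
  assume "X \<in> V"
  then have "norm (sv X) \<le> (3 + \<mu>) / (1 + norm X)" by (rule norm_sv_le)
  moreover have "0 < 1 + norm X" using norm_ge_zero[of X] by linarith
  then have "(3 + \<mu>) / (1 + norm X) \<le> (3 + \<mu>) / 1" using \<mu> by (intro divide_left_mono) auto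
  ultimately show ?thesis by simp
qed

lemma inverse_norm_sv_le: "X \<in> V \<Longrightarrow> 1 / norm (sv X) \<le> (1 + \<mu>) * (1 + norm X)"
proof -
  assume "X \<in> V"
  have "1 / norm (sv X) = norm (X + of_real (\<mu> + 1))" by (simp add: sv_def norm_divide)
  also have "\<dots> \<le> norm X + (\<mu> + 1)" using norm_triangle_ineq[of X "of_real (\<mu> + 1)"] \<mu>
    by (simp del: of_real_add)
  also have "\<dots> \<le> (1 + \<mu>) * (1 + norm X)" using \<mu> by (simp add: algebra_simps)
  finally show ?thesis .
qed

lemma X_sv: "X \<in> V \<Longrightarrow> X = 1 / sv X - of_real (\<mu> + 1)"
  by (simp add: sv_def)

lemma sv_deriv: "X \<in> V \<Longrightarrow> (sv has_field_derivative - (sv X)\<^sup>2) (at X)"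
  unfolding sv_def[abs_def] using sv_nz[of X]
  by (auto intro!: derivative_eq_intros simp: power2_eq_square simp del: of_real_add)

lemma V_open: "open V" using open_infinite_domain[OF p \<delta>(1)] .

lemma sv_holomorphic: "sv holomorphic_on V"
  using sv_deriv V_open by (auto simp: holomorphic_on_open)

text \<open>The approximating polynomial may depend on \<open>M\<close>, which makes closure under
  sums and products immediate; that its low coefficients stabilise is derived where it is used. The
  weight \<open>1 + |X|\<close> keeps the estimate meaningful at \<open>X = 0\<close>.\<close>

definition sv_expandable :: "(complex \<Rightarrow> complex) \<Rightarrow> bool" where
  "sv_expandable f \<longleftrightarrow> f holomorphic_on V \<and>
     (\<forall>M. \<exists>q C. \<forall>X\<in>V. norm (f X - poly q (sv X)) \<le> C / (1 + norm X) ^ M)"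

lemma poly_sv_bounded: "\<exists>B>0. \<forall>X\<in>V. norm (poly q (sv X)) \<le> B"
proof -
  have "compact (poly q ` cball 0 (3 + \<mu>))"
    by (intro compact_continuous_image continuous_intros) auto
  then obtain B where "B > 0" "\<And>z. z \<in> cball 0 (3 + \<mu>) \<Longrightarrow> norm (poly q z) \<le> B"
    using compact_imp_bounded bounded_pos by (metis imageI)
  then show ?thesis using norm_sv_le' by (intro exI[of _ B]) auto
qed

lemma sv_expandable_bounded: assumes "sv_expandable f" shows "\<exists>B>0. \<forall>X\<in>V. norm (f X) \<le> B"
proof -
  obtain q C where q: "\<And>X. X \<in> V \<Longrightarrow> norm (f X - poly q (sv X)) \<le> C"
    using assms unfolding sv_expandable_def by (metis div_by_1 power_0)
  obtain B where B: "B > 0" "\<And>X. X \<in> V \<Longrightarrow> norm (poly q (sv X)) \<le> B" using poly_sv_bounded by blast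
  have "norm (f X) \<le> \<bar>C\<bar> + B" if "X \<in> V" for X
    using q[OF that] B(2)[OF that] norm_triangle_ineq2[of "f X" "poly q (sv X)"] by linarith
  then show ?thesis using B(1) by (intro exI[of _ "\<bar>C\<bar> + B"]) auto
qed

lemma sv_expandable_poly: "sv_expandable (\<lambda>X. poly q (sv X))"
  unfolding sv_expandable_def
proof (intro conjI allI)
  show "(\<lambda>X. poly q (sv X)) holomorphic_on V"
    by (induction q) (auto intro!: holomorphic_intros sv_holomorphic)
qed (rule exI[of _ q], rule exI[of _ 0], simp)

lemma sv_expandable_add: assumes "sv_expandable f" "sv_expandable g" shows "sv_expandable (\<lambda>X. f X + g X)"
  unfolding sv_expandable_def
proof (intro conjI allI)
  show "(\<lambda>X. f X + g X) holomorphic_on V" using assms by (auto simp: sv_expandable_def intro: holomorphic_intros)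
  fix M
  obtain q C r D where *: "\<And>X. X \<in> V \<Longrightarrow> norm (f X - poly q (sv X)) \<le> C / (1 + norm X) ^ M"
      "\<And>X. X \<in> V \<Longrightarrow> norm (g X - poly r (sv X)) \<le> D / (1 + norm X) ^ M"
    using assms unfolding sv_expandable_def by metis
  have "norm (f X + g X - poly (q + r) (sv X)) \<le> (C + D) / (1 + norm X) ^ M" if "X \<in> V" for X
    using *[OF that] norm_triangle_ineq[of "f X - poly q (sv X)" "g X - poly r (sv X)"]
    by (simp add: add_divide_distrib algebra_simps)
  then show "\<exists>q C. \<forall>X\<in>V. norm (f X + g X - poly q (sv X)) \<le> C / (1 + norm X) ^ M" by blast
qed

lemma sv_expandable_mult: assumes "sv_expandable f" "sv_expandable g" shows "sv_expandable (\<lambda>X. f X * g X)"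
  unfolding sv_expandable_def
proof (intro conjI allI)
  show "(\<lambda>X. f X * g X) holomorphic_on V" using assms by (auto simp: sv_expandable_def intro: holomorphic_intros)
  fix M
  obtain q C r D where *: "\<And>X. X \<in> V \<Longrightarrow> norm (f X - poly q (sv X)) \<le> C / (1 + norm X) ^ M"
      "\<And>X. X \<in> V \<Longrightarrow> norm (g X - poly r (sv X)) \<le> D / (1 + norm X) ^ M"
    using assms unfolding sv_expandable_def by metis
  obtain B where B: "B > 0" "\<And>X. X \<in> V \<Longrightarrow> norm (f X) \<le> B" using sv_expandable_bounded[OF assms(1)] by blast
  obtain B' where B': "B' > 0" "\<And>X. X \<in> V \<Longrightarrow> norm (poly r (sv X)) \<le> B'" using poly_sv_bounded by blast
  have "norm (f X * g X - poly (q * r) (sv X)) \<le> (B * D + B' * C) / (1 + norm X) ^ M" if X: "X \<in> V" for X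
  proof -
    have "f X * g X - poly (q * r) (sv X) = f X * (g X - poly r (sv X)) + poly r (sv X) * (f X - poly q (sv X))"
      by (simp add: algebra_simps)
    also have "norm \<dots> \<le> B * (D / (1 + norm X) ^ M) + B' * (C / (1 + norm X) ^ M)"
      by (rule order_trans[OF norm_triangle_ineq], unfold norm_mult, intro add_mono mult_mono)
        (use * B B' X in auto)
    finally show ?thesis by (simp add: add_divide_distrib)
  qed
  then show "\<exists>q C. \<forall>X\<in>V. norm (f X * g X - poly q (sv X)) \<le> C / (1 + norm X) ^ M" by blast
qed

lemma sv_expandable_const: "sv_expandable (\<lambda>X. c)"
  using sv_expandable_poly[of "[:c:]"] by simp

lemma sv_expandable_sv: "sv_expandable sv"
  using sv_expandable_poly[of "[:0, 1:]"] by simp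

lemma real_in_V: "t > 0 \<Longrightarrow> of_real t \<in> V"
  using \<delta> pi_gt_zero by (simp add: infinite_domain_def Arg_of_real)

lemma sv_tendsto: "(\<lambda>n. sv (of_real (real n + 1))) \<longlonglongrightarrow> 0"
proof (rule Lim_null_comparison)
  show "\<forall>\<^sub>F n in sequentially. norm (sv (of_real (real n + 1))) \<le> (3 + \<mu>) * inverse (real (Suc n))"
  proof (rule always_eventually, rule allI)
    fix n
    have "norm (sv (of_real (real n + 1))) \<le> (3 + \<mu>) / (1 + norm (of_real (real n + 1) :: complex))"
      by (rule norm_sv_le[OF real_in_V]) simp
    also have "\<dots> \<le> (3 + \<mu>) / real (Suc n)" using \<mu> unfolding norm_of_real by (intro divide_left_mono) auto
    finally show "norm (sv (of_real (real n + 1))) \<le> (3 + \<mu>) * inverse (real (Suc n))" by (simp add: divide_inverse)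
  qed
  show "(\<lambda>n. (3 + \<mu>) * inverse (real (Suc n))) \<longlonglongrightarrow> 0"
    by (rule tendsto_mult_right_zero[OF LIMSEQ_inverse_real_of_nat])
qed

text \<open>The constant \<open>c\<close> is the limit of \<open>f\<close> along the positive axis,
  hence the constant term of every approximant of positive order. Removing it leaves polynomials
  divisible by \<open>sv\<close>. The division costs one power of decay, so order \<open>M\<close>
  of \<open>g\<close> uses order \<open>Suc M\<close> of \<open>f\<close>.\<close>

lemma sv_expandable_decomp:
  assumes f: "sv_expandable f"
  obtains c g where "sv_expandable g" "\<And>X. X \<in> V \<Longrightarrow> f X = c + sv X * g X"
proof -
  have "\<exists>q C. \<forall>X\<in>V. norm (f X - poly q (sv X)) \<le> C / (1 + norm X) ^ M" for M using f by (simp add: sv_expandable_def)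
  then obtain q C where q: "\<And>M X. X \<in> V \<Longrightarrow> norm (f X - poly (q M) (sv X)) \<le> C M / (1 + norm X) ^ M" by metis
  have z: "(\<lambda>n. C M / (1 + norm (of_real (real n + 1) :: complex)) ^ M) \<longlonglongrightarrow> 0" if "M > 0" for M
  proof (rule Lim_null_comparison)
    show "\<forall>\<^sub>F n in sequentially. norm (C M / (1 + norm (of_real (real n + 1) :: complex)) ^ M) \<le> \<bar>C M\<bar> * inverse (real (Suc n))"
    proof (rule always_eventually, rule allI)
      fix n
      have "real (Suc n) \<le> (1 + (real n + 1)) ^ 1" by simp
      also have "\<dots> \<le> (1 + (real n + 1)) ^ M" using that by (intro power_increasing) auto
      finally have "\<bar>C M\<bar> / (1 + (real n + 1)) ^ M \<le> \<bar>C M\<bar> / real (Suc n)" by (intro divide_left_mono) auto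
      then show "norm (C M / (1 + norm (of_real (real n + 1) :: complex)) ^ M) \<le> \<bar>C M\<bar> * inverse (real (Suc n))"
        unfolding norm_of_real by (simp add: divide_inverse abs_mult)
    qed
    show "(\<lambda>n. \<bar>C M\<bar> * inverse (real (Suc n))) \<longlonglongrightarrow> 0"
      by (rule tendsto_mult_right_zero[OF LIMSEQ_inverse_real_of_nat])
  qed
  have lim: "(\<lambda>n. f (of_real (real n + 1))) \<longlonglongrightarrow> poly (q M) 0" if M: "M > 0" for M
  proof -
    have "(\<lambda>n. f (of_real (real n + 1)) - poly (q M) (sv (of_real (real n + 1)))) \<longlonglongrightarrow> 0"
    proof (rule Lim_null_comparison[OF _ z[OF M]], rule always_eventually, rule allI)
      fix n
      show "norm (f (of_real (real n + 1)) - poly (q M) (sv (of_real (real n + 1)))) \<le> C M / (1 + norm (of_real (real n + 1) :: complex)) ^ M"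
        by (rule q[OF real_in_V]) simp
    qed
    moreover have "(\<lambda>n. poly (q M) (sv (of_real (real n + 1)))) \<longlonglongrightarrow> poly (q M) 0"
      by (rule isCont_tendsto_compose[OF _ sv_tendsto]) simp
    ultimately have "(\<lambda>n. (f (of_real (real n + 1)) - poly (q M) (sv (of_real (real n + 1)))) + poly (q M) (sv (of_real (real n + 1)))) \<longlonglongrightarrow> 0 + poly (q M) 0"
      by (rule tendsto_add)
    then show ?thesis by simp
  qed
  define c where "c = poly (q 1) 0"
  have c: "poly (q M) 0 = c" if "M > 0" for M
    unfolding c_def by (rule LIMSEQ_unique[OF lim[OF that] lim]) simp
  define g where "g X = (f X - c) / sv X" for X
  have "sv_expandable g" unfolding sv_expandable_def
  proof (intro conjI allI)
    show "g holomorphic_on V" using f sv_holomorphic sv_nonzero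
      by (auto simp: sv_expandable_def g_def[abs_def] intro!: holomorphic_intros)
    fix M
    obtain a r where r: "q (Suc M) = pCons a r" by (rule pCons_cases)
    then have a: "a = c" using c[of "Suc M"] by simp
    have "norm (g X - poly r (sv X)) \<le> (C (Suc M) * (1 + \<mu>)) / (1 + norm X) ^ M" if X: "X \<in> V" for X
    proof -
      have "g X - poly r (sv X) = (f X - poly (q (Suc M)) (sv X)) / sv X"
        using sv_nonzero[OF X] by (simp add: g_def r a field_simps)
      then have "norm (g X - poly r (sv X)) = norm (f X - poly (q (Suc M)) (sv X)) * (1 / norm (sv X))"
        by (simp add: norm_divide)
      also have "\<dots> \<le> (C (Suc M) / (1 + norm X) ^ Suc M) * ((1 + \<mu>) * (1 + norm X))"
        using q[OF X, of "Suc M"] inverse_norm_sv_le[OF X] order_trans[OF norm_ge_zero q[OF X, of "Suc M"]]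
        by (intro mult_mono) auto
      also have "\<dots> = (C (Suc M) * (1 + \<mu>)) / (1 + norm X) ^ M"
      proof -
        have "A / w ^ Suc M * ((1 + \<mu>) * w) = A * (1 + \<mu>) / w ^ M" if "w > 0" for A w :: real
          using that by simp
        moreover have "1 + norm X > 0" using norm_ge_zero[of X] by linarith
        ultimately show ?thesis by blast
      qed
      finally show ?thesis .
    qed
    then show "\<exists>q C. \<forall>X\<in>V. norm (g X - poly q (sv X)) \<le> C / (1 + norm X) ^ M" by blast
  qed
  then show ?thesis using that[of g c] sv_nonzero by (simp add: g_def)
qed

text \<open>Formal solution in powers of \<open>sv\<close>: the operator \<open>u' - p X\<^sup>p\<^sup>-\<^sup>1 u\<close> maps \<open>sv ^ (m + 1)\<close> to
  \<open>- p sv ^ (m - (p - 2))\<close> up to higher powers of \<open>sv\<close>.\<close>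

lemma formal_solution_step:
  "\<exists>k r. \<forall>X\<in>V. ((\<lambda>X. sv X * poly k (sv X)) has_field_derivative
     (of_nat p * X ^ (p - 1) * (sv X * poly k (sv X)) + (sv X ^ n * poly q (sv X) - sv X ^ M * poly r (sv X)) / sv X ^ (p - 2))) (at X)"
proof (induction "M - n" arbitrary: n q)
  case 0
  have eq: "sv X ^ n * poly q (sv X) - sv X ^ M * poly (monom 1 (n - M) * q) (sv X) = 0" for X
  proof -
    have "sv X ^ n = sv X ^ M * sv X ^ (n - M)" using 0 by (simp flip: power_add)
    then show ?thesis by (simp add: poly_monom)
  qed
  show ?case
    by (rule exI[of _ 0], rule exI[of _ "monom 1 (n - M) * q"], rule ballI)
      (simp only: eq poly_0 mult_zero_right div_0 add_0_right DERIV_const)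
next
  case (Suc d)
  obtain a q1 where q: "q = pCons a q1" by (rule pCons_cases)
  define c0 where "c0 = complex_of_real (\<mu> + 1)"
  obtain e b where eb: "[:1, - c0:] ^ (p - 1) = pCons e b" by (rule pCons_cases)
  have "poly ([:1, - c0:] ^ (p - 1)) 0 = 1" by (simp add: poly_power)
  then have e: "e = 1" unfolding eb by simp
  have bz: "(1 - c0 * z) ^ (p - 1) = 1 + z * poly b z" for z
  proof -
    have "(1 - c0 * z) ^ (p - 1) = poly ([:1, - c0:] ^ (p - 1)) z" by (simp add: poly_power mult.commute)
    then show ?thesis unfolding eb e by simp
  qed
  \<comment> \<open>Chosen so that \<open>- A * sv ^ Suc n\<close> cancels the leading coefficient
    \<open>a\<close> of the source.\<close>
  define A where "A = a / of_nat p"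
  have pA: "of_nat p * A = a" using p by (simp add: A_def)
  \<comment> \<open>What remains one order higher: the tail \<open>q1\<close> of \<open>q\<close>,
    the correction \<open>b\<close> from \<open>(1 - c0 z) ^ (p - 1) = 1 + z b(z)\<close>, and the
    derivative of \<open>sv ^ Suc n\<close>, which appears \<open>p - 1\<close> powers later. The
    induction therefore runs on \<open>M - n\<close>.\<close>
  define q' where "q' = q1 - smult a b - monom (A * of_nat (n + 1)) (p - 1)"
  obtain k r where kr: "\<And>X. X \<in> V \<Longrightarrow> ((\<lambda>X. sv X * poly k (sv X)) has_field_derivative
     (of_nat p * X ^ (p - 1) * (sv X * poly k (sv X)) + (sv X ^ Suc n * poly q' (sv X) - sv X ^ M * poly r (sv X)) / sv X ^ (p - 2))) (at X)"
  proof -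
    have "d = M - Suc n" using Suc(2) by simp
    from Suc(1)[OF this, of q'] show ?thesis using that by blast
  qed
  define k1 where "k1 = monom (- A) n"
  have "((\<lambda>X. sv X * poly (k1 + k) (sv X)) has_field_derivative
     (of_nat p * X ^ (p - 1) * (sv X * poly (k1 + k) (sv X)) + (sv X ^ n * poly q (sv X) - sv X ^ M * poly r (sv X)) / sv X ^ (p - 2))) (at X)"
    if X: "X \<in> V" for X
  proof -
    define z where "z = sv X"
    have z: "z \<noteq> 0" using sv_nonzero[OF X] by (simp add: z_def)
    have Xz: "X ^ (p - 1) = (1 - c0 * z) ^ (p - 1) / (z ^ (p - 2) * z)"
    proof -
      have "X = (1 - c0 * z) / z" using X_sv[OF X] z by (simp add: z_def c0_def field_simps)
      moreover have "z ^ (p - 1) = z ^ (p - 2) * z"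
      proof -
        have "p - 1 = Suc (p - 2)" using p by simp
        then show ?thesis by (simp add: mult.commute)
      qed
      ultimately show ?thesis by (metis power_divide)
    qed
    have d1: "((\<lambda>X. (- A) * sv X ^ Suc n) has_field_derivative (- A) * (of_nat (Suc n) * (- z\<^sup>2) * z ^ n)) (at X)"
      by (rule derivative_eq_intros sv_deriv[OF X] refl | simp add: z_def)+
    have split: "z ^ n * poly q z = z ^ Suc n * poly q' z + (a * z ^ n * (1 - c0 * z) ^ (p - 1) + A * of_nat (n + 1) * z ^ (n + p))"
    proof -
      have "z ^ (n + p) = z ^ n * z * z ^ (p - 1)" using p by (cases p) (auto simp: power_add)
      then show ?thesis unfolding bz q q'_def by (simp add: poly_monom algebra_simps)
    qed
    have main: "(- A) * (of_nat (Suc n) * (- z\<^sup>2) * z ^ n)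
        = of_nat p * X ^ (p - 1) * ((- A) * z ^ Suc n) +
          (a * z ^ n * (1 - c0 * z) ^ (p - 1) + A * of_nat (n + 1) * z ^ (n + p)) / z ^ (p - 2)"
    proof -
      have "z ^ p = z\<^sup>2 * z ^ (p - 2)" by (metis le_add_diff_inverse p power_add)
      then have "z ^ (n + p) = z ^ n * z\<^sup>2 * z ^ (p - 2)" by (simp add: power_add)
      then have 1: "A * of_nat (n + 1) * z ^ (n + p) / z ^ (p - 2) = A * of_nat (n + 1) * (z ^ n * z\<^sup>2)"
        using z by simp
      have 2: "of_nat p * X ^ (p - 1) * ((- A) * z ^ Suc n) = - (a * z ^ n * (1 - c0 * z) ^ (p - 1) / z ^ (p - 2))"
        unfolding Xz pA[symmetric] using z by (simp add: field_simps)
      show ?thesis unfolding add_divide_distrib 1 2 by (simp add: algebra_simps)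
    qed
    have "((\<lambda>X. (- A) * sv X ^ Suc n + sv X * poly k (sv X)) has_field_derivative
       (- A) * (of_nat (Suc n) * (- z\<^sup>2) * z ^ n) +
       (of_nat p * X ^ (p - 1) * (z * poly k z) + (z ^ Suc n * poly q' z - z ^ M * poly r z) / z ^ (p - 2))) (at X)"
      using DERIV_add[OF d1 kr[OF X]] by (simp add: z_def)
    moreover have "(\<lambda>X. (- A) * sv X ^ Suc n + sv X * poly k (sv X)) = (\<lambda>X. sv X * poly (k1 + k) (sv X))"
      by (rule ext) (simp add: k1_def poly_monom algebra_simps)
    moreover have "(- A) * (of_nat (Suc n) * (- z\<^sup>2) * z ^ n) +
       (of_nat p * X ^ (p - 1) * (z * poly k z) + (z ^ Suc n * poly q' z - z ^ M * poly r z) / z ^ (p - 2))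
       = of_nat p * X ^ (p - 1) * (z * poly (k1 + k) z) + (z ^ n * poly q z - z ^ M * poly r z) / z ^ (p - 2)"
      unfolding main split by (simp add: k1_def poly_monom add_divide_distrib diff_divide_distrib algebra_simps)
    ultimately show ?thesis by (simp add: z_def)
  qed
  then show ?case by blast
qed

end

section \<open>Solving the equation for functions of \<open>x / \<eta>\<close>\<close>

context layer begin

text \<open>For each \<open>M\<close> the formal solution leaves a residual of order
  \<open>M\<close>. One true solution \<open>w\<close> is made from the formal solution of order 0
  by adding a null solution of its residual. Its difference to any other formal solution is bounded,
  hence satisfies the condition at infinity, and solves the equation with a small source; the
  weighted estimate makes this difference small. The division by \<open>sv ^ (p - 2)\<close> admits
  sources that grow like \<open>X ^ (p - 2)\<close>.\<close>

lemma sv_expandable_solve: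
  assumes f: "sv_expandable f"
  obtains k where "sv_expandable k" "\<And>X. X \<in> V \<Longrightarrow> ((\<lambda>X. sv X * k X) has_field_derivative
      (of_nat p * X ^ (p - 1) * (sv X * k X) + f X / sv X ^ (p - 2))) (at X)"
proof -
  define m where "m = max 1 \<mu>"
  have m: "m \<ge> 1" "m \<ge> \<mu>" by (auto simp: m_def)
  have p1: "p \<ge> 1" using p by simp
  note sd = sin_pos_less_1[OF \<delta>]
  note acc = accessible_infinite_domain[OF p \<delta> \<mu> m]
  have star: "of_real t * x \<in> V" if "x \<in> V" "t \<in> {0..1}" for x t
    using infinite_domain_starlike[OF \<mu> that] .
  have fh: "f holomorphic_on V" using f by (simp add: sv_expandable_def)
  have nX: "1 + norm X > 0" for X :: complex using norm_ge_zero[of X] by linarith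
  have residual: "\<exists>k g B. g holomorphic_on V \<and> B > 0 \<and> (\<forall>X\<in>V. norm (g X) \<le> B / (1 + norm X) ^ M) \<and>
     (\<forall>X\<in>V. ((\<lambda>X. sv X * poly k (sv X)) has_field_derivative
       (of_nat p * X ^ (p - 1) * (sv X * poly k (sv X)) + f X / sv X ^ (p - 2) - g X)) (at X))" for M
  proof -
    \<comment> \<open>The surplus \<open>p - 2\<close> is lost again in the division by
      \<open>sv ^ (p - 2)\<close>.\<close>
    define M' where "M' = M + (p - 2)"
    obtain q C where q: "\<And>X. X \<in> V \<Longrightarrow> norm (f X - poly q (sv X)) \<le> C / (1 + norm X) ^ M'"
      using f unfolding sv_expandable_def by blast
    obtain k r where kr: "\<And>X. X \<in> V \<Longrightarrow> ((\<lambda>X. sv X * poly k (sv X)) has_field_derivative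
     (of_nat p * X ^ (p - 1) * (sv X * poly k (sv X)) + (sv X ^ 0 * poly q (sv X) - sv X ^ M' * poly r (sv X)) / sv X ^ (p - 2))) (at X)"
      using formal_solution_step[of 0 q M'] by blast
    obtain B where B: "B > 0" "\<And>X. X \<in> V \<Longrightarrow> norm (poly r (sv X)) \<le> B" using poly_sv_bounded by blast
    define g where "g X = (f X - poly q (sv X) + sv X ^ M' * poly r (sv X)) / sv X ^ (p - 2)" for X
    have C0: "C \<ge> 0"
    proof -
      have "0 \<le> C / (1 + norm (of_real 1 :: complex)) ^ M'"
        using order_trans[OF norm_ge_zero q[OF real_in_V[of 1]]] by simp
      moreover have "0 < (1 + norm (of_real 1 :: complex)) ^ M'" by simp
      ultimately show ?thesis by (metis divide_neg_pos not_le)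
    qed
    \<comment> \<open>Adding 1 to the constant makes it positive, as the weights built from it have
      to be.\<close>
    have "norm (g X) \<le> ((C + (3 + \<mu>) ^ M' * B) * (1 + \<mu>) ^ (p - 2) + 1) / (1 + norm X) ^ M" if X: "X \<in> V" for X
    proof -
      define w where "w = 1 + norm X"
      have w: "w > 0" using nX by (simp add: w_def)
      have "norm (sv X ^ M' * poly r (sv X)) \<le> ((3 + \<mu>) / w) ^ M' * B"
        unfolding norm_mult norm_power w_def using norm_sv_le[OF X] B(2)[OF X] \<mu> nX[of X]
        by (intro mult_mono power_mono) auto
      then have "norm (f X - poly q (sv X) + sv X ^ M' * poly r (sv X)) \<le> C / w ^ M' + ((3 + \<mu>) / w) ^ M' * B"
        using q[OF X] unfolding w_def by (intro order_trans[OF norm_triangle_ineq] add_mono)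
      also have "\<dots> = (C + (3 + \<mu>) ^ M' * B) / w ^ M'" unfolding power_divide add_divide_distrib[of C] by simp
      finally have n: "norm (f X - poly q (sv X) + sv X ^ M' * poly r (sv X)) \<le> (C + (3 + \<mu>) ^ M' * B) / w ^ M'" .
      have d: "1 / norm (sv X) ^ (p - 2) \<le> ((1 + \<mu>) * w) ^ (p - 2)"
        using power_mono[OF inverse_norm_sv_le[OF X], of "p - 2"] by (simp add: power_divide w_def)
      have "norm (g X) = norm (f X - poly q (sv X) + sv X ^ M' * poly r (sv X)) * (1 / norm (sv X) ^ (p - 2))"
        by (simp add: g_def norm_divide norm_power)
      also have "\<dots> \<le> (C + (3 + \<mu>) ^ M' * B) / w ^ M' * ((1 + \<mu>) * w) ^ (p - 2)"
        using n d C0 B \<mu> w by (intro mult_mono) auto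
      also have "\<dots> = (C + (3 + \<mu>) ^ M' * B) * (1 + \<mu>) ^ (p - 2) / w ^ M"
        using w by (simp add: M'_def power_add power_mult_distrib)
      also have "\<dots> \<le> ((C + (3 + \<mu>) ^ M' * B) * (1 + \<mu>) ^ (p - 2) + 1) / w ^ M"
        using w by (intro divide_right_mono) auto
      finally show ?thesis by (simp add: w_def)
    qed
    moreover have "(C + (3 + \<mu>) ^ M' * B) * (1 + \<mu>) ^ (p - 2) + 1 > 0"
      using C0 B \<mu> by (intro add_nonneg_pos mult_nonneg_nonneg add_nonneg_nonneg) auto
    moreover have "g holomorphic_on V" unfolding g_def
      by (intro holomorphic_intros fh sv_holomorphic sv_expandable_poly[unfolded sv_expandable_def, THEN conjunct1]) (use sv_nonzero in auto)
    moreover have "((\<lambda>X. sv X * poly k (sv X)) has_field_derivative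
       (of_nat p * X ^ (p - 1) * (sv X * poly k (sv X)) + f X / sv X ^ (p - 2) - g X)) (at X)" if X: "X \<in> V" for X
    proof -
      have e: "(sv X ^ 0 * poly q (sv X) - sv X ^ M' * poly r (sv X)) / sv X ^ (p - 2) = f X / sv X ^ (p - 2) - g X"
        by (simp add: g_def add_divide_distrib diff_divide_distrib)
      show ?thesis using kr[OF X] unfolding e by (simp add: algebra_simps)
    qed
    ultimately show ?thesis by blast
  qed
  \<comment> \<open>A bounded residual suffices to define the solution; the residuals of higher
    order serve for comparison with it.\<close>
  obtain k0 g0 B0 where g0: "g0 holomorphic_on V" "\<And>X. X \<in> V \<Longrightarrow> norm (g0 X) \<le> B0"
    and k0: "\<And>X. X \<in> V \<Longrightarrow> ((\<lambda>X. sv X * poly k0 (sv X)) has_field_derivative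
       (of_nat p * X ^ (p - 1) * (sv X * poly k0 (sv X)) + f X / sv X ^ (p - 2) - g0 X)) (at X)" and B0: "B0 > 0"
    using residual[of 0] unfolding power_0 div_by_1 by blast
  define v where "v = null_solution p 1 (\<lambda>n. real n + 1) g0"
  have vode: "linear_ode p 1 V g0 v" unfolding v_def by (rule null_solution_ode[OF V_open star g0(1)])
  have vvan: "(\<lambda>n. v (of_real (real n + 1)) * exp (- (of_real (real n + 1) ^ p) / 1 ^ p)) \<longlonglongrightarrow> 0"
    unfolding v_def
    by (rule null_solution_vanishes[where W = V and \<kappa> = "sin \<delta>" and B = B0])
      (use p1 sd V_open star g0 real_in_V in \<open>auto simp: incseq_def simp del: of_real_add\<close>)
  obtain Cv where Cv: "Cv > 0" "\<And>x. x \<in> V \<Longrightarrow> norm (v x) \<le> Cv * B0"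
  proof -
    obtain C where C: "C > 0" and est: "\<And>\<eta> W q u f \<phi> x. accessible p (sin \<delta>) m \<eta> W q \<Longrightarrow> admissible_weight p (sin \<delta>) m 1 \<eta> W \<phi> \<Longrightarrow>
       linear_ode p \<eta> W f u \<Longrightarrow> (\<And>x. x \<in> W \<Longrightarrow> norm \<eta> * norm (f x) \<le> \<phi> x) \<Longrightarrow>
       (\<And>x. x \<in> W \<Longrightarrow> x = of_real (norm \<eta>) \<or> \<not> small_or_descending p (sin \<delta>) m \<eta> x \<Longrightarrow>
          \<exists>\<^sub>F n in sequentially. norm (u (of_real (q n))) * exp (Re ((x ^ p - of_real (q n ^ p)) / \<eta> ^ p)) \<le> \<phi> x) \<Longrightarrow>
       x \<in> W \<Longrightarrow> norm (u x) \<le> C * \<phi> x"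
      using accessible_estimate[OF p1 sd(1) m(1), of 1] by auto
    have "norm (v x) \<le> C * B0" if "x \<in> V" for x
    proof (rule est[OF acc admissible_weight_const[OF sd(1) less_imp_le[OF B0] order_refl] vode _ _ that])
      fix x assume "x \<in> V"
      then show "norm (1::complex) * norm (g0 x) \<le> B0" using g0 by simp
      show "\<exists>\<^sub>F n in sequentially. norm (v (of_real (real n + 1))) * exp (Re ((x ^ p - of_real ((real n + 1) ^ p)) / 1 ^ p)) \<le> B0"
        by (rule vanishing_imp_frequently[OF vvan B0])
    qed
    then show ?thesis using that C by blast
  qed
  define w where "w X = sv X * poly k0 (sv X) + v X" for X
  have wd: "(w has_field_derivative (of_nat p * X ^ (p - 1) * w X + f X / sv X ^ (p - 2))) (at X)" if X: "X \<in> V" for X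
  proof -
    have "(v has_field_derivative (of_nat p * X ^ (p - 1) * v X + g0 X)) (at X)"
      using vode X by (simp add: linear_ode_def)
    from DERIV_add[OF k0[OF X] this] show ?thesis by (simp add: w_def[abs_def] algebra_simps)
  qed
  obtain Bk where Bk: "Bk > 0" "\<And>X. X \<in> V \<Longrightarrow> norm (poly k0 (sv X)) \<le> Bk" using poly_sv_bounded by blast
  have svb: "norm (sv X * poly k (sv X)) \<le> (3 + \<mu>) * B" if "X \<in> V" "norm (poly k (sv X)) \<le> B" for X k B
    unfolding norm_mult using norm_sv_le'[OF that(1)] that(2) \<mu> by (intro mult_mono) auto
  have wb: "norm (w X) \<le> (3 + \<mu>) * Bk + Cv * B0" if X: "X \<in> V" for X
    unfolding w_def by (rule norm_triangle_le[OF add_mono[OF svb[OF X Bk(2)[OF X]] Cv(2)[OF X]]])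
  have expo: "(\<lambda>n. exp (- (of_real (real n + 1) ^ p) / 1 ^ p :: complex)) \<longlonglongrightarrow> 0"
  proof (rule Lim_null_comparison)
    show "\<forall>\<^sub>F n in sequentially. norm (exp (- (of_real (real n + 1) ^ p) / 1 ^ p :: complex)) \<le> inverse (real (Suc n))"
    proof (rule always_eventually, rule allI)
      fix n
      have "(real n + 1) ^ 1 \<le> (real n + 1) ^ p" using p1 by (intro power_increasing) auto
      also have "\<dots> \<le> exp ((real n + 1) ^ p)" using exp_ge_add_one_self[of "(real n + 1) ^ p"] by linarith
      finally have "inverse (exp ((real n + 1) ^ p)) \<le> inverse (real n + 1)" by (intro le_imp_inverse_le) auto
      moreover have "norm (exp (- (of_real (real n + 1) ^ p) / 1 ^ p :: complex)) = inverse (exp ((real n + 1) ^ p))"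
      proof -
        have "- (of_real (real n + 1) ^ p) / 1 ^ p = (of_real (- ((real n + 1) ^ p)) :: complex)" by simp
        then show ?thesis by (simp only: norm_exp_eq_Re Re_complex_of_real exp_minus)
      qed
      ultimately show "norm (exp (- (of_real (real n + 1) ^ p) / 1 ^ p :: complex)) \<le> inverse (real (Suc n))"
        by (simp add: add.commute)
    qed
  qed (rule LIMSEQ_inverse_real_of_nat)
  define \<kappa> where "\<kappa> X = w X / sv X" for X
  have "sv_expandable \<kappa>" unfolding sv_expandable_def
  proof (intro conjI allI)
    have "w holomorphic_on V" using wd V_open by (auto simp: holomorphic_on_open)
    then show "\<kappa> holomorphic_on V" unfolding \<kappa>_def
      by (intro holomorphic_intros sv_holomorphic) (use sv_nonzero in auto)
    fix M
    \<comment> \<open>Order \<open>Suc M\<close>, because \<open>\<kappa>\<close> is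
      \<open>w / sv\<close> and division by \<open>sv\<close> costs one power.\<close>
    obtain k g B where g: "\<And>X. X \<in> V \<Longrightarrow> norm (g X) \<le> B / (1 + norm X) ^ Suc M"
      and k: "\<And>X. X \<in> V \<Longrightarrow> ((\<lambda>X. sv X * poly k (sv X)) has_field_derivative
       (of_nat p * X ^ (p - 1) * (sv X * poly k (sv X)) + f X / sv X ^ (p - 2) - g X)) (at X)" and B: "B > 0"
      using residual[of "Suc M"] by blast
    define u where "u X = w X - sv X * poly k (sv X)" for X
    have uode: "linear_ode p 1 V g u" unfolding linear_ode_def
    proof
      fix X assume X: "X \<in> V"
      show "(u has_field_derivative (of_nat p * X ^ (p - 1) / 1 ^ p * u X + g X)) (at X)"
        using DERIV_diff[OF wd[OF X] k[OF X]] by (simp add: u_def[abs_def] algebra_simps)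
    qed
    obtain B' where B': "B' > 0" "\<And>X. X \<in> V \<Longrightarrow> norm (poly k (sv X)) \<le> B'" using poly_sv_bounded by blast
    have ub: "norm (u X) \<le> (3 + \<mu>) * Bk + Cv * B0 + (3 + \<mu>) * B'" if X: "X \<in> V" for X
      using wb[OF X] svb[OF X B'(2)[OF X]] norm_triangle_ineq4[of "w X" "sv X * poly k (sv X)"] unfolding u_def by linarith
    \<comment> \<open>Boundedness of \<open>u\<close> is enough here: the factor
      \<open>exp (- q ^ p)\<close> tends to zero by itself.\<close>
    have uvan: "(\<lambda>n. u (of_real (real n + 1)) * exp (- (of_real (real n + 1) ^ p) / 1 ^ p)) \<longlonglongrightarrow> 0"
    proof (rule Lim_null_comparison)
      show "\<forall>\<^sub>F n in sequentially. norm (u (of_real (real n + 1)) * exp (- (of_real (real n + 1) ^ p) / 1 ^ p))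
         \<le> ((3 + \<mu>) * Bk + Cv * B0 + (3 + \<mu>) * B') * norm (exp (- (of_real (real n + 1) ^ p) / 1 ^ p :: complex))"
      proof (rule always_eventually, rule allI)
        fix n
        show "norm (u (of_real (real n + 1)) * exp (- (of_real (real n + 1) ^ p) / 1 ^ p))
         \<le> ((3 + \<mu>) * Bk + Cv * B0 + (3 + \<mu>) * B') * norm (exp (- (of_real (real n + 1) ^ p) / 1 ^ p :: complex))"
          unfolding norm_mult by (intro mult_right_mono ub real_in_V) auto
      qed
      show "(\<lambda>n. ((3 + \<mu>) * Bk + Cv * B0 + (3 + \<mu>) * B') * norm (exp (- (of_real (real n + 1) ^ p) / 1 ^ p :: complex))) \<longlonglongrightarrow> 0"
        by (intro tendsto_mult_right_zero tendsto_norm_zero expo)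
    qed
    define L where "L = (1 + m) ^ Suc M + fact (Suc M) * (2 / sin \<delta>) ^ Suc M * exp (sin \<delta> / 2) + 3 ^ Suc M"
    have L: "L \<ge> 1"
    proof -
      have "1 \<le> (3::real) ^ Suc M" by (rule one_le_power) simp
      moreover have "0 \<le> (1 + m) ^ Suc M" "0 \<le> fact (Suc M) * (2 / sin \<delta>) ^ Suc M * exp (sin \<delta> / 2)"
        using m sd by (auto intro!: mult_nonneg_nonneg)
      ultimately show ?thesis unfolding L_def by linarith
    qed
    note wt = admissible_weight_power[OF sd(1) p1 m(1) less_imp_le[OF B], of "Suc M" V, folded L_def]
    obtain C where C: "C > 0" and est: "\<And>\<eta> W q u f \<phi> x. accessible p (sin \<delta>) m \<eta> W q \<Longrightarrow> admissible_weight p (sin \<delta>) m L \<eta> W \<phi> \<Longrightarrow>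
       linear_ode p \<eta> W f u \<Longrightarrow> (\<And>x. x \<in> W \<Longrightarrow> norm \<eta> * norm (f x) \<le> \<phi> x) \<Longrightarrow>
       (\<And>x. x \<in> W \<Longrightarrow> x = of_real (norm \<eta>) \<or> \<not> small_or_descending p (sin \<delta>) m \<eta> x \<Longrightarrow>
          \<exists>\<^sub>F n in sequentially. norm (u (of_real (q n))) * exp (Re ((x ^ p - of_real (q n ^ p)) / \<eta> ^ p)) \<le> \<phi> x) \<Longrightarrow>
       x \<in> W \<Longrightarrow> norm (u x) \<le> C * \<phi> x"
      using accessible_estimate[OF p1 sd(1) m(1) L] by auto
    have ue: "norm (u X) \<le> C * (B / (1 + norm X) ^ Suc M)" if X: "X \<in> V" for X
    proof (rule est[OF acc wt uode _ _ X])
      fix x assume "x \<in> V"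
      show "norm (1::complex) * norm (g x) \<le> B / (1 + norm x) ^ Suc M" using g[OF \<open>x \<in> V\<close>] by simp
      show "\<exists>\<^sub>F n in sequentially. norm (u (of_real (real n + 1))) * exp (Re ((x ^ p - of_real ((real n + 1) ^ p)) / 1 ^ p)) \<le> B / (1 + norm x) ^ Suc M"
        by (rule vanishing_imp_frequently[OF uvan]) (use B nX[of x] in simp)
    qed
    have "norm (\<kappa> X - poly k (sv X)) \<le> (C * B * (1 + \<mu>)) / (1 + norm X) ^ M" if X: "X \<in> V" for X
    proof -
      have "\<kappa> X - poly k (sv X) = u X / sv X" using sv_nonzero[OF X] by (simp add: \<kappa>_def u_def diff_divide_distrib)
      then have "norm (\<kappa> X - poly k (sv X)) = norm (u X) * (1 / norm (sv X))" by (simp add: norm_divide)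
      also have "\<dots> \<le> (C * (B / (1 + norm X) ^ Suc M)) * ((1 + \<mu>) * (1 + norm X))"
        using ue[OF X] inverse_norm_sv_le[OF X] B C nX[of X] by (intro mult_mono) auto
      also have "\<dots> = (C * B * (1 + \<mu>)) / (1 + norm X) ^ M"
      proof -
        have "C * (B / w ^ Suc M) * ((1 + \<mu>) * w) = C * B * (1 + \<mu>) / w ^ M" if "w > 0" for w :: real
          using that by simp
        then show ?thesis using nX by blast
      qed
      finally show ?thesis .
    qed
    then show "\<exists>q C. \<forall>X\<in>V. norm (\<kappa> X - poly q (sv X)) \<le> C / (1 + norm X) ^ M" by blast
  qed
  moreover have "((\<lambda>X. sv X * \<kappa> X) has_field_derivative
      (of_nat p * X ^ (p - 1) * (sv X * \<kappa> X) + f X / sv X ^ (p - 2))) (at X)" if X: "X \<in> V" for X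
  proof -
    have e: "sv Y * \<kappa> Y = w Y" if "Y \<in> V" for Y using sv_nonzero[OF that] by (simp add: \<kappa>_def)
    have "((\<lambda>X. sv X * \<kappa> X) has_field_derivative (of_nat p * X ^ (p - 1) * w X + f X / sv X ^ (p - 2))) (at X)"
      by (rule has_field_derivative_transform_within_open[OF wd[OF X] V_open X]) (simp add: e)
    then show ?thesis by (simp add: e[OF X])
  qed
  ultimately show ?thesis using that by blast
qed

text \<open>Expansions without constant term; this corresponds to sums that start at
  \<open>\<nu> = 1\<close> in \<open>G_space\<close>.\<close>

definition decaying :: "(complex \<Rightarrow> complex) \<Rightarrow> bool" where
  "decaying g \<longleftrightarrow> (\<exists>k. sv_expandable k \<and> (\<forall>X\<in>V. g X = sv X * k X))"

lemma decaying_sv_expandable: "decaying g \<Longrightarrow> sv_expandable g"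
  unfolding decaying_def
proof (elim exE conjE)
  fix k assume k: "sv_expandable k" and e: "\<forall>X\<in>V. g X = sv X * k X"
  note a = sv_expandable_mult[OF sv_expandable_sv k]
  have "g holomorphic_on V" using a e holomorphic_cong[of V V g "\<lambda>X. sv X * k X"] by (simp add: sv_expandable_def)
  then show "sv_expandable g" using a e by (simp add: sv_expandable_def)
qed

lemma decaying_add:
  assumes "decaying f" "decaying g" shows "decaying (\<lambda>X. f X + g X)"
proof -
  obtain k l where "sv_expandable k" "\<And>X. X \<in> V \<Longrightarrow> f X = sv X * k X" "sv_expandable l" "\<And>X. X \<in> V \<Longrightarrow> g X = sv X * l X"
    using assms unfolding decaying_def by blast
  then show ?thesis unfolding decaying_def
    by (intro exI[of _ "\<lambda>X. k X + l X"]) (simp add: sv_expandable_add distrib_left)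
qed

lemma decaying_sv_expandable_mult:
  assumes "sv_expandable f" "decaying g" shows "decaying (\<lambda>X. f X * g X)"
proof -
  obtain k where "sv_expandable k" "\<And>X. X \<in> V \<Longrightarrow> g X = sv X * k X"
    using assms unfolding decaying_def by blast
  then show ?thesis using assms(1) unfolding decaying_def
    by (intro exI[of _ "\<lambda>X. f X * k X"]) (simp add: sv_expandable_mult)
qed

text \<open>Because \<open>X * sv X\<close> is a polynomial in \<open>sv X\<close>, multiplication
  by \<open>X\<close> leaves the class only through a constant. This turns
  \<open>x * g (x / \<eta>)\<close> into \<open>\<eta>\<close> times a combined sum.\<close>

lemma decaying_shift:
  assumes "decaying g"
  obtains c g' where "decaying g'" "\<And>X. X \<in> V \<Longrightarrow> X * g X = c + g' X"
proof -
  obtain k where k: "sv_expandable k" "\<And>X. X \<in> V \<Longrightarrow> g X = sv X * k X" using assms unfolding decaying_def by blast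
  define c0 where "c0 = complex_of_real (\<mu> + 1)"
  have "sv_expandable (\<lambda>X. poly [:1, - c0:] (sv X) * k X)" by (rule sv_expandable_mult[OF sv_expandable_poly k(1)])
  then obtain c h where h: "sv_expandable h" "\<And>X. X \<in> V \<Longrightarrow> poly [:1, - c0:] (sv X) * k X = c + sv X * h X"
    using sv_expandable_decomp by blast
  have "X * g X = c + sv X * h X" if X: "X \<in> V" for X
  proof -
    have "X * sv X = poly [:1, - c0:] (sv X)"
      using X_sv[OF X] sv_nonzero[OF X] by (simp add: c0_def field_simps)
    then show ?thesis using h(2)[OF X] k(2)[OF X] by (simp add: mult.assoc[symmetric])
  qed
  moreover have "decaying (\<lambda>X. sv X * h X)" using h unfolding decaying_def by blast
  ultimately show ?thesis using that by blast
qed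

lemma decaying_solve:
  assumes g: "sv_expandable (\<lambda>X. sv X ^ (p - 2) * g X)"
  obtains w where "decaying w" "\<And>X. X \<in> V \<Longrightarrow> (w has_field_derivative (of_nat p * X ^ (p - 1) * w X + g X)) (at X)"
proof -
  obtain k where k: "sv_expandable k" "\<And>X. X \<in> V \<Longrightarrow> ((\<lambda>X. sv X * k X) has_field_derivative
      (of_nat p * X ^ (p - 1) * (sv X * k X) + (sv X ^ (p - 2) * g X) / sv X ^ (p - 2))) (at X)"
    using sv_expandable_solve[OF g] by blast
  have "decaying (\<lambda>X. sv X * k X)" using k unfolding decaying_def by blast
  then show ?thesis using that[of "\<lambda>X. sv X * k X"] k(2) sv_nonzero by simp
qed

lemma decaying_solve_decaying:
  assumes "decaying g"
  obtains w where "decaying w" "\<And>X. X \<in> V \<Longrightarrow> (w has_field_derivative (of_nat p * X ^ (p - 1) * w X + g X)) (at X)"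
proof (rule decaying_solve)
  have "sv_expandable (\<lambda>X. poly (monom 1 (p - 2)) (sv X) * g X)" by (rule sv_expandable_mult[OF sv_expandable_poly decaying_sv_expandable[OF assms]])
  then show "sv_expandable (\<lambda>X. sv X ^ (p - 2) * g X)" by (simp add: poly_monom)
qed (use that in blast)

text \<open>Since \<open>X * sv X = 1 - (\<mu> + 1) * sv X\<close>, the product
  \<open>sv ^ (p - 2) * X ^ j\<close> is a polynomial in \<open>sv\<close> as long as
  \<open>j \<le> p - 2\<close>.\<close>

lemma decaying_solve_monom:
  assumes j: "j \<le> p - 2"
  obtains w where "decaying w" "\<And>X. X \<in> V \<Longrightarrow> (w has_field_derivative (of_nat p * X ^ (p - 1) * w X + X ^ j)) (at X)"
proof -
  define c0 where "c0 = complex_of_real (\<mu> + 1)"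
  define q where "q = monom 1 (p - 2 - j) * [:1, - c0:] ^ j"
  have e: "sv X ^ (p - 2) * X ^ j = poly q (sv X)" if X: "X \<in> V" for X
  proof -
    have "X * sv X = 1 - c0 * sv X"
      using X_sv[OF X] sv_nonzero[OF X] by (simp add: c0_def field_simps)
    then have "X ^ j * sv X ^ j = (1 - c0 * sv X) ^ j" by (metis power_mult_distrib)
    moreover have "sv X ^ (p - 2) = sv X ^ (p - 2 - j) * sv X ^ j" by (metis j le_add_diff_inverse2 power_add)
    ultimately show ?thesis by (simp add: q_def poly_monom poly_power mult_ac)
  qed
  have h: "(\<lambda>X. sv X ^ (p - 2) * X ^ j) holomorphic_on V" by (intro holomorphic_intros sv_holomorphic)
  have "sv_expandable (\<lambda>X. sv X ^ (p - 2) * X ^ j)"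
    using sv_expandable_poly[of q] h unfolding sv_expandable_def by (simp add: e)
  then show ?thesis by (rule decaying_solve) (rule that)
qed

end

section \<open>Combined sums\<close>

locale layer_disc = layer +
  fixes r0 \<rho> :: real
  assumes \<rho>: "0 < \<rho>" "\<rho> < r0"
begin

definition region :: "complex \<Rightarrow> complex \<Rightarrow> bool" where
  "region x \<eta> \<longleftrightarrow> \<eta> \<noteq> 0 \<and> norm \<eta> \<le> 1 \<and> norm x < \<rho> \<and> x / \<eta> \<in> V"

text \<open>Generated rather than written as a sum, so that closure properties follow by rule
  induction; \<open>comb_normal_form\<close> recovers the sum. Products are absent because they are
  combined sums only up to powers of \<open>\<eta>\<close>.\<close>

inductive comb :: "(complex \<Rightarrow> complex \<Rightarrow> complex) \<Rightarrow> bool" where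
  outer: "a holomorphic_on ball 0 r0 \<Longrightarrow> comb (\<lambda>x \<eta>. a x)"
| inner: "decaying g \<Longrightarrow> comb (\<lambda>x \<eta>. g (x / \<eta>))"
| add: "comb F \<Longrightarrow> comb G \<Longrightarrow> comb (\<lambda>x \<eta>. F x \<eta> + G x \<eta>)"
| shift: "comb F \<Longrightarrow> comb (\<lambda>x \<eta>. \<eta> * F x \<eta>)"

definition bigO :: "nat \<Rightarrow> (complex \<Rightarrow> complex \<Rightarrow> complex) \<Rightarrow> bool" where
  "bigO N F \<longleftrightarrow> (\<exists>K. \<forall>x \<eta>. region x \<eta> \<longrightarrow> norm (F x \<eta>) \<le> K * norm \<eta> ^ N)"

lemma bigO_E:
  assumes "bigO N F"
  obtains K where "K > 0" "\<And>x \<eta>. region x \<eta> \<Longrightarrow> norm (F x \<eta>) \<le> K * norm \<eta> ^ N"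
proof -
  obtain K where K: "\<And>x \<eta>. region x \<eta> \<Longrightarrow> norm (F x \<eta>) \<le> K * norm \<eta> ^ N"
    using assms unfolding bigO_def by blast
  have "norm (F x \<eta>) \<le> (\<bar>K\<bar> + 1) * norm \<eta> ^ N" if "region x \<eta>" for x \<eta>
    using K[OF that] mult_right_mono[of K "\<bar>K\<bar> + 1" "norm \<eta> ^ N"] by (auto intro: order_trans)
  then show ?thesis by (intro that[of "\<bar>K\<bar> + 1"]) auto
qed

lemma bigO_I: "(\<And>x \<eta>. region x \<eta> \<Longrightarrow> norm (F x \<eta>) \<le> K * norm \<eta> ^ N) \<Longrightarrow> bigO N F"
  unfolding bigO_def by blast

lemma bigO_cong: "(\<And>x \<eta>. region x \<eta> \<Longrightarrow> F x \<eta> = G x \<eta>) \<Longrightarrow> bigO N G \<Longrightarrow> bigO N F"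
  unfolding bigO_def by auto

lemma bigO_zero: "bigO N (\<lambda>x \<eta>. 0)"
  by (rule bigO_I[of _ 0]) simp

lemma bigO_add: assumes "bigO N F" "bigO N G" shows "bigO N (\<lambda>x \<eta>. F x \<eta> + G x \<eta>)"
proof -
  obtain K L where K: "\<And>x \<eta>. region x \<eta> \<Longrightarrow> norm (F x \<eta>) \<le> K * norm \<eta> ^ N"
    and L: "\<And>x \<eta>. region x \<eta> \<Longrightarrow> norm (G x \<eta>) \<le> L * norm \<eta> ^ N"
    using assms by (metis bigO_E)
  show ?thesis
  proof (rule bigO_I)
    fix x \<eta> assume "region x \<eta>"
    from K[OF this] L[OF this] norm_triangle_ineq[of "F x \<eta>" "G x \<eta>"]
    show "norm (F x \<eta> + G x \<eta>) \<le> (K + L) * norm \<eta> ^ N" by (simp add: distrib_right)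
  qed
qed

lemma bigO_mult: assumes "bigO N F" "bigO M G" shows "bigO (N + M) (\<lambda>x \<eta>. F x \<eta> * G x \<eta>)"
proof -
  obtain K where K: "K > 0" "\<And>x \<eta>. region x \<eta> \<Longrightarrow> norm (F x \<eta>) \<le> K * norm \<eta> ^ N"
    using assms(1) by (rule bigO_E) blast
  obtain L where L: "L > 0" "\<And>x \<eta>. region x \<eta> \<Longrightarrow> norm (G x \<eta>) \<le> L * norm \<eta> ^ M"
    using assms(2) by (rule bigO_E) blast
  show ?thesis
  proof (rule bigO_I)
    fix x \<eta> assume r: "region x \<eta>"
    have "norm (F x \<eta> * G x \<eta>) \<le> (K * norm \<eta> ^ N) * (L * norm \<eta> ^ M)"
      unfolding norm_mult by (intro mult_mono K(2)[OF r] L(2)[OF r]) (use K in auto)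
    then show "norm (F x \<eta> * G x \<eta>) \<le> (K * L) * norm \<eta> ^ (N + M)" by (simp add: power_add mult_ac)
  qed
qed

lemma bigO_mono: assumes "bigO N F" "M \<le> N" shows "bigO M F"
proof -
  obtain K where K: "K > 0" "\<And>x \<eta>. region x \<eta> \<Longrightarrow> norm (F x \<eta>) \<le> K * norm \<eta> ^ N"
    using assms(1) by (rule bigO_E) blast
  show ?thesis
  proof (rule bigO_I)
    fix x \<eta> assume r: "region x \<eta>"
    have "norm \<eta> ^ N \<le> norm \<eta> ^ M" using r assms(2) by (intro power_decreasing) (auto simp: region_def)
    then have "K * norm \<eta> ^ N \<le> K * norm \<eta> ^ M" using K(1) by simp
    with K(2)[OF r] show "norm (F x \<eta>) \<le> K * norm \<eta> ^ M" by linarith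
  qed
qed

lemma bigO_shift: "bigO (Suc 0) (\<lambda>x \<eta>. \<eta>)"
  by (rule bigO_I[of _ 1]) simp

lemma bigO_minus: "bigO N F \<Longrightarrow> bigO N (\<lambda>x \<eta>. - F x \<eta>)"
  unfolding bigO_def by simp

lemma bigO_diff: "bigO N F \<Longrightarrow> bigO N G \<Longrightarrow> bigO N (\<lambda>x \<eta>. F x \<eta> - G x \<eta>)"
  using bigO_add[OF _ bigO_minus] by simp

lemma bounded_outer:
  assumes "a holomorphic_on ball 0 r0"
  shows "\<exists>B>0. \<forall>x. norm x < \<rho> \<longrightarrow> norm (a x) \<le> B"
proof -
  have "continuous_on (cball 0 \<rho>) a"
    using \<rho> by (intro holomorphic_on_imp_continuous_on holomorphic_on_subset[OF assms]) auto
  then have "compact (a ` cball 0 \<rho>)" by (rule compact_continuous_image) simp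
  then obtain B where "B > 0" "\<And>z. z \<in> cball 0 \<rho> \<Longrightarrow> norm (a z) \<le> B"
    using compact_imp_bounded bounded_pos by (metis imageI)
  then show ?thesis by (intro exI[of _ B]) auto
qed

lemma comb_bounded: "comb F \<Longrightarrow> bigO 0 F"
proof (induction rule: comb.induct)
  case (outer a)
  obtain B where "\<And>x. norm x < \<rho> \<Longrightarrow> norm (a x) \<le> B" using bounded_outer[OF outer] by blast
  then show ?case by (intro bigO_I[of _ B]) (auto simp: region_def)
next
  case (inner g)
  obtain B where "\<And>X. X \<in> V \<Longrightarrow> norm (g X) \<le> B" using sv_expandable_bounded[OF decaying_sv_expandable[OF inner]] by blast
  then show ?case by (intro bigO_I[of _ B]) (auto simp: region_def)
next
  case (add F G)
  then show ?case by (intro bigO_add)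
next
  case (shift F)
  then have "bigO (Suc 0 + 0) (\<lambda>x \<eta>. \<eta> * F x \<eta>)" by (intro bigO_mult bigO_shift)
  then show ?case by (rule bigO_mono) simp
qed

lemma comb_zero: "comb (\<lambda>x \<eta>. 0)"
  using outer[of "\<lambda>x. 0"] by simp

lemma comb_const_power: "comb F \<Longrightarrow> comb (\<lambda>x \<eta>. \<eta> ^ n * F x \<eta>)"
proof (induction n)
  case (Suc n)
  then show ?case using shift[of "\<lambda>x \<eta>. \<eta> ^ n * F x \<eta>"] by (simp add: mult.assoc)
qed simp

lemma comb_cmult: "comb F \<Longrightarrow> comb (\<lambda>x \<eta>. c * F x \<eta>)"
proof (induction rule: comb.induct)
  case (outer a)
  then show ?case using comb.outer[of "\<lambda>x. c * a x"] by (simp add: holomorphic_intros)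
next
  case (inner g)
  then show ?case using comb.inner[OF decaying_sv_expandable_mult[OF sv_expandable_const inner]] by simp
next
  case (add F G)
  then show ?case using comb.add[OF add.IH] by (simp add: distrib_left)
next
  case (shift F)
  then show ?case using comb.shift[OF shift.IH] by (simp add: mult.left_commute)
qed

lemma divided_difference_holomorphic:
  assumes "a holomorphic_on ball 0 r0"
  obtains b where "b holomorphic_on ball 0 r0" "\<And>x. a x = a 0 + x * b x"
proof
  show "(\<lambda>z. if z = 0 then deriv a 0 else (a z - a 0) / (z - 0)) holomorphic_on ball 0 r0"
    by (rule pole_lemma_open[OF assms]) simp
  show "a x = a 0 + x * (if x = 0 then deriv a 0 else (a x - a 0) / (x - 0))" for x by simp
qed

text \<open>The product of a function of \<open>x\<close> and a function of
  \<open>x / \<eta>\<close> expands into infinitely many powers of \<open>\<eta>\<close>, so the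
  algebra exists only modulo errors of a fixed order \<open>N\<close>.\<close>

definition combO :: "nat \<Rightarrow> (complex \<Rightarrow> complex \<Rightarrow> complex) \<Rightarrow> bool" where
  "combO N F \<longleftrightarrow> (\<exists>H. comb H \<and> bigO N (\<lambda>x \<eta>. F x \<eta> - H x \<eta>))"

lemma comb_imp_combO: "comb F \<Longrightarrow> combO N F"
  unfolding combO_def by (intro exI[of _ F]) (simp add: bigO_zero)

lemma combO_bigO: "bigO N F \<Longrightarrow> combO N F"
  unfolding combO_def by (intro exI[of _ "\<lambda>x \<eta>. 0"]) (simp add: comb_zero)

lemma combO_cong:
  assumes "\<And>x \<eta>. region x \<eta> \<Longrightarrow> F x \<eta> = G x \<eta>" "combO N G" shows "combO N F"
proof -
  obtain H where "comb H" "bigO N (\<lambda>x \<eta>. G x \<eta> - H x \<eta>)" using assms(2) unfolding combO_def by blast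
  then show ?thesis unfolding combO_def using assms(1) by (intro exI[of _ H]) (auto intro: bigO_cong)
qed

lemma combO_add: assumes "combO N F" "combO N G" shows "combO N (\<lambda>x \<eta>. F x \<eta> + G x \<eta>)"
proof -
  obtain H K where HK: "comb H" "bigO N (\<lambda>x \<eta>. F x \<eta> - H x \<eta>)" "comb K" "bigO N (\<lambda>x \<eta>. G x \<eta> - K x \<eta>)"
    using assms unfolding combO_def by blast
  have "bigO N (\<lambda>x \<eta>. (F x \<eta> + G x \<eta>) - (H x \<eta> + K x \<eta>))"
    using bigO_add[OF HK(2,4)] by (simp add: algebra_simps)
  then show ?thesis using add[OF HK(1,3)] unfolding combO_def by blast
qed

lemma combO_shift: assumes "combO N F" shows "combO (Suc N) (\<lambda>x \<eta>. \<eta> * F x \<eta>)"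
proof -
  obtain H where H: "comb H" "bigO N (\<lambda>x \<eta>. F x \<eta> - H x \<eta>)" using assms unfolding combO_def by blast
  have "bigO (Suc N) (\<lambda>x \<eta>. \<eta> * F x \<eta> - \<eta> * H x \<eta>)"
    using bigO_mult[OF bigO_shift H(2)] by (simp add: algebra_simps)
  then show ?thesis using shift[OF H(1)] unfolding combO_def by blast
qed

lemma combO_mono: "combO N F \<Longrightarrow> M \<le> N \<Longrightarrow> combO M F"
  unfolding combO_def using bigO_mono by blast

text \<open>Writing \<open>a x = a 0 + x * b x\<close> and \<open>X * g X = c + h X\<close>, the
  product becomes \<open>a 0 * g + \<eta> * (c * b + b * h)\<close>. The only product left has the
  same type and a factor \<open>\<eta>\<close>, so induction on \<open>N\<close> applies.\<close>

lemma combO_outer_inner: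
  "a holomorphic_on ball 0 r0 \<Longrightarrow> decaying g \<Longrightarrow> combO N (\<lambda>x \<eta>. a x * g (x / \<eta>))"
proof (induction N arbitrary: a g)
  case 0
  then have "bigO (0 + 0) (\<lambda>x \<eta>. a x * g (x / \<eta>))" by (intro bigO_mult comb_bounded outer inner)
  then show ?case by (intro combO_bigO) simp
next
  case (Suc N)
  obtain b where b: "b holomorphic_on ball 0 r0" "\<And>x. a x = a 0 + x * b x"
    using divided_difference_holomorphic[OF Suc.prems(1)] by blast
  obtain c h where h: "decaying h" "\<And>X. X \<in> V \<Longrightarrow> X * g X = c + h X"
    using decaying_shift[OF Suc.prems(2)] by blast
  have "combO (Suc N) (\<lambda>x \<eta>. a 0 * g (x / \<eta>) + \<eta> * (c * b x + b x * h (x / \<eta>)))"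
    by (intro combO_add combO_shift comb_imp_combO comb_cmult inner outer Suc b h)
  then show ?case
  proof (rule combO_cong[rotated])
    fix x \<eta> assume r: "region x \<eta>"
    then have "x * g (x / \<eta>) = \<eta> * (c + h (x / \<eta>))"
      using h(2)[of "x / \<eta>"] by (simp add: region_def field_simps)
    then have "b x * (x * g (x / \<eta>)) = b x * (\<eta> * (c + h (x / \<eta>)))" by simp
    moreover have "a x * g (x / \<eta>) = a 0 * g (x / \<eta>) + b x * (x * g (x / \<eta>))"
      by (subst b(2)) (simp add: algebra_simps)
    ultimately show "a x * g (x / \<eta>) = a 0 * g (x / \<eta>) + \<eta> * (c * b x + b x * h (x / \<eta>))"
      by (simp add: algebra_simps)
  qed
qed

lemma comb_mult: "comb F \<Longrightarrow> comb G \<Longrightarrow> combO N (\<lambda>x \<eta>. F x \<eta> * G x \<eta>)"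
proof (induction arbitrary: G rule: comb.induct)
  case (outer a)
  from outer(2,1) show ?case
  proof (induction rule: comb.induct)
    case (outer b)
    then show ?case by (intro comb_imp_combO comb.outer holomorphic_intros)
  next
    case (inner g)
    then show ?case by (intro combO_outer_inner)
  next
    case (add F G)
    then show ?case using combO_add by (simp add: distrib_left)
  next
    case (shift F)
    then have "combO N (\<lambda>x \<eta>. \<eta> * (a x * F x \<eta>))" using combO_mono[OF combO_shift] by simp
    then show ?case by (simp add: mult.left_commute)
  qed
next
  case (inner g)
  from inner(2,1) show ?case
  proof (induction rule: comb.induct)
    case (outer b)
    then show ?case using combO_outer_inner[of b g N] by (simp add: mult.commute)
  next
    case (inner h)
    then show ?case using comb_imp_combO[OF comb.inner[OF decaying_sv_expandable_mult[OF decaying_sv_expandable]]] by blast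
  next
    case (add F G)
    then show ?case using combO_add by (simp add: distrib_left)
  next
    case (shift F)
    then have "combO N (\<lambda>x \<eta>. \<eta> * (g (x / \<eta>) * F x \<eta>))" using combO_mono[OF combO_shift] by simp
    then show ?case by (simp add: mult.left_commute)
  qed
next
  case (add F F')
  then show ?case using combO_add by (simp add: distrib_right)
next
  case (shift F)
  have "combO N (\<lambda>x \<eta>. \<eta> * (F x \<eta> * G x \<eta>))"
    by (rule combO_mono[OF combO_shift[OF shift.IH[OF shift.prems]]]) simp
  then show ?case by (simp add: mult.assoc)
qed

lemma combO_bounded: assumes "combO N F" shows "bigO 0 F"
proof -
  obtain H where H: "comb H" "bigO N (\<lambda>x \<eta>. F x \<eta> - H x \<eta>)" using assms unfolding combO_def by blast
  from bigO_add[OF bigO_mono[OF H(2)] comb_bounded[OF H(1)]] show ?thesis by simp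
qed

lemma combO_mult: assumes F: "combO N F" and G: "combO N G" shows "combO N (\<lambda>x \<eta>. F x \<eta> * G x \<eta>)"
proof -
  obtain H where H: "comb H" "bigO N (\<lambda>x \<eta>. F x \<eta> - H x \<eta>)" using F unfolding combO_def by blast
  obtain K where K: "comb K" "bigO N (\<lambda>x \<eta>. G x \<eta> - K x \<eta>)" using G unfolding combO_def by blast
  have 1: "bigO N (\<lambda>x \<eta>. F x \<eta> * (G x \<eta> - K x \<eta>))" using bigO_mult[OF combO_bounded[OF F] K(2)] by simp
  have 2: "bigO N (\<lambda>x \<eta>. (F x \<eta> - H x \<eta>) * K x \<eta>)" using bigO_mult[OF H(2) comb_bounded[OF K(1)]] by simp
  have "combO N (\<lambda>x \<eta>. H x \<eta> * K x \<eta> + (F x \<eta> * (G x \<eta> - K x \<eta>) + (F x \<eta> - H x \<eta>) * K x \<eta>))"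
    by (intro combO_add comb_mult combO_bigO 1 2 H K)
  then show ?thesis by (simp add: algebra_simps)
qed

lemma combO_power: "combO N F \<Longrightarrow> combO N (\<lambda>x \<eta>. F x \<eta> ^ n)"
proof (induction n)
  case 0
  then show ?case using comb_imp_combO[OF outer[of "\<lambda>x. 1"]] by simp
qed (use combO_mult in simp)

lemma combO_sum: "finite S \<Longrightarrow> (\<And>i. i \<in> S \<Longrightarrow> combO N (F i)) \<Longrightarrow> combO N (\<lambda>x \<eta>. \<Sum>i\<in>S. F i x \<eta>)"
proof (induction rule: finite_induct)
  case empty
  then show ?case using comb_imp_combO[OF comb_zero] by simp
qed (use combO_add in simp)

text \<open>Solvability up to a remainder in the source and without a boundary condition; the
  missing condition at \<open>\<rho>\<close> is what later creates the boundary layer.\<close>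

definition solvable :: "nat \<Rightarrow> (complex \<Rightarrow> complex \<Rightarrow> complex) \<Rightarrow> bool" where
  "solvable N F \<longleftrightarrow> (\<exists>U R. comb U \<and> bigO N R \<and> (\<forall>x \<eta>. region x \<eta> \<longrightarrow>
     ((\<lambda>x. U x \<eta>) has_field_derivative
       (of_nat p * x ^ (p - 1) / \<eta> ^ p * U x \<eta> + F x \<eta> + R x \<eta>)) (at x)))"

lemma solvable_add: assumes "solvable N F" "solvable N G" shows "solvable N (\<lambda>x \<eta>. F x \<eta> + G x \<eta>)"
proof -
  obtain U R U' R' where *: "comb U" "bigO N R" "\<And>x \<eta>. region x \<eta> \<Longrightarrow> ((\<lambda>x. U x \<eta>) has_field_derivative
       (of_nat p * x ^ (p - 1) / \<eta> ^ p * U x \<eta> + F x \<eta> + R x \<eta>)) (at x)"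
    "comb U'" "bigO N R'" "\<And>x \<eta>. region x \<eta> \<Longrightarrow> ((\<lambda>x. U' x \<eta>) has_field_derivative
       (of_nat p * x ^ (p - 1) / \<eta> ^ p * U' x \<eta> + G x \<eta> + R' x \<eta>)) (at x)"
    using assms unfolding solvable_def by blast
  show ?thesis unfolding solvable_def
  proof (rule exI[of _ "\<lambda>x \<eta>. U x \<eta> + U' x \<eta>"], rule exI[of _ "\<lambda>x \<eta>. R x \<eta> + R' x \<eta>"], intro conjI allI impI)
    fix x \<eta> assume "region x \<eta>"
    from DERIV_add[OF *(3,6)[OF this]]
    show "((\<lambda>x. U x \<eta> + U' x \<eta>) has_field_derivative
       (of_nat p * x ^ (p - 1) / \<eta> ^ p * (U x \<eta> + U' x \<eta>) + (F x \<eta> + G x \<eta>) + (R x \<eta> + R' x \<eta>))) (at x)"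
      by (simp add: algebra_simps add_divide_distrib)
  qed (intro comb.add bigO_add *)+
qed

lemma solvable_shift: assumes "solvable N F" shows "solvable (Suc N) (\<lambda>x \<eta>. \<eta> * F x \<eta>)"
proof -
  obtain U R where *: "comb U" "bigO N R" "\<And>x \<eta>. region x \<eta> \<Longrightarrow> ((\<lambda>x. U x \<eta>) has_field_derivative
       (of_nat p * x ^ (p - 1) / \<eta> ^ p * U x \<eta> + F x \<eta> + R x \<eta>)) (at x)"
    using assms unfolding solvable_def by blast
  show ?thesis unfolding solvable_def
  proof (rule exI[of _ "\<lambda>x \<eta>. \<eta> * U x \<eta>"], rule exI[of _ "\<lambda>x \<eta>. \<eta> * R x \<eta>"], intro conjI allI impI)
    show "bigO (Suc N) (\<lambda>x \<eta>. \<eta> * R x \<eta>)" using bigO_mult[OF bigO_shift *(2)] by simp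
    fix x \<eta> assume "region x \<eta>"
    from DERIV_cmult[OF *(3)[OF this], of \<eta>]
    show "((\<lambda>x. \<eta> * U x \<eta>) has_field_derivative
       (of_nat p * x ^ (p - 1) / \<eta> ^ p * (\<eta> * U x \<eta>) + \<eta> * F x \<eta> + \<eta> * R x \<eta>)) (at x)"
      by (simp add: algebra_simps)
  qed (intro comb.shift *)
qed

lemma solvable_mono: "solvable N F \<Longrightarrow> M \<le> N \<Longrightarrow> solvable M F"
  unfolding solvable_def using bigO_mono by blast

text \<open>Under \<open>x = \<eta> X\<close> the equation takes the form with
  \<open>\<eta> = 1\<close>, and differentiation in \<open>x\<close> costs one factor
  \<open>\<eta>\<close>. Hence \<open>\<eta> ^ Suc j\<close> in the solution against
  \<open>\<eta> ^ j\<close> in the source, with no remainder.\<close>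

lemma solvable_inner_scaled:
  assumes w: "decaying w" "\<And>X. X \<in> V \<Longrightarrow> (w has_field_derivative (of_nat p * X ^ (p - 1) * w X + g X)) (at X)"
  shows "solvable N (\<lambda>x \<eta>. c * \<eta> ^ j * g (x / \<eta>))"
  unfolding solvable_def
proof (rule exI[of _ "\<lambda>x \<eta>. \<eta> ^ Suc j * (c * w (x / \<eta>))"], rule exI[of _ "\<lambda>x \<eta>. 0"], intro conjI allI impI)
  show "comb (\<lambda>x \<eta>. \<eta> ^ Suc j * (c * w (x / \<eta>)))" by (intro comb_const_power comb_cmult inner w)
  show "bigO N (\<lambda>x \<eta>. 0)" by (rule bigO_zero)
  fix x \<eta> assume r: "region x \<eta>"
  then have V: "x / \<eta> \<in> V" and \<eta>: "\<eta> \<noteq> 0" by (auto simp: region_def)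
  have "((\<lambda>x. w (x / \<eta>)) has_field_derivative (of_nat p * (x / \<eta>) ^ (p - 1) * w (x / \<eta>) + g (x / \<eta>)) * (1 / \<eta>)) (at x)"
    by (rule DERIV_chain2[where f = w and g = "\<lambda>x. x / \<eta>", OF w(2)[OF V]]) (use \<eta> in \<open>auto intro!: derivative_eq_intros\<close>)
  from DERIV_cmult[OF this, of "\<eta> ^ Suc j * c"]
  have "((\<lambda>x. \<eta> ^ Suc j * (c * w (x / \<eta>))) has_field_derivative
     \<eta> ^ Suc j * c * ((of_nat p * (x / \<eta>) ^ (p - 1) * w (x / \<eta>) + g (x / \<eta>)) * (1 / \<eta>))) (at x)"
    by (simp add: mult.assoc)
  moreover have "\<eta> ^ Suc j * c * ((of_nat p * (x / \<eta>) ^ (p - 1) * w (x / \<eta>) + g (x / \<eta>)) * (1 / \<eta>))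
     = of_nat p * x ^ (p - 1) / \<eta> ^ p * (\<eta> ^ Suc j * (c * w (x / \<eta>))) + c * \<eta> ^ j * g (x / \<eta>) + 0"
  proof -
    have "\<eta> ^ p = \<eta> ^ (p - 1) * \<eta>" using p by (cases p) auto
    then show ?thesis using \<eta> by (simp add: power_divide field_simps)
  qed
  ultimately show "((\<lambda>x. \<eta> ^ Suc j * (c * w (x / \<eta>))) has_field_derivative
     (of_nat p * x ^ (p - 1) / \<eta> ^ p * (\<eta> ^ Suc j * (c * w (x / \<eta>))) + c * \<eta> ^ j * g (x / \<eta>) + 0)) (at x)" by simp
qed

lemma solvable_cong:
  "(\<And>x \<eta>. region x \<eta> \<Longrightarrow> F x \<eta> = G x \<eta>) \<Longrightarrow> solvable N G \<Longrightarrow> solvable N F"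
  unfolding solvable_def by simp

text \<open>For the slow part, \<open>x\<^sup>p\<^sup>-\<^sup>1 a(x)\<close> is solved to leading order by \<open>- \<eta>\<^sup>p a(x) / p\<close>, and the
  monomials of lower degree are absorbed by functions of \<open>x / \<eta>\<close>.\<close>

lemma solvable_outer:
  "a holomorphic_on ball 0 r0 \<Longrightarrow> solvable N (\<lambda>x \<eta>. a x)"
proof (induction N arbitrary: a)
  case 0
  show ?case unfolding solvable_def
  proof (rule exI[of _ "\<lambda>x \<eta>. 0"], rule exI[of _ "\<lambda>x \<eta>. - a x"], intro conjI allI impI)
    show "bigO 0 (\<lambda>x \<eta>. - a x)" by (intro bigO_minus comb_bounded outer 0)
  qed (auto intro: comb_zero)
next
  case (Suc N)
  \<comment> \<open>The trial solution \<open>- \<eta> ^ p b / p\<close> leaves the source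
    \<open>\<eta> ^ p b' / p\<close>, which the induction hypothesis treats with \<open>p\<close>
    powers of \<open>\<eta>\<close> to spare.\<close>
  have top: "solvable (Suc N) (\<lambda>x \<eta>. x ^ (p - 1) * b x)" if b: "b holomorphic_on ball 0 r0" for b
  proof -
    have "(\<lambda>x. deriv b x / of_nat p) holomorphic_on ball 0 r0"
      using p by (intro holomorphic_intros holomorphic_deriv b) auto
    from Suc.IH[OF this] obtain U R where *: "comb U" "bigO N R" "\<And>x \<eta>. region x \<eta> \<Longrightarrow> ((\<lambda>x. U x \<eta>) has_field_derivative
       (of_nat p * x ^ (p - 1) / \<eta> ^ p * U x \<eta> + deriv b x / of_nat p + R x \<eta>)) (at x)"
      unfolding solvable_def by blast
    show ?thesis unfolding solvable_def
    proof (rule exI[of _ "\<lambda>x \<eta>. \<eta> ^ p * (U x \<eta> + (- 1 / of_nat p) * b x)"], rule exI[of _ "\<lambda>x \<eta>. \<eta> ^ p * R x \<eta>"], intro conjI allI impI)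
      show "comb (\<lambda>x \<eta>. \<eta> ^ p * (U x \<eta> + (- 1 / of_nat p) * b x))"
        by (intro comb_const_power comb.add * comb_cmult outer b)
      have "bigO p (\<lambda>x \<eta>. \<eta> ^ p)" by (rule bigO_I[of _ 1]) (simp add: norm_power)
      from bigO_mult[OF this *(2)] show "bigO (Suc N) (\<lambda>x \<eta>. \<eta> ^ p * R x \<eta>)"
        by (rule bigO_mono) (use p in simp)
      fix x \<eta> assume r: "region x \<eta>"
      then have \<eta>: "\<eta> \<noteq> 0" and x: "x \<in> ball 0 r0" using \<rho> by (auto simp: region_def)
      have db: "(b has_field_derivative deriv b x) (at x)" by (rule holomorphic_derivI[OF b _ x]) simp
      have "((\<lambda>x. \<eta> ^ p * (U x \<eta> + (- 1 / of_nat p) * b x)) has_field_derivative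
         \<eta> ^ p * ((of_nat p * x ^ (p - 1) / \<eta> ^ p * U x \<eta> + deriv b x / of_nat p + R x \<eta>) + (- 1 / of_nat p) * deriv b x)) (at x)"
        by (intro DERIV_cmult DERIV_add *(3)[OF r] db)
      moreover have "\<eta> ^ p * ((of_nat p * x ^ (p - 1) / \<eta> ^ p * U x \<eta> + deriv b x / of_nat p + R x \<eta>) + (- 1 / of_nat p) * deriv b x)
         = of_nat p * x ^ (p - 1) / \<eta> ^ p * (\<eta> ^ p * (U x \<eta> + (- 1 / of_nat p) * b x)) + x ^ (p - 1) * b x + \<eta> ^ p * R x \<eta>"
        using \<eta> p by (simp add: field_simps)
      ultimately show "((\<lambda>x. \<eta> ^ p * (U x \<eta> + (- 1 / of_nat p) * b x)) has_field_derivative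
         (of_nat p * x ^ (p - 1) / \<eta> ^ p * (\<eta> ^ p * (U x \<eta> + (- 1 / of_nat p) * b x)) + x ^ (p - 1) * b x + \<eta> ^ p * R x \<eta>)) (at x)"
        by simp
    qed
  qed
  \<comment> \<open>Downward induction on the exponent of \<open>x\<close>: splitting off
    \<open>b 0\<close> leaves a monomial, solved in \<open>x / \<eta>\<close>, and a multiple of the
    next higher power.\<close>
  have "solvable (Suc N) (\<lambda>x \<eta>. x ^ (p - 1 - i) * b x)" if "b holomorphic_on ball 0 r0" "i \<le> p - 1" for b i
    using that
  proof (induction i arbitrary: b)
    case 0
    then show ?case using top by simp
  next
    case (Suc i)
    define j where "j = p - 1 - Suc i"
    have j: "j \<le> p - 2" "Suc j = p - 1 - i" using Suc.prems by (auto simp: j_def)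
    obtain c where c: "c holomorphic_on ball 0 r0" "\<And>x. b x = b 0 + x * c x"
      using divided_difference_holomorphic[OF Suc.prems(1)] by blast
    obtain w where w: "decaying w" "\<And>X. X \<in> V \<Longrightarrow> (w has_field_derivative (of_nat p * X ^ (p - 1) * w X + X ^ j)) (at X)"
      using decaying_solve_monom[OF j(1)] by blast
    have "solvable (Suc N) (\<lambda>x \<eta>. b 0 * \<eta> ^ j * (x / \<eta>) ^ j + x ^ Suc j * c x)"
      using solvable_inner_scaled[OF w] Suc.IH[OF c(1)] Suc.prems j by (intro solvable_add) auto
    then show ?case
    proof (rule solvable_cong[rotated])
      fix x \<eta> assume "region x \<eta>"
      then have "\<eta> \<noteq> 0" by (simp add: region_def)
      then show "x ^ (p - 1 - Suc i) * b x = b 0 * \<eta> ^ j * (x / \<eta>) ^ j + x ^ Suc j * c x"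
        unfolding j_def[symmetric] by (subst c(2)) (simp add: power_divide algebra_simps)
    qed
  qed
  from this[OF Suc.prems, of "p - 1"] show ?case by simp
qed

lemma comb_solvable: "comb F \<Longrightarrow> solvable N F"
proof (induction rule: comb.induct)
  case (outer a)
  then show ?case by (rule solvable_outer)
next
  case (inner g)
  obtain w where "decaying w" "\<And>X. X \<in> V \<Longrightarrow> (w has_field_derivative (of_nat p * X ^ (p - 1) * w X + g X)) (at X)"
    using decaying_solve_decaying[OF inner] by blast
  from solvable_inner_scaled[OF this, of N 1 0] show ?case by simp
next
  case (add F G)
  then show ?case by (intro solvable_add)
next
  case (shift F)
  then show ?case using solvable_mono[OF solvable_shift] by simp
qed

lemma combO_solvable: assumes "combO N F" shows "solvable N F"
proof -
  obtain H where H: "comb H" "bigO N (\<lambda>x \<eta>. F x \<eta> - H x \<eta>)" using assms unfolding combO_def by blast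
  obtain U R where *: "comb U" "bigO N R" "\<And>x \<eta>. region x \<eta> \<Longrightarrow> ((\<lambda>x. U x \<eta>) has_field_derivative
       (of_nat p * x ^ (p - 1) / \<eta> ^ p * U x \<eta> + H x \<eta> + R x \<eta>)) (at x)"
    using comb_solvable[OF H(1), of N] unfolding solvable_def by blast
  show ?thesis unfolding solvable_def
  proof (rule exI[of _ U], rule exI[of _ "\<lambda>x \<eta>. R x \<eta> - (F x \<eta> - H x \<eta>)"], intro conjI allI impI)
    show "bigO N (\<lambda>x \<eta>. R x \<eta> - (F x \<eta> - H x \<eta>))" by (intro bigO_diff * H)
    fix x \<eta> assume "region x \<eta>"
    from *(3)[OF this] show "((\<lambda>x. U x \<eta>) has_field_derivative
       (of_nat p * x ^ (p - 1) / \<eta> ^ p * U x \<eta> + F x \<eta> + (R x \<eta> - (F x \<eta> - H x \<eta>)))) (at x)"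
      by (simp add: algebra_simps)
  qed (rule *)
qed

end

section \<open>Existence of the solution\<close>

text \<open>For a half opening of at most \<open>pi\<close>, an argument inside the sector has to be
  the principal one.\<close>

lemma sector_eq:
  assumes "0 < b" "b \<le> pi"
  shows "sector (- b) b r = {x. x \<noteq> 0 \<and> ereal (norm x) < r \<and> \<bar>Arg x\<bar> < b}"
proof -
  have "(\<exists>\<theta>. - b < \<theta> \<and> \<theta> < b \<and> is_Arg x \<theta>) \<longleftrightarrow> \<bar>Arg x\<bar> < b" if x: "x \<noteq> 0" for x
  proof
    assume "\<exists>\<theta>. - b < \<theta> \<and> \<theta> < b \<and> is_Arg x \<theta>"
    then obtain \<theta> where t: "- b < \<theta>" "\<theta> < b" "is_Arg x \<theta>" by blast
    have "Arg x = \<theta>"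
      by (rule Arg_unique_lemma[OF t(3) is_Arg_Arg[OF x]]) (use t assms x mpi_less_Arg[of x] Arg_le_pi[of x] in auto)
    then show "\<bar>Arg x\<bar> < b" using t by simp
  next
    assume "\<bar>Arg x\<bar> < b"
    then show "\<exists>\<theta>. - b < \<theta> \<and> \<theta> < b \<and> is_Arg x \<theta>"
      using is_Arg_Arg[OF x] by (intro exI[of _ "Arg x"]) auto
  qed
  then show ?thesis unfolding sector_def by blast
qed

locale canard = layer_disc +
  fixes r2 \<epsilon>0 M :: real and P :: "complex \<Rightarrow> complex \<Rightarrow> complex \<Rightarrow> complex"
  assumes r2: "r2 > 0" and \<epsilon>0: "\<epsilon>0 > 0" and M: "M > 0"
    and holP: "holomorphic3_on (\<lambda>(x, y, e). P x y e) (ball 0 r0 \<times> ball 0 r2 \<times> sector (- \<delta>) \<delta> (ereal \<epsilon>0))"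
    and bP: "\<And>x y e. norm x < r0 \<Longrightarrow> norm y < r2 \<Longrightarrow> e \<in> sector (- \<delta>) \<delta> (ereal \<epsilon>0) \<Longrightarrow> norm (P x y e) \<le> M"
begin

abbreviation "\<Sigma>e \<equiv> sector (- \<delta>) \<delta> (ereal \<epsilon>0)"
abbreviation "\<Omega> \<equiv> finite_domain p \<mu> \<delta> \<rho>"

definition S1 :: "real \<Rightarrow> complex set" where
  "S1 h = {\<eta>. \<eta> \<noteq> 0 \<and> norm \<eta> < h \<and> real p * \<bar>Arg \<eta>\<bar> < \<delta>}"

definition joint :: "real \<Rightarrow> (complex \<times> complex) set" where
  "joint h = {(x, \<eta>). \<eta> \<in> S1 h \<and> x \<in> \<Omega> \<eta>}"

definition q :: "nat \<Rightarrow> real" where "q n = \<rho> * (1 - 1 / (real n + 2))"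

definition m where "m = max 1 \<mu>"

text \<open>The conditions place, in turn, \<open>|\<eta>|\<close> below 1 and below
  \<open>\<rho>\<close>, the disc of radius \<open>\<mu> |\<eta>|\<close> inside that of radius
  \<open>\<rho>\<close>, and \<open>\<eta> ^ p\<close> inside \<open>\<Sigma>\<close>.\<close>

definition small :: "real \<Rightarrow> bool" where
  "small h \<longleftrightarrow> 0 < h \<and> h \<le> 1 \<and> h \<le> \<rho> \<and> \<mu> * h \<le> \<rho> \<and> h ^ p \<le> \<epsilon>0"

lemma m: "m \<ge> 1" "m \<ge> \<mu>" by (auto simp: m_def)

lemma p1: "p \<ge> 1" using p by simp

lemma q: "0 < q n" "q n < \<rho>" "incseq q" "q \<longlonglongrightarrow> \<rho>"
proof -
  have "0 < 1 - 1 / (real n + 2)" "1 - 1 / (real n + 2) < 1" by (auto simp: field_simps)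
  then have "\<rho> * 0 < \<rho> * (1 - 1 / (real n + 2))" "\<rho> * (1 - 1 / (real n + 2)) < \<rho> * 1"
    using \<rho> by (intro mult_strict_left_mono; simp)+
  then show "0 < q n" "q n < \<rho>" by (auto simp: q_def)
  show "incseq q" unfolding incseq_def q_def using \<rho>
    by (intro allI impI mult_left_mono diff_left_mono divide_left_mono) auto
  have "(\<lambda>n. \<rho> * (1 - 1 / (real n + 2))) \<longlonglongrightarrow> \<rho> * (1 - 0)"
  proof (intro tendsto_intros)
    have "(\<lambda>n. 1 / real (n + 2)) \<longlonglongrightarrow> 0" by (rule LIMSEQ_ignore_initial_segment[OF lim_1_over_n])
    then show "(\<lambda>n. 1 / (real n + 2)) \<longlonglongrightarrow> 0" by (simp add: add.commute)
  qed
  then show "q \<longlonglongrightarrow> \<rho>" by (simp add: q_def[abs_def])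
qed

lemma S1_open: "open (S1 h)"
proof -
  have eq: "S1 h = ball 0 h \<inter> {\<eta> \<in> - \<real>\<^sub>\<le>\<^sub>0. real p * \<bar>Arg \<eta>\<bar> < \<delta>}"
    using Arg_bound_slit[OF p] \<delta> pi_gt_zero unfolding S1_def by (force simp: complex_nonpos_Reals_iff)
  show ?thesis unfolding eq by (intro open_Int open_ball open_slit_less continuous_intros) auto
qed

lemma joint_open: "open (joint h)"
proof -
  \<comment> \<open>Outside the disc of radius \<open>\<mu> |\<eta>|\<close> the domain is the same
    for all \<open>\<eta>\<close>; at \<open>\<eta> = 0\<close> that disc is empty, so
    \<open>\<Omega> 0\<close> is this common part.\<close>
  have eq: "joint h = ({z. norm (fst z) < \<mu> * norm (snd z)} \<inter> (UNIV \<times> S1 h)) \<union> (\<Omega> 0 \<times> S1 h)"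
    by (auto simp: joint_def finite_domain_def)
  have "open {z :: complex \<times> complex. norm (fst z) < \<mu> * norm (snd z)}"
    by (intro open_Collect_less continuous_intros)
  then show ?thesis unfolding eq
    by (intro open_Un open_Int open_Times S1_open open_finite_domain[OF p \<delta>(1)]) auto
qed

lemma accessible:
  assumes h: "small h" and \<eta>: "\<eta> \<in> S1 h"
  shows "accessible p (sin \<delta>) m \<eta> (\<Omega> \<eta>) q"
  by (rule accessible_finite_domain[OF p \<delta> \<mu> m]) (use assms q in \<open>auto simp: S1_def small_def\<close>)

lemma power_in_Sigma:
  assumes h: "small h" and \<eta>: "\<eta> \<in> S1 h"
  shows "\<eta> ^ p \<in> \<Sigma>e"
proof -
  have "norm \<eta> ^ p < h ^ p" using \<eta> p1 by (intro power_strict_mono) (auto simp: S1_def)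
  then have "norm (\<eta> ^ p) < \<epsilon>0" using h by (simp add: norm_power small_def)
  moreover have "is_Arg (\<eta> ^ p) (real p * Arg \<eta>)"
    unfolding is_Arg_def norm_power by (metis power_polar rcis_def cis_conv_exp)
  moreover have "\<bar>real p * Arg \<eta>\<bar> < \<delta>" using \<eta> by (simp add: S1_def abs_mult)
  ultimately show ?thesis using \<eta> unfolding sector_def
    by (auto simp: S1_def intro!: exI[of _ "real p * Arg \<eta>"])
qed

text \<open>Dividing by \<open>\<eta>\<close> costs \<open>\<delta> / p\<close> in the argument, the
  difference between the openings of the two domains. The difference of the arguments stays below
  \<open>pi\<close>, so it is again a principal argument.\<close>

lemma region:
  assumes h: "small h" and x: "(x, \<eta>) \<in> joint h"
  shows "region x \<eta>"
proof -
  have \<eta>: "\<eta> \<noteq> 0" "norm \<eta> < h" "real p * \<bar>Arg \<eta>\<bar> < \<delta>" and x: "x \<in> \<Omega> \<eta>"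
    using x by (auto simp: joint_def S1_def)
  have hh: "h \<le> 1" "\<mu> * h \<le> \<rho>" using h by (auto simp: small_def)
  show ?thesis
  proof (cases "norm x < \<mu> * norm \<eta>")
    case True
    have "\<mu> * norm \<eta> \<le> \<mu> * h" using \<eta> \<mu> by (intro mult_left_mono) auto
    then have "norm x < \<rho>" using True hh by linarith
    then show ?thesis using True \<eta> hh by (simp add: region_def infinite_domain_def norm_divide field_simps)
  next
    case False
    then have x: "x \<noteq> 0" "norm x < \<rho>" "real p * \<bar>Arg x\<bar> < 3 * pi / 2 - 2 * \<delta>"
      using x by (auto simp: finite_domain_def)
    define \<theta> where "\<theta> = Arg x - Arg \<eta>"
    have "real p * \<bar>\<theta>\<bar> \<le> real p * \<bar>Arg x\<bar> + real p * \<bar>Arg \<eta>\<bar>"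
      unfolding \<theta>_def distrib_left[symmetric] by (intro mult_left_mono) auto
    then have pt: "real p * \<bar>\<theta>\<bar> < 3 * pi / 2 - \<delta>" using x \<eta> by linarith
    have "2 * \<bar>\<theta>\<bar> \<le> real p * \<bar>\<theta>\<bar>" using p by (intro mult_right_mono) auto
    then have t: "\<bar>\<theta>\<bar> < pi" using pt \<delta> pi_gt_zero by linarith
    have "Arg (x / \<eta>) = \<theta>"
    proof (rule Arg_unique'[where r = "norm x / norm \<eta>"])
      show "x / \<eta> = rcis (norm x / norm \<eta>) \<theta>"
        unfolding \<theta>_def by (metis rcis_cmod_Arg rcis_divide)
    qed (use x \<eta> t in auto)
    then show ?thesis using pt x \<eta> hh by (simp add: region_def infinite_domain_def)
  qed
qed

text \<open>Separate holomorphy in \<open>x\<close> and \<open>\<eta>\<close> passes through the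
  integral operator and through limits one variable at a time. For bounded functions it implies
  joint continuity, and joint differentiability is established once, for the final solution.\<close>

definition good :: "real \<Rightarrow> (complex \<Rightarrow> complex \<Rightarrow> complex) \<Rightarrow> bool" where
  "good h f \<longleftrightarrow> (\<forall>\<eta>\<in>S1 h. (\<lambda>x. f x \<eta>) holomorphic_on \<Omega> \<eta>) \<and>
     (\<forall>x. f x holomorphic_on {\<eta>. (x, \<eta>) \<in> joint h})"

lemma good_continuous:
  assumes g: "good h f" and b: "\<And>x \<eta>. (x, \<eta>) \<in> joint h \<Longrightarrow> norm (f x \<eta>) \<le> B"
  shows "continuous_on (joint h) (\<lambda>(x, \<eta>). f x \<eta>)"
proof (rule separately_holomorphic_continuous_on[OF joint_open b])
  show "(\<lambda>x. f x e) holomorphic_on {x. (x, e) \<in> joint h}" for e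
  proof (cases "e \<in> S1 h")
    case True
    then have "{x. (x, e) \<in> joint h} = \<Omega> e" by (auto simp: joint_def)
    then show ?thesis using g True by (simp add: good_def)
  next
    case False
    then have "{x. (x, e) \<in> joint h} = {}" by (auto simp: joint_def)
    then show ?thesis unfolding holomorphic_on_def by blast
  qed
  show "continuous_on {e. (x, e) \<in> joint h} (f x)" for x
    using g by (auto simp: good_def intro: holomorphic_on_imp_continuous_on)
qed

lemma slice_open: "open {\<eta>. (x, \<eta>) \<in> joint h}"
  using open_vimage[OF joint_open, of "\<lambda>e. (x, e)"] by (simp add: vimage_def continuous_on_Pair)

lemma Omega_starlike: "small h \<Longrightarrow> \<eta> \<in> S1 h \<Longrightarrow> x \<in> \<Omega> \<eta> \<Longrightarrow> t \<in> {0..1} \<Longrightarrow> of_real t * x \<in> \<Omega> \<eta>"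
  using finite_domain_starlike[OF \<mu> _ \<rho>(1) \<delta>] by (simp add: S1_def)

text \<open>The segment from \<open>0\<close> to \<open>x\<close> is parametrised by
  \<open>{0..1}\<close>, and the starlike slices keep it in the joint domain; then the integrand is
  jointly continuous and holomorphic in \<open>\<eta>\<close>.\<close>

lemma Wint_holomorphic_parameter:
  assumes h: "small h" and g: "good h f" and b: "\<And>x \<eta>. (x, \<eta>) \<in> joint h \<Longrightarrow> norm (f x \<eta>) \<le> B"
  shows "(\<lambda>\<eta>. Wint p \<eta> (\<lambda>t. f t \<eta>) x) holomorphic_on {\<eta>. (x, \<eta>) \<in> joint h}"
proof -
  let ?U = "{\<eta>. (x, \<eta>) \<in> joint h}"
  define k where "k \<eta> t = exp (- ((of_real t * x) ^ p) / \<eta> ^ p) * f (of_real t * x) \<eta> * x" for \<eta> :: complex and t :: real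
  have inj: "(of_real t * x, \<eta>) \<in> joint h" if "\<eta> \<in> ?U" "t \<in> {0..1}" for \<eta> t
    using Omega_starlike[OF h] that by (auto simp: joint_def)
  have nz: "\<eta> \<noteq> 0" if "\<eta> \<in> ?U" for \<eta> using that by (auto simp: joint_def S1_def)
  have cont: "continuous_on (?U \<times> {0..1}) (\<lambda>(\<eta>, t). k \<eta> t)"
  proof -
    have "continuous_on (?U \<times> {0..1}) ((\<lambda>(x, \<eta>). f x \<eta>) \<circ> (\<lambda>(\<eta>, t). (of_real t * x, \<eta>)))"
      by (rule continuous_on_compose[OF _ continuous_on_subset[OF good_continuous[OF g b]]])
        (use inj in \<open>auto simp: case_prod_beta' intro!: continuous_intros\<close>)
    then have "continuous_on (?U \<times> {0..1}) (\<lambda>z. f (of_real (snd z) * x) (fst z))"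
      by (simp add: o_def case_prod_beta')
    then show ?thesis unfolding k_def case_prod_beta'
      by (intro continuous_intros) (use nz in auto)
  qed
  have hol: "(\<lambda>\<eta>. k \<eta> t) holomorphic_on ?U" if t: "t \<in> {0..1}" for t
  proof -
    have "f (of_real t * x) holomorphic_on ?U"
      by (rule holomorphic_on_subset[of _ "{\<eta>. (of_real t * x, \<eta>) \<in> joint h}"])
        (use g inj t in \<open>auto simp: good_def\<close>)
    then show ?thesis unfolding k_def by (intro holomorphic_intros) (use nz in auto)
  qed
  have eq: "Wint p \<eta> (\<lambda>t. f t \<eta>) x = integral {0..1} (k \<eta>)" if \<eta>: "\<eta> \<in> ?U" for \<eta>
  proof -
    have "continuous_on {0..1} ((\<lambda>(\<eta>, t). k \<eta> t) \<circ> (\<lambda>t. (\<eta>, t)))"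
      by (rule continuous_on_compose[OF _ continuous_on_subset[OF cont]]) (use \<eta> in \<open>auto intro!: continuous_intros\<close>)
    then have "k \<eta> integrable_on {0..1}" by (intro integrable_continuous_interval) (simp add: o_def)
    then have "(k \<eta> has_integral integral {0..1} (k \<eta>)) {0..1}" by blast
    then have "((\<lambda>t. exp (- (t ^ p) / \<eta> ^ p) * f t \<eta>) has_contour_integral integral {0..1} (k \<eta>)) (linepath 0 x)"
      unfolding has_contour_integral_linepath by (simp add: k_def[abs_def] linepath_def scaleR_conv_of_real)
    then show ?thesis unfolding Wint_def by (rule contour_integral_unique)
  qed
  show ?thesis
    using holomorphic_parametric_integral[OF slice_open cont hol]
    by (subst holomorphic_cong[OF refl eq]) auto
qed

definition J :: "(complex \<Rightarrow> complex \<Rightarrow> complex) \<Rightarrow> complex \<Rightarrow> complex \<Rightarrow> complex" where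
  "J f x \<eta> = null_solution p \<eta> q (\<lambda>t. f t \<eta>) x"

text \<open>Along \<open>q\<close>, which tends to the finite number \<open>\<rho>\<close>, the
  exponential has a nonzero limit; the second condition therefore says that \<open>u\<close> tends
  to zero at \<open>\<rho>\<close>.\<close>

definition solves :: "real \<Rightarrow> (complex \<Rightarrow> complex \<Rightarrow> complex) \<Rightarrow> (complex \<Rightarrow> complex \<Rightarrow> complex) \<Rightarrow> bool" where
  "solves h f u \<longleftrightarrow> (\<forall>\<eta>\<in>S1 h. linear_ode p \<eta> (\<Omega> \<eta>) (\<lambda>x. f x \<eta>) (\<lambda>x. u x \<eta>) \<and>
     (\<lambda>n. u (of_real (q n)) \<eta> * exp (- (of_real (q n) ^ p) / \<eta> ^ p)) \<longlonglongrightarrow> 0)"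

lemma Re_inverse_power:
  assumes h: "small h" and \<eta>: "\<eta> \<in> S1 h"
  shows "sin \<delta> / norm \<eta> ^ p \<le> Re (1 / \<eta> ^ p)" "Re (1 / \<eta> ^ p) \<ge> 0"
proof -
  show 1: "sin \<delta> / norm \<eta> ^ p \<le> Re (1 / \<eta> ^ p)" using accessible[OF assms] by (simp add: accessible_def)
  have "0 \<le> sin \<delta> / norm \<eta> ^ p" using sin_pos_less_1[OF \<delta>] by simp
  then show "Re (1 / \<eta> ^ p) \<ge> 0" using 1 by linarith
qed

lemma q_in: "small h \<Longrightarrow> \<eta> \<in> S1 h \<Longrightarrow> of_real (q n) \<in> \<Omega> \<eta>"
  using accessible unfolding accessible_def by blast

lemma J_solves:
  assumes h: "small h" and g: "good h f" and b: "\<And>x \<eta>. (x, \<eta>) \<in> joint h \<Longrightarrow> norm (f x \<eta>) \<le> B"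
  shows "solves h f (J f)"
  unfolding solves_def
proof (intro ballI conjI)
  fix \<eta> assume \<eta>: "\<eta> \<in> S1 h"
  have fh: "(\<lambda>x. f x \<eta>) holomorphic_on \<Omega> \<eta>" using g \<eta> by (simp add: good_def)
  note op = open_finite_domain[OF p \<delta>(1)]
  show "linear_ode p \<eta> (\<Omega> \<eta>) (\<lambda>x. f x \<eta>) (\<lambda>x. J f x \<eta>)"
    unfolding J_def by (rule null_solution_ode[OF op Omega_starlike[OF h \<eta>] fh])
  show "(\<lambda>n. J f (of_real (q n)) \<eta> * exp (- (of_real (q n) ^ p) / \<eta> ^ p)) \<longlonglongrightarrow> 0"
    unfolding J_def
  proof (rule null_solution_vanishes[OF p1 _ _ op Omega_starlike[OF h \<eta>] fh])
    show "norm (f x \<eta>) \<le> B" if "x \<in> \<Omega> \<eta>" for x using b that \<eta> by (simp add: joint_def)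
  qed (use q q_in[OF h \<eta>] Re_inverse_power[OF h \<eta>] sin_pos_less_1[OF \<delta>] \<eta> in \<open>auto simp: S1_def\<close>)
qed

text \<open>The delicate part is holomorphy in \<open>\<eta>\<close> of the subtracted limit
  \<open>L\<close>. The integrals \<open>W n\<close> up to \<open>q n\<close> converge to it
  uniformly on \<open>S1 h\<close>.\<close>

lemma J_good:
  assumes h: "small h" and g: "good h f" and b: "\<And>x \<eta>. (x, \<eta>) \<in> joint h \<Longrightarrow> norm (f x \<eta>) \<le> B"
  shows "good h (J f)"
  unfolding good_def
proof (intro conjI ballI allI)
  fix \<eta> assume \<eta>: "\<eta> \<in> S1 h"
  have "linear_ode p \<eta> (\<Omega> \<eta>) (\<lambda>x. f x \<eta>) (\<lambda>x. J f x \<eta>)"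
    using J_solves[OF assms] \<eta> by (simp add: solves_def)
  then show "(\<lambda>x. J f x \<eta>) holomorphic_on \<Omega> \<eta>"
    using open_finite_domain[OF p \<delta>(1)] by (auto simp: linear_ode_def holomorphic_on_open)
next
  fix x
  let ?U = "{\<eta>. (x, \<eta>) \<in> joint h}"
  define W where "W n \<eta> = Wint p \<eta> (\<lambda>t. f t \<eta>) (of_real (q n))" for n \<eta>
  define L where "L \<eta> = lim (\<lambda>n. W n \<eta>)" for \<eta>
  \<comment> \<open>On the positive axis the kernel has modulus at most 1, because
    \<open>Re (1 / \<eta> ^ p) \<ge> 0\<close>; hence a rate of convergence that is free of
    \<open>\<eta>\<close>.\<close>
  have Wd: "norm (W n \<eta> - W k \<eta>) \<le> B * \<bar>q n - q k\<bar>" if \<eta>: "\<eta> \<in> S1 h" for n k \<eta>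
  proof -
    have fh: "(\<lambda>x. f x \<eta>) holomorphic_on \<Omega> \<eta>" using g \<eta> by (simp add: good_def)
    have seg: "z \<in> of_real ` {0<..<\<rho>}" if "z \<in> closed_segment (of_real (q n)) (of_real (q k) :: complex)" for z
    proof -
      have "\<exists>u. z = (1 - u) *\<^sub>R of_real (q n) + u *\<^sub>R of_real (q k) \<and> 0 \<le> u \<and> u \<le> 1"
        using that unfolding closed_segment_def by (simp only: mem_Collect_eq)
      then obtain u where u: "z = (1 - u) *\<^sub>R of_real (q n) + u *\<^sub>R of_real (q k)" "0 \<le> u" "u \<le> 1"
        by (elim exE conjE)
      then have z: "z = of_real ((1 - u) * q n + u * q k)" by (simp add: scaleR_conv_of_real)
      have "(1 - u) * q n + u * q k \<in> closed_segment (q n) (q k)"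
        using u by (auto simp: closed_segment_def)
      also have "\<dots> \<subseteq> {0<..<\<rho>}" using q by (intro closed_segment_subset) auto
      finally show ?thesis unfolding z by (rule imageI)
    qed
    have zO: "z \<in> \<Omega> \<eta>" if zr: "z \<in> of_real ` {0<..<\<rho>}" for z
    proof -
      obtain t where t: "0 < t" "t < \<rho>" "z = of_real t" using zr by auto
      have "\<forall>\<^sub>F n in sequentially. q n > t" by (rule order_tendstoD(1)[OF q(4) t(2)])
      then obtain j where "q j > t" using eventually_sequentially by auto
      then show ?thesis using Omega_starlike[OF h \<eta> q_in[OF h \<eta>], of "t / q j" j] t q(1)[of j] by simp
    qed
    have "norm (W n \<eta> - W k \<eta>) \<le> B * norm (of_real (q n) - of_real (q k) :: complex)"
      unfolding W_def
    proof (rule field_differentiable_bound[OF convex_closed_segment[of "of_real (q n)" "of_real (q k)"]])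
      fix z assume z: "z \<in> closed_segment (of_real (q n)) (of_real (q k) :: complex)"
      show "(Wint p \<eta> (\<lambda>t. f t \<eta>) has_field_derivative exp (- (z ^ p) / \<eta> ^ p) * f z \<eta>)
          (at z within closed_segment (of_real (q n)) (of_real (q k)))"
        by (rule has_field_derivative_at_within,
            rule Wint_derivative[OF open_finite_domain[OF p \<delta>(1)] Omega_starlike[OF h \<eta>] fh zO[OF seg[OF z]]])
      obtain t where t: "0 < t" "z = of_real t" using seg[OF z] by auto
      have "norm (exp (- (z ^ p) / \<eta> ^ p)) \<le> 1"
      proof -
        have "- (z ^ p) / \<eta> ^ p = of_real (- (t ^ p)) * (1 / \<eta> ^ p)" by (simp add: t)
        then have "Re (- (z ^ p) / \<eta> ^ p) = - (t ^ p * Re (1 / \<eta> ^ p))"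
          by (simp only: times_complex.sel(1)) simp
        moreover have "0 \<le> t ^ p * Re (1 / \<eta> ^ p)" using Re_inverse_power(2)[OF h \<eta>] t by (intro mult_nonneg_nonneg) auto
        ultimately show ?thesis unfolding norm_exp_eq_Re by simp
      qed
      moreover have "norm (f z \<eta>) \<le> B" using b zO[OF seg[OF z]] \<eta> by (simp add: joint_def)
      ultimately have "norm (exp (- (z ^ p) / \<eta> ^ p)) * norm (f z \<eta>) \<le> 1 * B" by (intro mult_mono) auto
      then show "norm (exp (- (z ^ p) / \<eta> ^ p) * f z \<eta>) \<le> B" by (simp add: norm_mult)
    qed auto
    then show ?thesis by (simp flip: of_real_diff)
  qed
  have conv: "(\<lambda>n. W n \<eta>) \<longlonglongrightarrow> L \<eta>" if \<eta>: "\<eta> \<in> S1 h" for \<eta>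
  proof -
    have B: "B \<ge> 0" using order_trans[OF norm_ge_zero b[of "of_real (q 0)" \<eta>]] q_in[OF h \<eta>] \<eta> by (simp add: joint_def)
    have "Cauchy (\<lambda>n. W n \<eta>)"
    proof (rule CauchyI)
      fix e :: real assume e: "e > 0"
      have "Cauchy q" using q(4) by (rule LIMSEQ_imp_Cauchy)
      then obtain N where N: "\<And>n k. n \<ge> N \<Longrightarrow> k \<ge> N \<Longrightarrow> norm (q n - q k) < e / (B + 1)"
        using CauchyD[of q "e / (B + 1)"] e B by auto
      have "norm (W n \<eta> - W k \<eta>) < e" if "n \<ge> N" "k \<ge> N" for n k
      proof -
        have "norm (W n \<eta> - W k \<eta>) \<le> (B + 1) * \<bar>q n - q k\<bar>"
          using Wd[OF \<eta>, of n k] mult_right_mono[of B "B + 1" "\<bar>q n - q k\<bar>"] by linarith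
        also have "\<dots> < (B + 1) * (e / (B + 1))" using N[OF that] B by (intro mult_strict_left_mono) auto
        also have "\<dots> = e" using B by simp
        finally show ?thesis .
      qed
      then show "\<exists>N. \<forall>n\<ge>N. \<forall>k\<ge>N. norm (W n \<eta> - W k \<eta>) < e" by blast
    qed
    then show ?thesis unfolding L_def using Cauchy_convergent_iff convergent_LIMSEQ_iff by blast
  qed
  have WL: "norm (W n \<eta> - L \<eta>) \<le> B * \<bar>q n - \<rho>\<bar>" if \<eta>: "\<eta> \<in> S1 h" for n \<eta>
  proof (rule tendsto_le[OF _ _ _ always_eventually])
    show "(\<lambda>k. norm (W n \<eta> - W k \<eta>)) \<longlonglongrightarrow> norm (W n \<eta> - L \<eta>)" by (intro tendsto_intros conv \<eta>)
    show "(\<lambda>k. B * \<bar>q n - q k\<bar>) \<longlonglongrightarrow> B * \<bar>q n - \<rho>\<bar>" by (intro tendsto_intros q)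
  qed (use Wd[OF \<eta>] in auto)
  have "L holomorphic_on S1 h"
  proof (rule holomorphic_uniform_sequence[OF S1_open, where f = W])
    show "W n holomorphic_on S1 h" for n
    proof -
      have "{\<eta>. (of_real (q n), \<eta>) \<in> joint h} = S1 h" using q_in[OF h] by (auto simp: joint_def)
      then show ?thesis unfolding W_def using Wint_holomorphic_parameter[OF h g b, of "of_real (q n)"] by simp
    qed
    fix \<eta> assume "\<eta> \<in> S1 h"
    then obtain d where d: "d > 0" "cball \<eta> d \<subseteq> S1 h" using S1_open open_contains_cball by blast
    have "uniform_limit (cball \<eta> d) W L sequentially"
    proof (rule uniform_limitI)
      fix e :: real assume e: "e > 0"
      have "(\<lambda>n. B * \<bar>q n - \<rho>\<bar>) \<longlonglongrightarrow> B * \<bar>\<rho> - \<rho>\<bar>" by (intro tendsto_intros q)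
      then have "\<forall>\<^sub>F n in sequentially. B * \<bar>q n - \<rho>\<bar> < e" using e by (intro order_tendstoD(2)) auto
      then show "\<forall>\<^sub>F n in sequentially. \<forall>w\<in>cball \<eta> d. dist (W n w) (L w) < e"
      proof eventually_elim
        case (elim n)
        show ?case
        proof
          fix w assume "w \<in> cball \<eta> d"
          then have "w \<in> S1 h" using d by blast
          from WL[OF this, of n] elim show "dist (W n w) (L w) < e" by (simp add: dist_norm)
        qed
      qed
    qed
    with d show "\<exists>d>0. cball \<eta> d \<subseteq> S1 h \<and> uniform_limit (cball \<eta> d) W L sequentially" by blast
  qed
  then have LU: "L holomorphic_on ?U" by (rule holomorphic_on_subset) (auto simp: joint_def)
  have "(\<lambda>\<eta>. exp (x ^ p / \<eta> ^ p) * (Wint p \<eta> (\<lambda>t. f t \<eta>) x - L \<eta>)) holomorphic_on ?U"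
    by (intro holomorphic_intros LU Wint_holomorphic_parameter[OF h g b]) (auto simp: joint_def S1_def)
  then show "J f x holomorphic_on ?U" by (simp add: J_def[abs_def] null_solution_def L_def W_def)
qed

lemma solves_diff:
  assumes "solves h f u" "solves h g v"
  shows "solves h (\<lambda>x \<eta>. f x \<eta> - g x \<eta>) (\<lambda>x \<eta>. u x \<eta> - v x \<eta>)"
  unfolding solves_def
proof (intro ballI conjI)
  fix \<eta> assume \<eta>: "\<eta> \<in> S1 h"
  note a = assms[unfolded solves_def, rule_format, OF \<eta>]
  show "linear_ode p \<eta> (\<Omega> \<eta>) (\<lambda>x. f x \<eta> - g x \<eta>) (\<lambda>x. u x \<eta> - v x \<eta>)"
    unfolding linear_ode_def
  proof
    fix x assume x: "x \<in> \<Omega> \<eta>"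
    from DERIV_diff[of "\<lambda>x. u x \<eta>" _ x UNIV "\<lambda>x. v x \<eta>"] a x
    show "((\<lambda>x. u x \<eta> - v x \<eta>) has_field_derivative
      of_nat p * x ^ (p - 1) / \<eta> ^ p * (u x \<eta> - v x \<eta>) + (f x \<eta> - g x \<eta>)) (at x)"
      unfolding linear_ode_def by (fastforce simp: algebra_simps diff_divide_distrib)
  qed
  show "(\<lambda>n. (u (of_real (q n)) \<eta> - v (of_real (q n)) \<eta>) * exp (- (of_real (q n) ^ p) / \<eta> ^ p)) \<longlonglongrightarrow> 0"
    using tendsto_diff[OF conjunct2[OF a(1)] conjunct2[OF a(2)]] by (simp add: left_diff_distrib)
qed

text \<open>The a priori estimate with the constant weight \<open>|\<eta>| B\<close>: the integral
  operator has norm of order \<open>|\<eta>|\<close>, which is small for small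
  \<open>\<eta>\<close>.\<close>

lemma solves_bound:
  obtains C where "C > 0" "\<And>h f u B x \<eta>. small h \<Longrightarrow> solves h f u \<Longrightarrow> B > 0 \<Longrightarrow>
    (\<And>x. x \<in> \<Omega> \<eta> \<Longrightarrow> norm (f x \<eta>) \<le> B) \<Longrightarrow> (x, \<eta>) \<in> joint h \<Longrightarrow> norm (u x \<eta>) \<le> C * norm \<eta> * B"
proof -
  have sd: "sin \<delta> > 0" using sin_pos_less_1[OF \<delta>] by simp
  obtain C where C: "C > 0" and est: "\<And>\<eta> W q u f \<phi> x. accessible p (sin \<delta>) m \<eta> W q \<Longrightarrow> admissible_weight p (sin \<delta>) m 1 \<eta> W \<phi> \<Longrightarrow>
       linear_ode p \<eta> W f u \<Longrightarrow> (\<And>x. x \<in> W \<Longrightarrow> norm \<eta> * norm (f x) \<le> \<phi> x) \<Longrightarrow>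
       (\<And>x. x \<in> W \<Longrightarrow> x = of_real (norm \<eta>) \<or> \<not> small_or_descending p (sin \<delta>) m \<eta> x \<Longrightarrow>
          \<exists>\<^sub>F n in sequentially. norm (u (of_real (q n))) * exp (Re ((x ^ p - of_real (q n ^ p)) / \<eta> ^ p)) \<le> \<phi> x) \<Longrightarrow>
       x \<in> W \<Longrightarrow> norm (u x) \<le> C * \<phi> x"
    using accessible_estimate[OF p1 sd m(1) order_refl] by blast
  show ?thesis
  proof (rule that[OF C])
    fix h f u B x \<eta>
    assume h: "small h" and s: "solves h f u" and B: "B > 0"
      and f: "\<And>x. x \<in> \<Omega> \<eta> \<Longrightarrow> norm (f x \<eta>) \<le> B" and x: "(x, \<eta>) \<in> joint h"
    have \<eta>: "\<eta> \<in> S1 h" and xO: "x \<in> \<Omega> \<eta>" using x by (auto simp: joint_def)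
    have Bp: "norm \<eta> * B > 0" using \<eta> B by (simp add: S1_def)
    note sv = s[unfolded solves_def, rule_format, OF \<eta>]
    have "norm (u x \<eta>) \<le> C * (norm \<eta> * B)"
    proof (rule est[OF accessible[OF h \<eta>] admissible_weight_const[OF sd less_imp_le[OF Bp] order_refl] conjunct1[OF sv] _ _ xO])
      fix z assume "z \<in> \<Omega> \<eta>"
      then show "norm \<eta> * norm (f z \<eta>) \<le> norm \<eta> * B" using f by (intro mult_left_mono) auto
      show "\<exists>\<^sub>F n in sequentially. norm (u (of_real (q n)) \<eta>) * exp (Re ((z ^ p - of_real (q n ^ p)) / \<eta> ^ p)) \<le> norm \<eta> * B"
        by (rule vanishing_imp_frequently[OF conjunct2[OF sv] Bp])
    qed
    then show "norm (u x \<eta>) \<le> C * norm \<eta> * B" by (simp add: mult.assoc)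
  qed
qed

end

section \<open>Picard iteration\<close>

context canard begin

definition rhs :: "(complex \<Rightarrow> complex \<Rightarrow> complex) \<Rightarrow> complex \<Rightarrow> complex \<Rightarrow> complex" where
  "rhs y x \<eta> = P x (y x \<eta>) (\<eta> ^ p)"

lemma rhs_good:
  assumes h: "small h" and y: "good h y" and b: "\<And>x \<eta>. (x, \<eta>) \<in> joint h \<Longrightarrow> norm (y x \<eta>) < r2"
  shows "good h (rhs y)"
  unfolding good_def
proof (intro conjI ballI allI)
  have dom: "(x, y x \<eta>, \<eta> ^ p) \<in> ball 0 r0 \<times> ball 0 r2 \<times> \<Sigma>e" if "(x, \<eta>) \<in> joint h" for x \<eta>
    using region[OF h that] b[OF that] power_in_Sigma[OF h, of \<eta>] that \<rho> by (auto simp: region_def joint_def)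
  {
    fix \<eta> assume \<eta>: "\<eta> \<in> S1 h"
    show "(\<lambda>x. rhs y x \<eta>) holomorphic_on \<Omega> \<eta>" unfolding rhs_def
    proof (rule holomorphic3_on_compose[OF holP open_finite_domain[OF p \<delta>(1)]])
      show "(\<lambda>x. y x \<eta>) holomorphic_on \<Omega> \<eta>" using y \<eta> by (simp add: good_def)
      show "(x, y x \<eta>, \<eta> ^ p) \<in> ball 0 r0 \<times> ball 0 r2 \<times> \<Sigma>e" if "x \<in> \<Omega> \<eta>" for x
        using dom that \<eta> by (simp add: joint_def)
    qed (intro holomorphic_intros)+
  next
    fix x
    show "rhs y x holomorphic_on {\<eta>. (x, \<eta>) \<in> joint h}" unfolding rhs_def
    proof (rule holomorphic3_on_compose[OF holP slice_open])
      show "y x holomorphic_on {\<eta>. (x, \<eta>) \<in> joint h}" using y by (simp add: good_def)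
    qed (use dom in \<open>auto intro!: holomorphic_intros\<close>)
  }
qed

lemma rhs_bound:
  assumes h: "small h" and x: "(x, \<eta>) \<in> joint h" and b: "norm (y x \<eta>) < r2"
  shows "norm (rhs y x \<eta>) \<le> M"
  unfolding rhs_def
  by (rule bP) (use region[OF h x] b power_in_Sigma[OF h, of \<eta>] x \<rho> in \<open>auto simp: region_def joint_def\<close>)

text \<open>Cauchy's estimate in the variable \<open>y\<close> with radius \<open>r2 / 2\<close>;
  this is why the iterates are confined to half of the disc \<open>D2\<close>.\<close>

lemma rhs_lipschitz:
  assumes h: "small h" and x: "(x, \<eta>) \<in> joint h" and b: "norm (y x \<eta>) < r2 / 2" "norm (z x \<eta>) < r2 / 2"
  shows "norm (rhs y x \<eta> - rhs z x \<eta>) \<le> 4 * M / r2 * norm (y x \<eta> - z x \<eta>)"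
proof -
  have xr: "norm x < r0" using region[OF h x] \<rho> by (simp add: region_def)
  have e: "\<eta> ^ p \<in> \<Sigma>e" using power_in_Sigma[OF h, of \<eta>] x by (simp add: joint_def)
  have "(\<lambda>w. P x w (\<eta> ^ p)) holomorphic_on ball 0 (2 * (r2 / 2))"
    by (rule holomorphic3_on_compose[OF holP]) (use xr e in \<open>auto intro!: holomorphic_intros\<close>)
  from lipschitz_Cauchy[OF this, of M "y x \<eta>" "z x \<eta>"] show ?thesis
    using r2 b bP[OF xr _ e] by (simp add: rhs_def)
qed

text \<open>Contraction with factor \<open>1 / 2\<close> on a domain that is small in
  \<open>\<eta>\<close> only; the range of \<open>x\<close> does not shrink. The bound by
  \<open>K |\<eta>|\<close> is recorded because it later makes \<open>y ^ N\<close> an error of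
  order \<open>N\<close>.\<close>

lemma exists_solution:
  obtains h K y where "small h" "K > 0" "\<And>x \<eta>. (x, \<eta>) \<in> joint h \<Longrightarrow> norm (y x \<eta>) \<le> K * norm \<eta>"
    "\<And>x \<eta>. (x, \<eta>) \<in> joint h \<Longrightarrow> norm (y x \<eta>) < r2 / 2"
    "holomorphic2_on (\<lambda>(x, \<eta>). y x \<eta>) (joint h)"
    "\<And>\<eta>. \<eta> \<in> S1 h \<Longrightarrow> linear_ode p \<eta> (\<Omega> \<eta>) (\<lambda>x. rhs y x \<eta>) (\<lambda>x. y x \<eta>)"
proof -
  obtain C where C: "C > 0" and est: "\<And>h f u B x \<eta>. small h \<Longrightarrow> solves h f u \<Longrightarrow> B > 0 \<Longrightarrow>
    (\<And>x. x \<in> \<Omega> \<eta> \<Longrightarrow> norm (f x \<eta>) \<le> B) \<Longrightarrow> (x, \<eta>) \<in> joint h \<Longrightarrow> norm (u x \<eta>) \<le> C * norm \<eta> * B"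
    using solves_bound by blast
  \<comment> \<open>The entry with \<open>4 * C * M\<close> keeps the iterates below
    \<open>r2 / 2\<close>, the one with \<open>8 * C * M\<close> makes \<open>C * h\<close> times
    the Lipschitz constant \<open>4 * M / r2\<close> at most \<open>1 / 2\<close>; the others give
    \<open>small h\<close>.\<close>
  define h where "h = Min {1, \<rho>, \<rho> / \<mu>, \<epsilon>0, r2 / (4 * C * M), r2 / (8 * C * M)}"
  have hp: "h > 0" using \<rho> \<mu> \<epsilon>0 r2 C M by (simp add: h_def)
  have hle: "h \<le> 1" "h \<le> \<rho>" "h \<le> \<rho> / \<mu>" "h \<le> \<epsilon>0" "h \<le> r2 / (4 * C * M)" "h \<le> r2 / (8 * C * M)"
    unfolding h_def by (intro Min_le; simp)+
  have h: "small h"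
  proof -
    have "h ^ p \<le> h ^ 1" using hp hle p1 by (intro power_decreasing) auto
    moreover have "\<mu> * h \<le> \<rho>" using hle(3) \<mu> by (simp add: pos_le_divide_eq mult.commute)
    ultimately show ?thesis using hp hle by (simp add: small_def)
  qed
  have ch: "C * h * M < r2 / 2" "C * h * (4 * M / r2) \<le> 1 / 2"
  proof -
    have "h * (4 * C * M) \<le> r2" "h * (8 * C * M) \<le> r2"
      using hle(5,6) C M by (simp_all add: pos_le_divide_eq)
    then show "C * h * M < r2 / 2" "C * h * (4 * M / r2) \<le> 1 / 2" using r2 by (auto simp: field_simps)
  qed
  define Y where "Y = rec_nat (\<lambda>x \<eta>. 0) (\<lambda>_ y. J (rhs y))"
  have Y0: "Y 0 = (\<lambda>x \<eta>. 0)" and YS: "Y (Suc n) = J (rhs (Y n))" for n by (simp_all add: Y_def)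
  have eh: "C * norm \<eta> * M < r2 / 2" if "(x, \<eta>) \<in> joint h" for x \<eta>
  proof -
    have "C * norm \<eta> * M \<le> C * h * M" using that C M by (intro mult_right_mono mult_left_mono) (auto simp: joint_def S1_def)
    then show ?thesis using ch by linarith
  qed
  have Yinv: "good h (Y n) \<and> (\<forall>x \<eta>. (x, \<eta>) \<in> joint h \<longrightarrow> norm (Y n x \<eta>) \<le> C * norm \<eta> * M)" for n
  proof (induction n)
    case 0
    then show ?case using C M by (simp add: Y0 good_def)
  next
    case (Suc n)
    have lt: "norm (Y n x \<eta>) < r2" if "(x, \<eta>) \<in> joint h" for x \<eta>
    proof -
      have "norm (Y n x \<eta>) \<le> C * norm \<eta> * M" using Suc that by blast
      with eh[OF that] r2 show ?thesis by linarith
    qed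
    have rg: "good h (rhs (Y n))" by (rule rhs_good[OF h _ lt]) (use Suc in auto)
    have rb: "norm (rhs (Y n) x \<eta>) \<le> M" if "(x, \<eta>) \<in> joint h" for x \<eta>
      by (rule rhs_bound[where y = "Y n", OF h that lt[OF that]])
    have s: "solves h (rhs (Y n)) (Y (Suc n))" unfolding YS by (rule J_solves[OF h rg rb])
    have "norm (Y (Suc n) x \<eta>) \<le> C * norm \<eta> * M" if x: "(x, \<eta>) \<in> joint h" for x \<eta>
      by (rule est[OF h s M _ x]) (use rb x in \<open>auto simp: joint_def\<close>)
    moreover have "good h (Y (Suc n))" unfolding YS by (rule J_good[OF h rg rb])
    ultimately show ?case by blast
  qed
  have Yg: "good h (Y n)" and Yb: "(x, \<eta>) \<in> joint h \<Longrightarrow> norm (Y n x \<eta>) \<le> C * norm \<eta> * M" for n x \<eta>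
    using Yinv by blast+
  have Ylt: "norm (Y n x \<eta>) < r2 / 2" if "(x, \<eta>) \<in> joint h" for n x \<eta>
    using Yb[OF that, of n] eh[OF that] by linarith
  have Ylt': "norm (Y n x \<eta>) < r2" if "(x, \<eta>) \<in> joint h" for n x \<eta>
    using Ylt[OF that, of n] r2 by linarith
  have Ysol: "solves h (rhs (Y n)) (Y (Suc n))" for n
  proof -
    have rb: "norm (rhs (Y n) x \<eta>) \<le> M" if "(x, \<eta>) \<in> joint h" for x \<eta>
      by (rule rhs_bound[where y = "Y n", OF h that Ylt'[OF that]])
    have "good h (rhs (Y n))" by (rule rhs_good[OF h Yg Ylt'])
    then show ?thesis unfolding YS using rb by (rule J_solves[OF h])
  qed
  have Ydiff: "norm (Y (Suc n) x \<eta> - Y n x \<eta>) \<le> r2 * (1 / 2) ^ n" if "(x, \<eta>) \<in> joint h" for n x \<eta>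
    using that
  proof (induction n arbitrary: x \<eta>)
    case 0
    then show ?case using Ylt[OF 0, of 1] r2 by (simp add: Y0)
  next
    case (Suc n)
    have "norm (Y (Suc (Suc n)) x \<eta> - Y (Suc n) x \<eta>) \<le> C * norm \<eta> * (4 * M / r2 * (r2 * (1 / 2) ^ n))"
    proof (rule est[OF h solves_diff[OF Ysol Ysol] _ _ Suc.prems])
      show "4 * M / r2 * (r2 * (1 / 2) ^ n) > 0" using M r2 by simp
      fix z assume "z \<in> \<Omega> \<eta>"
      then have z: "(z, \<eta>) \<in> joint h" using Suc.prems by (simp add: joint_def)
      have "norm (rhs (Y (Suc n)) z \<eta> - rhs (Y n) z \<eta>) \<le> 4 * M / r2 * norm (Y (Suc n) z \<eta> - Y n z \<eta>)"
        by (rule rhs_lipschitz[where y = "Y (Suc n)" and z = "Y n", OF h z Ylt[OF z] Ylt[OF z]])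
      also have "\<dots> \<le> 4 * M / r2 * (r2 * (1 / 2) ^ n)"
        using Suc.IH[OF z] M r2 by (intro mult_left_mono) auto
      finally show "norm (rhs (Y (Suc n)) z \<eta> - rhs (Y n) z \<eta>) \<le> 4 * M / r2 * (r2 * (1 / 2) ^ n)" .
    qed
    also have "\<dots> = (C * norm \<eta> * (4 * M / r2)) * (r2 * (1 / 2) ^ n)" by simp
    also have "\<dots> \<le> 1 / 2 * (r2 * (1 / 2) ^ n)"
    proof (rule mult_right_mono)
      have "C * norm \<eta> * (4 * M / r2) \<le> C * h * (4 * M / r2)"
        using Suc.prems C M r2 by (intro mult_right_mono mult_left_mono) (auto simp: joint_def S1_def)
      then show "C * norm \<eta> * (4 * M / r2) \<le> 1 / 2" using ch by linarith
    qed (use r2 in auto)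
    finally show ?case by simp
  qed
  \<comment> \<open>The limit is written as a telescoping series, to which the Weierstrass test
    applies; its partial sums are the \<open>Y n\<close>, because \<open>Y 0\<close> is
    zero.\<close>
  define y where "y x \<eta> = (\<Sum>i. Y (Suc i) x \<eta> - Y i x \<eta>)" for x \<eta>
  have "uniform_limit (joint h) (\<lambda>n z. \<Sum>i<n. Y (Suc i) (fst z) (snd z) - Y i (fst z) (snd z))
     (\<lambda>z. \<Sum>i. Y (Suc i) (fst z) (snd z) - Y i (fst z) (snd z)) sequentially"
  proof (rule Weierstrass_m_test)
    show "norm (Y (Suc n) (fst z) (snd z) - Y n (fst z) (snd z)) \<le> r2 * (1 / 2) ^ n" if "z \<in> joint h" for n z
      using Ydiff[of "fst z" "snd z"] that by simp
    show "summable (\<lambda>n. r2 * (1 / 2) ^ n)" by (intro summable_mult summable_geometric) auto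
  qed
  moreover have "(\<Sum>i<n. Y (Suc i) (fst z) (snd z) - Y i (fst z) (snd z)) = Y n (fst z) (snd z)" for n z
    using sum_lessThan_telescope[of "\<lambda>i. Y i (fst z) (snd z)" n] by (simp add: Y0)
  ultimately have ul: "uniform_limit (joint h) (\<lambda>n z. Y n (fst z) (snd z)) (\<lambda>z. y (fst z) (snd z)) sequentially"
    by (simp add: y_def)
  have ulx: "uniform_limit (\<Omega> \<eta>) (\<lambda>n x. Y n x \<eta>) (\<lambda>x. y x \<eta>) sequentially" if "\<eta> \<in> S1 h" for \<eta>
    using uniform_limit_compose'[OF ul, of "\<lambda>x. (x, \<eta>)" "\<Omega> \<eta>"] that by (auto simp: joint_def)
  have ule: "uniform_limit {\<eta>. (x, \<eta>) \<in> joint h} (\<lambda>n. Y n x) (y x) sequentially" for x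
    using uniform_limit_compose'[OF ul, of "\<lambda>e. (x, e)" "{\<eta>. (x, \<eta>) \<in> joint h}"] by auto
  have lim: "(\<lambda>n. Y n x \<eta>) \<longlonglongrightarrow> y x \<eta>" if "(x, \<eta>) \<in> joint h" for x \<eta>
    using tendsto_uniform_limitI[OF ul that] by simp
  have yb: "norm (y x \<eta>) \<le> C * norm \<eta> * M" if "(x, \<eta>) \<in> joint h" for x \<eta>
    by (rule tendsto_upperbound[OF tendsto_norm[OF lim[OF that]]]) (use Yb[OF that] in auto)
  have ylt: "norm (y x \<eta>) < r2 / 2" if "(x, \<eta>) \<in> joint h" for x \<eta>
    using yb[OF that] eh[OF that] by linarith
  have unif_hol: "g holomorphic_on S" if S: "open S" and f: "\<And>n. f n holomorphic_on S" and l: "uniform_limit S f g sequentially"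
    for f g and S :: "complex set"
  proof (rule holomorphic_uniform_sequence[OF S f])
    fix x assume "x \<in> S"
    then obtain d where "d > 0" "cball x d \<subseteq> S" using S open_contains_cball by blast
    then show "\<exists>d>0. cball x d \<subseteq> S \<and> uniform_limit (cball x d) f g sequentially"
      using uniform_limit_on_subset[OF l] by blast
  qed
  have yg: "good h y" unfolding good_def
  proof (intro conjI ballI allI)
    show "(\<lambda>x. y x \<eta>) holomorphic_on \<Omega> \<eta>" if "\<eta> \<in> S1 h" for \<eta>
      by (rule unif_hol[OF open_finite_domain[OF p \<delta>(1)] _ ulx[OF that]]) (use Yg that in \<open>auto simp: good_def\<close>)
    show "y x holomorphic_on {\<eta>. (x, \<eta>) \<in> joint h}" for x
      by (rule unif_hol[OF slice_open _ ule]) (use Yg in \<open>auto simp: good_def\<close>)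
  qed
  have Pc: "continuous_on (ball 0 r0 \<times> ball 0 r2 \<times> \<Sigma>e) (\<lambda>(x, y, e). P x y e)"
    by (rule holomorphic3_on_imp_continuous_on[OF holP])
  have dom: "(x, w, \<eta> ^ p) \<in> ball 0 r0 \<times> ball 0 r2 \<times> \<Sigma>e" if "(x, \<eta>) \<in> joint h" "norm w < r2" for x \<eta> and w :: complex
    using region[OF h that(1)] that power_in_Sigma[OF h, of \<eta>] \<rho> by (auto simp: region_def joint_def)
  have yode: "linear_ode p \<eta> (\<Omega> \<eta>) (\<lambda>x. rhs y x \<eta>) (\<lambda>x. y x \<eta>)" if \<eta>: "\<eta> \<in> S1 h" for \<eta>
    unfolding linear_ode_def
  proof
    fix x assume x: "x \<in> \<Omega> \<eta>"
    then have xj: "(x, \<eta>) \<in> joint h" using \<eta> by (simp add: joint_def)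
    note op = open_finite_domain[OF p \<delta>(1)]
    have yh: "(\<lambda>x. y x \<eta>) holomorphic_on \<Omega> \<eta>" using yg \<eta> by (simp add: good_def)
    \<comment> \<open>Derivatives converge under uniform limits of holomorphic functions. The shift
      to \<open>Suc n\<close> is needed because \<open>Y (Suc n)\<close> solves the equation whose
      source contains \<open>Y n\<close>.\<close>
    have "(\<lambda>n. deriv (\<lambda>x. Y n x \<eta>) x) \<longlonglongrightarrow> deriv (\<lambda>x. y x \<eta>) x"
      by (rule deriv_complex_uniform_limit[OF ulx[OF \<eta>] _ _ op x]) (use Yg \<eta> in \<open>auto simp: good_def\<close>)
    then have d: "(\<lambda>n. deriv (\<lambda>x. Y (Suc n) x \<eta>) x) \<longlonglongrightarrow> deriv (\<lambda>x. y x \<eta>) x"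
      by (rule LIMSEQ_Suc)
    have "deriv (\<lambda>x. Y (Suc n) x \<eta>) x = of_nat p * x ^ (p - 1) / \<eta> ^ p * Y (Suc n) x \<eta> + rhs (Y n) x \<eta>" for n
      using Ysol[of n] \<eta> x by (intro DERIV_imp_deriv) (simp add: solves_def linear_ode_def)
    then have d': "(\<lambda>n. of_nat p * x ^ (p - 1) / \<eta> ^ p * Y (Suc n) x \<eta> + rhs (Y n) x \<eta>) \<longlonglongrightarrow> deriv (\<lambda>x. y x \<eta>) x"
      using d by simp
    have "(\<lambda>n. rhs (Y n) x \<eta>) \<longlonglongrightarrow> rhs y x \<eta>"
    proof -
      have "continuous_on (ball 0 r2) ((\<lambda>(x, y, e). P x y e) \<circ> (\<lambda>w. (x, w, \<eta> ^ p)))"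
        by (rule continuous_on_compose[OF _ continuous_on_subset[OF Pc]])
          (use dom[OF xj] in \<open>auto intro!: continuous_intros\<close>)
      then have "isCont (\<lambda>w. P x w (\<eta> ^ p)) (y x \<eta>)"
        using ylt[OF xj] r2 by (simp add: continuous_on_eq_continuous_at o_def)
      then show ?thesis unfolding rhs_def by (rule isCont_tendsto_compose[OF _ lim[OF xj]])
    qed
    moreover have "(\<lambda>n. Y (Suc n) x \<eta>) \<longlonglongrightarrow> y x \<eta>" by (rule LIMSEQ_Suc[OF lim[OF xj]])
    ultimately have "(\<lambda>n. of_nat p * x ^ (p - 1) / \<eta> ^ p * Y (Suc n) x \<eta> + rhs (Y n) x \<eta>)
       \<longlonglongrightarrow> of_nat p * x ^ (p - 1) / \<eta> ^ p * y x \<eta> + rhs y x \<eta>"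
      by (intro tendsto_add tendsto_mult tendsto_const)
    from LIMSEQ_unique[OF d' this]
    show "((\<lambda>x. y x \<eta>) has_field_derivative of_nat p * x ^ (p - 1) / \<eta> ^ p * y x \<eta> + rhs y x \<eta>) (at x)"
      using holomorphic_derivI[OF yh op x] by simp
  qed
  \<comment> \<open>The equation itself supplies the partial derivative in \<open>x\<close>, and it
    is continuous because \<open>y\<close> and \<open>P\<close> are.\<close>
  have "holomorphic2_on (\<lambda>(x, \<eta>). y x \<eta>) (joint h)"
  proof (rule holomorphic2_onI[OF joint_open])
    show "((\<lambda>x. y x e) has_field_derivative of_nat p * x ^ (p - 1) / e ^ p * y x e + rhs y x e) (at x)"
      if "(x, e) \<in> joint h" for x e
      using yode[of e] that by (simp add: joint_def linear_ode_def)
    show "y x holomorphic_on {e. (x, e) \<in> joint h}" for x using yg by (simp add: good_def)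
    have "norm (y x \<eta>) \<le> r2 / 2" if "(x, \<eta>) \<in> joint h" for x \<eta> using ylt[OF that] by simp
    from good_continuous[OF yg this]
    have yc: "continuous_on (joint h) (\<lambda>z. y (fst z) (snd z))" by (simp add: case_prod_beta')
    have "continuous_on (joint h) ((\<lambda>(x, y, e). P x y e) \<circ> (\<lambda>z. (fst z, y (fst z) (snd z), snd z ^ p)))"
    proof (rule continuous_on_compose[OF _ continuous_on_subset[OF Pc]])
      show "continuous_on (joint h) (\<lambda>z. (fst z, y (fst z) (snd z), snd z ^ p))" by (intro continuous_intros yc)
      show "(\<lambda>z. (fst z, y (fst z) (snd z), snd z ^ p)) ` joint h \<subseteq> ball 0 r0 \<times> ball 0 r2 \<times> \<Sigma>e"
      proof (rule image_subsetI)
        fix z assume z: "z \<in> joint h"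
        then have "(fst z, snd z) \<in> joint h" by simp
        from dom[OF this, of "y (fst z) (snd z)"] ylt[OF this] r2
        show "(fst z, y (fst z) (snd z), snd z ^ p) \<in> ball 0 r0 \<times> ball 0 r2 \<times> \<Sigma>e" by simp
      qed
    qed
    then have rc: "continuous_on (joint h) (\<lambda>z. rhs y (fst z) (snd z))" by (simp add: o_def rhs_def)
    show "continuous_on (joint h) (\<lambda>(x, e). of_nat p * x ^ (p - 1) / e ^ p * y x e + rhs y x e)"
      unfolding case_prod_beta' by (intro continuous_intros yc rc) (auto simp: joint_def S1_def)
  qed
  moreover have "norm (y x \<eta>) \<le> C * M * norm \<eta>" if "(x, \<eta>) \<in> joint h" for x \<eta>
    using yb[OF that] by (simp add: mult_ac)
  moreover have "C * M > 0" using C M by simp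
  ultimately show ?thesis using that[of h "C * M" y] h ylt yode by blast
qed

end

section \<open>Approximation of the solution by combined sums\<close>

lemma exp_shift_weight:
  "exp (Re ((y - a) / e) / 2) = exp (Re ((x - a) / e) / 2) * exp (Re ((y - x) / e) / 2)"
proof -
  have "(y - a) / e = (x - a) / e + (y - x) / e" by (simp add: diff_divide_distrib)
  then have "Re ((y - a) / e) / 2 = Re ((x - a) / e) / 2 + Re ((y - x) / e) / 2" by (simp add: add_divide_distrib)
  then show ?thesis by (simp only: exp_add)
qed

text \<open>Between two points \<open>E\<close> grows by the exponential of half the increment of
  \<open>Re (x ^ p / \<eta> ^ p)\<close>, the largest growth that is allowed; the constant
  \<open>c\<close> does not grow at all. The factor \<open>exp (m ^ p)\<close> accounts for the
  small disc.\<close>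

lemma admissible_weight_exp:
  assumes \<kappa>: "\<kappa> > 0" and p: "p \<ge> 1" and m: "m \<ge> 0" and c: "c \<ge> 0" and K: "K \<ge> 0" and \<eta>: "\<eta> \<noteq> 0"
  shows "admissible_weight p \<kappa> m (exp (m ^ p)) \<eta> W (\<lambda>x. K * (c + exp (Re ((x ^ p - a) / \<eta> ^ p) / 2)))"
proof -
  define E where "E x = exp (Re ((x ^ p - a) / \<eta> ^ p) / 2)" for x
  have E0: "E x > 0" for x by (simp add: E_def)
  have shift: "E y = E x * exp (Re ((y ^ p - x ^ p) / \<eta> ^ p) / 2)" for x y
    unfolding E_def by (rule exp_shift_weight)
  have L1: "exp (m ^ p) \<ge> 1" using m by simp
  have cmp: "K * (c + E y) \<le> exp (m ^ p) * (K * (c + E x)) * e" if "E y \<le> exp (m ^ p) * E x * e" "e \<ge> 1" for x y e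
  proof -
    have "1 * 1 \<le> exp (m ^ p) * e" using L1 that by (intro mult_mono) auto
    then have "c * 1 \<le> c * (exp (m ^ p) * e)" using c by (intro mult_left_mono) auto
    then have "c + E y \<le> c * (exp (m ^ p) * e) + exp (m ^ p) * E x * e" using that by linarith
    also have "\<dots> = exp (m ^ p) * e * (c + E x)" by (simp add: algebra_simps)
    finally have "c + E y \<le> exp (m ^ p) * e * (c + E x)" .
    then have "K * (c + E y) \<le> K * (exp (m ^ p) * e * (c + E x))" using K by (intro mult_left_mono)
    then show ?thesis by (simp add: mult_ac)
  qed
  have "admissible_weight p \<kappa> m (exp (m ^ p)) \<eta> W (\<lambda>x. K * (c + E x))"
    unfolding admissible_weight_def
  proof (intro conjI ballI impI)
    fix x
    show "K * (c + E x) \<ge> 0" using K c E0[of x] by (intro mult_nonneg_nonneg) auto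
    assume x: "norm x \<le> m * norm \<eta>"
    have "norm (x ^ p / \<eta> ^ p) = (norm x / norm \<eta>) ^ p" by (simp add: norm_divide norm_power power_divide)
    also have "\<dots> \<le> m ^ p" using x \<eta> by (intro power_mono) (auto simp: divide_le_eq)
    finally have r: "\<bar>Re (x ^ p / \<eta> ^ p)\<bar> \<le> m ^ p" using abs_Re_le_cmod order_trans by blast
    have mp: "m ^ p \<ge> 0" using m by simp
    have p0: "(0::complex) ^ p = 0" using p by (simp add: power_0_left)
    have "exp (Re ((x ^ p - 0 ^ p) / \<eta> ^ p) / 2) \<le> exp (m ^ p)" using r mp by (simp add: p0)
    then have "E x \<le> E 0 * exp (m ^ p)" unfolding shift[of x 0] using E0[of 0] by (intro mult_left_mono) auto
    then show "K * (c + E x) \<le> exp (m ^ p) * (K * (c + E 0))" using cmp[of x 0 1] by (simp add: mult.commute)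
    have "exp (Re ((0 ^ p - x ^ p) / \<eta> ^ p) / 2) \<le> exp (m ^ p)" using r mp by (simp add: p0)
    then have "E 0 \<le> E x * exp (m ^ p)" unfolding shift[of 0 x] using E0[of x] by (intro mult_left_mono) auto
    then show "K * (c + E 0) \<le> exp (m ^ p) * (K * (c + E x))" using cmp[of 0 x 1] by (simp add: mult.commute)
  next
    fix x and t :: real
    assume t: "t \<in> {0..1}" and x: "norm \<eta> \<le> norm x \<and> Re (x ^ p / \<eta> ^ p) \<le> - \<kappa> * (norm x / norm \<eta>) ^ p"
    define R where "R = Re (x ^ p / \<eta> ^ p)"
    have "0 \<le> \<kappa> * (norm x / norm \<eta>) ^ p" using \<kappa> by simp
    then have R: "R \<le> 0" using x unfolding R_def by linarith
    have tp: "t ^ p \<le> 1" using t by (simp add: power_le_one)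
    have "((of_real t * x) ^ p - x ^ p) / \<eta> ^ p = of_real (- (1 - t ^ p)) * (x ^ p / \<eta> ^ p)"
      by (simp add: power_mult_distrib algebra_simps diff_divide_distrib)
    then have "Re (((of_real t * x) ^ p - x ^ p) / \<eta> ^ p) = - (1 - t ^ p) * R"
      unfolding R_def by (simp only: times_complex.sel(1)) simp
    then have e: "E (of_real t * x) = E x * exp (- (1 - t ^ p) * R / 2)" using shift[of "of_real t * x" x] by simp
    have "- (1 - t ^ p) * R / 2 \<ge> 0" using R tp by (simp add: mult_nonpos_nonpos)
    then have "exp (- (1 - t ^ p) * R / 2) \<ge> 1" by simp
    then show "K * (c + E (of_real t * x)) \<le> exp (m ^ p) * (K * (c + E x)) * exp (- (1 - t ^ p) * Re (x ^ p / \<eta> ^ p) / 2)"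
      unfolding R_def[symmetric]
      by (intro cmp) (use e L1 E0[of x] in \<open>simp_all add: mult_le_cancel_right1\<close>)
  next
    fix x y
    assume xy: "norm \<eta> \<le> norm x \<and> norm x / 3 \<le> norm y \<and> 0 \<le> Re ((y ^ p - x ^ p) / \<eta> ^ p)"
    have "1 * (E x * exp (Re ((y ^ p - x ^ p) / \<eta> ^ p) / 2)) \<le> exp (m ^ p) * (E x * exp (Re ((y ^ p - x ^ p) / \<eta> ^ p) / 2))"
      using L1 E0[of x] by (intro mult_right_mono) auto
    then have "E y \<le> exp (m ^ p) * E x * exp (Re ((y ^ p - x ^ p) / \<eta> ^ p) / 2)"
      unfolding shift[of y x] by (simp add: mult.assoc)
    then show "K * (c + E y) \<le> exp (m ^ p) * (K * (c + E x)) * exp (Re ((y ^ p - x ^ p) / \<eta> ^ p) / 2)"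
      by (rule cmp) (use xy in simp)
  qed
  then show ?thesis by (simp add: E_def)
qed

section \<open>Taylor expansion of the coefficients of \<open>P\<close> in \<open>y\<close>\<close>

text \<open>Separate holomorphy with local bounds is stable under division by \<open>y\<close>, and
  it is all that combined sums require. The radius \<open>r2 / 2\<close> leaves room for Cauchy
  estimates and contains the values of the solution.\<close>

definition taylor_class :: "real \<Rightarrow> real \<Rightarrow> (complex \<Rightarrow> complex \<Rightarrow> complex) \<Rightarrow> bool" where
  "taylor_class r0 r2 Q \<longleftrightarrow> (\<forall>y\<in>ball 0 r2. (\<lambda>x. Q x y) holomorphic_on ball 0 r0) \<and>
     (\<forall>x\<in>ball 0 r0. Q x holomorphic_on ball 0 r2) \<and>
     (\<forall>r<r0. \<exists>B. \<forall>x\<in>cball 0 r. \<forall>y\<in>cball 0 (r2 / 2). norm (Q x y) \<le> B)"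

text \<open>\<open>Q1\<close> is the divided difference at \<open>y = 0\<close>. For
  \<open>|y| < r2 / 4\<close> it is bounded through a Lipschitz or derivative bound, otherwise by
  the quotient; the constant \<open>8 * B / r2\<close> covers both. At \<open>y = 0\<close> it is a
  derivative in \<open>y\<close>, and holomorphy in \<open>x\<close> comes from a locally uniform
  limit of nonzero \<open>y\<close>.\<close>

lemma taylor_class_divide:
  assumes Q: "taylor_class r0 r2 Q" and r2: "r2 > 0"
  obtains a Q1 where "a holomorphic_on ball 0 r0" "taylor_class r0 r2 Q1"
    "\<And>x y. Q x y = a x + y * Q1 x y"
proof -
  define Q1 where "Q1 x y = (if y = 0 then deriv (Q x) 0 else (Q x y - Q x 0) / (y - 0))" for x y
  have Qx: "(\<lambda>x. Q x y) holomorphic_on ball 0 r0" if "norm y < r2" for y using Q that by (simp add: taylor_class_def)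
  have Qy: "Q x holomorphic_on ball 0 r2" if "norm x < r0" for x using Q that by (simp add: taylor_class_def)
  have Q1y: "Q1 x holomorphic_on ball 0 r2" if "norm x < r0" for x
    unfolding Q1_def using pole_lemma_open[OF Qy[OF that] open_ball] .
  have bound: "\<exists>B. \<forall>x\<in>cball 0 r. \<forall>y\<in>cball 0 (r2 / 2). norm (Q1 x y) \<le> B" if r: "r < r0" for r
  proof -
    obtain B where B: "\<And>x y. norm x \<le> r \<Longrightarrow> norm y \<le> r2 / 2 \<Longrightarrow> norm (Q x y) \<le> B"
      using Q r unfolding taylor_class_def by (metis mem_cball_0)
    have "norm (Q1 x y) \<le> 8 * B / r2" if x: "norm x \<le> r" and y: "norm y \<le> r2 / 2" for x y
    proof -
      have hol: "Q x holomorphic_on ball 0 (r2 / 2)" by (rule holomorphic_on_subset[OF Qy]) (use x r r2 in auto)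
      have B0: "B \<ge> 0" using B[OF x y] norm_ge_zero order_trans by blast
      consider "y = 0" | "y \<noteq> 0" "norm y < r2 / 4" | "norm y \<ge> r2 / 4" by linarith
      then show ?thesis
      proof cases
        case 1
        have "norm (deriv (Q x) 0) \<le> 2 * B / (r2 / 2)"
          by (rule deriv_bound_Cauchy[OF hol]) (use B x r2 in auto)
        also have "\<dots> \<le> 8 * B / r2" using B0 r2 by (simp add: field_simps)
        finally show ?thesis using 1 by (simp add: Q1_def)
      next
        case 2
        have "norm (Q x y - Q x 0) \<le> 2 * B / (r2 / 4) * norm (y - 0)"
          by (rule lipschitz_Cauchy[of "Q x" 0 "r2 / 4"]) (use hol 2 B x r2 in auto)
        then have "norm (Q x y - Q x 0) / norm y \<le> 8 * B / r2" using 2 r2 by (simp add: field_simps)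
        then show ?thesis using 2 by (simp add: Q1_def norm_divide)
      next
        case 3
        then have y0: "norm y > 0" using r2 by (meson divide_pos_pos less_le_trans zero_less_numeral)
        have "norm (Q x y - Q x 0) \<le> B + B"
          using B[OF x y] B[OF x, of 0] r2 norm_triangle_ineq4[of "Q x y" "Q x 0"] by auto
        then have "norm (Q x y - Q x 0) / norm y \<le> (B + B) / (r2 / 4)"
          using 3 B0 r2 by (intro frac_le) auto
        then show ?thesis using y0 by (simp add: Q1_def norm_divide)
      qed
    qed
    then show ?thesis by (metis mem_cball_0)
  qed
  have "(\<lambda>x. Q1 x y) holomorphic_on ball 0 r0" if y: "norm y < r2" for y
  proof (cases "y = 0")
    case False
    then show ?thesis unfolding Q1_def using Qx[OF y] Qx[of 0] r2
      by (auto intro!: holomorphic_intros)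
  next
    case True
    \<comment> \<open>The factor \<open>r2 / 8\<close> keeps these points in the disc of radius
      \<open>r2 / 4\<close> on which the Lipschitz estimate holds.\<close>
    define e where "e n = complex_of_real (r2 / 8 * inverse (real (Suc n)))" for n
    have e: "e n \<noteq> 0" "norm (e n) = r2 / 8 * inverse (real (Suc n))" for n
      unfolding e_def norm_of_real of_real_eq_0_iff using r2 by simp_all
    have elt: "norm (e n) < r2 / 4" for n
    proof -
      have "inverse (real (Suc n)) \<le> 1" by (simp add: field_simps)
      then have "r2 / 8 * inverse (real (Suc n)) \<le> r2 / 8 * 1" using r2 by (intro mult_left_mono) auto
      then show ?thesis using r2 unfolding e by simp
    qed
    have "(\<lambda>x. Q1 x 0) holomorphic_on ball 0 r0"
    proof (rule holomorphic_uniform_sequence[OF open_ball, where f = "\<lambda>n x. Q1 x (e n)"])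
      show "(\<lambda>x. Q1 x (e n)) holomorphic_on ball 0 r0" for n
      proof -
        have "norm (e n) < r2" using elt[of n] r2 by linarith
        from Qx[OF this] show ?thesis unfolding Q1_def using Qx[of 0] r2 e(1)[of n]
          by (auto intro!: holomorphic_intros)
      qed
      fix z assume "z \<in> ball (0::complex) r0"
      then obtain d where d: "d > 0" "cball z d \<subseteq> ball 0 r0" using open_contains_cball by blast
      have "compact (norm ` cball z d)" by (intro compact_continuous_image continuous_intros) auto
      moreover have "norm ` cball z d \<noteq> {}" using d by auto
      ultimately have "\<exists>s\<in>norm ` cball z d. \<forall>t\<in>norm ` cball z d. t \<le> s" by (rule compact_attains_sup)
      then obtain s where s: "s \<in> norm ` cball z d" "\<forall>t\<in>norm ` cball z d. t \<le> s" by (elim bexE)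
      have sr: "s < r0" using s d by auto
      obtain B where B: "\<And>x y. norm x \<le> s \<Longrightarrow> norm y \<le> r2 / 2 \<Longrightarrow> norm (Q1 x y) \<le> B"
        using bound[OF sr] by (metis mem_cball_0)
      have "uniform_limit (cball z d) (\<lambda>n x. Q1 x (e n)) (\<lambda>x. Q1 x 0) sequentially"
      proof (rule uniform_limitI)
        fix c :: real assume c: "c > 0"
        have "(\<lambda>n. 2 * B / (r2 / 4) * (r2 / 8 * inverse (real (Suc n)))) \<longlonglongrightarrow> 2 * B / (r2 / 4) * (r2 / 8 * 0)"
          by (intro tendsto_intros LIMSEQ_inverse_real_of_nat)
        then have "\<forall>\<^sub>F n in sequentially. 2 * B / (r2 / 4) * (r2 / 8 * inverse (real (Suc n))) < c"
          using c by (intro order_tendstoD(2)) auto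
        then show "\<forall>\<^sub>F n in sequentially. \<forall>x\<in>cball z d. dist (Q1 x (e n)) (Q1 x 0) < c"
        proof eventually_elim
          case (elim n)
          show ?case
          proof
            fix x assume x: "x \<in> cball z d"
            then have xs: "norm x \<le> s" using s by auto
            have "norm (Q1 x (e n) - Q1 x 0) \<le> 2 * B / (r2 / 4) * norm (e n - 0)"
            proof (rule lipschitz_Cauchy[of "Q1 x" 0 "r2 / 4"])
              show "Q1 x holomorphic_on ball 0 (2 * (r2 / 4))"
                by (rule holomorphic_on_subset[OF Q1y]) (use xs sr r2 in auto)
            qed (use B xs r2 elt[of n] in auto)
            then show "dist (Q1 x (e n)) (Q1 x 0) < c" using elim by (simp add: dist_norm e)
          qed
        qed
      qed
      with d show "\<exists>d>0. cball z d \<subseteq> ball 0 r0 \<and> uniform_limit (cball z d) (\<lambda>n x. Q1 x (e n)) (\<lambda>x. Q1 x 0) sequentially"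
        by blast
    qed
    then show ?thesis using True by simp
  qed
  then have "taylor_class r0 r2 Q1" using Q1y bound by (simp add: taylor_class_def)
  moreover have "(\<lambda>x. Q x 0) holomorphic_on ball 0 r0" using Qx r2 by simp
  moreover have "Q x y = Q x 0 + y * Q1 x y" for x y by (simp add: Q1_def)
  ultimately show ?thesis using that by blast
qed

lemma taylor_class_expand:
  assumes Q: "taylor_class r0 r2 Q" and r2: "r2 > 0"
  shows "\<exists>a R. (\<forall>l. a l holomorphic_on ball 0 r0) \<and> taylor_class r0 r2 R \<and>
    (\<forall>x y. Q x y = (\<Sum>l<N. a l x * y ^ l) + y ^ N * R x y)"
proof (induction N)
  case 0
  show ?case by (rule exI[of _ "\<lambda>_ _. 0"], rule exI[of _ Q]) (use Q in auto)
next
  case (Suc N)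
  then obtain a R where aR: "\<And>l. a l holomorphic_on ball 0 r0" "taylor_class r0 r2 R"
    "\<And>x y. Q x y = (\<Sum>l<N. a l x * y ^ l) + y ^ N * R x y" by blast
  obtain b R1 where b: "b holomorphic_on ball 0 r0" "taylor_class r0 r2 R1" "\<And>x y. R x y = b x + y * R1 x y"
    using taylor_class_divide[OF aR(2) r2] by blast
  define a' where "a' l = (if l < N then a l else b)" for l
  have "Q x y = (\<Sum>l<Suc N. a' l x * y ^ l) + y ^ Suc N * R1 x y" for x y
  proof -
    have "(\<Sum>l<N. a' l x * y ^ l) = (\<Sum>l<N. a l x * y ^ l)" by (intro sum.cong) (auto simp: a'_def)
    then show ?thesis unfolding aR(3)[of x y] b(3)[of x y] by (simp add: a'_def algebra_simps)
  qed
  moreover have "a' l holomorphic_on ball 0 r0" for l using aR b by (simp add: a'_def)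
  ultimately show ?case using b(2) by blast
qed

lemma holomorphic2_on_taylor_class:
  assumes f: "holomorphic2_on (\<lambda>(x, y). f x y) (ball 0 r0 \<times> ball 0 r2)" and r2: "r2 > 0"
  shows "taylor_class r0 r2 f"
  unfolding taylor_class_def
proof (intro conjI ballI allI impI)
  show "(\<lambda>x. f x y) holomorphic_on ball 0 r0" if "y \<in> ball 0 r2" for y
    by (rule holomorphic2_on_compose[OF f]) (use that in \<open>auto intro!: holomorphic_intros\<close>)
  show "f x holomorphic_on ball 0 r2" if "x \<in> ball 0 r0" for x
    by (rule holomorphic2_on_compose[OF f]) (use that in \<open>auto intro!: holomorphic_intros\<close>)
  fix r assume r: "r < r0"
  have "compact ((\<lambda>(x, y). f x y) ` (cball 0 r \<times> cball 0 (r2 / 2)))"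
    by (intro compact_continuous_image continuous_on_subset[OF holomorphic2_on_imp_continuous_on[OF f]] compact_Times)
      (use r r2 in auto)
  then obtain B where "\<And>z. z \<in> (\<lambda>(x, y). f x y) ` (cball 0 r \<times> cball 0 (r2 / 2)) \<Longrightarrow> norm z \<le> B"
    using compact_imp_bounded bounded_pos by metis
  then show "\<exists>B. \<forall>x\<in>cball 0 r. \<forall>y\<in>cball 0 (r2 / 2). norm (f x y) \<le> B" by fast
qed

section \<open>Errors that include a boundary layer at the base point\<close>

context canard begin

text \<open>The square root of the modulus of the homogeneous solution that is 1 at
  \<open>\<rho>\<close>. The root is taken to make it an admissible weight.\<close>

definition boundary_layer :: "complex \<Rightarrow> complex \<Rightarrow> real" where
  "boundary_layer x \<eta> = exp (Re ((x ^ p - of_real (\<rho> ^ p)) / \<eta> ^ p) / 2)"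

text \<open>Near \<open>\<rho>\<close> the boundary layer is of size 1 and the condition says no
  more than boundedness; away from \<open>\<rho>\<close> it means order \<open>N\<close>.\<close>

definition weakO :: "real \<Rightarrow> nat \<Rightarrow> (complex \<Rightarrow> complex \<Rightarrow> complex) \<Rightarrow> bool" where
  "weakO h N F \<longleftrightarrow> (\<exists>K. \<forall>x \<eta>. (x, \<eta>) \<in> joint h \<longrightarrow> norm (F x \<eta>) \<le> K * (norm \<eta> ^ N + boundary_layer x \<eta>))"

definition bddJ :: "real \<Rightarrow> (complex \<Rightarrow> complex \<Rightarrow> complex) \<Rightarrow> bool" where
  "bddJ h F \<longleftrightarrow> (\<exists>B. \<forall>x \<eta>. (x, \<eta>) \<in> joint h \<longrightarrow> norm (F x \<eta>) \<le> B)"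

lemma boundary_layer_pos: "boundary_layer x \<eta> > 0" by (simp add: boundary_layer_def)

lemma weight_pos: "norm \<eta> ^ N + boundary_layer x \<eta> > 0"
  using boundary_layer_pos[of x \<eta>] by (simp add: add_nonneg_pos)

lemma weakO_E:
  assumes "weakO h N F"
  obtains K where "K > 0" "\<And>x \<eta>. (x, \<eta>) \<in> joint h \<Longrightarrow> norm (F x \<eta>) \<le> K * (norm \<eta> ^ N + boundary_layer x \<eta>)"
proof -
  obtain K where K: "\<And>x \<eta>. (x, \<eta>) \<in> joint h \<Longrightarrow> norm (F x \<eta>) \<le> K * (norm \<eta> ^ N + boundary_layer x \<eta>)"
    using assms unfolding weakO_def by blast
  have "norm (F x \<eta>) \<le> (\<bar>K\<bar> + 1) * (norm \<eta> ^ N + boundary_layer x \<eta>)" if "(x, \<eta>) \<in> joint h" for x \<eta>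
    using K[OF that] mult_right_mono[of K "\<bar>K\<bar> + 1" "norm \<eta> ^ N + boundary_layer x \<eta>"] weight_pos[of \<eta> N x] by linarith
  then show ?thesis by (intro that[of "\<bar>K\<bar> + 1"]) auto
qed

lemma weakO_cong:
  "(\<And>x \<eta>. (x, \<eta>) \<in> joint h \<Longrightarrow> F x \<eta> = G x \<eta>) \<Longrightarrow> weakO h N G \<Longrightarrow> weakO h N F"
  unfolding weakO_def by auto

lemma weakO_add: assumes "weakO h N F" "weakO h N G" shows "weakO h N (\<lambda>x \<eta>. F x \<eta> + G x \<eta>)"
proof -
  obtain K where K: "\<And>x \<eta>. (x, \<eta>) \<in> joint h \<Longrightarrow> norm (F x \<eta>) \<le> K * (norm \<eta> ^ N + boundary_layer x \<eta>)"
    using assms(1) by (rule weakO_E) blast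
  obtain L where L: "\<And>x \<eta>. (x, \<eta>) \<in> joint h \<Longrightarrow> norm (G x \<eta>) \<le> L * (norm \<eta> ^ N + boundary_layer x \<eta>)"
    using assms(2) by (rule weakO_E) blast
  have "norm (F x \<eta> + G x \<eta>) \<le> (K + L) * (norm \<eta> ^ N + boundary_layer x \<eta>)" if "(x, \<eta>) \<in> joint h" for x \<eta>
    unfolding distrib_right[of K L] by (rule norm_triangle_le[OF add_mono[OF K[OF that] L[OF that]]])
  then show ?thesis unfolding weakO_def by blast
qed

lemma weakO_mult: assumes "weakO h N F" "bddJ h G" shows "weakO h N (\<lambda>x \<eta>. F x \<eta> * G x \<eta>)"
proof -
  obtain K where K: "K > 0" "\<And>x \<eta>. (x, \<eta>) \<in> joint h \<Longrightarrow> norm (F x \<eta>) \<le> K * (norm \<eta> ^ N + boundary_layer x \<eta>)"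
    using assms(1) by (rule weakO_E) blast
  obtain B where B: "\<And>x \<eta>. (x, \<eta>) \<in> joint h \<Longrightarrow> norm (G x \<eta>) \<le> B" using assms(2) unfolding bddJ_def by blast
  have "norm (F x \<eta> * G x \<eta>) \<le> (K * B) * (norm \<eta> ^ N + boundary_layer x \<eta>)" if "(x, \<eta>) \<in> joint h" for x \<eta>
  proof -
    have "norm (F x \<eta> * G x \<eta>) \<le> (K * (norm \<eta> ^ N + boundary_layer x \<eta>)) * B"
      unfolding norm_mult using K(1) weight_pos[of \<eta> N x] by (intro mult_mono K(2) B that) auto
    then show ?thesis by (simp add: mult_ac)
  qed
  then show ?thesis unfolding weakO_def by blast
qed

lemma weakO_sum: "finite S \<Longrightarrow> (\<And>i. i \<in> S \<Longrightarrow> weakO h N (F i)) \<Longrightarrow> weakO h N (\<lambda>x \<eta>. \<Sum>i\<in>S. F i x \<eta>)"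
proof (induction rule: finite_induct)
  case empty
  then show ?case unfolding weakO_def by (intro exI[of _ 0]) simp
qed (use weakO_add in simp)

lemma bddJ_mult: assumes "bddJ h F" "bddJ h G" shows "bddJ h (\<lambda>x \<eta>. F x \<eta> * G x \<eta>)"
proof -
  obtain A where A: "\<And>x \<eta>. (x, \<eta>) \<in> joint h \<Longrightarrow> norm (F x \<eta>) \<le> A" using assms(1) unfolding bddJ_def by blast
  obtain B where B: "\<And>x \<eta>. (x, \<eta>) \<in> joint h \<Longrightarrow> norm (G x \<eta>) \<le> B" using assms(2) unfolding bddJ_def by blast
  have "norm (F x \<eta> * G x \<eta>) \<le> A * B" if "(x, \<eta>) \<in> joint h" for x \<eta>
    unfolding norm_mult using A[OF that] B[OF that] order_trans[OF norm_ge_zero A[OF that]] by (intro mult_mono) auto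
  then show ?thesis unfolding bddJ_def by blast
qed

lemma bddJ_power: "bddJ h F \<Longrightarrow> bddJ h (\<lambda>x \<eta>. F x \<eta> ^ n)"
proof (induction n)
  case 0
  then show ?case unfolding bddJ_def by (intro exI[of _ 1]) simp
qed (use bddJ_mult in simp)

lemma bigO_imp_weakO: assumes h: "small h" and F: "bigO N F" shows "weakO h N F"
proof -
  obtain K where K: "K > 0" "\<And>x \<eta>. region x \<eta> \<Longrightarrow> norm (F x \<eta>) \<le> K * norm \<eta> ^ N" using F by (rule bigO_E) blast
  have "norm (F x \<eta>) \<le> K * (norm \<eta> ^ N + boundary_layer x \<eta>)" if "(x, \<eta>) \<in> joint h" for x \<eta>
  proof -
    have "K * norm \<eta> ^ N \<le> K * (norm \<eta> ^ N + boundary_layer x \<eta>)"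
      using K(1) boundary_layer_pos[of x \<eta>] by (intro mult_left_mono) auto
    with K(2)[OF region[OF h that]] show ?thesis by linarith
  qed
  then show ?thesis unfolding weakO_def by blast
qed

lemma comb_bddJ: "small h \<Longrightarrow> comb F \<Longrightarrow> bddJ h F"
  using comb_bounded[of F] region unfolding bigO_def bddJ_def by (metis mult.right_neutral power_0)

lemma weakO_power_diff:
  assumes "weakO h N (\<lambda>x \<eta>. F x \<eta> - G x \<eta>)" "bddJ h F" "bddJ h G"
  shows "weakO h N (\<lambda>x \<eta>. F x \<eta> ^ n - G x \<eta> ^ n)"
proof (induction n)
  case 0
  then show ?case unfolding weakO_def by (intro exI[of _ 0]) simp
next
  case (Suc n)
  have "weakO h N (\<lambda>x \<eta>. (F x \<eta> ^ n - G x \<eta> ^ n) * F x \<eta> + (F x \<eta> - G x \<eta>) * G x \<eta> ^ n)"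
    by (intro weakO_add weakO_mult Suc assms bddJ_power)
  then show ?case by (simp add: algebra_simps)
qed

text \<open>The difference \<open>y - U\<close> solves the linear equation with a source of order
  \<open>N\<close>, and the integration gains one factor \<open>|\<eta>|\<close>. At the base point
  it is known only to be bounded, and its propagation downhill is what the boundary layer
  absorbs.\<close>

lemma weakO_step:
  assumes h: "small h" and y: "bddJ h y"
    and ode: "\<And>\<eta>. \<eta> \<in> S1 h \<Longrightarrow> linear_ode p \<eta> (\<Omega> \<eta>) (\<lambda>x. f x \<eta>) (\<lambda>x. y x \<eta>)"
    and F: "combO N F" and d: "weakO h N (\<lambda>x \<eta>. f x \<eta> - F x \<eta>)"
  obtains U where "comb U" "weakO h (Suc N) (\<lambda>x \<eta>. y x \<eta> - U x \<eta>)"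
proof -
  obtain U R where U: "comb U" "bigO N R" "\<And>x \<eta>. region x \<eta> \<Longrightarrow> ((\<lambda>x. U x \<eta>) has_field_derivative
       (of_nat p * x ^ (p - 1) / \<eta> ^ p * U x \<eta> + F x \<eta> + R x \<eta>)) (at x)"
    using combO_solvable[OF F] unfolding solvable_def by blast
  define g where "g x \<eta> = (f x \<eta> - F x \<eta>) + (- R x \<eta>)" for x \<eta>
  have "weakO h N g" unfolding g_def by (intro weakO_add d bigO_imp_weakO[OF h] bigO_minus U)
  then obtain K1 where K1: "K1 > 0" "\<And>x \<eta>. (x, \<eta>) \<in> joint h \<Longrightarrow> norm (g x \<eta>) \<le> K1 * (norm \<eta> ^ N + boundary_layer x \<eta>)"
    by (rule weakO_E) blast
  obtain B1 where B1: "\<And>x \<eta>. (x, \<eta>) \<in> joint h \<Longrightarrow> norm (y x \<eta>) \<le> B1" using y unfolding bddJ_def by blast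
  obtain B2 where B2: "\<And>x \<eta>. (x, \<eta>) \<in> joint h \<Longrightarrow> norm (U x \<eta>) \<le> B2"
    using comb_bddJ[OF h U(1)] unfolding bddJ_def by blast
  define B where "B = \<bar>B1\<bar> + \<bar>B2\<bar>"
  \<comment> \<open>\<open>K1\<close> covers the source and \<open>2 * B\<close> the boundary term,
    with \<open>B\<close> a bound for \<open>y - U\<close>.\<close>
  define K where "K = K1 + 2 * B"
  have B0: "B \<ge> 0" by (simp add: B_def)
  have K: "K > 0" using K1 B0 by (simp add: K_def)
  have uB: "norm (y x \<eta> - U x \<eta>) \<le> B" if "(x, \<eta>) \<in> joint h" for x \<eta>
    using B1[OF that] B2[OF that] norm_triangle_ineq4[of "y x \<eta>" "U x \<eta>"] unfolding B_def by linarith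
  have sd: "sin \<delta> > 0" using sin_pos_less_1[OF \<delta>] by simp
  have L: "exp (m ^ p) \<ge> 1" using m by simp
  obtain C where C: "C > 0" and est: "\<And>\<eta> W q u f \<phi> x. accessible p (sin \<delta>) m \<eta> W q \<Longrightarrow> admissible_weight p (sin \<delta>) m (exp (m ^ p)) \<eta> W \<phi> \<Longrightarrow>
       linear_ode p \<eta> W f u \<Longrightarrow> (\<And>x. x \<in> W \<Longrightarrow> norm \<eta> * norm (f x) \<le> \<phi> x) \<Longrightarrow>
       (\<And>x. x \<in> W \<Longrightarrow> x = of_real (norm \<eta>) \<or> \<not> small_or_descending p (sin \<delta>) m \<eta> x \<Longrightarrow>
          \<exists>\<^sub>F n in sequentially. norm (u (of_real (q n))) * exp (Re ((x ^ p - of_real (q n ^ p)) / \<eta> ^ p)) \<le> \<phi> x) \<Longrightarrow>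
       x \<in> W \<Longrightarrow> norm (u x) \<le> C * \<phi> x"
    using accessible_estimate[OF p1 sd m(1) L] by blast
  have "norm (y x \<eta> - U x \<eta>) \<le> (C * K) * (norm \<eta> ^ Suc N + boundary_layer x \<eta>)" if x: "(x, \<eta>) \<in> joint h" for x \<eta>
  proof -
    have \<eta>: "\<eta> \<in> S1 h" and xO: "x \<in> \<Omega> \<eta>" using x by (auto simp: joint_def)
    have jn: "(z, \<eta>) \<in> joint h" if "z \<in> \<Omega> \<eta>" for z using that \<eta> by (simp add: joint_def)
    have \<eta>0: "\<eta> \<noteq> 0" and n1: "norm \<eta> \<le> 1" using region[OF h x] by (auto simp: region_def)
    note acc = accessible[OF h \<eta>]
    have wt: "admissible_weight p (sin \<delta>) m (exp (m ^ p)) \<eta> (\<Omega> \<eta>) (\<lambda>x. K * (norm \<eta> ^ Suc N + boundary_layer x \<eta>))"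
      unfolding boundary_layer_def by (rule admissible_weight_exp) (use sd p1 m K \<eta>0 in auto)
    have "norm (y x \<eta> - U x \<eta>) \<le> C * (K * (norm \<eta> ^ Suc N + boundary_layer x \<eta>))"
    proof (rule est[OF acc wt _ _ _ xO])
      show "linear_ode p \<eta> (\<Omega> \<eta>) (\<lambda>x. g x \<eta>) (\<lambda>x. y x \<eta> - U x \<eta>)"
        unfolding linear_ode_def
      proof
        fix z assume z: "z \<in> \<Omega> \<eta>"
        have "((\<lambda>x. y x \<eta>) has_field_derivative (of_nat p * z ^ (p - 1) / \<eta> ^ p * y z \<eta> + f z \<eta>)) (at z)"
          using ode[OF \<eta>] z by (simp add: linear_ode_def)
        from DERIV_diff[OF this U(3)[OF region[OF h jn[OF z]]]]
        show "((\<lambda>x. y x \<eta> - U x \<eta>) has_field_derivative (of_nat p * z ^ (p - 1) / \<eta> ^ p * (y z \<eta> - U z \<eta>) + g z \<eta>)) (at z)"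
          by (simp add: g_def algebra_simps diff_divide_distrib)
      qed
      fix z assume z: "z \<in> \<Omega> \<eta>"
      note bl = boundary_layer_pos[of z \<eta>]
      have "norm \<eta> * norm (g z \<eta>) \<le> norm \<eta> * (K1 * (norm \<eta> ^ N + boundary_layer z \<eta>))"
        by (intro mult_left_mono K1 jn z) auto
      also have "\<dots> = K1 * (norm \<eta> ^ Suc N + norm \<eta> * boundary_layer z \<eta>)" by (simp add: algebra_simps)
      also have "\<dots> \<le> K * (norm \<eta> ^ Suc N + boundary_layer z \<eta>)"
      proof (intro mult_mono add_left_mono)
        show "norm \<eta> * boundary_layer z \<eta> \<le> boundary_layer z \<eta>" using n1 bl by (simp add: mult_left_le_one_le)
      qed (use B0 K bl in \<open>auto simp: K_def\<close>)
      finally show "norm \<eta> * norm (g z \<eta>) \<le> K * (norm \<eta> ^ Suc N + boundary_layer z \<eta>)" .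
      assume s: "z = of_real (norm \<eta>) \<or> \<not> small_or_descending p (sin \<delta>) m \<eta> z"
      define r where "r = Re ((z ^ p - of_real (\<rho> ^ p)) / \<eta> ^ p)"
      have lim: "(\<lambda>n. Re ((z ^ p - of_real (q n ^ p)) / \<eta> ^ p)) \<longlonglongrightarrow> r"
        unfolding r_def by (intro tendsto_intros q) (use \<eta>0 in auto)
      have "\<forall>\<^sub>F n in sequentially. \<exists>T. T 1 = of_real (q n) \<and> ascending_chord p (sin \<delta>) \<eta> (\<Omega> \<eta>) z T (of_real (q n ^ p) - z ^ p)"
        using acc z s unfolding accessible_def by blast
      then have "\<forall>\<^sub>F n in sequentially. Re ((z ^ p - of_real (q n ^ p)) / \<eta> ^ p) \<le> 0"
      proof eventually_elim
        case (elim n)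
        then have "sin \<delta> * norm (of_real (q n ^ p) - z ^ p) / norm \<eta> ^ p \<le> Re ((of_real (q n ^ p) - z ^ p) / \<eta> ^ p)"
          by (auto simp: ascending_chord_def)
        moreover have "0 \<le> sin \<delta> * norm (of_real (q n ^ p) - z ^ p) / norm \<eta> ^ p" using sd by simp
        moreover have "Re ((z ^ p - of_real (q n ^ p)) / \<eta> ^ p) = - Re ((of_real (q n ^ p) - z ^ p) / \<eta> ^ p)"
          by (simp add: diff_divide_distrib)
        ultimately show ?case by linarith
      qed
      \<comment> \<open>The chords from \<open>z\<close> to \<open>q n\<close> ascend, so in the
        limit \<open>\<rho>\<close> lies at least as high as \<open>z\<close>.\<close>
      then have r0: "r \<le> 0" by (intro tendsto_upperbound[OF lim]) auto
      have "(\<lambda>n. exp (Re ((z ^ p - of_real (q n ^ p)) / \<eta> ^ p))) \<longlonglongrightarrow> exp r" by (intro tendsto_intros lim)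
      \<comment> \<open>For \<open>r \<le> 0\<close> the full exponential is at most its square
        root; the factor 2 makes the inequality strict, so that it holds for almost all
        \<open>q n\<close>.\<close>
      moreover have "exp r < 2 * boundary_layer z \<eta>"
      proof -
        have "exp r \<le> boundary_layer z \<eta>" using r0 by (simp add: boundary_layer_def r_def)
        then show ?thesis using bl by linarith
      qed
      ultimately have "\<forall>\<^sub>F n in sequentially. exp (Re ((z ^ p - of_real (q n ^ p)) / \<eta> ^ p)) < 2 * boundary_layer z \<eta>"
        by (rule order_tendstoD)
      then have "\<forall>\<^sub>F n in sequentially. norm (y (of_real (q n)) \<eta> - U (of_real (q n)) \<eta>) * exp (Re ((z ^ p - of_real (q n ^ p)) / \<eta> ^ p)) \<le> K * (norm \<eta> ^ Suc N + boundary_layer z \<eta>)"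
      proof eventually_elim
        case (elim n)
        have "norm (y (of_real (q n)) \<eta> - U (of_real (q n)) \<eta>) * exp (Re ((z ^ p - of_real (q n ^ p)) / \<eta> ^ p)) \<le> B * (2 * boundary_layer z \<eta>)"
          using elim uB[OF jn[OF q_in[OF h \<eta>]]] B0 by (intro mult_mono) auto
        also have "\<dots> = (2 * B) * boundary_layer z \<eta>" by simp
        also have "\<dots> \<le> K * (norm \<eta> ^ Suc N + boundary_layer z \<eta>)"
          using K1 B0 bl by (intro mult_mono) (auto simp: K_def)
        finally show ?case .
      qed
      then show "\<exists>\<^sub>F n in sequentially. norm (y (of_real (q n)) \<eta> - U (of_real (q n)) \<eta>) * exp (Re ((z ^ p - of_real (q n ^ p)) / \<eta> ^ p)) \<le> K * (norm \<eta> ^ Suc N + boundary_layer z \<eta>)"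
        by (intro eventually_frequently) auto
    qed
    then show ?thesis by (simp add: mult.assoc)
  qed
  then have "weakO h (Suc N) (\<lambda>x \<eta>. y x \<eta> - U x \<eta>)" unfolding weakO_def by blast
  then show ?thesis using that U(1) by blast
qed

text \<open>Three errors of order \<open>N\<close> are added: the remainder of the expansion in
  \<open>\<epsilon>\<close>, the Taylor remainder in \<open>y\<close>, which contains
  \<open>y ^ N\<close> with \<open>y\<close> of order \<open>|\<eta>|\<close>, and the replacement
  of \<open>y\<close> by \<open>H\<close> in a polynomial.\<close>

lemma rhs_comb_approximation:
  assumes h: "small h" and K: "K > 0" and yK: "\<And>x \<eta>. (x, \<eta>) \<in> joint h \<Longrightarrow> norm (y x \<eta>) \<le> K * norm \<eta>"
    and ylt: "\<And>x \<eta>. (x, \<eta>) \<in> joint h \<Longrightarrow> norm (y x \<eta>) < r2 / 2"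
    and Pk: "\<And>k. holomorphic2_on (\<lambda>(x, y). Pk k x y) (ball 0 r0 \<times> ball 0 r2)"
    and Pr: "\<And>x y e. x \<in> ball 0 r0 \<Longrightarrow> y \<in> ball 0 r2 \<Longrightarrow> e \<in> \<Sigma>e \<Longrightarrow> norm (P x y e - (\<Sum>k<N. Pk k x y * e ^ k)) \<le> CP * norm e ^ N"
    and H: "comb H" "weakO h N (\<lambda>x \<eta>. y x \<eta> - H x \<eta>)"
  obtains F where "combO N F" "weakO h N (\<lambda>x \<eta>. rhs y x \<eta> - F x \<eta>)"
proof -
  define \<Phi> where "\<Phi> k a R \<longleftrightarrow> (\<forall>l. a l holomorphic_on ball 0 r0) \<and> taylor_class r0 r2 R \<and>
    (\<forall>x y. Pk k x y = (\<Sum>l<N. a l x * y ^ l) + y ^ N * R x y)" for k :: nat and a R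
  have "\<exists>a R. \<Phi> k a R" for k unfolding \<Phi>_def
    by (rule taylor_class_expand[OF holomorphic2_on_taylor_class[OF Pk r2] r2])
  then obtain a R where "\<And>k. \<Phi> k (a k) (R k)" by metis
  then have aR: "\<And>k l. a k l holomorphic_on ball 0 r0" "\<And>k. taylor_class r0 r2 (R k)"
    "\<And>k x y. Pk k x y = (\<Sum>l<N. a k l x * y ^ l) + y ^ N * R k x y" unfolding \<Phi>_def by blast+
  \<comment> \<open>The factor 1 makes the power of \<open>\<eta>\<close> an instance of
    \<open>comb_const_power\<close>, applied to a constant function of \<open>x\<close>.\<close>
  define F where "F x \<eta> = (\<Sum>k<N. (\<Sum>l<N. a k l x * H x \<eta> ^ l) * (\<eta> ^ (p * k) * 1))" for x \<eta>
  have comb1: "comb (\<lambda>x \<eta>. \<eta> ^ n * 1)" for n by (rule comb_const_power[OF outer]) simp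
  have "combO N F" unfolding F_def
    by (intro combO_sum combO_mult combO_power comb_imp_combO H outer aR comb1) auto
  moreover have "weakO h N (\<lambda>x \<eta>. rhs y x \<eta> - F x \<eta>)"
  proof -
    have yB: "bddJ h y" unfolding bddJ_def by (intro exI[of _ "r2 / 2"]) (use ylt less_imp_le in blast)
    have HB: "bddJ h H" by (rule comb_bddJ[OF h H(1)])
    have xr: "norm x < \<rho>" and n1: "norm \<eta> \<le> 1" if "(x, \<eta>) \<in> joint h" for x \<eta>
      using region[OF h that] by (auto simp: region_def)
    have eB: "bddJ h (\<lambda>x \<eta>. \<eta> ^ n * 1)" for n
      unfolding bddJ_def by (intro exI[of _ 1]) (use n1 in \<open>auto simp: norm_power power_le_one\<close>)
    have aB: "bddJ h (\<lambda>x \<eta>. a k l x)" for k l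
      by (rule comb_bddJ[OF h outer[OF aR(1)]])
    have RB: "bddJ h (\<lambda>x \<eta>. R k x (y x \<eta>))" for k
    proof -
      obtain B where B: "\<forall>x\<in>cball 0 \<rho>. \<forall>y\<in>cball 0 (r2 / 2). norm (R k x y) \<le> B"
        using aR(2)[of k] \<rho> unfolding taylor_class_def by blast
      have "norm (R k x (y x \<eta>)) \<le> B" if "(x, \<eta>) \<in> joint h" for x \<eta>
        using B xr[OF that] ylt[OF that] by simp
      then show ?thesis unfolding bddJ_def by blast
    qed
    have small_weight: "weakO h N G" if "\<And>x \<eta>. (x, \<eta>) \<in> joint h \<Longrightarrow> norm (G x \<eta>) \<le> c * norm \<eta> ^ N" for G c
    proof -
      have "norm (G x \<eta>) \<le> \<bar>c\<bar> * (norm \<eta> ^ N + boundary_layer x \<eta>)" if j: "(x, \<eta>) \<in> joint h" for x \<eta>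
      proof -
        have "c * norm \<eta> ^ N \<le> \<bar>c\<bar> * (norm \<eta> ^ N + boundary_layer x \<eta>)"
          using boundary_layer_pos[of x \<eta>] by (intro mult_mono) auto
        with \<open>\<And>x \<eta>. (x, \<eta>) \<in> joint h \<Longrightarrow> norm (G x \<eta>) \<le> c * norm \<eta> ^ N\<close>[OF j] show ?thesis by linarith
      qed
      then show ?thesis unfolding weakO_def by blast
    qed
    have "weakO h N (\<lambda>x \<eta>. rhs y x \<eta> - (\<Sum>k<N. Pk k x (y x \<eta>) * (\<eta> ^ p) ^ k))"
    proof (rule small_weight[of _ "\<bar>CP\<bar>"])
      fix x \<eta> assume j: "(x, \<eta>) \<in> joint h"
      have "norm (rhs y x \<eta> - (\<Sum>k<N. Pk k x (y x \<eta>) * (\<eta> ^ p) ^ k)) \<le> CP * norm (\<eta> ^ p) ^ N"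
        unfolding rhs_def by (rule Pr) (use xr[OF j] ylt[OF j] r2 \<rho> power_in_Sigma[OF h, of \<eta>] j in \<open>auto simp: joint_def\<close>)
      also have "\<dots> \<le> \<bar>CP\<bar> * norm \<eta> ^ N"
      proof (intro mult_mono)
        have "norm \<eta> ^ p \<le> norm \<eta> ^ 1" using n1[OF j] p1 by (intro power_decreasing) auto
        then show "norm (\<eta> ^ p) ^ N \<le> norm \<eta> ^ N" unfolding norm_power by (intro power_mono) auto
      qed auto
      finally show "norm (rhs y x \<eta> - (\<Sum>k<N. Pk k x (y x \<eta>) * (\<eta> ^ p) ^ k)) \<le> \<bar>CP\<bar> * norm \<eta> ^ N" .
    qed
    moreover have "weakO h N (\<lambda>x \<eta>. \<Sum>k<N. (y x \<eta> ^ N * R k x (y x \<eta>)) * (\<eta> ^ (p * k) * 1))"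
    proof (intro weakO_sum weakO_mult RB eB)
      show "weakO h N (\<lambda>x \<eta>. y x \<eta> ^ N)"
      proof (rule small_weight[of _ "K ^ N"])
        fix x \<eta> assume "(x, \<eta>) \<in> joint h"
        then have "norm (y x \<eta>) ^ N \<le> (K * norm \<eta>) ^ N" by (intro power_mono yK) auto
        then show "norm (y x \<eta> ^ N) \<le> K ^ N * norm \<eta> ^ N" by (simp add: norm_power power_mult_distrib)
      qed
    qed auto
    moreover have "weakO h N (\<lambda>x \<eta>. \<Sum>k<N. (\<Sum>l<N. (y x \<eta> ^ l - H x \<eta> ^ l) * a k l x) * (\<eta> ^ (p * k) * 1))"
      by (intro weakO_sum weakO_mult eB aB weakO_power_diff H yB HB) auto
    ultimately have "weakO h N (\<lambda>x \<eta>. (rhs y x \<eta> - (\<Sum>k<N. Pk k x (y x \<eta>) * (\<eta> ^ p) ^ k)) +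
        ((\<Sum>k<N. (y x \<eta> ^ N * R k x (y x \<eta>)) * (\<eta> ^ (p * k) * 1)) +
         (\<Sum>k<N. (\<Sum>l<N. (y x \<eta> ^ l - H x \<eta> ^ l) * a k l x) * (\<eta> ^ (p * k) * 1))))"
      by (intro weakO_add)
    then show ?thesis
    proof (rule weakO_cong[rotated])
      fix x \<eta>
      have "Pk k x (y x \<eta>) * (\<eta> ^ p) ^ k - (\<Sum>l<N. a k l x * H x \<eta> ^ l) * (\<eta> ^ (p * k) * 1)
        = (y x \<eta> ^ N * R k x (y x \<eta>)) * (\<eta> ^ (p * k) * 1) + (\<Sum>l<N. (y x \<eta> ^ l - H x \<eta> ^ l) * a k l x) * (\<eta> ^ (p * k) * 1)" for k
        unfolding aR(3) power_mult by (simp add: left_diff_distrib sum_subtractf algebra_simps)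
      then have "(\<Sum>k<N. Pk k x (y x \<eta>) * (\<eta> ^ p) ^ k) - F x \<eta> =
        (\<Sum>k<N. (y x \<eta> ^ N * R k x (y x \<eta>)) * (\<eta> ^ (p * k) * 1)) +
         (\<Sum>k<N. (\<Sum>l<N. (y x \<eta> ^ l - H x \<eta> ^ l) * a k l x) * (\<eta> ^ (p * k) * 1))"
        unfolding F_def by (simp only: sum_subtractf[symmetric] sum.distrib[symmetric])
      then show "rhs y x \<eta> - F x \<eta> = (rhs y x \<eta> - (\<Sum>k<N. Pk k x (y x \<eta>) * (\<eta> ^ p) ^ k)) +
        ((\<Sum>k<N. (y x \<eta> ^ N * R k x (y x \<eta>)) * (\<eta> ^ (p * k) * 1)) +
         (\<Sum>k<N. (\<Sum>l<N. (y x \<eta> ^ l - H x \<eta> ^ l) * a k l x) * (\<eta> ^ (p * k) * 1)))"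
        by (simp add: algebra_simps)
    qed
  qed
  ultimately show ?thesis using that by blast
qed

lemma solution_comb_approximation:
  assumes h: "small h" and K: "K > 0" and yK: "\<And>x \<eta>. (x, \<eta>) \<in> joint h \<Longrightarrow> norm (y x \<eta>) \<le> K * norm \<eta>"
    and ylt: "\<And>x \<eta>. (x, \<eta>) \<in> joint h \<Longrightarrow> norm (y x \<eta>) < r2 / 2"
    and ode: "\<And>\<eta>. \<eta> \<in> S1 h \<Longrightarrow> linear_ode p \<eta> (\<Omega> \<eta>) (\<lambda>x. rhs y x \<eta>) (\<lambda>x. y x \<eta>)"
    and P: "uniform_asymptotic_expansion (ball 0 r0) (ball 0 r2) \<Sigma>e P"
  shows "\<exists>H. comb H \<and> weakO h N (\<lambda>x \<eta>. y x \<eta> - H x \<eta>)"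
proof (induction N)
  have yB: "bddJ h y" unfolding bddJ_def by (intro exI[of _ "r2 / 2"]) (use ylt less_imp_le in blast)
  {
    case 0
    have "weakO h 0 (\<lambda>x \<eta>. y x \<eta> - 0)"
    proof -
      have "norm (y x \<eta>) \<le> (r2 / 2) * (norm \<eta> ^ 0 + boundary_layer x \<eta>)" if "(x, \<eta>) \<in> joint h" for x \<eta>
      proof -
        have "r2 / 2 * 1 \<le> (r2 / 2) * (norm \<eta> ^ 0 + boundary_layer x \<eta>)"
          using r2 boundary_layer_pos[of x \<eta>] by (intro mult_left_mono) auto
        with ylt[OF that] show ?thesis by linarith
      qed
      then show ?thesis unfolding weakO_def by (intro exI[of _ "r2 / 2"]) simp
    qed
    then show ?case using comb_zero by (intro exI[of _ "\<lambda>x \<eta>. 0"]) auto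
  next
    case (Suc N)
    obtain Pk where Pk: "\<And>k. holomorphic2_on (\<lambda>(x, y). Pk k x y) (ball 0 r0 \<times> ball 0 r2)"
      and "\<And>N. \<exists>C. \<forall>x\<in>ball 0 r0. \<forall>y\<in>ball 0 r2. \<forall>e\<in>\<Sigma>e. norm (P x y e - (\<Sum>k<N. Pk k x y * e ^ k)) \<le> C * norm e ^ N"
      using P unfolding uniform_asymptotic_expansion_def by blast
    then obtain CP where CP: "\<And>x y e. x \<in> ball 0 r0 \<Longrightarrow> y \<in> ball 0 r2 \<Longrightarrow> e \<in> \<Sigma>e \<Longrightarrow> norm (P x y e - (\<Sum>k<N. Pk k x y * e ^ k)) \<le> CP * norm e ^ N"
      by meson
    obtain H where H: "comb H" "weakO h N (\<lambda>x \<eta>. y x \<eta> - H x \<eta>)" using Suc by blast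
    obtain F where F: "combO N F" "weakO h N (\<lambda>x \<eta>. rhs y x \<eta> - F x \<eta>)"
      using rhs_comb_approximation[OF h K yK ylt Pk CP H] by blast
    obtain U where "comb U" "weakO h (Suc N) (\<lambda>x \<eta>. y x \<eta> - U x \<eta>)"
      using weakO_step[OF h yB ode F] by blast
    then show ?case by blast
  }
qed

text \<open>For \<open>|x| \<le> r1\<close> the point \<open>x ^ p\<close> lies in the cone below
  \<open>\<rho> ^ p\<close> at a positive distance from its apex, so the height difference is at
  least a constant over \<open>|\<eta>| ^ p\<close>. The exponential then beats every power of
  \<open>|\<eta>|\<close>.\<close>

lemma boundary_layer_small:
  assumes r: "0 < r1" "r1 ^ p < \<rho> ^ p * cos (2 * \<delta>)"
  obtains K where "\<And>x \<eta>. \<eta> \<noteq> 0 \<Longrightarrow> norm \<eta> \<le> 1 \<Longrightarrow> real p * \<bar>Arg \<eta>\<bar> < \<delta> \<Longrightarrow> norm x \<le> r1 \<Longrightarrow>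
    boundary_layer x \<eta> \<le> K * norm \<eta> ^ N"
proof -
  define R where "R = \<rho> ^ p"
  have R0: "R > 0" using \<rho> by (simp add: R_def)
  have sd: "sin \<delta> > 0" using sin_pos_less_1[OF \<delta>] by simp
  have "R * cos (2 * \<delta>) \<le> R * 1" using R0 by (intro mult_left_mono) auto
  then have rR: "r1 ^ p < R" using r(2) unfolding R_def by linarith
  \<comment> \<open>The division by 2 is the half exponent of the boundary layer;
    \<open>sin \<delta>\<close> is the ascent rate from \<open>cone_direction\<close>.\<close>
  define c where "c = sin \<delta> * (R - r1 ^ p) / 2"
  have c: "c > 0" using sd rR by (simp add: c_def)
  have "boundary_layer x \<eta> \<le> (fact N * (1 / c) ^ N) * norm \<eta> ^ N"
    if \<eta>: "\<eta> \<noteq> 0" "norm \<eta> \<le> 1" "real p * \<bar>Arg \<eta>\<bar> < \<delta>" and x: "norm x \<le> r1" for x \<eta>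
  proof -
    define D where "D = of_real R - x ^ p"
    have xp: "norm (x ^ p) \<le> r1 ^ p" unfolding norm_power using x by (intro power_mono) auto
    have ReD: "Re (D * cis t) > 0" if t: "t = 2 * \<delta> \<or> t = - (2 * \<delta>)" for t
    proof -
      have "Re (x ^ p * cis t) \<le> norm (x ^ p * cis t)" by (rule complex_Re_le_cmod)
      also have "\<dots> = norm (x ^ p)" by (simp add: norm_mult)
      finally have "Re (x ^ p * cis t) \<le> r1 ^ p" using xp by linarith
      moreover have "Re (of_real R * cis t) = R * cos (2 * \<delta>)" using t by auto
      moreover have "Re (D * cis t) = Re (of_real R * cis t) - Re (x ^ p * cis t)"
        by (simp only: D_def left_diff_distrib minus_complex.sel)
      ultimately show ?thesis using r(2) unfolding R_def[symmetric] by linarith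
    qed
    have "D \<noteq> 0" using ReD[of "2 * \<delta>"] by auto
    then have "sin \<delta> * norm D \<le> Re (D * cis (- (real p * Arg \<eta>)))"
      by (rule cone_direction[OF \<delta> _ ReD[of "2 * \<delta>"] ReD[of "- (2 * \<delta>)"]]) (use \<eta> in \<open>auto simp: abs_mult\<close>)
    moreover have "Re (D / \<eta> ^ p) = Re (D * cis (- (real p * Arg \<eta>))) / norm \<eta> ^ p"
    proof -
      have "D / \<eta> ^ p = D * cis (- (real p * Arg \<eta>)) / of_real (norm \<eta> ^ p)"
        by (subst power_polar[of \<eta>]) (simp add: rcis_def divide_inverse cis_inverse mult_ac)
      then show ?thesis by (simp only: Re_divide_of_real)
    qed
    ultimately have re: "sin \<delta> * norm D / norm \<eta> ^ p \<le> Re (D / \<eta> ^ p)" by (simp add: divide_right_mono)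
    have "R - r1 ^ p \<le> norm D"
    proof -
      have "norm (of_real R :: complex) - norm (x ^ p) \<le> norm D" unfolding D_def by (rule norm_triangle_ineq2)
      then show ?thesis using xp R0 by simp
    qed
    then have "sin \<delta> * (R - r1 ^ p) / norm \<eta> ^ p \<le> sin \<delta> * norm D / norm \<eta> ^ p"
      using sd by (intro divide_right_mono mult_left_mono) auto
    with re have "2 * c / norm \<eta> ^ p \<le> Re (D / \<eta> ^ p)" by (simp add: c_def)
    moreover have "Re ((x ^ p - of_real (\<rho> ^ p)) / \<eta> ^ p) = - Re (D / \<eta> ^ p)"
      by (simp add: D_def R_def diff_divide_distrib)
    ultimately have bl: "boundary_layer x \<eta> \<le> exp (- (c / norm \<eta> ^ p))"
      unfolding boundary_layer_def exp_le_cancel_iff by linarith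
    have np: "norm \<eta> ^ p > 0" using \<eta> by simp
    have "(c / norm \<eta> ^ p) ^ N \<le> fact N * exp (c / norm \<eta> ^ p)" using c np by (intro power_le_fact_exp) auto
    then have "exp (- (c / norm \<eta> ^ p)) \<le> fact N / (c / norm \<eta> ^ p) ^ N"
      using c np by (simp add: exp_minus field_simps)
    also have "\<dots> = (fact N * (1 / c) ^ N) * (norm \<eta> ^ p) ^ N" using c np by (simp add: power_divide)
    also have "\<dots> \<le> (fact N * (1 / c) ^ N) * norm \<eta> ^ N"
    proof (intro mult_left_mono power_mono)
      show "norm \<eta> ^ p \<le> norm \<eta>" using \<eta> p1 power_decreasing[of 1 p "norm \<eta>"] by simp
    qed (use c in auto)
    finally show ?thesis using bl by linarith
  qed
  then show ?thesis using that by blast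
qed

end

section \<open>Uniqueness of the coefficients and the theorem\<close>

lemma eq_zero_if_small:
  fixes z :: "'a::real_normed_vector"
  assumes d: "d > 0" and le: "\<And>t. 0 < t \<Longrightarrow> t < d \<Longrightarrow> norm z \<le> C * t"
  shows "z = 0"
proof (rule ccontr)
  assume "z \<noteq> 0"
  then have z: "norm z > 0" by simp
  define t where "t = min (d / 2) (norm z / (2 * (\<bar>C\<bar> + 1)))"
  have t: "0 < t" "t < d" using d z by (auto simp: t_def)
  have "norm z \<le> C * t" using le t by blast
  also have "\<dots> \<le> (\<bar>C\<bar> + 1) * t" using t by (intro mult_right_mono) auto
  also have "\<dots> \<le> (\<bar>C\<bar> + 1) * (norm z / (2 * (\<bar>C\<bar> + 1)))" by (intro mult_left_mono) (auto simp: t_def)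
  also have "\<dots> = norm z / 2"
  proof -
    have "c * (w / (2 * c)) = w / 2" if "c \<noteq> 0" for c w :: real using that by simp
    moreover have "\<bar>C\<bar> + 1 \<noteq> 0" using abs_ge_zero[of C] by linarith
    ultimately show ?thesis by blast
  qed
  finally show False using z by simp
qed

text \<open>The constant term is of order \<open>t\<close>, hence zero; then \<open>t\<close>
  divides out and \<open>m\<close> drops by one.\<close>

lemma coeff_zero_if_small:
  fixes d :: "complex poly"
  assumes "\<And>t. 0 < t \<Longrightarrow> t \<le> 1 \<Longrightarrow> norm (poly d (of_real t)) \<le> C * t ^ m" "i < m"
  shows "coeff d i = 0"
  using assms
proof (induction m arbitrary: d i)
  case (Suc m)
  obtain a d' where d: "d = pCons a d'" by (rule pCons_cases)
  have "compact (poly d' ` cball 0 1)" by (intro compact_continuous_image continuous_intros) auto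
  then obtain B where B: "B > 0" "\<And>z. z \<in> cball 0 1 \<Longrightarrow> norm (poly d' z) \<le> B"
    using compact_imp_bounded bounded_pos by (metis imageI)
  have "a = 0"
  proof (rule eq_zero_if_small[of 1 _ "\<bar>C\<bar> + B"])
    fix t :: real assume t: "0 < t" "t < 1"
    have "a = poly d (of_real t) - of_real t * poly d' (of_real t)" by (simp add: d)
    then have "norm a \<le> norm (poly d (of_real t)) + norm (of_real t * poly d' (of_real t))"
      using norm_triangle_ineq4[of "poly d (of_real t)" "of_real t * poly d' (of_real t)"] by (simp only:)
    also have "norm (poly d (of_real t)) \<le> \<bar>C\<bar> * t"
    proof -
      have "norm (poly d (of_real t)) \<le> C * t ^ Suc m" using Suc.prems(1) t by simp
      also have "\<dots> \<le> \<bar>C\<bar> * t ^ 1" using t by (intro mult_mono power_decreasing) auto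
      finally show ?thesis by simp
    qed
    also have "norm (of_real t * poly d' (of_real t)) \<le> t * B"
      unfolding norm_mult using B t by (intro mult_mono) auto
    finally show "norm a \<le> (\<bar>C\<bar> + B) * t" by (simp add: algebra_simps)
  qed simp
  show ?case
  proof (cases i)
    case 0
    then show ?thesis using \<open>a = 0\<close> d by simp
  next
    case (Suc j)
    have "coeff d' j = 0"
    proof (rule Suc.IH)
      show "j < m" using Suc Suc.prems by simp
      fix t :: real assume t: "0 < t" "t \<le> 1"
      have "t * norm (poly d' (of_real t)) = norm (poly d (of_real t))"
        using t by (simp add: d \<open>a = 0\<close> norm_mult)
      also have "\<dots> \<le> t * (C * t ^ m)" using Suc.prems(1)[OF t] by (simp add: mult_ac)
      finally show "norm (poly d' (of_real t)) \<le> C * t ^ m" using t by simp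
    qed
    then show ?thesis using Suc d by simp
  qed
qed simp

lemma poly_split_low:
  fixes q :: "complex poly"
  shows "\<exists>r. \<forall>z. poly q z = (\<Sum>\<nu><N. coeff q \<nu> * z ^ \<nu>) + z ^ N * poly r z"
proof (induction N arbitrary: q)
  case 0
  then show ?case by auto
next
  case (Suc N)
  obtain a q' where q: "q = pCons a q'" by (rule pCons_cases)
  obtain r where r: "\<And>z. poly q' z = (\<Sum>\<nu><N. coeff q' \<nu> * z ^ \<nu>) + z ^ N * poly r z" using Suc by blast
  have "poly q z = (\<Sum>\<nu><Suc N. coeff q \<nu> * z ^ \<nu>) + z ^ Suc N * poly r z" for z
    unfolding q sum.lessThan_Suc_shift poly_pCons r by (simp add: sum_distrib_left algebra_simps)
  then show ?case by blast
qed

section \<open>From powers of \<open>sv X\<close> to powers of \<open>1 / X\<close>\<close>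

context layer begin

text \<open>The analogue of \<open>sv_expandable\<close> in the variable \<open>1 / X\<close>,
  restricted to \<open>|X| \<ge> 1\<close>; it serves to change the variable of the
  expansion.\<close>

definition invexp :: "(complex \<Rightarrow> complex) \<Rightarrow> bool" where
  "invexp f \<longleftrightarrow> (\<forall>N. \<exists>q C. \<forall>X\<in>V. norm X \<ge> 1 \<longrightarrow> norm (f X - poly q (1 / X)) \<le> C / norm X ^ N)"

lemma poly_inverse_bounded: "\<exists>B>0. \<forall>X. norm X \<ge> 1 \<longrightarrow> norm (poly q (1 / X :: complex)) \<le> B"
proof -
  have "compact (poly q ` cball (0::complex) 1)" by (intro compact_continuous_image continuous_intros) auto
  then obtain B where B: "B > 0" "\<And>z. z \<in> cball 0 1 \<Longrightarrow> norm (poly q z) \<le> B"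
    using compact_imp_bounded bounded_pos by (metis imageI)
  then show ?thesis by (intro exI[of _ B]) (auto simp: norm_divide divide_le_eq_1)
qed

lemma invexp_const: "invexp (\<lambda>X. c)"
  unfolding invexp_def by (intro allI exI[of _ "[:c:]"] exI[of _ 0]) simp

lemma invexp_add: assumes "invexp f" "invexp g" shows "invexp (\<lambda>X. f X + g X)"
  unfolding invexp_def
proof
  fix N
  obtain q C where q: "\<And>X. X \<in> V \<Longrightarrow> norm X \<ge> 1 \<Longrightarrow> norm (f X - poly q (1 / X)) \<le> C / norm X ^ N"
    using assms(1) unfolding invexp_def by blast
  obtain r D where r: "\<And>X. X \<in> V \<Longrightarrow> norm X \<ge> 1 \<Longrightarrow> norm (g X - poly r (1 / X)) \<le> D / norm X ^ N"
    using assms(2) unfolding invexp_def by blast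
  have "norm (f X + g X - poly (q + r) (1 / X)) \<le> (C + D) / norm X ^ N" if "X \<in> V" "norm X \<ge> 1" for X
    using q[OF that] r[OF that] norm_triangle_ineq[of "f X - poly q (1 / X)" "g X - poly r (1 / X)"]
    by (simp add: add_divide_distrib algebra_simps)
  then show "\<exists>q C. \<forall>X\<in>V. norm X \<ge> 1 \<longrightarrow> norm (f X + g X - poly q (1 / X)) \<le> C / norm X ^ N" by blast
qed

lemma invexp_mult: assumes "invexp f" "invexp g" shows "invexp (\<lambda>X. f X * g X)"
  unfolding invexp_def
proof
  fix N
  obtain q C where q: "\<And>X. X \<in> V \<Longrightarrow> norm X \<ge> 1 \<Longrightarrow> norm (f X - poly q (1 / X)) \<le> C / norm X ^ N"
    using assms(1) unfolding invexp_def by blast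
  obtain r D where r: "\<And>X. X \<in> V \<Longrightarrow> norm X \<ge> 1 \<Longrightarrow> norm (g X - poly r (1 / X)) \<le> D / norm X ^ N"
    using assms(2) unfolding invexp_def by blast
  obtain q0 C0 where q0: "\<And>X. X \<in> V \<Longrightarrow> norm X \<ge> 1 \<Longrightarrow> norm (f X - poly q0 (1 / X)) \<le> C0 / norm X ^ 0"
    using assms(1) unfolding invexp_def by blast
  obtain B0 where B0: "\<And>X. norm X \<ge> 1 \<Longrightarrow> norm (poly q0 (1 / X)) \<le> B0" using poly_inverse_bounded by blast
  obtain B1 where B1: "B1 > 0" "\<And>X. norm X \<ge> 1 \<Longrightarrow> norm (poly r (1 / X)) \<le> B1" using poly_inverse_bounded by blast
  have fB: "norm (f X) \<le> \<bar>C0\<bar> + \<bar>B0\<bar>" if "X \<in> V" "norm X \<ge> 1" for X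
    using q0[OF that] B0[OF that(2)] norm_triangle_ineq2[of "f X" "poly q0 (1 / X)"] by simp
  have "norm (f X * g X - poly (q * r) (1 / X)) \<le> ((\<bar>C0\<bar> + \<bar>B0\<bar>) * D + B1 * C) / norm X ^ N" if X: "X \<in> V" "norm X \<ge> 1" for X
  proof -
    have "f X * g X - poly (q * r) (1 / X) = f X * (g X - poly r (1 / X)) + poly r (1 / X) * (f X - poly q (1 / X))"
      by (simp add: algebra_simps)
    also have "norm \<dots> \<le> (\<bar>C0\<bar> + \<bar>B0\<bar>) * (D / norm X ^ N) + B1 * (C / norm X ^ N)"
      by (rule order_trans[OF norm_triangle_ineq], unfold norm_mult, intro add_mono mult_mono)
        (use q r fB B1 X in auto)
    finally show ?thesis by (simp add: add_divide_distrib)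
  qed
  then show "\<exists>q C. \<forall>X\<in>V. norm X \<ge> 1 \<longrightarrow> norm (f X * g X - poly q (1 / X)) \<le> C / norm X ^ N" by blast
qed

text \<open>Instead of a geometric series, the identity
  \<open>sv X = (1 / X) (1 - c0 * sv X)\<close> is iterated; each substitution gains one power of
  \<open>1 / X\<close>.\<close>

lemma invexp_sv: "invexp sv"
  unfolding invexp_def
proof
  fix N
  show "\<exists>q C. \<forall>X\<in>V. norm X \<ge> 1 \<longrightarrow> norm (sv X - poly q (1 / X)) \<le> C / norm X ^ N"
  proof (induction N)
    case 0
    show ?case by (rule exI[of _ 0], rule exI[of _ "3 + \<mu>"]) (use norm_sv_le' in auto)
  next
    case (Suc N)
    then obtain q C where q: "\<And>X. X \<in> V \<Longrightarrow> norm X \<ge> 1 \<Longrightarrow> norm (sv X - poly q (1 / X)) \<le> C / norm X ^ N" by blast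
    define c0 where "c0 = complex_of_real (\<mu> + 1)"
    define q' where "q' = pCons 0 (1 - smult c0 q)"
    have "norm (sv X - poly q' (1 / X)) \<le> (norm c0 * C) / norm X ^ Suc N" if X: "X \<in> V" "norm X \<ge> 1" for X
    proof -
      have X0: "X \<noteq> 0" using X by auto
      have "X * sv X = 1 - c0 * sv X"
        using X_sv[OF X(1)] sv_nonzero[OF X(1)] by (simp add: c0_def field_simps)
      then have "sv X = (1 / X) * (1 - c0 * sv X)" using X0 by (simp add: field_simps)
      then have "sv X - poly q' (1 / X) = (1 / X) * (1 - c0 * sv X) - poly q' (1 / X)" by (simp only:)
      also have "\<dots> = - (c0 / X) * (sv X - poly q (1 / X))" by (simp add: q'_def algebra_simps)
      also have "norm \<dots> = norm c0 / norm X * norm (sv X - poly q (1 / X))"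
        by (simp add: norm_mult norm_divide)
      also have "\<dots> \<le> norm c0 / norm X * (C / norm X ^ N)" by (intro mult_left_mono q X) auto
      finally show ?thesis by simp
    qed
    then show ?case by blast
  qed
qed

lemma invexp_poly_sv: "invexp (\<lambda>X. poly q (sv X))"
proof (induction q)
  case 0
  then show ?case using invexp_const[of 0] by simp
next
  case (pCons a q)
  then show ?case using invexp_add[OF invexp_const invexp_mult[OF invexp_sv pCons(2)]] by simp
qed

lemma decaying_bound: assumes "decaying g" shows "\<exists>B>0. \<forall>X\<in>V. norm (g X) \<le> B / (1 + norm X)"
proof -
  obtain k where k: "sv_expandable k" "\<And>X. X \<in> V \<Longrightarrow> g X = sv X * k X" using assms unfolding decaying_def by blast
  obtain B where B: "B > 0" "\<And>X. X \<in> V \<Longrightarrow> norm (k X) \<le> B" using sv_expandable_bounded[OF k(1)] by blast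
  have "norm (g X) \<le> ((3 + \<mu>) * B) / (1 + norm X)" if X: "X \<in> V" for X
  proof -
    have "0 \<le> (3 + \<mu>) / (1 + norm X)" using \<mu> by (intro divide_nonneg_nonneg) auto
    then have "norm (g X) \<le> ((3 + \<mu>) / (1 + norm X)) * B"
      unfolding k(2)[OF X] norm_mult by (intro mult_mono norm_sv_le B X) auto
    then show ?thesis by simp
  qed
  then show ?thesis using B \<mu> by (intro exI[of _ "(3 + \<mu>) * B"]) auto
qed

text \<open>The approximants for different orders agree in their low coefficients: on the positive
  axis, with \<open>t = 1 / X\<close>, their difference is a polynomial of high order in
  \<open>t\<close>. The decay of \<open>g\<close> removes the constant term.\<close>

lemma decaying_G_space: assumes g: "decaying g" shows "g \<in> G_space V"
proof -
  note ag = decaying_sv_expandable[OF g]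
  obtain B where B: "B > 0" "\<And>X. X \<in> V \<Longrightarrow> norm (g X) \<le> B" using sv_expandable_bounded[OF ag] by blast
  obtain D where D: "D > 0" "\<And>X. X \<in> V \<Longrightarrow> norm (g X) \<le> D / (1 + norm X)" using decaying_bound[OF g] by blast
  have "\<exists>q C. \<forall>X\<in>V. norm X \<ge> 1 \<longrightarrow> norm (g X - poly q (1 / X)) \<le> C / norm X ^ N" for N
  proof -
    obtain q C where q: "\<And>X. X \<in> V \<Longrightarrow> norm (g X - poly q (sv X)) \<le> C / (1 + norm X) ^ N"
      using ag unfolding sv_expandable_def by blast
    obtain r E where r: "\<And>X. X \<in> V \<Longrightarrow> norm X \<ge> 1 \<Longrightarrow> norm (poly q (sv X) - poly r (1 / X)) \<le> E / norm X ^ N"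
      using invexp_poly_sv[of q] unfolding invexp_def by blast
    have "norm (g X - poly r (1 / X)) \<le> (\<bar>C\<bar> + E) / norm X ^ N" if X: "X \<in> V" "norm X \<ge> 1" for X
    proof -
      have "0 < norm X ^ N" using X by (intro zero_less_power) linarith
      then have "C / (1 + norm X) ^ N \<le> \<bar>C\<bar> / norm X ^ N"
        by (intro frac_le power_mono) auto
      then show ?thesis using q[OF X(1)] r[OF X]
          norm_triangle_ineq[of "g X - poly q (sv X)" "poly q (sv X) - poly r (1 / X)"]
        by (simp add: add_divide_distrib)
    qed
    then show ?thesis by blast
  qed
  then obtain Q C where Q: "\<And>N X. X \<in> V \<Longrightarrow> norm X \<ge> 1 \<Longrightarrow> norm (g X - poly (Q N) (1 / X)) \<le> C N / norm X ^ N" by metis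
  have Qt: "norm (g (of_real (1 / t)) - poly (Q N) (of_real t)) \<le> C N * t ^ N" if "0 < t" "t \<le> 1" for N t
  proof -
    have n: "norm (of_real (1 / t) :: complex) = 1 / t" unfolding norm_of_real using that by simp
    have "of_real (1 / t) \<in> V" using that by (intro real_in_V) simp
    moreover have "1 \<le> norm (of_real (1 / t) :: complex)" unfolding n using that by simp
    ultimately have "norm (g (of_real (1 / t)) - poly (Q N) (1 / of_real (1 / t))) \<le> C N / norm (of_real (1 / t) :: complex) ^ N"
      by (rule Q)
    moreover have "1 / of_real (1 / t) = (of_real t :: complex)" by simp
    moreover have "C N / (1 / t) ^ N = C N * t ^ N" by (simp add: power_divide)
    ultimately show ?thesis unfolding n by (simp only:)
  qed
  \<comment> \<open>\<open>Q (Suc \<nu>)\<close> is the first approximant whose error is too small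
    to change the coefficient of index \<open>\<nu>\<close>.\<close>
  define c where "c \<nu> = coeff (Q (Suc \<nu>)) \<nu>" for \<nu>
  have cN: "coeff (Q N) \<nu> = c \<nu>" if "\<nu> < N" for \<nu> N
  proof -
    have "coeff (Q N - Q (Suc \<nu>)) \<nu> = 0"
    proof (rule coeff_zero_if_small[where m = "Suc \<nu>"])
      fix t :: real assume t: "0 < t" "t \<le> 1"
      have "t ^ N \<le> t ^ Suc \<nu>" using t that by (intro power_decreasing) auto
      then have "\<bar>C N\<bar> * t ^ N \<le> \<bar>C N\<bar> * t ^ Suc \<nu>" by (intro mult_left_mono) auto
      moreover have "C N * t ^ N \<le> \<bar>C N\<bar> * t ^ N" using t by (intro mult_right_mono) auto
      ultimately have "norm (poly (Q N) (of_real t) - poly (Q (Suc \<nu>)) (of_real t)) \<le> \<bar>C N\<bar> * t ^ Suc \<nu> + C (Suc \<nu>) * t ^ Suc \<nu>"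
        using Qt[OF t, of N] Qt[OF t, of "Suc \<nu>"]
          norm_triangle_ineq4[of "g (of_real (1 / t)) - poly (Q (Suc \<nu>)) (of_real t)" "g (of_real (1 / t)) - poly (Q N) (of_real t)"]
        by simp
      then show "norm (poly (Q N - Q (Suc \<nu>)) (of_real t)) \<le> (\<bar>C N\<bar> + C (Suc \<nu>)) * t ^ Suc \<nu>"
        by (simp add: algebra_simps)
    qed simp
    then show ?thesis by (simp add: c_def)
  qed
  have c0: "c 0 = 0" unfolding c_def
  proof (rule coeff_zero_if_small[where m = 1])
    fix t :: real assume t: "0 < t" "t \<le> 1"
    have "norm (g (of_real (1 / t))) \<le> D / (1 + norm (of_real (1 / t) :: complex))" using D(2)[OF real_in_V[of "1 / t"]] t by simp
    also have "\<dots> \<le> D / (1 / t)" using D t by (intro divide_left_mono) (auto simp: norm_divide add_pos_pos)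
    also have "\<dots> = D * t" using t by simp
    finally show "norm (poly (Q (Suc 0)) (of_real t)) \<le> (D + C 1) * t ^ 1"
      using Qt[OF t, of 1] norm_triangle_ineq4[of "g (of_real (1 / t))" "g (of_real (1 / t)) - poly (Q 1) (of_real t)"]
      by (simp add: algebra_simps)
  qed simp
  have "\<exists>K. \<forall>X\<in>V - {0}. norm (g X - (\<Sum>\<nu>\<in>{1..<N}. c \<nu> / X ^ \<nu>)) \<le> K / norm X ^ N" for N
  proof -
    obtain r where r: "\<And>z. poly (Q N) z = (\<Sum>\<nu><N. coeff (Q N) \<nu> * z ^ \<nu>) + z ^ N * poly r z"
      using poly_split_low by blast
    obtain A where A: "A > 0" "\<And>X. norm X \<ge> 1 \<Longrightarrow> norm (poly r (1 / X)) \<le> A" using poly_inverse_bounded by blast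
    define S where "S = (\<Sum>\<nu>\<in>{1..<N}. norm (c \<nu>))"
    have S0: "S \<ge> 0" unfolding S_def by (intro sum_nonneg) auto
    define K where "K = \<bar>C N\<bar> + A + B + S"
    have sumeq: "(\<Sum>\<nu><N. coeff (Q N) \<nu> * z ^ \<nu>) = (\<Sum>\<nu>\<in>{1..<N}. c \<nu> * z ^ \<nu>)" for z
    proof -
      have "(\<Sum>\<nu><N. coeff (Q N) \<nu> * z ^ \<nu>) = (\<Sum>\<nu><N. c \<nu> * z ^ \<nu>)" by (intro sum.cong) (auto simp: cN)
      also have "\<dots> = (\<Sum>\<nu>\<in>{1..<N}. c \<nu> * z ^ \<nu>)"
      proof (rule sum.mono_neutral_right)
        show "\<forall>i\<in>{..<N} - {1..<N}. c i * z ^ i = 0"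
        proof
          fix i assume "i \<in> {..<N} - {1..<N}"
          then have "i = 0" by auto
          then show "c i * z ^ i = 0" using c0 by simp
        qed
      qed auto
      finally show ?thesis .
    qed
    have "norm (g X - (\<Sum>\<nu>\<in>{1..<N}. c \<nu> / X ^ \<nu>)) \<le> K / norm X ^ N" if X: "X \<in> V - {0}" for X
    proof (cases "norm X \<ge> 1")
      case True
      have XV: "X \<in> V" and X0: "norm X > 0" using X by auto
      have "g X - (\<Sum>\<nu>\<in>{1..<N}. c \<nu> / X ^ \<nu>) = (g X - poly (Q N) (1 / X)) + (1 / X) ^ N * poly r (1 / X)"
        unfolding r sumeq by (simp add: power_divide)
      then have "norm (g X - (\<Sum>\<nu>\<in>{1..<N}. c \<nu> / X ^ \<nu>)) \<le> norm (g X - poly (Q N) (1 / X)) + norm ((1 / X) ^ N * poly r (1 / X))"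
        by (simp only: norm_triangle_ineq)
      also have "\<dots> \<le> C N / norm X ^ N + A / norm X ^ N"
      proof (rule add_mono)
        show "norm (g X - poly (Q N) (1 / X)) \<le> C N / norm X ^ N" by (rule Q[OF XV True])
        have "norm ((1 / X) ^ N * poly r (1 / X)) = norm (poly r (1 / X)) / norm X ^ N"
          by (simp add: norm_mult norm_power norm_divide power_divide)
        also have "\<dots> \<le> A / norm X ^ N" by (intro divide_right_mono A True) auto
        finally show "norm ((1 / X) ^ N * poly r (1 / X)) \<le> A / norm X ^ N" .
      qed
      also have "\<dots> = (C N + A) / norm X ^ N" by (simp add: add_divide_distrib)
      also have "\<dots> \<le> K / norm X ^ N" using B S0 by (intro divide_right_mono) (auto simp: K_def)
      finally show ?thesis .
    next
      case False
      \<comment> \<open>Inside the unit disc \<open>1 / |X| ^ N\<close> dominates the constant and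
        all \<open>1 / |X| ^ \<nu>\<close> with \<open>\<nu> < N\<close>, so each term obeys the
        bound separately.\<close>
      have XV: "X \<in> V" and X0: "norm X > 0" using X by auto
      have XN: "0 < norm X ^ N" "norm X ^ N \<le> 1" using X0 False by (auto intro: power_le_one)
      have "norm (g X - (\<Sum>\<nu>\<in>{1..<N}. c \<nu> / X ^ \<nu>)) \<le> norm (g X) + norm (\<Sum>\<nu>\<in>{1..<N}. c \<nu> / X ^ \<nu>)"
        by (rule norm_triangle_ineq4)
      also have "\<dots> \<le> B / norm X ^ N + S / norm X ^ N"
      proof (rule add_mono)
        have "B / 1 \<le> B / norm X ^ N" using B XN by (intro divide_left_mono) auto
        then show "norm (g X) \<le> B / norm X ^ N" using B(2)[OF XV] by simp
        have "norm (\<Sum>\<nu>\<in>{1..<N}. c \<nu> / X ^ \<nu>) \<le> (\<Sum>\<nu>\<in>{1..<N}. norm (c \<nu>) / norm X ^ N)"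
        proof (rule sum_norm_le)
          fix \<nu> assume "\<nu> \<in> {1..<N}"
          then have "norm X ^ N \<le> norm X ^ \<nu>" using X0 False by (intro power_decreasing) auto
          then show "norm (c \<nu> / X ^ \<nu>) \<le> norm (c \<nu>) / norm X ^ N"
            unfolding norm_divide norm_power using XN X0 by (intro divide_left_mono) auto
        qed
        then show "norm (\<Sum>\<nu>\<in>{1..<N}. c \<nu> / X ^ \<nu>) \<le> S / norm X ^ N"
          by (simp add: S_def sum_divide_distrib)
      qed
      also have "\<dots> = (B + S) / norm X ^ N" by (simp add: add_divide_distrib)
      also have "\<dots> \<le> K / norm X ^ N" using A by (intro divide_right_mono) (auto simp: K_def)
      finally show ?thesis .
    qed
    then show ?thesis by blast
  qed
  moreover have "bounded (g ` V)" using B unfolding bounded_iff by blast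
  ultimately show ?thesis using ag unfolding G_space_def sv_expandable_def by blast
qed

lemma V_connected: "connected V"
proof -
  have "0 \<in> V" using \<mu> by (simp add: infinite_domain_def)
  moreover have "closed_segment 0 x \<subseteq> V" if "x \<in> V" for x
    using infinite_domain_starlike[OF \<mu> that] by (auto simp: closed_segment_def scaleR_conv_of_real)
  ultimately have "starlike V" unfolding starlike_def by blast
  then show ?thesis by (rule starlike_imp_connected)
qed

end

section \<open>Normal form of combined sums and uniqueness of their coefficients\<close>

context layer_disc begin

lemma decaying_zero: "decaying (\<lambda>X. 0)"
  unfolding decaying_def by (intro exI[of _ "\<lambda>X. 0"]) (simp add: sv_expandable_const)

text \<open>The representation is claimed for every length \<open>k \<ge> n\<close>, with zero
  coefficients at the end, so that sums of different lengths can be added term by term.\<close>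

lemma comb_normal_form:
  "comb F \<Longrightarrow> \<exists>n a g. (\<forall>i. a i holomorphic_on ball 0 r0 \<and> decaying (g i)) \<and>
     (\<forall>k\<ge>n. \<forall>x \<eta>. F x \<eta> = (\<Sum>i<k. (a i x + g i (x / \<eta>)) * \<eta> ^ i))"
proof (induction rule: comb.induct)
  case (outer a)
  show ?case
  proof (rule exI[of _ 1], rule exI[of _ "\<lambda>i. if i = 0 then a else (\<lambda>x. 0)"], rule exI[of _ "\<lambda>i X. 0"], intro conjI allI impI)
    fix k x \<eta> assume "k \<ge> (1::nat)"
    then obtain k' where k: "k = Suc k'" by (cases k) auto
    show "a x = (\<Sum>i<k. ((if i = 0 then a else (\<lambda>x. 0)) x + 0) * \<eta> ^ i)"
      unfolding k sum.lessThan_Suc_shift by simp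
  qed (use outer decaying_zero in auto)
next
  case (inner g)
  show ?case
  proof (rule exI[of _ 1], rule exI[of _ "\<lambda>i x. 0"], rule exI[of _ "\<lambda>i. if i = 0 then g else (\<lambda>x. 0)"], intro conjI allI impI)
    fix k x \<eta> assume "k \<ge> (1::nat)"
    then obtain k' where k: "k = Suc k'" by (cases k) auto
    show "g (x / \<eta>) = (\<Sum>i<k. (0 + (if i = 0 then g else (\<lambda>x. 0)) (x / \<eta>)) * \<eta> ^ i)"
      unfolding k sum.lessThan_Suc_shift by simp
  qed (use inner decaying_zero in auto)
next
  case (add F G)
  obtain n a g where 1: "\<And>i. a i holomorphic_on ball 0 r0 \<and> decaying (g i)"
    "\<And>k x \<eta>. k \<ge> n \<Longrightarrow> F x \<eta> = (\<Sum>i<k. (a i x + g i (x / \<eta>)) * \<eta> ^ i)" using add.IH(1) by blast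
  obtain n' a' g' where 2: "\<And>i. a' i holomorphic_on ball 0 r0 \<and> decaying (g' i)"
    "\<And>k x \<eta>. k \<ge> n' \<Longrightarrow> G x \<eta> = (\<Sum>i<k. (a' i x + g' i (x / \<eta>)) * \<eta> ^ i)" using add.IH(2) by blast
  show ?case
  proof (rule exI[of _ "max n n'"], rule exI[of _ "\<lambda>i x. a i x + a' i x"], rule exI[of _ "\<lambda>i X. g i X + g' i X"], intro conjI allI impI)
    fix k x \<eta> assume k: "k \<ge> max n n'"
    show "F x \<eta> + G x \<eta> = (\<Sum>i<k. (a i x + a' i x + (g i (x / \<eta>) + g' i (x / \<eta>))) * \<eta> ^ i)"
      using 1(2)[of k x \<eta>] 2(2)[of k x \<eta>] k by (simp add: sum.distrib[symmetric] algebra_simps)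
  qed (use 1 2 decaying_add in \<open>auto intro!: holomorphic_intros\<close>)
next
  case (shift F)
  obtain n a g where 1: "\<And>i. a i holomorphic_on ball 0 r0 \<and> decaying (g i)"
    "\<And>k x \<eta>. k \<ge> n \<Longrightarrow> F x \<eta> = (\<Sum>i<k. (a i x + g i (x / \<eta>)) * \<eta> ^ i)" using shift.IH by blast
  show ?case
  proof (rule exI[of _ "Suc n"], rule exI[of _ "case_nat (\<lambda>x. 0) a"], rule exI[of _ "case_nat (\<lambda>x. 0) g"], intro conjI allI impI)
    fix k x \<eta> assume "k \<ge> Suc n"
    then obtain k' where k: "k = Suc k'" "k' \<ge> n" by (cases k) auto
    show "\<eta> * F x \<eta> = (\<Sum>i<k. (case_nat (\<lambda>x. 0) a i x + case_nat (\<lambda>x. 0) g i (x / \<eta>)) * \<eta> ^ i)"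
      unfolding k sum.lessThan_Suc_shift using 1(2)[OF k(2), of x \<eta>] by (simp add: sum_distrib_left mult_ac)
  next
    show "case_nat (\<lambda>x. 0) a i holomorphic_on ball 0 r0" for i using 1 by (cases i) auto
    show "decaying (case_nat (\<lambda>x. 0) g i)" for i using 1 decaying_zero by (cases i) auto
  qed
qed

text \<open>Once the lower coefficients vanish, \<open>a i x + g i (x / t)\<close> is of order
  \<open>t\<close> on the positive axis. For fixed \<open>x\<close> the second term tends to zero
  with \<open>t\<close>, which isolates \<open>a i\<close>; for fixed \<open>X = x / t\<close> it
  stays constant, which isolates \<open>g i\<close>. The identity theorem extends both to their
  domains.\<close>

lemma combined_coefficients_unique:
  assumes a: "\<And>i. a i holomorphic_on ball 0 r0" and g: "\<And>i. decaying (g i)"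
    and r1: "0 < r1" and h: "0 < h"
    and le: "\<And>x t. 0 < x \<Longrightarrow> x < r1 \<Longrightarrow> 0 < t \<Longrightarrow> t < h \<Longrightarrow>
      norm (\<Sum>i<k. (a i (of_real x) + g i (of_real x / of_real t)) * of_real t ^ i) \<le> K * t ^ N"
    and i: "i < N" "i < k"
  shows "(\<forall>x\<in>ball 0 r0. a i x = 0) \<and> (\<forall>X\<in>V. g i X = 0)"
  using i
proof (induction i rule: less_induct)
  case (less i)
  define r where "r = min r1 \<rho>"
  have r: "0 < r" "r \<le> r1" "r \<le> \<rho>" using r1 \<rho> by (auto simp: r_def)
  define c where "c j x t = a j (of_real x) + g j (of_real x / of_real t)" for j and x t :: real
  have "\<exists>B>0. \<forall>x t. 0 < x \<longrightarrow> x < r \<longrightarrow> 0 < t \<longrightarrow> norm (c j x t) \<le> B" for j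
  proof -
    obtain A where A: "A > 0" "\<And>x. norm x < \<rho> \<Longrightarrow> norm (a j x) \<le> A" using bounded_outer[OF a] by blast
    obtain B where B: "B > 0" "\<And>X. X \<in> V \<Longrightarrow> norm (g j X) \<le> B" using sv_expandable_bounded[OF decaying_sv_expandable[OF g]] by blast
    have "norm (c j x t) \<le> A + B" if "0 < x" "x < r" "0 < t" for x t
      unfolding c_def using A(2)[of "of_real x"] B(2)[of "of_real x / of_real t"] that r real_in_V[of "x / t"]
      by (intro norm_triangle_le add_mono) auto
    then show ?thesis using A B by (intro exI[of _ "A + B"]) auto
  qed
  then obtain B where B: "\<And>j. B j > 0" "\<And>j x t. 0 < x \<Longrightarrow> x < r \<Longrightarrow> 0 < t \<Longrightarrow> norm (c j x t) \<le> B j" by metis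
  define C where "C = \<bar>K\<bar> + (\<Sum>j\<in>{Suc i..<k}. B j)"
  define d where "d = min h 1"
  have d: "0 < d" "d \<le> h" "d \<le> 1" using h by (auto simp: d_def)
  \<comment> \<open>The sum is solved for its lowest term and divided by \<open>t ^ i\<close>; the
    hypothesis of order \<open>N > i\<close> and the higher terms all carry
    \<open>t ^ Suc i\<close>.\<close>
  have key: "norm (c i x t) \<le> C * t" if x: "0 < x" "x < r" and t: "0 < t" "t < d" for x t
  proof -
    have z: "c j x t = 0" if "j < i" for j
    proof -
      have "norm (of_real x :: complex) < r0" using x r \<rho> by simp
      moreover have "of_real x / of_real t \<in> V" using real_in_V[of "x / t"] x t by simp
      ultimately show ?thesis using less.IH[of j] that less.prems by (auto simp: c_def)
    qed
    have "(\<Sum>j<k. c j x t * of_real t ^ j) = (\<Sum>j\<in>{i..<k}. c j x t * of_real t ^ j)"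
      by (rule sum.mono_neutral_right) (use z in auto)
    also have "\<dots> = c i x t * of_real t ^ i + (\<Sum>j\<in>{Suc i..<k}. c j x t * of_real t ^ j)"
      using less.prems by (simp add: sum.atLeast_Suc_lessThan)
    finally have "c i x t * of_real t ^ i = (\<Sum>j<k. c j x t * of_real t ^ j) - (\<Sum>j\<in>{Suc i..<k}. c j x t * of_real t ^ j)" by simp
    then have "norm (c i x t * of_real t ^ i) \<le> norm (\<Sum>j<k. c j x t * of_real t ^ j) + norm (\<Sum>j\<in>{Suc i..<k}. c j x t * of_real t ^ j)"
      by (simp only: norm_triangle_ineq4)
    also have "\<dots> \<le> \<bar>K\<bar> * t ^ Suc i + (\<Sum>j\<in>{Suc i..<k}. B j * t ^ Suc i)"
    proof (intro add_mono sum_norm_le)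
      have "norm (\<Sum>j<k. c j x t * of_real t ^ j) \<le> K * t ^ N"
        unfolding c_def using le[of x t] x t r d by simp
      also have "\<dots> \<le> \<bar>K\<bar> * t ^ Suc i" using t d less.prems by (intro mult_mono power_decreasing) auto
      finally show "norm (\<Sum>j<k. c j x t * of_real t ^ j) \<le> \<bar>K\<bar> * t ^ Suc i" .
      fix j assume "j \<in> {Suc i..<k}"
      then have "t ^ j \<le> t ^ Suc i" using t d by (intro power_decreasing) auto
      then show "norm (c j x t * of_real t ^ j) \<le> B j * t ^ Suc i"
        unfolding norm_mult norm_power using B(2)[OF x t(1), of j] less_imp_le[OF B(1)[of j]] t by (intro mult_mono) auto
    qed
    also have "\<dots> = (C * t) * t ^ i" unfolding sum_distrib_right[symmetric] C_def by (simp add: algebra_simps)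
    finally have "norm (c i x t) * t ^ i \<le> (C * t) * t ^ i" using t by (simp add: norm_mult norm_power)
    then show ?thesis using t by simp
  qed
  obtain D where D: "D > 0" "\<And>X. X \<in> V \<Longrightarrow> norm (g i X) \<le> D / (1 + norm X)" using decaying_bound[OF g] by blast
  have ax: "a i (of_real x) = 0" if x: "0 < x" "x < r" for x
  proof (rule eq_zero_if_small[OF d(1), of _ "C + D / x"])
    fix t assume t: "0 < t" "t < d"
    have "norm (g i (of_real x / of_real t)) \<le> D / (1 + x / t)"
      using D(2)[of "of_real x / of_real t"] real_in_V[of "x / t"] x t by (simp add: norm_divide)
    also have "\<dots> \<le> D / (x / t)" using D x t by (intro divide_left_mono) (auto simp: add_pos_pos)
    finally have "norm (g i (of_real x / of_real t)) \<le> D / x * t" by simp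
    moreover have "norm (a i (of_real x)) \<le> norm (c i x t) + norm (g i (of_real x / of_real t))"
      using norm_triangle_ineq4[of "c i x t" "g i (of_real x / of_real t)"] by (simp add: c_def)
    ultimately show "norm (a i (of_real x)) \<le> (C + D / x) * t" using key[OF x t] by (simp add: distrib_right)
  qed
  \<comment> \<open>Now \<open>x = X * t\<close> moves with \<open>t\<close>, so \<open>t\<close> is
    limited to \<open>r / X\<close> to keep \<open>x\<close> in the admissible range.\<close>
  have gX: "g i (of_real X) = 0" if X: "0 < X" for X
  proof (rule eq_zero_if_small[of "min d (r / X)" _ C])
    show "min d (r / X) > 0" using d r X by simp
    fix t assume t: "0 < t" "t < min d (r / X)"
    have "X * t < r" using t X by (simp add: pos_less_divide_eq mult.commute)
    moreover have "X * t > 0" using t X by simp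
    ultimately have "norm (c i (X * t) t) \<le> C * t" using key t by simp
    moreover have "c i (X * t) t = g i (of_real X)" using ax[of "X * t"] \<open>X * t < r\<close> \<open>X * t > 0\<close> t by (simp add: c_def)
    ultimately show "norm (g i (of_real X)) \<le> C * t" by simp
  qed
  \<comment> \<open>The identity theorem needs a limit point, and an interval of the real axis
    provides one in the complex plane.\<close>
  have islim: "of_real y islimpt (of_real ` {0<..<s} :: complex set)" if "0 < y" "y < s" for y s
  proof -
    have "of_real y \<in> closure (of_real ` ({0<..<s} - {y}) :: complex set)"
    proof -
      define w where "w n = y + (s - y) / 2 * inverse (real (Suc n))" for n
      have "w \<longlonglongrightarrow> y + (s - y) / 2 * 0"
        unfolding w_def by (intro tendsto_intros LIMSEQ_inverse_real_of_nat)
      then have lim: "(\<lambda>n. of_real (w n) :: complex) \<longlonglongrightarrow> of_real y" by (intro tendsto_of_real) simp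
      have mem: "w n \<in> {0<..<s} - {y}" for n
      proof -
        have i: "0 < inverse (real (Suc n))" "inverse (real (Suc n)) \<le> 1" by (auto simp: field_simps)
        have "0 < (s - y) / 2 * inverse (real (Suc n))" using that i by (intro mult_pos_pos) auto
        moreover have "(s - y) / 2 * inverse (real (Suc n)) \<le> (s - y) / 2 * 1" using that i by (intro mult_left_mono) auto
        moreover have "y + v \<in> {0<..<s} - {y}" if "0 < v" "v \<le> (s - y) / 2 * 1" for v
          using that \<open>0 < y\<close> \<open>y < s\<close> by auto
        ultimately show ?thesis unfolding w_def by blast
      qed
      have "\<forall>n. of_real (w n) \<in> (of_real ` ({0<..<s} - {y}) :: complex set)"
        by (intro allI imageI mem)
      with lim show ?thesis unfolding closure_sequential
        by (intro exI[of _ "\<lambda>n. of_real (w n)"] conjI)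
    qed
    moreover have "of_real ` ({0<..<s} - {y}) = (of_real ` {0<..<s} :: complex set) - {of_real y}" by auto
    ultimately show ?thesis by (simp add: islimpt_in_closure)
  qed
  have "a i z = 0" if "z \<in> ball 0 r0" for z
  proof (rule analytic_continuation[OF a open_ball connected_ball _ _ islim[of "r / 2" r] _ that])
    show "of_real ` {0<..<r} \<subseteq> ball (0::complex) r0" using r \<rho> by auto
    show "of_real (r / 2) \<in> ball (0::complex) r0" using r \<rho> by (simp add: norm_divide)
  qed (use r ax in auto)
  moreover have "g i X = 0" if "X \<in> V" for X
  proof (rule analytic_continuation[OF _ V_open V_connected _ _ islim[of 1 2] _ that])
    show "g i holomorphic_on V" using decaying_sv_expandable[OF g] by (simp add: sv_expandable_def)
    show "of_real ` {0<..<2} \<subseteq> V" using real_in_V by auto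
    show "of_real 1 \<in> V" using real_in_V[of 1] by simp
  qed (use gX in auto)
  ultimately show ?case by blast
qed

lemma bigO_sum: "finite S \<Longrightarrow> (\<And>i. i \<in> S \<Longrightarrow> bigO N (F i)) \<Longrightarrow> bigO N (\<lambda>x \<eta>. \<Sum>i\<in>S. F i x \<eta>)"
proof (induction rule: finite_induct)
  case empty
  then show ?case by (simp add: bigO_zero)
qed (use bigO_add in simp)

text \<open>Each order \<open>N\<close> comes with its own sum, and uniqueness forces the sums to
  agree in all indices below both orders. The positive real points of \<open>D\<close> are enough
  for this comparison.\<close>

lemma combined_expansion:
  assumes DR: "\<And>x \<eta>. (x, \<eta>) \<in> D \<Longrightarrow> region x \<eta>" and r1: "0 < r1" and h: "0 < h"
    and real: "\<And>x t. 0 < x \<Longrightarrow> x < r1 \<Longrightarrow> 0 < t \<Longrightarrow> t < h \<Longrightarrow> (of_real x, of_real t) \<in> D"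
    and ap: "\<And>N. \<exists>H K. comb H \<and> (\<forall>x \<eta>. (x, \<eta>) \<in> D \<longrightarrow> norm (y x \<eta> - H x \<eta>) \<le> K * norm \<eta> ^ N)"
  shows "\<exists>a g. (\<forall>n. a n holomorphic_on ball 0 r0 \<and> decaying (g n)) \<and>
     (\<forall>N. \<exists>K. \<forall>x \<eta>. (x, \<eta>) \<in> D \<longrightarrow> norm (y x \<eta> - (\<Sum>n<N. (a n x + g n (x / \<eta>)) * \<eta> ^ n)) \<le> K * norm \<eta> ^ N)"
proof -
  define \<Phi> where "\<Phi> N n a g K \<longleftrightarrow> (\<forall>i. a i holomorphic_on ball 0 r0 \<and> decaying (g i)) \<and>
     (\<forall>k\<ge>n. \<forall>x \<eta>. (x, \<eta>) \<in> D \<longrightarrow> norm (y x \<eta> - (\<Sum>i<k. (a i x + g i (x / \<eta>)) * \<eta> ^ i)) \<le> K * norm \<eta> ^ N)"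
    for N n :: nat and a g :: "nat \<Rightarrow> complex \<Rightarrow> complex" and K :: real
  have "\<exists>n a g K. \<Phi> N n a g K" for N
  proof -
    obtain H K where H: "comb H" "\<And>x \<eta>. (x, \<eta>) \<in> D \<Longrightarrow> norm (y x \<eta> - H x \<eta>) \<le> K * norm \<eta> ^ N" using ap by blast
    obtain n a g where "\<And>i. a i holomorphic_on ball 0 r0 \<and> decaying (g i)"
      "\<And>k x \<eta>. k \<ge> n \<Longrightarrow> H x \<eta> = (\<Sum>i<k. (a i x + g i (x / \<eta>)) * \<eta> ^ i)" using comb_normal_form[OF H(1)] by blast
    then have "\<Phi> N n a g K" unfolding \<Phi>_def using H(2) by auto
    then show ?thesis by blast
  qed
  then obtain n a g K where "\<And>N. \<Phi> N (n N) (a N) (g N) (K N)" by metis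
  then have hol: "\<And>N i. a N i holomorphic_on ball 0 r0" and dec: "\<And>N i. decaying (g N i)"
    and est: "\<And>N k x \<eta>. k \<ge> n N \<Longrightarrow> (x, \<eta>) \<in> D \<Longrightarrow> norm (y x \<eta> - (\<Sum>i<k. (a N i x + g N i (x / \<eta>)) * \<eta> ^ i)) \<le> K N * norm \<eta> ^ N"
    unfolding \<Phi>_def by blast+
  have uniq: "(\<forall>x\<in>ball 0 r0. a N i x - a (Suc i) i x = 0) \<and> (\<forall>X\<in>V. g N i X + (- 1) * g (Suc i) i X = 0)" if i: "i < N" for N i
  proof (rule combined_coefficients_unique[where k = "max (max (n N) (n (Suc i))) (Suc i)" and N = "Suc i" and K = "\<bar>K N\<bar> + K (Suc i)"
      and a = "\<lambda>j x. a N j x - a (Suc i) j x" and g = "\<lambda>j X. g N j X + (- 1) * g (Suc i) j X", OF _ _ r1 h])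
    show "(\<lambda>x. a N j x - a (Suc i) j x) holomorphic_on ball 0 r0" for j by (intro holomorphic_intros hol)
    show "decaying (\<lambda>X. g N j X + (- 1) * g (Suc i) j X)" for j
      by (intro decaying_add decaying_sv_expandable_mult sv_expandable_const dec)
    fix x t assume xt: "0 < x" "x < r1" "0 < t" "t < h"
    define k where "k = max (max (n N) (n (Suc i))) (Suc i)"
    have D: "(of_real x, of_real t) \<in> D" by (rule real[OF xt])
    have t1: "t \<le> 1" using DR[OF D] xt by (simp add: region_def)
    define S where "S M = (\<Sum>j<k. (a M j (of_real x) + g M j (of_real x / of_real t)) * of_real t ^ j)" for M
    have 1: "norm (y (of_real x) (of_real t) - S N) \<le> K N * t ^ N" using est[of N k, OF _ D] xt by (simp add: S_def k_def)
    have 2: "norm (y (of_real x) (of_real t) - S (Suc i)) \<le> K (Suc i) * t ^ Suc i" using est[of "Suc i" k, OF _ D] xt by (simp add: S_def k_def)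
    have 3: "K N * t ^ N \<le> \<bar>K N\<bar> * t ^ Suc i" using t1 xt i by (intro mult_mono power_decreasing) auto
    have "norm (S N - S (Suc i)) \<le> (\<bar>K N\<bar> + K (Suc i)) * t ^ Suc i"
      using 1 2 3 norm_triangle_ineq4[of "y (of_real x) (of_real t) - S (Suc i)" "y (of_real x) (of_real t) - S N"]
      by (simp add: algebra_simps)
    moreover have "S N - S (Suc i) = (\<Sum>j<k. (a N j (of_real x) - a (Suc i) j (of_real x) +
        (g N j (of_real x / of_real t) + (- 1) * g (Suc i) j (of_real x / of_real t))) * of_real t ^ j)"
      unfolding S_def sum_subtractf[symmetric] by (intro sum.cong) (auto simp: algebra_simps)
    ultimately show "norm (\<Sum>j<max (max (n N) (n (Suc i))) (Suc i). (a N j (of_real x) - a (Suc i) j (of_real x) +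
        (g N j (of_real x / of_real t) + (- 1) * g (Suc i) j (of_real x / of_real t))) * of_real t ^ j) \<le> (\<bar>K N\<bar> + K (Suc i)) * t ^ Suc i"
      by (simp add: k_def)
  qed auto
  \<comment> \<open>The sum of order \<open>Suc i\<close> is the first one that determines the
    coefficient of index \<open>i\<close>.\<close>
  define a' where "a' i = a (Suc i) i" for i
  define g' where "g' i = g (Suc i) i" for i
  have expansion: "\<exists>K. \<forall>x \<eta>. (x, \<eta>) \<in> D \<longrightarrow> norm (y x \<eta> - (\<Sum>n<N. (a' n x + g' n (x / \<eta>)) * \<eta> ^ n)) \<le> K * norm \<eta> ^ N" for N
  proof -
    \<comment> \<open>The sum of order \<open>N\<close> may have more than \<open>N\<close> terms;
      those from index \<open>N\<close> on are themselves of order \<open>N\<close> and join the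
      error.\<close>
    define k where "k = max (n N) N"
    have "bigO N (\<lambda>x \<eta>. \<Sum>i\<in>{N..<k}. (a N i x + g N i (x / \<eta>)) * \<eta> ^ i)"
    proof (rule bigO_sum)
      fix i assume i: "i \<in> {N..<k}"
      have "bigO 0 (\<lambda>x \<eta>. a N i x + g N i (x / \<eta>))" by (intro comb_bounded add outer inner hol dec)
      moreover have "bigO i (\<lambda>x \<eta>. \<eta> ^ i)" by (rule bigO_I[of _ 1]) (simp add: norm_power)
      ultimately have "bigO (0 + i) (\<lambda>x \<eta>. (a N i x + g N i (x / \<eta>)) * \<eta> ^ i)" by (rule bigO_mult)
      then show "bigO N (\<lambda>x \<eta>. (a N i x + g N i (x / \<eta>)) * \<eta> ^ i)" by (rule bigO_mono) (use i in simp)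
    qed simp
    then obtain L where L: "\<And>x \<eta>. region x \<eta> \<Longrightarrow> norm (\<Sum>i\<in>{N..<k}. (a N i x + g N i (x / \<eta>)) * \<eta> ^ i) \<le> L * norm \<eta> ^ N"
      by (rule bigO_E) blast
    have "norm (y x \<eta> - (\<Sum>n<N. (a' n x + g' n (x / \<eta>)) * \<eta> ^ n)) \<le> (K N + L) * norm \<eta> ^ N" if D: "(x, \<eta>) \<in> D" for x \<eta>
    proof -
      have reg: "region x \<eta>" by (rule DR[OF D])
      have xV: "x \<in> ball 0 r0" "x / \<eta> \<in> V" using reg \<rho> by (auto simp: region_def)
      have "(\<Sum>n<N. (a' n x + g' n (x / \<eta>)) * \<eta> ^ n) = (\<Sum>i<N. (a N i x + g N i (x / \<eta>)) * \<eta> ^ i)"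
      proof (rule sum.cong[OF refl])
        fix i assume "i \<in> {..<N}"
        then have "i < N" by simp
        note u = uniq[OF this]
        have "a N i x = a (Suc i) i x" using u[THEN conjunct1, rule_format, OF xV(1)] by simp
        moreover have "g N i (x / \<eta>) = g (Suc i) i (x / \<eta>)" using u[THEN conjunct2, rule_format, OF xV(2)] by simp
        ultimately show "(a' i x + g' i (x / \<eta>)) * \<eta> ^ i = (a N i x + g N i (x / \<eta>)) * \<eta> ^ i"
          by (simp add: a'_def g'_def)
      qed
      moreover have "(\<Sum>i<k. (a N i x + g N i (x / \<eta>)) * \<eta> ^ i) = (\<Sum>i<N. (a N i x + g N i (x / \<eta>)) * \<eta> ^ i) + (\<Sum>i\<in>{N..<k}. (a N i x + g N i (x / \<eta>)) * \<eta> ^ i)"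
        by (simp add: k_def atLeast0LessThan[symmetric] sum.atLeastLessThan_concat)
      ultimately have "y x \<eta> - (\<Sum>n<N. (a' n x + g' n (x / \<eta>)) * \<eta> ^ n)
        = (y x \<eta> - (\<Sum>i<k. (a N i x + g N i (x / \<eta>)) * \<eta> ^ i)) + (\<Sum>i\<in>{N..<k}. (a N i x + g N i (x / \<eta>)) * \<eta> ^ i)" by simp
      also have "norm \<dots> \<le> K N * norm \<eta> ^ N + L * norm \<eta> ^ N"
        by (intro norm_triangle_le add_mono est D L reg) (simp add: k_def)
      finally show ?thesis by (simp add: distrib_right)
    qed
    then show ?thesis by (intro exI[of _ "K N + L"] allI impI)
  qed
  show ?thesis
  proof (rule exI[of _ a'], rule exI[of _ g'], intro conjI allI)
    show "a' i holomorphic_on ball 0 r0" "decaying (g' i)" for i by (simp_all add: a'_def g'_def hol dec)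
  qed (rule expansion)
qed

end

section \<open>Translation to quasi-sectors and assembly\<close>

lemma quasi_sector_infinite:
  assumes "p \<ge> 2" "0 < \<delta>" "\<delta> \<le> pi / 8"
  shows "quasi_sector (- ((3 * pi / 2 - \<delta>) / real p)) ((3 * pi / 2 - \<delta>) / real p) \<infinity> \<mu> = infinite_domain p \<mu> \<delta>"
proof -
  define b where "b = (3 * pi / 2 - \<delta>) / real p"
  have b: "0 < b" using assms pi_gt_zero by (simp add: b_def)
  have "b \<le> (3 * pi / 2) / 2" unfolding b_def using assms pi_gt_zero by (intro frac_le) auto
  then have b': "b \<le> pi" using pi_gt_zero by linarith
  have A: "\<bar>Arg x\<bar> < b \<longleftrightarrow> real p * \<bar>Arg x\<bar> < 3 * pi / 2 - \<delta>" for x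
    using assms by (simp add: b_def pos_less_divide_eq mult.commute)
  show ?thesis
    unfolding quasi_sector_def b_def[symmetric] sector_eq[OF b b'] infinite_domain_def A
    by (simp add: set_eq_iff disj_commute)
qed

lemma quasi_sector_finite:
  assumes "p \<ge> 2" "0 < \<delta>" "\<delta> \<le> pi / 8"
  shows "quasi_sector (- ((3 * pi / 2 - 2 * \<delta>) / real p)) ((3 * pi / 2 - 2 * \<delta>) / real p) (ereal r) s =
    {x. norm x < s} \<union> {x. x \<noteq> 0 \<and> norm x < r \<and> real p * \<bar>Arg x\<bar> < 3 * pi / 2 - 2 * \<delta>}"
proof -
  define b where "b = (3 * pi / 2 - 2 * \<delta>) / real p"
  have b: "0 < b" using assms pi_gt_zero by (simp add: b_def)
  have "b \<le> (3 * pi / 2) / 2" unfolding b_def using assms pi_gt_zero by (intro frac_le) auto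
  then have b': "b \<le> pi" using pi_gt_zero by linarith
  have A: "\<bar>Arg x\<bar> < b \<longleftrightarrow> real p * \<bar>Arg x\<bar> < 3 * pi / 2 - 2 * \<delta>" for x
    using assms by (simp add: b_def pos_less_divide_eq mult.commute)
  show ?thesis
    unfolding quasi_sector_def b_def[symmetric] sector_eq[OF b b'] A
    by (simp add: set_eq_iff disj_commute)
qed

lemma holomorphic2_on_subset: "holomorphic2_on f T \<Longrightarrow> S \<subseteq> T \<Longrightarrow> holomorphic2_on f S"
  unfolding holomorphic2_on_def by blast

text \<open>Restricting from \<open>|x| < \<rho>\<close> to \<open>|x| < r1\<close> discards the
  neighbourhood of the base point, and with it the boundary layer; what was of weak order
  \<open>N\<close> becomes of order \<open>N\<close>.\<close>

lemma (in canard) solution_with_expansion: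
  assumes r1: "0 < r1" "r1 ^ p < \<rho> ^ p * cos (2 * \<delta>)"
    and P: "uniform_asymptotic_expansion (ball 0 r0) (ball 0 r2) \<Sigma>e P"
  defines "V1 \<equiv> \<lambda>\<eta>. {x. norm x < \<mu> * norm \<eta>} \<union> {x. x \<noteq> 0 \<and> norm x < r1 \<and> real p * \<bar>Arg x\<bar> < 3 * pi / 2 - 2 * \<delta>}"
  obtains h y where "h > 0"
    "is_solution p (ball 0 r0) (ball 0 r2) \<Sigma>e P (S1 h) V1 y"
    "combined_asymptotic_expansion (S1 h) V1 r1 V y"
proof -
  obtain h0 K y where h0: "small h0" and K: "K > 0" and yK: "\<And>x \<eta>. (x, \<eta>) \<in> joint h0 \<Longrightarrow> norm (y x \<eta>) \<le> K * norm \<eta>"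
    and ylt: "\<And>x \<eta>. (x, \<eta>) \<in> joint h0 \<Longrightarrow> norm (y x \<eta>) < r2 / 2"
    and yhol: "holomorphic2_on (\<lambda>(x, \<eta>). y x \<eta>) (joint h0)"
    and ode: "\<And>\<eta>. \<eta> \<in> S1 h0 \<Longrightarrow> linear_ode p \<eta> (\<Omega> \<eta>) (\<lambda>x. rhs y x \<eta>) (\<lambda>x. y x \<eta>)"
    using exists_solution by blast
  \<comment> \<open>The second entry places the disc of radius \<open>\<mu> |\<eta>|\<close> inside
    the disc of radius \<open>r1\<close>.\<close>
  define h where "h = min h0 (r1 / \<mu>)"
  have h: "h > 0" "h \<le> h0" "\<mu> * h \<le> r1"
    using h0 r1 \<mu> by (auto simp: h_def small_def min_def field_simps)
  have c2: "cos (2 * \<delta>) \<le> 1" "0 < cos (2 * \<delta>)"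
    using \<delta> pi_gt_zero by (auto intro!: cos_gt_zero_pi)
  have r1\<rho>: "r1 < \<rho>"
  proof -
    have "\<rho> ^ p * cos (2 * \<delta>) \<le> \<rho> ^ p * 1" using \<rho> c2 by (intro mult_left_mono) auto
    then have "r1 ^ p < \<rho> ^ p" using r1 by linarith
    then show ?thesis using \<rho> by (simp add: power_less_imp_less_base)
  qed
  have S1h: "S1 h \<subseteq> S1 h0" using h by (auto simp: S1_def)
  have Vr: "norm x < r1" if \<eta>: "\<eta> \<in> S1 h" and x: "x \<in> V1 \<eta>" for x \<eta>
  proof -
    have "\<mu> * norm \<eta> \<le> \<mu> * h" using \<eta> \<mu> by (intro mult_left_mono) (auto simp: S1_def)
    then show ?thesis using x h by (auto simp: V1_def)
  qed
  \<comment> \<open>For \<open>|x| < r1\<close> the cone condition is automatic: its cosine is at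
    most 1 and \<open>r1 ^ p < \<rho> ^ p * cos (2 * \<delta>)\<close>.\<close>
  have V\<Omega>: "x \<in> \<Omega> \<eta>" if \<eta>: "\<eta> \<in> S1 h" and x: "x \<in> V1 \<eta>" for x \<eta>
  proof -
    have nx: "norm x < r1" by (rule Vr[OF that])
    have "norm x ^ p * cos (real p * \<bar>Arg x\<bar> - 2 * \<delta>) \<le> norm x ^ p * 1" by (intro mult_left_mono) auto
    also have "\<dots> \<le> r1 ^ p" using nx by (simp add: power_mono)
    finally have "norm x ^ p * cos (real p * \<bar>Arg x\<bar> - 2 * \<delta>) < \<rho> ^ p * cos (2 * \<delta>)" using r1 by linarith
    then show ?thesis using x nx r1\<rho> by (auto simp: V1_def finite_domain_def)
  qed
  define D where "D = {(x, \<eta>). \<eta> \<in> S1 h \<and> x \<in> V1 \<eta>}"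
  have Dj: "(x, \<eta>) \<in> joint h0" if "(x, \<eta>) \<in> D" for x \<eta>
    using that V\<Omega> S1h by (auto simp: D_def joint_def)
  have Dreg: "region x \<eta>" if "(x, \<eta>) \<in> D" for x \<eta> using region[OF h0 Dj[OF that]] .
  have sol: "is_solution p (ball 0 r0) (ball 0 r2) \<Sigma>e P (S1 h) V1 y"
    unfolding is_solution_def
  proof (intro conjI ballI)
    show "holomorphic2_on (\<lambda>(x, \<eta>). y x \<eta>) {(x, \<eta>). \<eta> \<in> S1 h \<and> x \<in> V1 \<eta>}"
      by (rule holomorphic2_on_subset[OF yhol]) (use Dj in \<open>auto simp: D_def\<close>)
    fix \<eta> x assume \<eta>: "\<eta> \<in> S1 h" and x: "x \<in> V1 \<eta>"
    then have xD: "(x, \<eta>) \<in> D" by (simp add: D_def)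
    note j = Dj[OF xD]
    have \<eta>0: "\<eta> \<in> S1 h0" "x \<in> \<Omega> \<eta>" and n0: "\<eta> \<noteq> 0" using j by (auto simp: joint_def S1_def)
    show "x \<in> ball 0 r0" using Vr[OF \<eta> x] r1\<rho> \<rho> by simp
    show "y x \<eta> \<in> ball 0 r2" using ylt[OF j] r2 by simp
    show "\<eta> ^ p \<in> \<Sigma>e" by (rule power_in_Sigma[OF h0 \<eta>0(1)])
    have "deriv (\<lambda>t. y t \<eta>) x = of_nat p * x ^ (p - 1) / \<eta> ^ p * y x \<eta> + rhs y x \<eta>"
      using ode[OF \<eta>0(1)] \<eta>0(2) by (intro DERIV_imp_deriv) (simp add: linear_ode_def)
    then show "\<eta> ^ p * deriv (\<lambda>t. y t \<eta>) x = of_nat p * x ^ (p - 1) * y x \<eta> + \<eta> ^ p * P x (y x \<eta>) (\<eta> ^ p)"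
      using n0 by (simp add: rhs_def distrib_left)
  qed
  have ap: "\<exists>H K. comb H \<and> (\<forall>x \<eta>. (x, \<eta>) \<in> D \<longrightarrow> norm (y x \<eta> - H x \<eta>) \<le> K * norm \<eta> ^ N)" for N
  proof -
    obtain H where H: "comb H" "weakO h0 N (\<lambda>x \<eta>. y x \<eta> - H x \<eta>)"
      using solution_comb_approximation[OF h0 K yK ylt ode P] by blast
    obtain A where A: "A > 0" "\<And>x \<eta>. (x, \<eta>) \<in> joint h0 \<Longrightarrow> norm (y x \<eta> - H x \<eta>) \<le> A * (norm \<eta> ^ N + boundary_layer x \<eta>)"
      using H(2) by (rule weakO_E) blast
    obtain B where B: "\<And>x \<eta>. \<eta> \<noteq> 0 \<Longrightarrow> norm \<eta> \<le> 1 \<Longrightarrow> real p * \<bar>Arg \<eta>\<bar> < \<delta> \<Longrightarrow> norm x \<le> r1 \<Longrightarrow>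
      boundary_layer x \<eta> \<le> B * norm \<eta> ^ N" using boundary_layer_small[OF r1] by blast
    have "norm (y x \<eta> - H x \<eta>) \<le> (A * (1 + B)) * norm \<eta> ^ N" if D: "(x, \<eta>) \<in> D" for x \<eta>
    proof -
      have "boundary_layer x \<eta> \<le> B * norm \<eta> ^ N"
      proof (rule B)
        have \<eta>: "\<eta> \<in> S1 h" "x \<in> V1 \<eta>" using D by (auto simp: D_def)
        then show "\<eta> \<noteq> 0" "real p * \<bar>Arg \<eta>\<bar> < \<delta>" by (auto simp: S1_def)
        show "norm \<eta> \<le> 1" using Dreg[OF D] by (simp add: region_def)
        show "norm x \<le> r1" using Vr[OF \<eta>] by simp
      qed
      then have "A * (norm \<eta> ^ N + boundary_layer x \<eta>) \<le> A * (norm \<eta> ^ N + B * norm \<eta> ^ N)"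
        using A by (intro mult_left_mono) auto
      with A(2)[OF Dj[OF D]] show ?thesis by (simp add: algebra_simps)
    qed
    with H(1) show ?thesis by blast
  qed
  have real: "(of_real x, of_real t) \<in> D" if "0 < x" "x < r1" "0 < t" "t < h" for x t
    using that \<delta> pi_gt_zero by (simp add: D_def S1_def V1_def Arg_of_real)
  obtain a g where ag: "\<And>n. a n holomorphic_on ball 0 r0" "\<And>n. decaying (g n)"
    "\<And>N. \<exists>K. \<forall>x \<eta>. (x, \<eta>) \<in> D \<longrightarrow> norm (y x \<eta> - (\<Sum>n<N. (a n x + g n (x / \<eta>)) * \<eta> ^ n)) \<le> K * norm \<eta> ^ N"
    using combined_expansion[OF Dreg r1(1) h(1) real ap] by blast
  have aH: "a n \<in> H_space r1" for n
  proof -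
    have sub: "cball 0 r1 \<subseteq> ball (0::complex) r0" using r1\<rho> \<rho> by auto
    have "compact (a n ` cball 0 r1)"
      by (intro compact_continuous_image holomorphic_on_imp_continuous_on holomorphic_on_subset[OF ag(1) sub]) auto
    then have "bounded (a n ` ball 0 r1)"
      using bounded_subset[OF compact_imp_bounded, of "a n ` cball 0 r1"] by (meson ball_subset_cball image_mono)
    moreover have "a n holomorphic_on ball 0 r1"
      by (rule holomorphic_on_subset[OF ag(1)]) (use sub in auto)
    ultimately show ?thesis by (simp add: H_space_def)
  qed
  have ex: "\<exists>K. \<forall>\<eta>\<in>S1 h. \<forall>x\<in>V1 \<eta>. norm (y x \<eta> - (\<Sum>n<N. (a n x + g n (x / \<eta>)) * \<eta> ^ n)) \<le> K * norm \<eta> ^ N" for N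
  proof -
    from ag(3)[of N] obtain K where K: "\<forall>x \<eta>. (x, \<eta>) \<in> D \<longrightarrow> norm (y x \<eta> - (\<Sum>n<N. (a n x + g n (x / \<eta>)) * \<eta> ^ n)) \<le> K * norm \<eta> ^ N"
      by (rule exE)
    show ?thesis by (intro exI[of _ K] ballI) (use K in \<open>simp add: D_def\<close>)
  qed
  have "combined_asymptotic_expansion (S1 h) V1 r1 V y"
    unfolding combined_asymptotic_expansion_def
  proof (rule conjI, intro ballI conjI)
    fix \<eta> assume \<eta>: "\<eta> \<in> S1 h"
    show "V1 \<eta> \<subseteq> ball 0 r1" using Vr[OF \<eta>] by auto
    show "(\<lambda>x. x / \<eta>) ` V1 \<eta> \<subseteq> V" using Dreg \<eta> by (auto simp: D_def region_def)
  qed (rule exI[of _ a], rule exI[of _ g], intro conjI allI, rule aH, rule decaying_G_space[OF ag(2)], rule ex)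
  with sol h(1) show ?thesis using that by blast
qed

theorem mainTheorem3:
  fixes p :: nat and r0 r2 \<epsilon>0 :: real
  assumes "p \<ge> 2" and "r0 > 0" and "r2 > 0" and "\<epsilon>0 > 0"
  shows "\<exists>\<delta>0>0. \<forall>\<delta>::real. 0 < \<delta> \<and> \<delta> \<le> \<delta>0 \<longrightarrow>
    (let D1 = ball 0 r0;
         D2 = ball 0 r2;
         \<Sigma> = sector (- \<delta>) \<delta> (ereal \<epsilon>0);
         \<alpha> = - (3 * pi / (2 * real p)) + 2 * \<delta> / real p;
         \<beta> = 3 * pi / (2 * real p) - 2 * \<delta> / real p
     in \<forall>(r1::real) (P :: complex \<Rightarrow> complex \<Rightarrow> complex \<Rightarrow> complex).
          0 < r1 \<and> r1 < r0 * root p (cos (2 * \<delta>)) \<and>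
          holomorphic3_on (\<lambda>(x, y, \<epsilon>). P x y \<epsilon>) (D1 \<times> D2 \<times> \<Sigma>) \<and>
          bounded ((\<lambda>(x, y, \<epsilon>). P x y \<epsilon>) ` (D1 \<times> D2 \<times> \<Sigma>)) \<and>
          uniform_asymptotic_expansion D1 D2 \<Sigma> P \<longrightarrow>
          (\<forall>\<mu>>0. \<exists>\<eta>1>0. \<exists>y :: complex \<Rightarrow> complex \<Rightarrow> complex.
             let S1 = sector (- (\<delta> / real p)) (\<delta> / real p) (ereal \<eta>1);
                 V\<eta> = (\<lambda>\<eta>. quasi_sector \<alpha> \<beta> (ereal r1) (\<mu> * norm \<eta>));
                 V = quasi_sector (\<alpha> - \<delta> / real p) (\<beta> + \<delta> / real p) \<infinity> \<mu>
             in is_solution p D1 D2 \<Sigma> P S1 V\<eta> y \<and>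
                combined_asymptotic_expansion S1 V\<eta> r1 V y))"
proof (rule exI[of _ "pi / 8"], intro conjI allI impI, simp)
  fix \<delta> :: real
  assume "0 < \<delta> \<and> \<delta> \<le> pi / 8"
  then have \<delta>: "0 < \<delta>" "\<delta> \<le> pi / 8" by auto
  have pp: "real p > 0" using assms by simp
  have eqs: "- (3 * pi / (2 * real p)) + 2 * \<delta> / real p = - ((3 * pi / 2 - 2 * \<delta>) / real p)"
    "3 * pi / (2 * real p) - 2 * \<delta> / real p = (3 * pi / 2 - 2 * \<delta>) / real p"
    "- ((3 * pi / 2 - 2 * \<delta>) / real p) - \<delta> / real p = - ((3 * pi / 2 - \<delta>) / real p)"
    "(3 * pi / 2 - 2 * \<delta>) / real p + \<delta> / real p = (3 * pi / 2 - \<delta>) / real p"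
    using pp by (simp_all add: field_simps)
  have main: "\<exists>\<eta>1>0. \<exists>y. is_solution p (ball 0 r0) (ball 0 r2) (sector (- \<delta>) \<delta> (ereal \<epsilon>0)) P
        (sector (- (\<delta> / real p)) (\<delta> / real p) (ereal \<eta>1))
        (\<lambda>\<eta>. quasi_sector (- ((3 * pi / 2 - 2 * \<delta>) / real p)) ((3 * pi / 2 - 2 * \<delta>) / real p) (ereal r1) (\<mu> * norm \<eta>)) y \<and>
      combined_asymptotic_expansion (sector (- (\<delta> / real p)) (\<delta> / real p) (ereal \<eta>1))
        (\<lambda>\<eta>. quasi_sector (- ((3 * pi / 2 - 2 * \<delta>) / real p)) ((3 * pi / 2 - 2 * \<delta>) / real p) (ereal r1) (\<mu> * norm \<eta>)) r1
        (quasi_sector (- ((3 * pi / 2 - \<delta>) / real p)) ((3 * pi / 2 - \<delta>) / real p) \<infinity> \<mu>) y"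
    if r1: "0 < r1" "r1 < r0 * root p (cos (2 * \<delta>))"
      and hol: "holomorphic3_on (\<lambda>(x, y, \<epsilon>). P x y \<epsilon>) (ball 0 r0 \<times> ball 0 r2 \<times> sector (- \<delta>) \<delta> (ereal \<epsilon>0))"
      and bd: "bounded ((\<lambda>(x, y, \<epsilon>). P x y \<epsilon>) ` (ball 0 r0 \<times> ball 0 r2 \<times> sector (- \<delta>) \<delta> (ereal \<epsilon>0)))"
      and asy: "uniform_asymptotic_expansion (ball 0 r0) (ball 0 r2) (sector (- \<delta>) \<delta> (ereal \<epsilon>0)) P"
      and \<mu>: "\<mu> > 0" for r1 \<mu> :: real and P
  proof -
    define c where "c = root p (cos (2 * \<delta>))"
    have "cos (2 * \<delta>) > 0" using \<delta> pi_gt_zero by (intro cos_gt_zero_pi) auto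
    then have c: "c > 0" "c ^ p = cos (2 * \<delta>)" using assms by (auto simp: c_def real_root_gt_zero)
    \<comment> \<open>Any number strictly between \<open>r1 / c\<close> and \<open>r0\<close> would
      do: the lower bound gives the cone condition for \<open>r1\<close>, the upper one keeps the
      closed disc of radius \<open>\<rho>\<close> inside \<open>D1\<close>.\<close>
    define \<rho> where "\<rho> = (r1 / c + r0) / 2"
    have "r1 / c < r0" using r1 c unfolding c_def[symmetric] by (simp add: pos_divide_less_eq)
    moreover have "x < (x + z) / 2 \<and> (x + z) / 2 < z" if "x < z" for x z :: real using that by auto
    ultimately have \<rho>: "r1 / c < \<rho>" "\<rho> < r0" unfolding \<rho>_def by blast+
    have \<rho>0: "0 < \<rho>" using \<rho>(1) r1 c by (meson divide_pos_pos less_trans)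
    have "r1 < \<rho> * c" using \<rho>(1) c by (simp add: pos_divide_less_eq)
    then have "r1 ^ p < (\<rho> * c) ^ p" using r1 assms by (intro power_strict_mono) auto
    then have r1p: "r1 ^ p < \<rho> ^ p * cos (2 * \<delta>)" by (simp add: power_mult_distrib c)
    obtain M where M: "M > 0" "\<And>z. z \<in> (\<lambda>(x, y, \<epsilon>). P x y \<epsilon>) ` (ball 0 r0 \<times> ball 0 r2 \<times> sector (- \<delta>) \<delta> (ereal \<epsilon>0)) \<Longrightarrow> norm z \<le> M"
      using bd bounded_pos by metis
    interpret canard p \<mu> \<delta> r0 \<rho> r2 \<epsilon>0 M P
    proof
      fix x y e :: complex assume "norm x < r0" "norm y < r2" "e \<in> sector (- \<delta>) \<delta> (ereal \<epsilon>0)"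
      then show "norm (P x y e) \<le> M" by (intro M(2)) force
    qed (use assms \<delta> \<mu> \<rho> \<rho>0 M hol in auto)
    obtain h y where h: "h > 0" and s: "is_solution p (ball 0 r0) (ball 0 r2) \<Sigma>e P (S1 h)
        (\<lambda>\<eta>. {x. norm x < \<mu> * norm \<eta>} \<union> {x. x \<noteq> 0 \<and> norm x < r1 \<and> real p * \<bar>Arg x\<bar> < 3 * pi / 2 - 2 * \<delta>}) y"
      "combined_asymptotic_expansion (S1 h)
        (\<lambda>\<eta>. {x. norm x < \<mu> * norm \<eta>} \<union> {x. x \<noteq> 0 \<and> norm x < r1 \<and> real p * \<bar>Arg x\<bar> < 3 * pi / 2 - 2 * \<delta>}) r1 V y"
      using solution_with_expansion[OF r1(1) r1p asy] by blast
    have "S1 h = sector (- (\<delta> / real p)) (\<delta> / real p) (ereal h)"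
    proof -
      have b: "0 < \<delta> / real p" using \<delta> pp by simp
      have "\<delta> / real p \<le> \<delta> / 1" using \<delta> assms by (intro divide_left_mono) auto
      then have b': "\<delta> / real p \<le> pi" using \<delta> pi_gt_zero by linarith
      show ?thesis unfolding sector_eq[OF b b'] S1_def using pp by (auto simp: pos_less_divide_eq mult.commute)
    qed
    with h s show ?thesis
      unfolding quasi_sector_infinite[OF assms(1) \<delta>] quasi_sector_finite[OF assms(1) \<delta>] by auto
  qed
  show "let D1 = ball 0 r0;
         D2 = ball 0 r2;
         \<Sigma> = sector (- \<delta>) \<delta> (ereal \<epsilon>0);
         \<alpha> = - (3 * pi / (2 * real p)) + 2 * \<delta> / real p;
         \<beta> = 3 * pi / (2 * real p) - 2 * \<delta> / real p
     in \<forall>(r1::real) (P :: complex \<Rightarrow> complex \<Rightarrow> complex \<Rightarrow> complex).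
          0 < r1 \<and> r1 < r0 * root p (cos (2 * \<delta>)) \<and>
          holomorphic3_on (\<lambda>(x, y, \<epsilon>). P x y \<epsilon>) (D1 \<times> D2 \<times> \<Sigma>) \<and>
          bounded ((\<lambda>(x, y, \<epsilon>). P x y \<epsilon>) ` (D1 \<times> D2 \<times> \<Sigma>)) \<and>
          uniform_asymptotic_expansion D1 D2 \<Sigma> P \<longrightarrow>
          (\<forall>\<mu>>0. \<exists>\<eta>1>0. \<exists>y :: complex \<Rightarrow> complex \<Rightarrow> complex.
             let S1 = sector (- (\<delta> / real p)) (\<delta> / real p) (ereal \<eta>1);
                 V\<eta> = (\<lambda>\<eta>. quasi_sector \<alpha> \<beta> (ereal r1) (\<mu> * norm \<eta>));
                 V = quasi_sector (\<alpha> - \<delta> / real p) (\<beta> + \<delta> / real p) \<infinity> \<mu>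
             in is_solution p D1 D2 \<Sigma> P S1 V\<eta> y \<and>
                combined_asymptotic_expansion S1 V\<eta> r1 V y)"
    unfolding Let_def eqs using main by blast
qed

end
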